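(* Let $n\ge 2$, let $\Omega\subset\mathbb{R}^n$ be a bounded domain, and let $1\le p\le q<\infty$ satisfy $$\frac1q\ \ge\ \frac1p-\frac1{n-1}.$$ Let $f:\Omega\times\mathbb{R}^n\to\mathbb{R}$ be a Carathéodory function such that $z\mapsto f(x,z)$ is convex for almost every $x\in\Omega$, and suppose that there exist $1\le L<\infty$ and $\mu\ge 0$ such that for all $z\in\mathbb{R}^n$ and almost every $x\in\Omega$ $$|z|^p\le f(x,z)\le L|z|^q+1,\qquad f(x,2z)\le \mu+Lf(x,z).$$ Let $u\in W^{1,1}_{\rm loc}(\Omega)$ be a quasi-minimizer of the functional $\mathcal{F}[u,\Omega]=\int_\Omega f(x,\nabla u)\,dx$. Then $u\in L^\infty_{\rm loc}(\Omega)$.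
   Context: Functions $u$ are scalar (real-valued). For a measurable set $A\subset\Omega$ write $\mathcal{F}(u,A):=\int_A f(x,\nabla u(x))\,dx$. Given $Q\ge1$, a function $u\in W^{1,1}_{\rm loc}(\Omega)$ is called a $Q$-minimizer of $\mathcal{F}$ if and only if $$\mathcal{F}(u,\operatorname{supp}\varphi)<\infty\quad\text{and}\quad \mathcal{F}(u,\operatorname{supp}\varphi)\le Q\,\mathcal{F}(u+\varphi,\operatorname{supp}\varphi)$$ for every $\varphi\in W^{1,1}(\Omega)$ whose support $\operatorname{supp}\varphi$ is compactly contained in $\Omega$. The function $u$ is called a quasi-minimizer if and only if there exists $Q\ge1$ such that $u$ is a $Q$-minimizer. *)

theory Defs
  imports "HOL-Analysis.Analysis"
begin

(* A function is of class C^(k+1) iff it is differentiable and all its first-order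
   partial derivatives are of class C^k. *)
fun C_k :: "nat \<Rightarrow> ('a::euclidean_space \<Rightarrow> real) \<Rightarrow> bool" where
  "C_k 0 \<phi> \<longleftrightarrow> continuous_on UNIV \<phi>"
| "C_k (Suc k) \<phi> \<longleftrightarrow>
     \<phi> differentiable_on UNIV \<and>
     (\<forall>b\<in>Basis. C_k k (\<lambda>x. frechet_derivative \<phi> (at x) b))"

definition test_functions :: "'a::euclidean_space set \<Rightarrow> ('a \<Rightarrow> real) set" where
  "test_functions \<Omega> =
     {\<phi>. (\<forall>k. C_k k \<phi>) \<and> compact (closure {x. \<phi> x \<noteq> 0}) \<and> closure {x. \<phi> x \<noteq> 0} \<subseteq> \<Omega>}"

definition locally_integrable ::
  "'a::euclidean_space set \<Rightarrow> ('a \<Rightarrow> 'b::euclidean_space) \<Rightarrow> bool" where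
  "locally_integrable \<Omega> u \<longleftrightarrow> (\<forall>K. compact K \<and> K \<subseteq> \<Omega> \<longrightarrow> u absolutely_integrable_on K)"

(* Elements of the function spaces below are represented by genuine functions on the whole
   space; only their values almost everywhere in \<Omega> matter. *)
definition has_weak_gradient ::
  "'a::euclidean_space set \<Rightarrow> ('a \<Rightarrow> real) \<Rightarrow> ('a \<Rightarrow> 'a) \<Rightarrow> bool" where
  "has_weak_gradient \<Omega> u g \<longleftrightarrow>
     locally_integrable \<Omega> u \<and> locally_integrable \<Omega> g \<and>
     (\<forall>\<phi>\<in>test_functions \<Omega>. \<forall>b\<in>Basis.
        (LINT x:\<Omega>|lebesgue. u x * frechet_derivative \<phi> (at x) b) =
        - (LINT x:\<Omega>|lebesgue. (g x \<bullet> b) * \<phi> x))"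

(* Weak gradients on an open set are unique up to null sets, so the choice is immaterial. *)
definition weak_gradient ::
  "'a::euclidean_space set \<Rightarrow> ('a \<Rightarrow> real) \<Rightarrow> 'a \<Rightarrow> 'a" where
  "weak_gradient \<Omega> u = (SOME g. has_weak_gradient \<Omega> u g)"

definition W11_loc :: "'a::euclidean_space set \<Rightarrow> ('a \<Rightarrow> real) set" where
  "W11_loc \<Omega> = {u. \<exists>g. has_weak_gradient \<Omega> u g}"

definition W11 :: "'a::euclidean_space set \<Rightarrow> ('a \<Rightarrow> real) set" where
  "W11 \<Omega> = {u. u absolutely_integrable_on \<Omega> \<and>
               (\<exists>g. has_weak_gradient \<Omega> u g \<and> g absolutely_integrable_on \<Omega>)}"

definition Linf_loc :: "'a::euclidean_space set \<Rightarrow> ('a \<Rightarrow> real) set" where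
  "Linf_loc \<Omega> = {u. \<forall>K. compact K \<and> K \<subseteq> \<Omega> \<longrightarrow>
     u \<in> borel_measurable (lebesgue_on K) \<and> (\<exists>C. AE x in lebesgue_on K. \<bar>u x\<bar> \<le> C)}"

(* Support of an equivalence class of functions modulo null sets: the complement in \<Omega> of the
   largest open set on which the function vanishes almost everywhere. *)
definition supp :: "'a::euclidean_space set \<Rightarrow> ('a \<Rightarrow> real) \<Rightarrow> 'a set" where
  "supp \<Omega> \<phi> = \<Omega> - \<Union>{U. open U \<and> U \<subseteq> \<Omega> \<and> (AE x in lebesgue_on U. \<phi> x = 0)}"

definition caratheodory ::
  "'a::euclidean_space set \<Rightarrow> ('a \<Rightarrow> 'a \<Rightarrow> real) \<Rightarrow> bool" where
  "caratheodory \<Omega> f \<longleftrightarrow>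
     (\<forall>z. (\<lambda>x. f x z) \<in> borel_measurable (lebesgue_on \<Omega>)) \<and>
     (AE x in lebesgue_on \<Omega>. continuous_on UNIV (f x))"

(* The integral of f(x, \<nabla>u(x)) over A, with values in [0,\<infinity>]. It is meant for integrands
   that are nonnegative for almost every x: the coercion ennreal truncates negative values to 0. *)
definition energy ::
  "'a::euclidean_space set \<Rightarrow> ('a \<Rightarrow> 'a \<Rightarrow> real) \<Rightarrow> ('a \<Rightarrow> real) \<Rightarrow> 'a set \<Rightarrow> ennreal" where
  "energy \<Omega> f u A = (\<integral>\<^sup>+x\<in>A. ennreal (f x (weak_gradient \<Omega> u x)) \<partial>lebesgue)"

(* supp \<Omega> \<phi> is relatively closed in \<Omega>, so it is compactly contained in \<Omega> iff it is compact. *)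
definition Q_minimizer ::
  "'a::euclidean_space set \<Rightarrow> ('a \<Rightarrow> 'a \<Rightarrow> real) \<Rightarrow> real \<Rightarrow> ('a \<Rightarrow> real) \<Rightarrow> bool" where
  "Q_minimizer \<Omega> f Q u \<longleftrightarrow>
     u \<in> W11_loc \<Omega> \<and>
     (\<forall>\<phi>\<in>W11 \<Omega>. compact (supp \<Omega> \<phi>) \<longrightarrow>
        energy \<Omega> f u (supp \<Omega> \<phi>) < \<infinity> \<and>
        energy \<Omega> f u (supp \<Omega> \<phi>) \<le> ennreal Q * energy \<Omega> f (\<lambda>x. u x + \<phi> x) (supp \<Omega> \<phi>))"

definition quasi_minimizer ::
  "'a::euclidean_space set \<Rightarrow> ('a \<Rightarrow> 'a \<Rightarrow> real) \<Rightarrow> ('a \<Rightarrow> real) \<Rightarrow> bool" where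
  "quasi_minimizer \<Omega> f u \<longleftrightarrow> (\<exists>Q\<ge>1. Q_minimizer \<Omega> f Q u)"

end

(* Let v = (u - k)_+ and A_k = {u > k}.  A quasi-minimizer u is compared with
   u - eta zeta v, which gives, by convexity and doubling, the Caccioppoli inequality
     int_{A_k, Q_rho} f <= C ( int_{A_k, Q_sigma - Q_rho} f + |A_k, Q_sigma| + int v^q |D eta|^q )
   and, after filling the hole, the same with a factor theta < 1 in front of an integral over Q_sigma.
   The cut-off eta is a product of functions of one coordinate that grow only at those heights at
   which the integral of |Dv|^p over the slice is comparable to its average.  There the Sobolev
   inequality on slices of dimension n - 1 bounds the last term by (int |Dv|^p)^(q/p), which is
   where the exponent condition with 1/(n - 1) enters.
   The energies are compared on supp (eta zeta v), and without zeta this set may contain a large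
   part of {u <= k}; zeta vanishes on an open set that covers {u <= k} up to small measure and
   changes the inequality by an arbitrarily small amount.
   De Giorgi's iteration of X(k, r) = int_{A_k, Q_r} (f + 1) then bounds u from above, and the same
   argument applied to -u and f(x, -z) bounds it from below. *)
theory Submission
  imports Defs
begin

text \<open>With a gradient of size 1/(sigma - rho) throughout the shell, the term int v^q |D eta|^q
  would call for the Sobolev exponent in dimension n. A cut-off free to choose its heights loses
  only a constant factor and moves the estimate to hyperplanes, which gains one dimension. Cubes and
  one-coordinate factors keep the slices flat, so the Gagliardo-Nirenberg grid inequality applies on
  them. The exponents are replaced by a pair p' <= p, q' >= q on the critical curve with p' < q';
  then q'/p' > 1 makes the last term superlinear, also for p = q. A superlinear estimate needs a
  small start, which the integrability of f + 1 supplies for large k without shrinking the cube; the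
  same choice of k makes v vanish on half of each cube, so that Poincare's inequality applies. The
  factor theta is not iterated away at a fixed level but carried through the iteration as a linear
  contraction. The gradient of zeta is affordable because zeta is assembled from adapted cut-offs on
  small cubes, in most of which the mean of |Dv|^p is tiny, Dv being 0 where v = 0; their weights
  scale like the volumes of the cubes.\<close>

abbreviation seq_lim :: "(nat \<Rightarrow> 'a::topological_space) \<Rightarrow> 'a \<Rightarrow> bool" ("((_)/ ----> (_))" [60, 60] 60) where
  "X ----> L \<equiv> X \<longlonglongrightarrow> L"

abbreviation nn_lborel :: "('a::euclidean_space \<Rightarrow> ennreal) \<Rightarrow> ennreal" (binder "NN " 10) where
  "nn_lborel f \<equiv> nn_integral lborel f"

abbreviation leb :: "'a::euclidean_space set \<Rightarrow> ennreal" where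
  "leb \<equiv> emeasure lborel"

abbreviation Borel :: "('a::topological_space \<Rightarrow> 'b::topological_space) set" where
  "Borel \<equiv> borel_measurable borel"

abbreviation grad_weight :: "real \<Rightarrow> ('a::euclidean_space \<Rightarrow> real) \<Rightarrow> ('a \<Rightarrow> 'a) \<Rightarrow> ennreal" where
  "grad_weight q v E \<equiv> NN x. ennreal (\<bar>v x\<bar> powr q * norm (E x) powr q)"

abbreviation by_parts :: "('a::euclidean_space \<Rightarrow> real) \<Rightarrow> ('a \<Rightarrow> 'a) \<Rightarrow> ('a \<Rightarrow> real) \<Rightarrow> ('a \<Rightarrow> 'a) \<Rightarrow> bool" where
  "by_parts w g \<phi> D \<equiv> (LINT x|lborel. w x *\<^sub>R D x) = - (LINT x|lborel. \<phi> x *\<^sub>R g x)"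

section \<open>Real powers of extended nonnegative reals\<close>

text \<open>The case \<open>a = 0\<close> is separate because \<open>0 powr 0 = 0\<close> on the
  reals, whereas a Hoelder factor of weight 0 has to be 1, also at 0 and at
  \<open>top\<close>.\<close>

definition epowr :: "ennreal \<Rightarrow> real \<Rightarrow> ennreal" where
  "epowr x a = (if a = 0 then 1 else if x = top then top else ennreal (enn2real x powr a))"

lemma epowr_0[simp]: "epowr x 0 = 1" by (simp add: epowr_def)

lemma epowr_zero[simp]: "a > 0 \<Longrightarrow> epowr 0 a = 0" by (simp add: epowr_def)

lemma epowr_top[simp]: "a > 0 \<Longrightarrow> epowr top a = top" by (simp add: epowr_def)

lemma epowr_ennreal: "a > 0 \<Longrightarrow> 0 \<le> x \<Longrightarrow> epowr (ennreal x) a = ennreal (x powr a)" by (simp add: epowr_def)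

lemma epowr_one[simp]: "epowr 1 a = 1" using epowr_ennreal[of _ 1] by (auto simp: epowr_def)

lemma epowr_exp_one[simp]: "epowr x 1 = x" by (cases x) (auto simp: epowr_def)

lemma epowr_mono: "a \<ge> 0 \<Longrightarrow> x \<le> y \<Longrightarrow> epowr x a \<le> epowr y a"
  by (cases x; cases y) (auto simp: epowr_def top_unique powr_mono2 intro!: ennreal_leI)

lemma epowr_mult: "a \<ge> 0 \<Longrightarrow> epowr (x * y) a = epowr x a * epowr y a" by (cases x; cases y)
    (auto simp: epowr_def ennreal_mult_top ennreal_top_mult powr_mult ennreal_mult enn2real_mult ennreal_mult_eq_top_iff ennreal_eq_0_iff dest: antisym)

lemma epowr_add: "a \<ge> 0 \<Longrightarrow> b \<ge> 0 \<Longrightarrow> epowr x (a + b) = epowr x a * epowr x b" by (cases x)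
    (auto simp: epowr_def ennreal_mult_top ennreal_top_mult powr_add ennreal_mult)

lemma epowr_epowr: "a > 0 \<Longrightarrow> b > 0 \<Longrightarrow> epowr (epowr x a) b = epowr x (a * b)" by (cases x) (auto simp: epowr_def powr_powr)

lemma epowr_eq_0_iff: "a > 0 \<Longrightarrow> epowr x a = 0 \<longleftrightarrow> x = 0" by (cases x) (auto simp: epowr_def)

lemma epowr_eq_top_iff: "a > 0 \<Longrightarrow> epowr x a = top \<longleftrightarrow> x = top" by (cases x) (auto simp: epowr_def)

lemma epowr_le_iff: "a > 0 \<Longrightarrow> epowr x a \<le> y \<longleftrightarrow> x \<le> epowr y (1 / a)"
  using epowr_mono[of "1/a" "epowr x a" y] epowr_mono[of a x "epowr y (1/a)"] by (auto simp: epowr_epowr)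

text \<open>Monotonicity gives the bound for each infimum; moving the exponent to the other side by
  \<open>epowr_le_iff\<close> turns the claim about the outer supremum into a family of such
  bounds.\<close>

lemma epowr_liminf_le:
  assumes "a > 0"
  shows "epowr (liminf X) a \<le> liminf (\<lambda>n. epowr (X n) a)"
  unfolding epowr_le_iff[OF assms] liminf_SUP_INF
proof (rule SUP_least)
  fix n
  have "epowr (INF m\<in>{n..}. X m) a \<le> (INF m\<in>{n..}. epowr (X m) a)" using assms by (intro INF_greatest epowr_mono INF_lower) auto
  also have "\<dots> \<le> (SUP n. INF m\<in>{n..}. epowr (X m) a)" by (rule SUP_upper) simp
  finally show "(INF m\<in>{n..}. X m) \<le> epowr (SUP n. INF m\<in>{n..}. epowr (X m) a) (1 / a)" by (simp add: epowr_le_iff[OF assms])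
qed

lemma measurable_epowr[measurable]:
  assumes [measurable]: "f \<in> borel_measurable M"
  shows "(\<lambda>x. epowr (f x) a) \<in> borel_measurable M"
  unfolding epowr_def by measurable

text \<open>Convexity of exp at the points ln (x j); a vanishing factor, where ln gives no
  information, is settled beforehand.\<close>

lemma weighted_AM_GM:
  fixes x a :: "'i \<Rightarrow> real"
  assumes "finite J" "\<And>j. j \<in> J \<Longrightarrow> 0 < a j" "(\<Sum>j\<in>J. a j) = 1" "\<And>j. j \<in> J \<Longrightarrow> 0 \<le> x j"
  shows "(\<Prod>j\<in>J. x j powr a j) \<le> (\<Sum>j\<in>J. a j * x j)"
proof (cases "\<exists>j\<in>J. x j = 0")
  case True
  then have "(\<Prod>j\<in>J. x j powr a j) = 0" using assms(1) by (auto simp: prod_zero_iff)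
  moreover have "0 \<le> (\<Sum>j\<in>J. a j * x j)" using assms by (intro sum_nonneg mult_nonneg_nonneg) (auto intro: less_imp_le)
  ultimately show ?thesis by simp
next
  case False
  then have pos: "x j > 0" if "j \<in> J" for j using assms(4) that by (metis less_eq_real_def)
  have ne: "J \<noteq> {}" using assms(3) by auto
  have "exp (\<Sum>j\<in>J. a j *\<^sub>R ln (x j)) \<le> (\<Sum>j\<in>J. a j * exp (ln (x j)))"
    using convex_on_sum[OF assms(1) ne exp_convex, of a "\<lambda>j. ln (x j)"] assms by (auto simp: less_imp_le)
  moreover have "exp (\<Sum>j\<in>J. a j *\<^sub>R ln (x j)) = (\<Prod>j\<in>J. x j powr a j)" using pos by (auto simp: exp_sum assms(1) powr_def intro!: prod.cong)
       (metis less_numeral_extra(3))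
  ultimately show ?thesis using pos by simp
qed

lemma epowr_AM_GM:
  assumes "finite J" "\<And>j. j \<in> J \<Longrightarrow> 0 < a j" "(\<Sum>j\<in>J. a j) = 1"
  shows "(\<Prod>j\<in>J. epowr (x j) (a j)) \<le> (\<Sum>j\<in>J. ennreal (a j) * x j)"
proof (cases "\<exists>j\<in>J. x j = top")
  case True
  then obtain j where j: "j \<in> J" "x j = top" by auto
  have "ennreal (a j) * x j \<le> (\<Sum>j\<in>J. ennreal (a j) * x j)" by (rule sum_nonneg_leq_bound[OF assms(1) _ refl j(1)]) auto
  moreover have "ennreal (a j) * x j = top" using j assms(2)[OF j(1)] by (simp add: ennreal_mult_top)
  ultimately show ?thesis by (simp add: top_unique)
next
  case False
  define y where "y j = enn2real (x j)" for j
  have xy: "x j = ennreal (y j)" if "j \<in> J" for j using False that by (auto simp: y_def less_top)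
  have y0: "y j \<ge> 0" for j by (simp add: y_def)
  have "(\<Prod>j\<in>J. epowr (x j) (a j)) = (\<Prod>j\<in>J. ennreal (y j powr a j))" using assms(2) y0 by (intro prod.cong) (auto simp: xy epowr_ennreal)
  also have "\<dots> = ennreal (\<Prod>j\<in>J. y j powr a j)" by (simp add: prod_ennreal)
  also have "\<dots> \<le> ennreal (\<Sum>j\<in>J. a j * y j)" using weighted_AM_GM[OF assms, of y] y0 by (intro ennreal_leI) auto
  also have "\<dots> = (\<Sum>j\<in>J. ennreal (a j) * x j)"
    using assms(2) y0 by (subst sum_ennreal[symmetric]) (auto simp: xy ennreal_mult less_imp_le intro!: sum.cong)
  finally show ?thesis .
qed

text \<open>Each factor is divided by its integral, and the weighted AM-GM inequality is integrated.
  The case of a vanishing integral comes before that of an infinite one, since 0 times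
  \<open>top\<close> is 0 on the right-hand side.\<close>

lemma nn_integral_Holder:
  fixes f :: "'i \<Rightarrow> 'b \<Rightarrow> ennreal"
  assumes J: "finite J" "\<And>j. j \<in> J \<Longrightarrow> 0 \<le> a j" "(\<Sum>j\<in>J. a j) = 1"
    and f: "\<And>j. j \<in> J \<Longrightarrow> f j \<in> borel_measurable M"
  shows "(\<integral>\<^sup>+x. (\<Prod>j\<in>J. epowr (f j x) (a j)) \<partial>M) \<le> (\<Prod>j\<in>J. epowr (\<integral>\<^sup>+x. f j x \<partial>M) (a j))"
proof -
  \<comment> \<open>Factors of weight 0 are identically 1 and are dropped, since AM-GM is stated for
    positive weights.\<close>
  define K where "K = {j\<in>J. 0 < a j}"
  have sK: "(\<Sum>j\<in>J. a j) = (\<Sum>j\<in>K. a j)" using J by (intro sum.mono_neutral_right) (auto simp: K_def less_le)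
  have K: "finite K" "\<And>j. j \<in> K \<Longrightarrow> 0 < a j" "(\<Sum>j\<in>K. a j) = 1" "K \<subseteq> J" using J by (auto simp: K_def sK[unfolded K_def])
  have red: "(\<Prod>j\<in>J. epowr (g j) (a j)) = (\<Prod>j\<in>K. epowr (g j) (a j))" for g
    using J by (intro prod.mono_neutral_right) (auto simp: K_def, metis antisym_conv1 epowr_0)
  note [measurable] = f
  have [measurable]: "f j \<in> borel_measurable M" if "j \<in> K" for j using that K by auto
  define c where "c j = (\<integral>\<^sup>+x. f j x \<partial>M)" for j
  show ?thesis unfolding red c_def[symmetric]
  proof (cases "\<exists>j\<in>K. c j = 0")
    case True
    then obtain j where j: "j \<in> K" "c j = 0" by auto
    then have "AE x in M. f j x = 0" by (simp add: c_def nn_integral_0_iff_AE)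
    then have "AE x in M. (\<Prod>j\<in>K. epowr (f j x) (a j)) = 0" by eventually_elim (use j K in \<open>auto simp: prod_zero_iff intro!: bexI[of _ j]\<close>)
    then have "(\<integral>\<^sup>+x. (\<Prod>j\<in>K. epowr (f j x) (a j)) \<partial>M) = 0" by (subst nn_integral_0_iff_AE) auto
    then show "(\<integral>\<^sup>+x. (\<Prod>j\<in>K. epowr (f j x) (a j)) \<partial>M) \<le> (\<Prod>j\<in>K. epowr (c j) (a j))" by simp
  next
    case nz: False
    show "(\<integral>\<^sup>+x. (\<Prod>j\<in>K. epowr (f j x) (a j)) \<partial>M) \<le> (\<Prod>j\<in>K. epowr (c j) (a j))"
    proof (cases "\<exists>j\<in>K. c j = top")
      case True
      then obtain j where j: "j \<in> K" "c j = top" by auto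
      have "(\<Prod>j\<in>K. epowr (c j) (a j)) = epowr (c j) (a j) * (\<Prod>j\<in>K-{j}. epowr (c j) (a j))" using j K by (simp add: prod.remove)
      also have "\<dots> = top" using j K nz by (auto simp: ennreal_top_mult prod_zero_iff epowr_eq_0_iff)
      finally show ?thesis by simp
    next
      case False
      define d where "d j = enn2real (c j)" for j
      have cd: "c j = ennreal (d j)" "d j > 0" if "j \<in> K" for j
      proof -
        show "c j = ennreal (d j)" using False that by (auto simp: d_def less_top)
        then show "d j > 0" using nz that by (metis d_def ennreal_0 enn2real_nonneg order_le_less)
      qed
      have split: "epowr (f j x) (a j) = epowr (c j) (a j) * epowr (f j x / c j) (a j)" if "j \<in> K" for j x
      proof -
        have "c j * (f j x / c j) = f j x"
          using cd[OF that] nz False that by (metis ennreal_times_divide ennreal_mult_divide_eq mult.commute)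
        then show ?thesis using K(2)[OF that] by (simp add: epowr_mult[symmetric])
      qed
      have "(\<integral>\<^sup>+x. (\<Prod>j\<in>K. epowr (f j x) (a j)) \<partial>M)
          = (\<integral>\<^sup>+x. (\<Prod>j\<in>K. epowr (c j) (a j)) * (\<Prod>j\<in>K. epowr (f j x / c j) (a j)) \<partial>M)" by (simp add: split prod.distrib)
      also have "\<dots> = (\<Prod>j\<in>K. epowr (c j) (a j)) * (\<integral>\<^sup>+x. (\<Prod>j\<in>K. epowr (f j x / c j) (a j)) \<partial>M)"
        by (rule nn_integral_cmult) measurable
      also have "\<dots> \<le> (\<Prod>j\<in>K. epowr (c j) (a j)) * (\<integral>\<^sup>+x. (\<Sum>j\<in>K. ennreal (a j) * (f j x / c j)) \<partial>M)"
        by (intro mult_left_mono nn_integral_mono epowr_AM_GM K) auto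
      also have "(\<integral>\<^sup>+x. (\<Sum>j\<in>K. ennreal (a j) * (f j x / c j)) \<partial>M) = (\<Sum>j\<in>K. ennreal (a j) * (c j / c j))"
        by (simp add: nn_integral_sum nn_integral_cmult nn_integral_divide c_def)
      also have "\<dots> = (\<Sum>j\<in>K. ennreal (a j))" using nz False by (intro sum.cong) (auto simp: ennreal_divide_self less_top)
      also have "\<dots> = 1" using K by (subst sum_ennreal) (auto simp: less_imp_le)
      finally show ?thesis by simp
    qed
  qed
qed

lemma nn_integral_Holder2:
  assumes [measurable]: "f \<in> borel_measurable M" "g \<in> borel_measurable M" and "0 \<le> a" "a \<le> 1"
  shows "(\<integral>\<^sup>+x. epowr (f x) a * epowr (g x) (1 - a) \<partial>M)
      \<le> epowr (\<integral>\<^sup>+x. f x \<partial>M) a * epowr (\<integral>\<^sup>+x. g x \<partial>M) (1 - a)"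
  using nn_integral_Holder[of "UNIV::bool set" "\<lambda>b. if b then a else 1 - a" "\<lambda>b. if b then f else g" M] assms
  by (simp add: UNIV_bool mult.commute if_distrib[of "\<lambda>f. f _"] cong: if_cong)

section \<open>The Gagliardo--Nirenberg grid inequality\<close>

interpretation lborel_product: product_sigma_finite "\<lambda>_. lborel :: real measure" by standard

lemma measurable_line_integral[measurable]:
  fixes f :: "('i \<Rightarrow> real) \<Rightarrow> ennreal"
  assumes f[measurable]: "f \<in> borel_measurable (PiM I (\<lambda>_. lborel))" and "i \<in> I"
  shows "(\<lambda>y. (NN s. f (y(i := s)))) \<in> borel_measurable (PiM I (\<lambda>_. lborel))"
proof -
  have "(\<lambda>(y, s). y(i := s)) \<in> PiM I (\<lambda>_. lborel) \<Otimes>\<^sub>M lborel \<rightarrow>\<^sub>M PiM I (\<lambda>_. lborel :: real measure)"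
    using measurable_add_dim[of i I "\<lambda>_. lborel :: real measure"] \<open>i \<in> I\<close> by (simp add: insert_absorb)
  from measurable_compose[OF this f]
  have "(\<lambda>(y, s). f (y(i := s))) \<in> borel_measurable (PiM I (\<lambda>_. lborel) \<Otimes>\<^sub>M lborel)" by (simp add: case_prod_beta')
  then show ?thesis by (rule lborel.borel_measurable_nn_integral)
qed

text \<open>Integrating out one variable with Hoelder's inequality replaces \<open>f\<close> by its line integral
  and lowers the number of variables by one while the shape of the integrand is kept.\<close>
lemma grid_lines:
  fixes f :: "('i \<Rightarrow> real) \<Rightarrow> ennreal"
  assumes "finite S" "0 \<le> l" "(real (card S) - 1) * l \<le> 1"
    and "f \<in> borel_measurable (PiM S (\<lambda>_. lborel))"
  shows "(\<integral>\<^sup>+y. epowr (f y) (1 - (real (card S) - 1) * l) *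
            (\<Prod>i\<in>S. epowr (NN s. f (y(i := s))) l) \<partial>PiM S (\<lambda>_. lborel))
       \<le> epowr (\<integral>\<^sup>+y. f y \<partial>PiM S (\<lambda>_. lborel)) (1 + l)"
  using assms
proof (induction S arbitrary: f)
  case empty
  then show ?case by (simp add: lborel_product.nn_integral_empty)
next
  case (insert i S)
  let ?M = "\<lambda>S. PiM S (\<lambda>_. lborel :: real measure)"
  note f[measurable] = insert.prems(3)
  have l: "0 \<le> l" "real (card S) * l \<le> 1" using insert by auto
  define F where "F y = (NN s. f (y(i := s)))" for y
  \<comment> \<open>In the variable that is integrated out, the line integral in direction i is
    constant. The other \<open>card S\<close> line integrals with weight \<open>l\<close> and
    \<open>f\<close> with weight \<open>e\<close> add up to 1, as Hoelder's inequality
    requires.\<close>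
  define e where "e = 1 - real (card S) * l"
  define G where "G y = epowr (f y) e * (\<Prod>j\<in>insert i S. epowr (NN s. f (y(j := s))) l)" for y
  have Gm[measurable]: "G \<in> borel_measurable (?M (insert i S))"
    unfolding G_def by measurable
  have add: "(\<lambda>(y, s). y(i := s)) \<in> ?M S \<Otimes>\<^sub>M lborel \<rightarrow>\<^sub>M ?M (insert i S)" by (rule measurable_add_dim)
  have Fm[measurable]: "F \<in> borel_measurable (?M S)"
    unfolding F_def using measurable_compose[OF add f] by (intro lborel.borel_measurable_nn_integral) (simp add: case_prod_beta')
  have inner: "(NN t. G (y(i := t))) \<le> epowr (F y) (1 - (real (card S) - 1) * l) *
            (\<Prod>j\<in>S. epowr (NN s. F (y(j := s))) l)" if y: "y \<in> space (?M S)" for y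
  proof -
    have ym: "(\<lambda>t. y(i := t)) \<in> lborel \<rightarrow>\<^sub>M ?M (insert i S)" using measurable_compose[OF measurable_Pair1'[OF y] add] by simp
    have fm: "(\<lambda>t. f (y(i := t))) \<in> borel_measurable lborel"
      using measurable_compose[OF ym f] .
    have jm: "(\<lambda>t. (NN s. f (y(i := t, j := s)))) \<in> borel_measurable lborel" if "j \<in> S" for j
      using measurable_compose[OF ym measurable_line_integral[OF f, of j]] that by (simp add: fun_upd_def)
    have hm: "(\<lambda>t. if j = i then f (y(i := t)) else (NN s. f (y(i := t, j := s))))
        \<in> borel_measurable lborel" if "j \<in> insert i S" for j using fm jm[of j] that by (cases "j = i") auto
    have G1: "G (y(i := t)) = epowr (F y) l * (\<Prod>j\<in>insert i S. epowr (if j = i then f (y(i := t)) else (NN s. f (y(i := t, j := s))))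
            (if j = i then e else l))" for t
      using insert.hyps unfolding G_def F_def by (auto simp: mult_ac intro!: arg_cong2[where f="(*)"] prod.cong)
    have "(NN t. G (y(i := t))) = epowr (F y) l *
        (NN t. (\<Prod>j\<in>insert i S. epowr (if j = i then f (y(i := t)) else (NN s. f (y(i := t, j := s))))
            (if j = i then e else l)))"
      unfolding G1 by (intro nn_integral_cmult borel_measurable_prod_ennreal measurable_epowr hm)
    also have "\<dots> \<le> epowr (F y) l * (\<Prod>j\<in>insert i S. epowr (NN t. (if j = i then f (y(i := t)) else (NN s. f (y(i := t, j := s)))))
            (if j = i then e else l))"
    proof (intro mult_left_mono nn_integral_Holder)
      have "(\<Sum>j\<in>S. if j = i then e else l) = (\<Sum>j\<in>S. l)" using insert.hyps by (intro sum.cong) auto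
      then show "(\<Sum>j\<in>insert i S. if j = i then e else l) = 1" using insert.hyps by (simp add: e_def)
    qed (use insert.hyps l hm in \<open>auto simp: e_def\<close>)
    also have "(\<Prod>j\<in>insert i S. epowr (NN t. (if j = i then f (y(i := t)) else (NN s. f (y(i := t, j := s)))))
            (if j = i then e else l)) = epowr (F y) e * (\<Prod>j\<in>S. epowr (NN t. (NN s. f (y(i := t, j := s)))) l)"
      using insert.hyps unfolding F_def by (auto intro!: arg_cong2[where f="(*)"] prod.cong)
    also have "(\<Prod>j\<in>S. epowr (NN t. (NN s. f (y(i := t, j := s)))) l)
         = (\<Prod>j\<in>S. epowr (NN s. F (y(j := s))) l)"
    proof (intro prod.cong refl arg_cong2[where f=epowr])
      fix j assume j: "j \<in> S"
      then have ij: "i \<noteq> j" using insert.hyps by auto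
      have m2: "(\<lambda>(t, s). y(i := t, j := s)) \<in> lborel \<Otimes>\<^sub>M lborel \<rightarrow>\<^sub>M ?M (insert i S)"
      proof -
        have "(\<lambda>z. (y(i := fst z), snd z)) \<in> lborel \<Otimes>\<^sub>M lborel \<rightarrow>\<^sub>M ?M (insert i S) \<Otimes>\<^sub>M lborel"
          using ym by measurable
        from measurable_compose[OF this measurable_add_dim[of j]] j show ?thesis by (simp add: case_prod_beta' insert_absorb)
      qed
      have "(NN t. (NN s. f (y(i := t, j := s)))) = (NN s. (NN t. f (y(i := t, j := s))))" by (rule lborel_pair.Fubini'[symmetric])
          (use measurable_compose[OF m2 f] in \<open>simp add: case_prod_beta' fun_upd_def\<close>)
      then show "(NN t. (NN s. f (y(i := t, j := s)))) = (NN s. F (y(j := s)))"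
        unfolding F_def using ij by (simp add: fun_upd_twist)
    qed
    \<comment> \<open>The constant factor with exponent \<open>l\<close> joins the one with exponent
      \<open>e\<close>, so \<open>F\<close> receives exactly the exponent of the induction
      hypothesis for \<open>S\<close>.\<close>
    finally show ?thesis using epowr_add[of l e "F y"] l by (simp add: e_def algebra_simps fun_upd_def)
  qed
  have "(\<integral>\<^sup>+y. G y \<partial>?M (insert i S)) = (\<integral>\<^sup>+y. (NN t. G (y(i := t))) \<partial>?M S)"
    by (rule lborel_product.product_nn_integral_insert) (use insert.hyps in auto)
  also have "\<dots> \<le> (\<integral>\<^sup>+y. epowr (F y) (1 - (real (card S) - 1) * l) *
            (\<Prod>j\<in>S. epowr (NN s. F (y(j := s))) l) \<partial>?M S)" by (intro nn_integral_mono inner)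
  also have "\<dots> \<le> epowr (\<integral>\<^sup>+y. F y \<partial>?M S) (1 + l)" by (rule insert.IH) (use l in \<open>auto simp: algebra_simps\<close>)
  also have "(\<integral>\<^sup>+y. F y \<partial>?M S) = (\<integral>\<^sup>+y. f y \<partial>?M (insert i S))"
    unfolding F_def by (rule lborel_product.product_nn_integral_insert[symmetric]) (use insert.hyps in auto)
  finally show ?case using insert.hyps by (simp add: G_def e_def fun_upd_def)
qed

text \<open>With l = 1 / (card S - 1) the exponent of \<open>f\<close> itself vanishes and only the
  line integrals remain; this is the inequality behind Sobolev's embedding for p = 1.\<close>

corollary gagliardo_grid:
  fixes f :: "('i \<Rightarrow> real) \<Rightarrow> ennreal"
  assumes "finite S" "card S \<ge> 2"
    and "f \<in> borel_measurable (PiM S (\<lambda>_. lborel))"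
  shows "(\<integral>\<^sup>+y. (\<Prod>i\<in>S. epowr (NN s. f (y(i := s))) (1 / (real (card S) - 1))) \<partial>PiM S (\<lambda>_. lborel))
       \<le> epowr (\<integral>\<^sup>+y. f y \<partial>PiM S (\<lambda>_. lborel)) (real (card S) / (real (card S) - 1))"
proof -
  have c: "real (card S) - 1 > 0" using assms(2) by simp
  then have "1 + 1 / (real (card S) - 1) = real (card S) / (real (card S) - 1)" by (simp add: field_simps)
  then show ?thesis using grid_lines[OF assms(1) _ _ assms(3), of "1 / (real (card S) - 1)"] c by simp
qed

section \<open>Continuously differentiable functions\<close>

text \<open>The derivative is recorded as a gradient field, so that classical and weak gradients are
  functions of the same type.\<close>

definition C1 :: "('a::euclidean_space \<Rightarrow> real) \<Rightarrow> ('a \<Rightarrow> 'a) \<Rightarrow> bool" where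
  "C1 \<phi> D \<longleftrightarrow> (\<forall>x. (\<phi> has_derivative (\<lambda>h. D x \<bullet> h)) (at x)) \<and> continuous_on UNIV D"

definition zero_off :: "'a::euclidean_space set \<Rightarrow> ('a \<Rightarrow> 'b::zero) \<Rightarrow> bool" where
  "zero_off S \<phi> \<longleftrightarrow> (\<forall>x. x \<notin> S \<longrightarrow> \<phi> x = 0)"

definition cube :: "'a::euclidean_space \<Rightarrow> real \<Rightarrow> 'a set" where
  "cube c r = cbox (c - r *\<^sub>R One) (c + r *\<^sub>R One)"

lemma mem_cube: "x \<in> cube c r \<longleftrightarrow> (\<forall>i\<in>Basis. \<bar>x \<bullet> i - c \<bullet> i\<bar> \<le> r)"
  by (auto simp: cube_def mem_box inner_diff_left inner_add_left abs_le_iff algebra_simps)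

lemma compact_cube[simp]: "compact (cube c r)" by (simp add: cube_def)

lemma closed_cube[simp]: "closed (cube c r)" by (simp add: compact_imp_closed)

lemma cube_borel[measurable]: "cube c r \<in> sets borel" by (simp add: cube_def)

lemma cube_mono: "r \<le> s \<Longrightarrow> cube c r \<subseteq> cube c s" by (auto simp: mem_cube) (meson order_trans)

lemma emeasure_cube:
  assumes "0 \<le> r"
  shows "leb (cube (c::'a::euclidean_space) r) = ennreal ((2 * r) ^ DIM('a))" using assms by (simp add: cube_def assms inner_diff_left inner_add_left inner_simps)

lemma C1_derivative: "C1 \<phi> D \<Longrightarrow> (\<phi> has_derivative (\<lambda>h. D x \<bullet> h)) (at x)" by (simp add: C1_def)

lemma C1_continuous: "C1 \<phi> D \<Longrightarrow> continuous_on UNIV \<phi>" by (meson C1_derivative continuous_at_imp_continuous_on has_derivative_continuous)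

lemma C1_continuous_grad: "C1 \<phi> D \<Longrightarrow> continuous_on UNIV D" by (simp add: C1_def)

lemma C1_measurable:
  assumes "C1 \<phi> D" shows "\<phi> \<in> Borel" "D \<in> Borel"
  using C1_continuous[OF assms] C1_continuous_grad[OF assms] by (auto intro: borel_measurable_continuous_onI)

lemma C1_const: "C1 (\<lambda>x. c) (\<lambda>x. 0)" by (simp add: C1_def)

lemma C1_inner: "C1 (\<lambda>x. x \<bullet> b) (\<lambda>x. b)" by (auto simp: C1_def inner_commute intro!: derivative_eq_intros)

lemma C1_add: "C1 f F \<Longrightarrow> C1 g G \<Longrightarrow> C1 (\<lambda>x. f x + g x) (\<lambda>x. F x + G x)"
  by (auto simp: C1_def inner_add_left intro!: continuous_intros has_derivative_add)

lemma C1_mult: "C1 f F \<Longrightarrow> C1 g G \<Longrightarrow> C1 (\<lambda>x. f x * g x) (\<lambda>x. g x *\<^sub>R F x + f x *\<^sub>R G x)"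
  using C1_continuous[of f F] C1_continuous[of g G] by (auto simp: C1_def inner_add_left algebra_simps intro!: continuous_intros derivative_eq_intros)

lemma C1_cmult: "C1 f F \<Longrightarrow> C1 (\<lambda>x. c * f x) (\<lambda>x. c *\<^sub>R F x)" using C1_mult[OF C1_const[of c], of f F] by simp

lemma C1_diff: "C1 f F \<Longrightarrow> C1 g G \<Longrightarrow> C1 (\<lambda>x. f x - g x) (\<lambda>x. F x - G x)"
  using C1_add[OF _ C1_cmult[of g G "-1"], of f F] by simp

lemma C1_compose:
  assumes "C1 f F" "\<And>s. (h has_real_derivative h' s) (at s)" "continuous_on UNIV h'"
  shows "C1 (\<lambda>x. h (f x)) (\<lambda>x. h' (f x) *\<^sub>R F x)"
  unfolding C1_def
proof (intro conjI allI)
  fix x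
  show "((\<lambda>x. h (f x)) has_derivative (\<lambda>k. (h' (f x) *\<^sub>R F x) \<bullet> k)) (at x)"
    using DERIV_compose_FDERIV[OF assms(2) C1_derivative[OF assms(1)], of x] by (simp add: mult.commute)
  show "continuous_on UNIV (\<lambda>x. h' (f x) *\<^sub>R F x)"
    using continuous_on_compose2[OF assms(3) C1_continuous[OF assms(1)]] C1_continuous_grad[OF assms(1)] by (intro continuous_intros) auto
qed

lemma C1_line:
  assumes "C1 f F"
  shows "((\<lambda>t. f (x + t *\<^sub>R v)) has_real_derivative (F (x + t *\<^sub>R v) \<bullet> v)) (at t within T)"
proof -
  have "((\<lambda>t. f (x + t *\<^sub>R v)) has_derivative (\<lambda>h. F (x + t *\<^sub>R v) \<bullet> (h *\<^sub>R v))) (at t within T)"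
    by (rule has_derivative_compose[OF _ C1_derivative[OF assms]])
       (auto intro!: derivative_eq_intros)
  then show ?thesis by (simp add: has_field_derivative_def mult.commute[of _ "_ \<bullet> _"])
qed

lemma C1_grad_zero:
  assumes "C1 f F" "open S" "x \<in> S" "\<And>y. y \<in> S \<Longrightarrow> f y = 0"
  shows "F x = 0"
proof -
  have "((\<lambda>x. 0) has_derivative (\<lambda>h. F x \<bullet> h)) (at x)"
    by (rule has_derivative_transform_within_open[OF C1_derivative[OF assms(1)] assms(2,3)]) (use assms in auto)
  then have "(\<lambda>h. F x \<bullet> h) = (\<lambda>h. 0)" by (rule has_derivative_unique) auto
  then have "F x \<bullet> F x = 0" by meson
  then show ?thesis by simp
qed

lemma C1_zero_off:
  assumes "C1 f F" "closed S" "zero_off S f"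
  shows "zero_off S F"
  unfolding zero_off_def using C1_grad_zero[OF assms(1), of "-S"] assms(2,3) by (auto simp: zero_off_def)

lemma zero_off_mono: "zero_off S f \<Longrightarrow> S \<subseteq> T \<Longrightarrow> zero_off T f" by (auto simp: zero_off_def)

lemma continuous_vanishes_bounded:
  fixes f :: "'a::euclidean_space \<Rightarrow> 'b::real_normed_vector"
  assumes "continuous_on UNIV f" "compact S" "zero_off S f"
  obtains B where "B > 0" "\<And>x. norm (f x) \<le> B"
proof -
  have "bounded (f ` S)" by (intro compact_imp_bounded compact_continuous_image assms continuous_on_subset[OF assms(1)]) auto
  then obtain B where "B > 0" "\<And>x. x \<in> S \<Longrightarrow> norm (f x) \<le> B" by (auto simp: bounded_pos)
  then have "norm (f x) \<le> B" for x using assms(3) by (cases "x \<in> S") (auto simp: zero_off_def)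
  then show ?thesis using that \<open>B > 0\<close> by blast
qed

lemma integrable_continuous_vanishes:
  fixes f :: "'a::euclidean_space \<Rightarrow> 'b::{banach, second_countable_topology}"
  assumes "continuous_on UNIV f" "compact S" "zero_off S f"
  shows "integrable lborel f"
proof -
  have "integrable lborel (\<lambda>x. indicator S x *\<^sub>R f x)" by (rule borel_integrable_compact[OF assms(2)]) (use assms continuous_on_subset in blast)
  moreover have "(\<lambda>x. indicator S x *\<^sub>R f x) = f" using assms(3) by (auto simp: zero_off_def indicator_def)
  ultimately show ?thesis by simp
qed

lemma lborel_shift:
  fixes c :: "'a::euclidean_space"
  shows "distr lborel borel (\<lambda>x. x + c) = lborel"
proof -
  have "(\<lambda>x. x + c) = (+) c" by (auto simp: add.commute)
  then show ?thesis using lborel_distr_plus[of c] by simp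
qed

lemma nn_integral_shift:
  fixes c :: "'a::euclidean_space"
  assumes "f \<in> Borel"
  shows "(NN x. f (x + c)) = (NN x. f x)" using nn_integral_distr[of "\<lambda>x. x + c" lborel borel f] assms lborel_shift[of c] by simp

lemma integral_shift:
  fixes c :: "'a::euclidean_space" and f :: "'a \<Rightarrow> 'b::{banach, second_countable_topology}"
  assumes "f \<in> Borel"
  shows "(LINT x|lborel. f (x + c)) = (LINT x|lborel. f x)" using integral_distr[of "\<lambda>x. x + c" lborel borel f] assms lborel_shift[of c] by simp

lemma integrable_shift:
  fixes c :: "'a::euclidean_space" and f :: "'a \<Rightarrow> 'b::{banach, second_countable_topology}"
  assumes "integrable lborel f"
  shows "integrable lborel (\<lambda>x. f (x + c))"
proof -
  have "f \<in> Borel" using assms by auto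
  then show ?thesis using integrable_distr_eq[of "\<lambda>x. x + c" lborel borel f] assms lborel_shift[of c] by simp
qed

lemma C1_lipschitz:
  assumes "C1 f F" "\<And>x. norm (F x) \<le> B"
  shows "\<bar>f x - f y\<bar> \<le> B * norm (x - y)"
proof -
  have "norm (f x - f y) \<le> B * norm (x - y)"
  proof (rule differentiable_bound[of UNIV f "\<lambda>x h. F x \<bullet> h"])
    show "onorm ((\<bullet>) (F x)) \<le> B" for x
      by (rule onorm_le) (metis Cauchy_Schwarz_ineq2 assms(2) dual_order.trans mult_right_mono norm_ge_zero real_norm_def)
  qed (use assms in \<open>auto simp: C1_def\<close>)
  then show ?thesis by simp
qed

text \<open>Difference quotients have integral zero by translation invariance; they converge to the
  derivative and are dominated through a Lipschitz bound.\<close>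

lemma integral_C1_grad:
  assumes "C1 (\<phi> :: 'a::euclidean_space \<Rightarrow> real) D" "compact S" "zero_off S \<phi>"
  shows "integrable lborel D" "(LINT x|lborel. D x) = 0"
proof -
  have vD: "zero_off S D" by (rule C1_zero_off[OF assms(1) compact_imp_closed[OF assms(2)] assms(3)])
  show iD: "integrable lborel D" by (rule integrable_continuous_vanishes[OF C1_continuous_grad[OF assms(1)] assms(2) vD])
  have i\<phi>: "integrable lborel \<phi>" by (rule integrable_continuous_vanishes[OF C1_continuous[OF assms(1)] assms(2,3)])
  obtain B where B: "B > 0" "\<And>x. norm (D x) \<le> B" using continuous_vanishes_bounded[OF C1_continuous_grad[OF assms(1)] assms(2) vD] by blast
  obtain R where R: "\<And>x. x \<in> S \<Longrightarrow> norm x \<le> R" "R > 0" using compact_imp_bounded[OF assms(2)] by (auto simp: bounded_pos)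
  note [measurable] = C1_measurable[OF assms(1)]
  have "(LINT x|lborel. D x \<bullet> b) = 0" if b: "b \<in> Basis" for b
  proof -
    define h :: "nat \<Rightarrow> real" where "h j = 1 / (real j + 1)" for j
    define s where "s j x = (\<phi> (x + h j *\<^sub>R b) - \<phi> x) / h j" for j x
    have h: "0 < h j" "h j \<le> 1" for j by (auto simp: h_def)
    have int0: "(LINT x|lborel. s j x) = 0" for j
      unfolding s_def using i\<phi> integrable_shift[OF i\<phi>] by (simp add: integral_shift)
    have "(\<lambda>j. LINT x|lborel. s j x) ----> (LINT x|lborel. D x \<bullet> b)"
    \<comment> \<open>The radius R + 1 leaves room for shifts of length at most 1.\<close>
    proof (rule integral_dominated_convergence[where w="\<lambda>x. indicator (cball 0 (R+1)) x *\<^sub>R B"])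
      show "integrable lborel (\<lambda>x. indicator (cball 0 (R+1)) x *\<^sub>R B :: real)" by (rule borel_integrable_compact) auto
      show "AE x in lborel. (\<lambda>j. s j x) ----> D x \<bullet> b"
      proof (rule AE_I2)
        fix x
        have "((\<lambda>t. \<phi> (x + t *\<^sub>R b)) has_real_derivative (D x \<bullet> b)) (at 0)" using C1_line[OF assms(1), of x b 0 UNIV] by simp
        then have lim: "((\<lambda>t. (\<phi> (x + t *\<^sub>R b) - \<phi> x) / t) \<longlongrightarrow> D x \<bullet> b) (at 0)"
          by (simp add: has_field_derivative_iff)
        have "h ----> 0" unfolding h_def using LIMSEQ_inverse_real_of_nat by (simp add: inverse_eq_divide add.commute)
        then have "filterlim h (at 0) sequentially" using h by (auto simp: filterlim_at intro!: always_eventually) (metis less_irrefl)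
        then show "(\<lambda>j. s j x) ----> D x \<bullet> b"
          unfolding s_def by (rule filterlim_compose[OF lim])
      qed
      fix j
      show "AE x in lborel. norm (s j x) \<le> indicator (cball 0 (R+1)) x *\<^sub>R B"
      proof (rule AE_I2)
        fix x
        show "norm (s j x) \<le> indicator (cball 0 (R+1)) x *\<^sub>R B"
        proof (cases "norm x \<le> R + 1")
          case True
          have "\<bar>\<phi> (x + h j *\<^sub>R b) - \<phi> x\<bar> \<le> B * h j" using C1_lipschitz[OF assms(1) B(2), of "x + h j *\<^sub>R b" x] b h[of j] by simp
          then show ?thesis using True h[of j] by (simp add: s_def field_simps)
        next
          case False
          have "norm x \<le> norm (x + h j *\<^sub>R b) + norm (h j *\<^sub>R b)" by (metis add_diff_cancel norm_triangle_ineq4)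
          then have "norm (x + h j *\<^sub>R b) > R" using False b h[of j] by simp
          then have "\<phi> (x + h j *\<^sub>R b) = 0" "\<phi> x = 0" using R False assms(3) by (force simp: zero_off_def)+
          then show ?thesis using False by (simp add: s_def)
        qed
      qed
    qed (auto simp: s_def)
    then show ?thesis using int0 by (simp add: LIMSEQ_const_iff)
  qed
  then have "(LINT x|lborel. D x) \<bullet> b = 0" if "b \<in> Basis" for b using that iD by simp
  then show "(LINT x|lborel. D x) = 0" using euclidean_all_zero_iff by blast
qed

text \<open>The product of the two functions inherits the compact support of \<open>\<phi>\<close>,
  so its gradient has integral zero; \<open>w\<close> may live on the whole space.\<close>

lemma integration_by_parts_C1:
  fixes w \<phi> :: "'a::euclidean_space \<Rightarrow> real"
  assumes "C1 w W" "C1 \<phi> D" "compact S" "zero_off S \<phi>"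
  shows "by_parts w W \<phi> D"
proof -
  have vD: "zero_off S D" by (rule C1_zero_off[OF assms(2) compact_imp_closed[OF assms(3)] assms(4)])
  have i1: "integrable lborel (\<lambda>x. w x *\<^sub>R D x)" by (rule integrable_continuous_vanishes[OF _ assms(3)])
      (use vD C1_continuous[OF assms(1)] C1_continuous_grad[OF assms(2)] in \<open>auto simp: zero_off_def intro!: continuous_intros\<close>)
  have i2: "integrable lborel (\<lambda>x. \<phi> x *\<^sub>R W x)" by (rule integrable_continuous_vanishes[OF _ assms(3)])
      (use assms(4) C1_continuous[OF assms(2)] C1_continuous_grad[OF assms(1)] in \<open>auto simp: zero_off_def intro!: continuous_intros\<close>)
  have "(LINT x|lborel. \<phi> x *\<^sub>R W x + w x *\<^sub>R D x) = 0"
    by (rule integral_C1_grad[OF C1_mult[OF assms(1,2)] assms(3)]) (use assms(4) in \<open>auto simp: zero_off_def\<close>)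
  then show ?thesis using i1 i2 by (simp add: add_eq_0_iff)
qed

section \<open>Sobolev inequalities on coordinate slices\<close>

text \<open>The coordinates of \<open>a\<close> outside \<open>I\<close> select the slice, those
  inside act as an offset, so slices through arbitrary points are covered.\<close>

definition slice :: "'a::euclidean_space \<Rightarrow> 'a set \<Rightarrow> ('a \<Rightarrow> real) \<Rightarrow> 'a" where
  "slice a I y = a + (\<Sum>i\<in>I. y i *\<^sub>R i)"

lemma slice_upd:
  assumes "finite I" "i \<in> I"
  shows "slice a I (y(i := s)) = slice a I y + (s - y i) *\<^sub>R i"
proof -
  have "(\<Sum>j\<in>I. (y(i := s)) j *\<^sub>R j) = s *\<^sub>R i + (\<Sum>j\<in>I - {i}. y j *\<^sub>R j)" using assms by (subst sum.remove[of I i]) auto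
  moreover have "(\<Sum>j\<in>I. y j *\<^sub>R j) = y i *\<^sub>R i + (\<Sum>j\<in>I - {i}. y j *\<^sub>R j)" using assms by (subst sum.remove[of I i]) auto
  ultimately show ?thesis by (simp add: slice_def algebra_simps)
qed

lemma measurable_slice[measurable]: "finite I \<Longrightarrow> slice a I \<in> PiM I (\<lambda>_. lborel) \<rightarrow>\<^sub>M borel"
  unfolding slice_def by measurable

lemma inner_slice:
  assumes "I \<subseteq> Basis" "i \<in> I"
  shows "slice a I y \<bullet> i = a \<bullet> i + y i"
proof -
  have "finite I" using assms finite_Basis finite_subset by blast
  have "(\<Sum>j\<in>I. y j * (j \<bullet> i)) = (\<Sum>j\<in>I. if j = i then y j else 0)"
    using assms by (intro sum.cong) (auto simp: inner_not_same_Basis subset_iff)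
  then show ?thesis using assms \<open>finite I\<close> by (simp add: slice_def inner_add_left inner_sum_left)
qed

text \<open>The fundamental theorem of calculus along the line, from a far point where
  \<open>w\<close> vanishes up to \<open>x\<close>.\<close>

lemma C1_line_bound:
  assumes "C1 (w :: 'a::euclidean_space \<Rightarrow> real) D" "compact S" "zero_off S w" "norm b = 1"
  shows "ennreal \<bar>w x\<bar> \<le> (NN s. ennreal (norm (D (x + s *\<^sub>R b))))"
proof -
  obtain R where R: "\<And>x. x \<in> S \<Longrightarrow> norm x \<le> R" "R > 0" using compact_imp_bounded[OF assms(2)] by (auto simp: bounded_pos)
  \<comment> \<open>Going back by more than norm x + R leaves the ball that contains the
    support.\<close>
  define t where "t = norm x + R + 1"
  have "norm (t *\<^sub>R b) \<le> norm (x + (-t) *\<^sub>R b) + norm x"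
    by (metis add.commute diff_add_cancel norm_minus_commute norm_triangle_ineq4 norm_triangle_sub scaleR_minus_left uminus_add_conv_diff)
  then have "norm (x + (-t) *\<^sub>R b) > R" using assms(4) R(2) by (simp add: t_def)
  then have w0: "w (x + (-t) *\<^sub>R b) = 0" using R assms(3) by (force simp: zero_off_def)
  have t0: "-t \<le> 0" using R norm_ge_zero[of x] unfolding t_def by linarith
  have cont: "continuous_on T (\<lambda>s. D (x + s *\<^sub>R b))" for T
    by (rule continuous_on_compose2[OF C1_continuous_grad[OF assms(1)]]) (auto intro!: continuous_intros)
  have "(LINT s|lborel. indicator {-t..0} s *\<^sub>R (D (x + s *\<^sub>R b) \<bullet> b)) = w (x + 0 *\<^sub>R b) - w (x + (-t) *\<^sub>R b)"
    by (rule integral_FTC_Icc[OF t0])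
       (use C1_line[OF assms(1), of x b] cont in \<open>auto simp: has_real_derivative_iff_has_vector_derivative intro!: continuous_intros\<close>)
  then have "ennreal \<bar>w x\<bar> = ennreal (norm (LINT s|lborel. indicator {-t..0} s *\<^sub>R (D (x + s *\<^sub>R b) \<bullet> b)))" using w0 by simp
  also have "\<dots> \<le> (NN s. ennreal (norm (indicator {-t..0} s *\<^sub>R (D (x + s *\<^sub>R b) \<bullet> b))))"
    by (rule integral_norm_bound_ennreal) (rule borel_integrable_compact, use cont in \<open>auto intro!: continuous_intros\<close>)
  also have "\<dots> \<le> (NN s. ennreal (norm (D (x + s *\<^sub>R b))))"
  proof (intro nn_integral_mono ennreal_leI)
    fix s
    have "\<bar>D (x + s *\<^sub>R b) \<bullet> b\<bar> \<le> norm (D (x + s *\<^sub>R b))" using Cauchy_Schwarz_ineq2[of "D (x + s *\<^sub>R b)" b] assms(4) by simp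
    then show "norm (indicator {-t..0} s *\<^sub>R (D (x + s *\<^sub>R b) \<bullet> b)) \<le> norm (D (x + s *\<^sub>R b))" by (auto simp: indicator_def)
  qed
  finally show ?thesis .
qed

lemma slice_line_bound:
  assumes "C1 (w :: 'a::euclidean_space \<Rightarrow> real) D" "compact S" "zero_off S w" "I \<subseteq> Basis" "i \<in> I"
  shows "ennreal \<bar>w (slice a I y)\<bar> \<le> (NN s. ennreal (norm (D (slice a I (y(i := s))))))"
proof -
  have fin: "finite I" using assms finite_Basis finite_subset by blast
  note [measurable] = C1_measurable[OF assms(1)]
  have "ennreal \<bar>w (slice a I y)\<bar> \<le> (NN s. ennreal (norm (D (slice a I y + s *\<^sub>R i))))" using assms by (intro C1_line_bound[OF assms(1-3)]) auto
  also have "\<dots> = (NN s. ennreal (norm (D (slice a I y + (s + - y i) *\<^sub>R i))))" by (rule nn_integral_shift[symmetric]) measurable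
  finally show ?thesis by (simp add: slice_upd[OF fin assms(5)])
qed

text \<open>The power card I / (card I - 1) of |w| is a product of card I equal factors. Each is
  bounded by the line integral in another direction, and the grid inequality integrates the
  product.\<close>

lemma GNS_slice:
  assumes "C1 (w :: 'a::euclidean_space \<Rightarrow> real) D" "compact S" "zero_off S w" "I \<subseteq> Basis" "card I \<ge> 2"
  shows "(\<integral>\<^sup>+y. epowr (ennreal \<bar>w (slice a I y)\<bar>) (real (card I) / (real (card I) - 1)) \<partial>PiM I (\<lambda>_. lborel))
     \<le> epowr (\<integral>\<^sup>+y. ennreal (norm (D (slice a I y))) \<partial>PiM I (\<lambda>_. lborel)) (real (card I) / (real (card I) - 1))"
proof -
  have fin[simp]: "finite I" using assms finite_Basis finite_subset by blast
  note [measurable] = C1_measurable[OF assms(1)]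
  have c: "real (card I) - 1 > 0" using assms(5) by simp
  have prod_const: "epowr x (real n * l) = (\<Prod>i\<in>J. epowr x l)" if "l \<ge> 0" "finite J" "card J = n" for x l n and J :: "'a set"
    using that(2,1,3) by (induction J arbitrary: n) (auto simp: distrib_right epowr_add)
  have "(\<integral>\<^sup>+y. epowr (ennreal \<bar>w (slice a I y)\<bar>) (real (card I) / (real (card I) - 1)) \<partial>PiM I (\<lambda>_. lborel))
     = (\<integral>\<^sup>+y. (\<Prod>i\<in>I. epowr (ennreal \<bar>w (slice a I y)\<bar>) (1 / (real (card I) - 1))) \<partial>PiM I (\<lambda>_. lborel))"
    using prod_const[of "1 / (real (card I) - 1)" I "card I"] c by simp
  also have "\<dots> \<le> (\<integral>\<^sup>+y. (\<Prod>i\<in>I. epowr (NN s. ennreal (norm (D (slice a I (y(i := s)))))) (1 / (real (card I) - 1))) \<partial>PiM I (\<lambda>_. lborel))"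
    using c by (intro nn_integral_mono prod_mono_ennreal epowr_mono slice_line_bound[OF assms(1-4)]) auto
  also have "\<dots> \<le> epowr (\<integral>\<^sup>+y. ennreal (norm (D (slice a I y))) \<partial>PiM I (\<lambda>_. lborel)) (real (card I) / (real (card I) - 1))"
    by (rule gagliardo_grid) (use assms in auto)
  finally show ?thesis .
qed

lemma slice_support:
  assumes "I \<subseteq> Basis" and "zero_off (cube c R) w"
  shows "w (slice a I y) \<noteq> 0 \<Longrightarrow> i \<in> I \<Longrightarrow> y i \<in> {c \<bullet> i - a \<bullet> i - R..c \<bullet> i - a \<bullet> i + R}"
proof -
  assume "w (slice a I y) \<noteq> 0" "i \<in> I"
  then have "slice a I y \<in> cube c R" using assms(2) by (auto simp: zero_off_def)
  then have "\<bar>slice a I y \<bullet> i - c \<bullet> i\<bar> \<le> R" using \<open>i \<in> I\<close> assms(1) by (auto simp: mem_cube)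
  then show ?thesis using inner_slice[OF assms(1) \<open>i \<in> I\<close>] by auto
qed

lemma slice_measure_support:
  assumes "I \<subseteq> Basis" "0 \<le> R"
  shows "emeasure (PiM I (\<lambda>_. lborel)) (\<Pi>\<^sub>E i\<in>I. {c \<bullet> i - a \<bullet> i - R..c \<bullet> i - a \<bullet> i + R}) = ennreal ((2 * R) ^ card I)"
proof -
  have fin[simp]: "finite I" using assms finite_Basis finite_subset by blast
  show ?thesis using assms by (subst lborel_product.emeasure_PiM) (auto simp: prod_ennreal[symmetric] ennreal_power)
qed

text \<open>A crude finite bound from the bounded support. It justifies dividing by the integral of
  |w|^q in \<open>slice_sobolev_critical\<close>, and it gives the one-dimensional case when
  \<open>B\<close> is a line integral.\<close>

lemma slice_integral_bound:
  fixes w :: "'a::euclidean_space \<Rightarrow> real"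
  assumes "I \<subseteq> Basis" "0 \<le> R" "zero_off (cube c R) w" "q > 0"
    and "\<And>y. ennreal \<bar>w (slice a I y)\<bar> \<le> B"
  shows "(\<integral>\<^sup>+y. epowr (ennreal \<bar>w (slice a I y)\<bar>) q \<partial>PiM I (\<lambda>_. lborel)) \<le> epowr B q * ennreal ((2 * R) ^ card I)"
proof -
  have fin[simp]: "finite I" using assms finite_Basis finite_subset by blast
  let ?T = "\<Pi>\<^sub>E i\<in>I. {c \<bullet> i - a \<bullet> i - R..c \<bullet> i - a \<bullet> i + R}"
  have "(\<integral>\<^sup>+y. epowr (ennreal \<bar>w (slice a I y)\<bar>) q \<partial>PiM I (\<lambda>_. lborel))
     \<le> (\<integral>\<^sup>+y. epowr B q * indicator ?T y \<partial>PiM I (\<lambda>_. lborel))"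
  proof (rule nn_integral_mono)
    fix y assume y: "y \<in> space (PiM I (\<lambda>_. lborel :: real measure))"
    show "epowr (ennreal \<bar>w (slice a I y)\<bar>) q \<le> epowr B q * indicator ?T y"
    proof (cases "w (slice a I y) = 0")
      case False
      then have "y \<in> ?T" using slice_support[OF assms(1,3) False] y by (auto simp: space_PiM PiE_def)
      then show ?thesis using assms(4,5) by (simp add: epowr_mono)
    qed (use assms in simp)
  qed
  also have "\<dots> = epowr B q * ennreal ((2 * R) ^ card I)"
    using slice_measure_support[OF assms(1,2), of c a] by (subst nn_integral_cmult_indicator) (auto intro!: sets_PiM_I_finite)
  finally show ?thesis .
qed

lemma C1_bounded:
  assumes "C1 (w :: 'a::euclidean_space \<Rightarrow> real) D" "compact S" "zero_off S w"
  obtains B where "B > 0" "\<And>x. \<bar>w x\<bar> \<le> B" using continuous_vanishes_bounded[OF C1_continuous[OF assms(1)] assms(2,3)] by auto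

text \<open>An exponent above 1 makes the power continuously differentiable across 0, so the Sobolev
  inequality for p = 1 can be applied to |w|^g.\<close>

lemma C1_abs_powr:
  assumes "C1 (w :: 'a::euclidean_space \<Rightarrow> real) D" "g > 1"
  shows "C1 (\<lambda>x. \<bar>w x\<bar> powr g) (\<lambda>x. (g * \<bar>w x\<bar> powr (g - 1) * sgn (w x)) *\<^sub>R D x)"
proof (rule C1_compose[OF assms(1)])
  have zero: "((\<lambda>s::real. \<bar>s\<bar> powr g) has_real_derivative 0) (at 0)"
  proof -
    have "((\<lambda>s::real. \<bar>s\<bar> powr (g - 1)) \<longlongrightarrow> 0) (at 0)"
    proof -
      have "((\<lambda>s::real. \<bar>s\<bar> powr (g - 1)) \<longlongrightarrow> \<bar>0\<bar> powr (g - 1)) (at 0)"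
        using assms(2) by (intro tendsto_powr2 tendsto_intros) auto
      then show ?thesis using assms(2) by simp
    qed
    then have "((\<lambda>s::real. \<bar>\<bar>s\<bar> powr g / s\<bar>) \<longlongrightarrow> 0) (at 0)"
      by (rule Lim_transform_eventually) (auto simp: eventually_at powr_diff intro!: exI[of _ 1])
    then have "((\<lambda>s::real. \<bar>s\<bar> powr g / s) \<longlongrightarrow> 0) (at 0)" by (rule tendsto_rabs_zero_cancel)
    then show ?thesis by (simp add: has_field_derivative_iff)
  qed
  fix s :: real
  show "((\<lambda>s. \<bar>s\<bar> powr g) has_real_derivative (g * \<bar>s\<bar> powr (g - 1) * sgn s)) (at s)"
  proof (cases "s = 0")
    case True then show ?thesis using zero by simp
  next
    case False
    have "(abs has_real_derivative sgn s) (at s)"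
    proof (cases "s > 0")
      case True
      show ?thesis by (rule has_field_derivative_transform_within_open[of "\<lambda>x. x" _ _ "{0<..}"]) (use True in auto)
    next
      case neg: False
      show ?thesis by (rule has_field_derivative_transform_within_open[of "\<lambda>x. - x" _ _ "{..<0}"])
           (use neg False in \<open>auto intro!: derivative_eq_intros\<close>)
    qed
    from DERIV_fun_powr[OF this, of g] False show ?thesis by simp
  qed
next
  have "continuous_on ({..0} \<union> {0..}) (\<lambda>s::real. (if s \<le> 0 then - (\<bar>s\<bar> powr (g - 1)) else \<bar>s\<bar> powr (g - 1)))"
    by (rule continuous_on_cases) (use assms(2) in \<open>auto intro!: continuous_on_minus continuous_on_powr' continuous_on_rabs continuous_on_const continuous_on_id\<close>)
  moreover have "{..0} \<union> {0..} = (UNIV::real set)" by auto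
  moreover have "(\<lambda>s::real. g * \<bar>s\<bar> powr (g - 1) * sgn s) = (\<lambda>s. g * (if s \<le> 0 then - (\<bar>s\<bar> powr (g - 1)) else \<bar>s\<bar> powr (g - 1)))"
    by (auto simp: fun_eq_iff sgn_real_def)
  ultimately show "continuous_on UNIV (\<lambda>s::real. g * \<bar>s\<bar> powr (g - 1) * sgn s)" by (simp only: continuous_on_mult continuous_on_const)
qed

text \<open>Here \<open>m\<close> is the dimension of the slices. For \<open>m = 1\<close> the Sobolev exponent of \<open>p = 1\<close> is infinite,
  so that every \<open>q\<close> is allowed.\<close>
definition admissible :: "nat \<Rightarrow> real \<Rightarrow> real \<Rightarrow> bool" where
  "admissible m p q \<longleftrightarrow> 1 \<le> p \<and> p < q \<and> (m \<ge> 2 \<and> 1 / q = 1 / p - 1 / real m \<or> m = 1 \<and> p = 1)"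

text \<open>The case p = 1 applied to |w|^g, with g = q (m - 1) / m so that the left-hand side
  becomes the integral of |w|^q. Hoelder's inequality splits the gradient of |w|^g, and the power of
  the same integral that arises on the right is divided off.\<close>

lemma slice_sobolev_critical:
  assumes w: "C1 (w :: 'a::euclidean_space \<Rightarrow> real) D" "zero_off (cube c R) w" "0 \<le> R"
    and I: "I \<subseteq> Basis" "card I \<ge> 2" and pq: "1 \<le> p" "p < q" "1 / q = 1 / p - 1 / real (card I)"
  shows "epowr (\<integral>\<^sup>+y. epowr (ennreal \<bar>w (slice a I y)\<bar>) q \<partial>PiM I (\<lambda>_. lborel)) (p / q)
     \<le> ennreal ((q * (real (card I) - 1) / real (card I)) powr p) * (\<integral>\<^sup>+y. epowr (ennreal (norm (D (slice a I y)))) p \<partial>PiM I (\<lambda>_. lborel))"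
proof -
  define m where "m = real (card I)"
  define g where "g = q * (m - 1) / m"
  have m: "m \<ge> 2" using I by (simp add: m_def)
  have fin[simp]: "finite I" using I finite_Basis finite_subset by blast
  note [measurable] = C1_measurable[OF w(1)]
  let ?M = "PiM I (\<lambda>_. lborel :: real measure)"
  define X where "X = (\<integral>\<^sup>+y. epowr (ennreal \<bar>w (slice a I y)\<bar>) q \<partial>?M)"
  define Y where "Y = (\<integral>\<^sup>+y. epowr (ennreal (norm (D (slice a I y)))) p \<partial>?M)"
  have q: "1 / q = 1 / p - 1 / m" "q > 0" using pq by (auto simp: m_def)
  have gq: "g * (m / (m - 1)) = q" using m by (simp add: g_def)
  \<comment> \<open>Equivalently g - 1 = q (1 - 1/p): under Hoelder's conjugate exponent the factor
    |w|^(g - 1) has the integral X.\<close>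
  have g1: "g = q * (1 - 1 / p) + 1" using q m by (simp add: g_def field_simps algebra_simps)
  have main: "X \<le> epowr (ennreal g * (epowr X (1 - 1 / p) * epowr Y (1 / p))) (m / (m - 1))"
  proof (cases "p = 1")
    case True
    then have "g = 1" using g1 by simp
    then have "q = m / (m - 1)" using gq by simp
    then show ?thesis using GNS_slice[OF w(1) compact_cube w(2) I, of a] True \<open>g = 1\<close> by (simp add: X_def Y_def m_def)
  next
    case False
    then have "p > 1" using pq by simp
    then have g: "g > 1" unfolding g1 using q by (simp add: field_simps)
    have v: "zero_off (cube c R) (\<lambda>x. \<bar>w x\<bar> powr g)" using w(2) by (auto simp: zero_off_def)
    have "X = (\<integral>\<^sup>+y. epowr (ennreal \<bar>\<bar>w (slice a I y)\<bar> powr g\<bar>) (m / (m - 1)) \<partial>?M)"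
      unfolding X_def using gq g m q(2) by (intro nn_integral_cong) (simp add: epowr_ennreal powr_powr)
    also have "\<dots> \<le> epowr (\<integral>\<^sup>+y. ennreal (norm ((g * \<bar>w (slice a I y)\<bar> powr (g - 1) * sgn (w (slice a I y))) *\<^sub>R D (slice a I y))) \<partial>?M) (m / (m - 1))"
      using GNS_slice[OF C1_abs_powr[OF w(1) g] compact_cube v I, of a] by (simp add: m_def)
    also have "\<dots> \<le> epowr (ennreal g * (epowr X (1 - 1 / p) * epowr Y (1 / p))) (m / (m - 1))"
    proof (intro epowr_mono)
      have "(\<integral>\<^sup>+y. ennreal (norm ((g * \<bar>w (slice a I y)\<bar> powr (g - 1) * sgn (w (slice a I y))) *\<^sub>R D (slice a I y))) \<partial>?M)
         \<le> (\<integral>\<^sup>+y. ennreal g * (epowr (epowr (ennreal (norm (D (slice a I y)))) p) (1 / p) * epowr (epowr (ennreal \<bar>w (slice a I y)\<bar>) q) (1 - 1 / p)) \<partial>?M)"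
      proof (intro nn_integral_mono)
        fix y
        let ?w = "w (slice a I y)" and ?D = "D (slice a I y)"
        have "epowr (epowr (ennreal \<bar>?w\<bar>) q) (1 - 1 / p) = ennreal (\<bar>?w\<bar> powr (g - 1))"
          using \<open>p > 1\<close> q by (simp add: epowr_ennreal powr_powr g1)
        moreover have "epowr (epowr (ennreal (norm ?D)) p) (1 / p) = ennreal (norm ?D)" using \<open>p > 1\<close> by (simp add: epowr_epowr)
        moreover have "norm ((g * \<bar>?w\<bar> powr (g - 1) * sgn ?w) *\<^sub>R ?D) \<le> g * (norm ?D * \<bar>?w\<bar> powr (g - 1))"
          using g by (auto simp: abs_mult sgn_real_def)
        ultimately show "ennreal (norm ((g * \<bar>?w\<bar> powr (g - 1) * sgn ?w) *\<^sub>R ?D)) \<le> ennreal g * (epowr (epowr (ennreal (norm ?D)) p) (1 / p) * epowr (epowr (ennreal \<bar>?w\<bar>) q) (1 - 1 / p))"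
          using g by (simp add: ennreal_mult[symmetric] ennreal_leI)
      qed
      also have "\<dots> = ennreal g * (\<integral>\<^sup>+y. epowr (epowr (ennreal (norm (D (slice a I y)))) p) (1 / p) * epowr (epowr (ennreal \<bar>w (slice a I y)\<bar>) q) (1 - 1 / p) \<partial>?M)"
        by (rule nn_integral_cmult) measurable
      also have "\<dots> \<le> ennreal g * (epowr Y (1 / p) * epowr X (1 - 1 / p))"
        unfolding X_def Y_def using \<open>p > 1\<close> by (intro mult_left_mono nn_integral_Holder2) auto
      finally show "(\<integral>\<^sup>+y. ennreal (norm ((g * \<bar>w (slice a I y)\<bar> powr (g - 1) * sgn (w (slice a I y))) *\<^sub>R D (slice a I y))) \<partial>?M)
         \<le> ennreal g * (epowr X (1 - 1 / p) * epowr Y (1 / p))" by (simp add: mult_ac)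
    qed (use m in simp)
    finally show ?thesis .
  qed
  have g0: "g \<ge> 1" unfolding g1 using q pq by simp
  obtain B where B: "B > 0" "\<And>x. \<bar>w x\<bar> \<le> B" using C1_bounded[OF w(1) compact_cube w(2)] by blast
  have "X \<le> epowr (ennreal B) q * ennreal ((2 * R) ^ card I)"
    unfolding X_def by (rule slice_integral_bound[OF I(1) w(3,2) q(2)]) (use B in \<open>auto intro: ennreal_leI\<close>)
  also have "\<dots> < top" using B q by (simp add: epowr_ennreal ennreal_mult_less_top)
  finally have Xfin: "X < top" .
  have "epowr X (p / q) \<le> ennreal (g powr p) * Y"
  proof (cases "X = 0")
    case True then show ?thesis using pq by simp
  next
    case False
    have "epowr X ((m - 1) / m) \<le> ennreal g * (epowr X (1 - 1 / p) * epowr Y (1 / p))" using main epowr_le_iff[of "(m - 1)/m" X] m by simp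
    moreover have "(m - 1) / m = (1 - 1 / p) + 1 / q" using q m by (simp add: field_simps)
    moreover have "epowr X ((1 - 1 / p) + 1 / q) = epowr X (1 - 1 / p) * epowr X (1 / q)" by (rule epowr_add) (use pq(1) q(2) in auto)
    ultimately have le: "epowr X (1 - 1 / p) * epowr X (1 / q) \<le> epowr X (1 - 1 / p) * (ennreal g * epowr Y (1 / p))" by (metis mult.left_commute)
    \<comment> \<open>Division is legitimate because X is neither 0 nor infinite; the crude bound
      was proved for this.\<close>
    have nz: "epowr X (1 - 1 / p) \<noteq> 0" "epowr X (1 - 1 / p) \<noteq> top"
      using False Xfin pq epowr_eq_0_iff[of "1 - 1/p" X] epowr_eq_top_iff[of "1 - 1/p" X] by (cases "p = 1"; simp)+
    have "epowr X (1 / q) \<le> ennreal g * epowr Y (1 / p)" using le nz by (subst (asm) ennreal_mult_le_mult_iff) auto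
    then have "epowr (epowr X (1 / q)) p \<le> epowr (ennreal g * epowr Y (1 / p)) p" using pq by (intro epowr_mono) auto
    moreover have "epowr (epowr X (1 / q)) p = epowr X (p / q)" using pq(1) q(2) by (subst epowr_epowr) auto
    ultimately show ?thesis using pq(1) g0 by (simp add: epowr_mult epowr_epowr epowr_ennreal)
  qed
  then show ?thesis by (simp add: X_def Y_def g_def m_def)
qed

text \<open>In dimension one |w| is bounded by the integral of its derivative, and the q-th power is
  integrated over a support of length at most 2 R.\<close>

lemma slice_sobolev_line:
  assumes w: "C1 (w :: 'a::euclidean_space \<Rightarrow> real) D" "zero_off (cube c R) w" "0 \<le> R"
    and I: "I \<subseteq> Basis" "card I = 1" and q: "q > 0"
  shows "epowr (\<integral>\<^sup>+y. epowr (ennreal \<bar>w (slice a I y)\<bar>) q \<partial>PiM I (\<lambda>_. lborel)) (1 / q)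
     \<le> ennreal ((2 * R) powr (1 / q)) * (\<integral>\<^sup>+y. ennreal (norm (D (slice a I y))) \<partial>PiM I (\<lambda>_. lborel))"
proof -
  obtain i where i: "I = {i}" using I(2) by (auto simp: card_1_singleton_iff)
  note [measurable] = C1_measurable[OF w(1)]
  let ?M = "PiM I (\<lambda>_. lborel :: real measure)"
  define Y where "Y = (\<integral>\<^sup>+y. ennreal (norm (D (slice a I y))) \<partial>?M)"
  have Y: "(NN s. ennreal (norm (D (slice a I (y(i := s)))))) = Y" for y
  proof -
    have "(\<integral>\<^sup>+y. ennreal (norm (D (a + y i *\<^sub>R i))) \<partial>PiM {i} (\<lambda>_. lborel)) = (NN s. ennreal (norm (D (a + s *\<^sub>R i))))"
      by (rule lborel_product.product_nn_integral_singleton) measurable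
    then show ?thesis by (simp add: Y_def i slice_def)
  qed
  have "(\<integral>\<^sup>+y. epowr (ennreal \<bar>w (slice a I y)\<bar>) q \<partial>?M) \<le> epowr Y q * ennreal ((2 * R) ^ card I)"
  proof (rule slice_integral_bound[OF I(1) w(3,2) q])
    fix y
    show "ennreal \<bar>w (slice a I y)\<bar> \<le> Y" using slice_line_bound[OF w(1) compact_cube w(2) I(1), of i a y] Y by (simp add: i)
  qed
  then have "epowr (\<integral>\<^sup>+y. epowr (ennreal \<bar>w (slice a I y)\<bar>) q \<partial>?M) (1 / q) \<le> epowr (epowr Y q * ennreal (2 * R)) (1 / q)"
    using q I(2) by (intro epowr_mono) auto
  also have "\<dots> = ennreal ((2 * R) powr (1 / q)) * Y" using q w(3) by (simp add: epowr_mult epowr_epowr epowr_ennreal mult.commute)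
  finally show ?thesis by (simp add: Y_def)
qed

text \<open>Both cases in one format. The power of \<open>R\<close> is the one dictated by scaling:
  its exponent is 0 in the critical case and 1/q on lines.\<close>

lemma slice_sobolev:
  assumes pq: "admissible m p q"
  obtains C where "C > 0" "\<And>(w :: 'a::euclidean_space \<Rightarrow> real) D c R I a. C1 w D \<Longrightarrow> zero_off (cube c R) w \<Longrightarrow> 0 < R \<Longrightarrow>
     I \<subseteq> Basis \<Longrightarrow> card I = m \<Longrightarrow>
     epowr (\<integral>\<^sup>+y. epowr (ennreal \<bar>w (slice a I y)\<bar>) q \<partial>PiM I (\<lambda>_. lborel)) (p / q)
     \<le> ennreal (C * R powr (m * p / q - m + p)) * (\<integral>\<^sup>+y. epowr (ennreal (norm (D (slice a I y)))) p \<partial>PiM I (\<lambda>_. lborel))"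
proof (cases "m \<ge> 2")
  case True
  then have q: "1 \<le> p" "p < q" "1 / q = 1 / p - 1 / real m" using pq by (auto simp: admissible_def)
  have "m * p / q - m + p = m * p * (1 / q) - m + p" by simp
  also have "\<dots> = 0" unfolding q(3) using True q(1) by (simp add: field_simps)
  finally have s: "m * p / q - m + p = 0" .
  let ?C = "(q * (real m - 1) / real m) powr p"
  show ?thesis
  proof (rule that[of ?C])
    show "?C > 0" using True q by simp
    fix w :: "'a \<Rightarrow> real" and D c and R :: real and I :: "'a set" and a :: 'a
    assume "C1 w D" "zero_off (cube c R) w" "0 < R" "I \<subseteq> Basis" "card I = m"
    then show "epowr (\<integral>\<^sup>+y. epowr (ennreal \<bar>w (slice a I y)\<bar>) q \<partial>PiM I (\<lambda>_. lborel)) (p / q)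
     \<le> ennreal (?C * R powr (m * p / q - m + p)) * (\<integral>\<^sup>+y. epowr (ennreal (norm (D (slice a I y)))) p \<partial>PiM I (\<lambda>_. lborel))"
      using slice_sobolev_critical[of w D c R I p q a] True q s by auto
  qed
next
  case False
  then have m: "m = 1" "p = 1" "q > 1" using pq by (auto simp: admissible_def)
  show ?thesis
  proof (rule that[of "2 powr (1 / q)"])
    fix w :: "'a \<Rightarrow> real" and D c and R :: real and I :: "'a set" and a :: 'a
    assume "C1 w D" "zero_off (cube c R) w" "0 < R" "I \<subseteq> Basis" "card I = m"
    then show "epowr (\<integral>\<^sup>+y. epowr (ennreal \<bar>w (slice a I y)\<bar>) q \<partial>PiM I (\<lambda>_. lborel)) (p / q)
     \<le> ennreal (2 powr (1 / q) * R powr (m * p / q - m + p)) * (\<integral>\<^sup>+y. epowr (ennreal (norm (D (slice a I y)))) p \<partial>PiM I (\<lambda>_. lborel))"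
      using slice_sobolev_line[of w D c R I q a] m by (simp add: powr_mult)
  qed simp
qed

section \<open>Smooth functions and mollifiers\<close>

text \<open>For m = 0 this is the standard flat function exp (-1/t); dividing by t^m makes the
  family closed under differentiation up to linear combinations.\<close>

definition flat :: "nat \<Rightarrow> real \<Rightarrow> real" where
  "flat m t = (if t \<le> 0 then 0 else exp (- (1 / t)) / t ^ m)"

lemma flat_pos: "t > 0 \<Longrightarrow> flat m t > 0" by (simp add: flat_def)

lemma flat_nonneg: "flat m t \<ge> 0" by (simp add: flat_def)

lemma flat_0: "t \<le> 0 \<Longrightarrow> flat m t = 0" by (simp add: flat_def)

lemma flat_tendsto_0: "(flat m \<longlongrightarrow> 0) (at_right 0)"
  by (force simp: eventually_at_right_field flat_def exp_minus field_simps power_inverse intro: filterlim_compose[OF tendsto_power_div_exp_0 filterlim_inverse_at_top_right] exI[of _ 1] Lim_transform_eventually)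

lemma flat_derivative:
  "(flat m has_real_derivative (flat (m + 2) t - real m * flat (m + 1) t)) (at t)"
proof (cases "t > 0")
  case True
  have "((\<lambda>t. exp (- (1 / t)) / t ^ m) has_real_derivative (flat (m + 2) t - real m * flat (m + 1) t)) (at t)"
    using True by (auto intro!: derivative_eq_intros simp: flat_def field_simps power2_eq_square)
       (cases m; simp add: field_simps power2_eq_square)
  then show ?thesis by (rule has_field_derivative_transform_within_open[of _ _ _ "{0<..}"]) (use True in \<open>auto simp: flat_def\<close>)
next
  case False
  show ?thesis
  proof (cases "t < 0")
    case True
    have "(flat m has_real_derivative 0) (at t)"
      by (rule has_field_derivative_transform_within_open[of "\<lambda>_. 0" _ _ "{..<0}"]) (use True in \<open>auto simp: flat_def\<close>)
    then show ?thesis using True by (simp add: flat_def)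
  next
    case f2: False
    then have t: "t = 0" using False by simp
    have "((\<lambda>y. (flat m y - flat m 0) / (y - 0)) \<longlongrightarrow> 0) (at_left 0)" by (rule Lim_transform_eventually[OF tendsto_const])
         (auto simp: eventually_at_left_field flat_def intro!: exI[of _ "-1"])
    moreover have "((\<lambda>y. (flat m y - flat m 0) / (y - 0)) \<longlongrightarrow> 0) (at_right 0)"
      by (rule Lim_transform_eventually[OF flat_tendsto_0[of "m + 1"]])
         (auto simp: eventually_at_right_field flat_def field_simps intro!: exI[of _ 1])
    ultimately have "((\<lambda>y. (flat m y - flat m 0) / (y - 0)) \<longlongrightarrow> 0) (at 0)" by (simp add: filterlim_split_at)
    then show ?thesis by (simp add: t has_field_derivative_iff flat_def)
  qed
qed

text \<open>A syntactic class closed under partial derivatives. Membership in every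
  \<open>C_k\<close> then follows by induction on k from \<open>smooth_derivative\<close> alone, and
  no calculus of higher derivatives enters.\<close>

inductive smooth :: "('a::euclidean_space \<Rightarrow> real) \<Rightarrow> bool" where
  smooth_const: "smooth (\<lambda>x. c)"
| smooth_inner: "smooth (\<lambda>x. x \<bullet> b)"
| smooth_add: "smooth f \<Longrightarrow> smooth g \<Longrightarrow> smooth (\<lambda>x. f x + g x)"
| smooth_mult: "smooth f \<Longrightarrow> smooth g \<Longrightarrow> smooth (\<lambda>x. f x * g x)"
| smooth_inverse: "smooth f \<Longrightarrow> (\<And>x. f x \<noteq> 0) \<Longrightarrow> smooth (\<lambda>x. inverse (f x))"
| smooth_flat: "smooth f \<Longrightarrow> smooth (\<lambda>x. flat m (f x))"

lemma smooth_diff: "smooth f \<Longrightarrow> smooth g \<Longrightarrow> smooth (\<lambda>x. f x - g x)"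
  using smooth_add[OF _ smooth_mult[OF smooth_const[of "-1"]], of f g] by simp

lemma smooth_sum: "finite I \<Longrightarrow> (\<And>i. i \<in> I \<Longrightarrow> smooth (f i)) \<Longrightarrow> smooth (\<lambda>x. \<Sum>i\<in>I. f i x)"
  by (induction I rule: finite_induct) (auto intro: smooth_const smooth_add)

lemma smooth_derivative:
  "smooth f \<Longrightarrow> \<exists>D. (\<forall>x. (f has_derivative (\<lambda>h. D x \<bullet> h)) (at x)) \<and> (\<forall>b. smooth (\<lambda>x. D x \<bullet> b))"
proof (induction rule: smooth.induct)
  case (smooth_const c)
  show ?case by (rule exI[of _ "\<lambda>x. 0"]) (auto intro: smooth.intros)
next
  case (smooth_inner b)
  show ?case by (rule exI[of _ "\<lambda>x. b"]) (auto intro!: smooth.intros derivative_eq_intros simp: inner_commute)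
next
  case (smooth_add f g)
  then obtain F G where *: "\<forall>x. (f has_derivative (\<lambda>h. F x \<bullet> h)) (at x)" "\<forall>b. smooth (\<lambda>x. F x \<bullet> b)"
    "\<forall>x. (g has_derivative (\<lambda>h. G x \<bullet> h)) (at x)" "\<forall>b. smooth (\<lambda>x. G x \<bullet> b)" by blast
  show ?case by (rule exI[of _ "\<lambda>x. F x + G x"]) (use * in \<open>auto intro!: smooth.intros has_derivative_add simp: inner_add_left\<close>)
next
  case (smooth_mult f g)
  then obtain F G where *: "\<forall>x. (f has_derivative (\<lambda>h. F x \<bullet> h)) (at x)" "\<forall>b. smooth (\<lambda>x. F x \<bullet> b)"
    "\<forall>x. (g has_derivative (\<lambda>h. G x \<bullet> h)) (at x)" "\<forall>b. smooth (\<lambda>x. G x \<bullet> b)" by blast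
  show ?case
  proof (intro exI[of _ "\<lambda>x. g x *\<^sub>R F x + f x *\<^sub>R G x"] conjI allI)
    show "((\<lambda>x. f x * g x) has_derivative (\<lambda>h. (g x *\<^sub>R F x + f x *\<^sub>R G x) \<bullet> h)) (at x)" for x
      using has_derivative_mult[OF *(1)[rule_format] *(3)[rule_format], of x] by (simp add: inner_add_left algebra_simps)
    show "smooth (\<lambda>x. (g x *\<^sub>R F x + f x *\<^sub>R G x) \<bullet> b)" for b using * smooth_mult by (auto simp: inner_add_left intro!: smooth.intros)
  qed
next
  case (smooth_inverse f)
  then obtain F where *: "\<forall>x. (f has_derivative (\<lambda>h. F x \<bullet> h)) (at x)" "\<forall>b. smooth (\<lambda>x. F x \<bullet> b)" by blast
  show ?case
  proof (intro exI[of _ "\<lambda>x. ((-1) * (inverse (f x) * inverse (f x))) *\<^sub>R F x"] conjI allI)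
    show "((\<lambda>x. inverse (f x)) has_derivative (\<lambda>h. (((-1) * (inverse (f x) * inverse (f x))) *\<^sub>R F x) \<bullet> h)) (at x)" for x
      using Deriv.has_derivative_inverse[OF smooth_inverse.hyps(2)[of x] *(1)[rule_format, of x]] by (simp add: algebra_simps)
    show "smooth (\<lambda>x. (((-1) * (inverse (f x) * inverse (f x))) *\<^sub>R F x) \<bullet> b)" for b
      unfolding inner_scaleR_left using * smooth_inverse.hyps by (intro smooth.intros) auto
  qed
next
  case (smooth_flat f m)
  then obtain F where *: "\<forall>x. (f has_derivative (\<lambda>h. F x \<bullet> h)) (at x)" "\<forall>b. smooth (\<lambda>x. F x \<bullet> b)" by blast
  show ?case
  proof (intro exI[of _ "\<lambda>x. (flat (m + 2) (f x) + (- real m) * flat (m + 1) (f x)) *\<^sub>R F x"] conjI allI)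
    show "((\<lambda>x. flat m (f x)) has_derivative (\<lambda>h. ((flat (m + 2) (f x) + (- real m) * flat (m + 1) (f x)) *\<^sub>R F x) \<bullet> h)) (at x)" for x
      using DERIV_compose_FDERIV[OF flat_derivative *(1)[rule_format], of m x] by (simp add: mult.commute)
    show "smooth (\<lambda>x. ((flat (m + 2) (f x) + (- real m) * flat (m + 1) (f x)) *\<^sub>R F x) \<bullet> b)" for b
      unfolding inner_scaleR_left using * smooth_flat by (intro smooth.intros) auto
  qed
qed

lemma smooth_C1: assumes "smooth f" obtains D where "C1 f D"
proof -
  obtain D where D: "\<forall>x. (f has_derivative (\<lambda>h. D x \<bullet> h)) (at x)" "\<forall>b. smooth (\<lambda>x. D x \<bullet> b)"
    using smooth_derivative[OF assms] by blast
  have "continuous_on UNIV (\<lambda>x. D x \<bullet> b)" for b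
    using smooth_derivative[OF D(2)[rule_format, of b]] by (meson continuous_at_imp_continuous_on has_derivative_continuous)
  then have "C1 f D" using D unfolding C1_def by (auto intro: continuous_on_componentwise[THEN iffD2])
  then show ?thesis using that by blast
qed

lemma smooth_C_k: "smooth f \<Longrightarrow> C_k k f"
proof (induction k arbitrary: f)
  case 0
  then show ?case using smooth_C1 C1_continuous by (metis C_k.simps(1))
next
  case (Suc k)
  obtain D where D: "\<forall>x. (f has_derivative (\<lambda>h. D x \<bullet> h)) (at x)" "\<forall>b. smooth (\<lambda>x. D x \<bullet> b)"
    using smooth_derivative[OF Suc.prems] by blast
  then have "frechet_derivative f (at x) = (\<lambda>h. D x \<bullet> h)" for x using frechet_derivative_at by metis
  then show ?case using D Suc.IH by (auto simp: differentiable_on_def differentiable_def)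
qed

lemma smooth_test_function:
  assumes "smooth f" "compact S" "zero_off S f" "S \<subseteq> \<Omega>"
  shows "f \<in> test_functions \<Omega>"
proof -
  have "closure {x. f x \<noteq> 0} \<subseteq> S" using assms by (intro closure_minimal) (auto simp: zero_off_def compact_imp_closed)
  then show ?thesis using assms smooth_C_k[OF assms(1)]
    by (auto simp: test_functions_def compact_closure zero_off_def intro: bounded_subset[OF compact_imp_bounded[OF assms(2)]])
qed

lemma test_function_C1:
  assumes "f \<in> test_functions \<Omega>"
  obtains D S where "C1 f D" "compact S" "S \<subseteq> \<Omega>" "zero_off S f" "\<And>x b. frechet_derivative f (at x) b = D x \<bullet> b"
proof -
  have C: "C_k (Suc 0) f" "C_k (Suc (Suc 0)) f" using assms by (auto simp: test_functions_def simp del: C_k.simps)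
  define D where "D x = (\<Sum>b\<in>Basis. frechet_derivative f (at x) b *\<^sub>R b)" for x
  have der: "(f has_derivative frechet_derivative f (at x)) (at x)" for x using C(1) by (auto simp: differentiable_on_def frechet_derivative_works[symmetric])
  have D: "frechet_derivative f (at x) h = D x \<bullet> h" for x h
  proof -
    have lin: "linear (frechet_derivative f (at x))" using der has_derivative_linear by blast
    have "frechet_derivative f (at x) (\<Sum>b\<in>Basis. (h \<bullet> b) *\<^sub>R b) = (\<Sum>b\<in>Basis. (h \<bullet> b) * frechet_derivative f (at x) b)"
      using lin by (simp add: linear_sum linear_scale)
    then show ?thesis by (simp add: euclidean_representation D_def inner_sum_right mult.commute inner_commute[of _ h])
  qed
  have "continuous_on UNIV (\<lambda>x. frechet_derivative f (at x) b)" if "b \<in> Basis" for b using C(1) that by auto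
  then have "continuous_on UNIV D" unfolding D_def by (intro continuous_intros) auto
  moreover have "(f has_derivative (\<lambda>h. D x \<bullet> h)) (at x)" for x using der[of x] D by (metis (no_types, lifting) ext)
  ultimately have "C1 f D" by (simp add: C1_def)
  moreover have "compact (closure {x. f x \<noteq> 0})" "closure {x. f x \<noteq> 0} \<subseteq> \<Omega>" using assms by (auto simp: test_functions_def)
  moreover have "zero_off (closure {x. f x \<noteq> 0}) f" using closure_subset by (force simp: zero_off_def)
  ultimately show ?thesis using that D by blast
qed

lemma smooth_sqdist: "smooth (\<lambda>x. (norm (x - c))\<^sup>2)"
proof -
  have "smooth (\<lambda>x::'a. \<Sum>b\<in>Basis. (x \<bullet> b - c \<bullet> b) * (x \<bullet> b - c \<bullet> b))"
    by (intro smooth_sum smooth_mult smooth_diff smooth_inner smooth_const) auto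
  moreover have "(\<lambda>x::'a. \<Sum>b\<in>Basis. (x \<bullet> b - c \<bullet> b) * (x \<bullet> b - c \<bullet> b)) = (\<lambda>x. (norm (x - c))\<^sup>2)"
  proof
    fix x :: 'a
    show "(\<Sum>b\<in>Basis. (x \<bullet> b - c \<bullet> b) * (x \<bullet> b - c \<bullet> b)) = (norm (x - c))\<^sup>2"
      unfolding power2_norm_eq_inner by (subst euclidean_inner) (simp add: inner_diff_left)
  qed
  ultimately show ?thesis by simp
qed

text \<open>The quotient f / (f + g), where f is positive exactly inside the outer ball and g
  exactly outside the inner one, so the denominator never vanishes. Positivity on the whole open
  outer ball later places that ball inside an essential support.\<close>

lemma smooth_plateau:
  fixes c :: "'a::euclidean_space"
  assumes "0 < a" "a < b"
  obtains P where "smooth P" "\<And>x. x \<in> cball c a \<Longrightarrow> P x = 1" "zero_off (cball c b) P" "\<And>x. 0 \<le> P x" "\<And>x. P x \<le> 1"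
    "\<And>x. x \<in> ball c b \<Longrightarrow> P x > 0"
proof -
  let ?f = "\<lambda>x. flat 0 (b\<^sup>2 - (norm (x - c))\<^sup>2)" and ?g = "\<lambda>x. flat 0 ((norm (x - c))\<^sup>2 - a\<^sup>2)"
  define P where "P x = ?f x * inverse (?f x + ?g x)" for x
  have pos: "?f x + ?g x > 0" for x
  proof (cases "norm (x - c) < b")
    case True
    then have "(norm (x - c))\<^sup>2 < b\<^sup>2" by (intro power_strict_mono) auto
    then show ?thesis using flat_pos[of "b\<^sup>2 - (norm (x - c))\<^sup>2" 0] flat_nonneg[of 0 "(norm (x - c))\<^sup>2 - a\<^sup>2"] by simp
  next
    case False
    then have "a\<^sup>2 < (norm (x - c))\<^sup>2" using assms by (intro power_strict_mono) auto
    then show ?thesis using flat_pos[of "(norm (x - c))\<^sup>2 - a\<^sup>2" 0] flat_nonneg[of 0 "b\<^sup>2 - (norm (x - c))\<^sup>2"] by simp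
  qed
  have nz: "?f x + ?g x \<noteq> 0" for x using pos[of x] by simp
  have s: "smooth P" unfolding P_def by (intro smooth_mult smooth_inverse smooth_add smooth_flat smooth_diff smooth_const smooth_sqdist) (use nz in auto)
  have one: "P x = 1" if "x \<in> cball c a" for x
  proof -
    have "norm (x - c) \<le> a" using that by (simp add: dist_norm norm_minus_commute)
    then have "(norm (x - c))\<^sup>2 \<le> a\<^sup>2" by (intro power_mono) auto
    then have "?g x = 0" by (simp add: flat_0)
    then show ?thesis using nz[of x] by (simp add: P_def)
  qed
  have van: "zero_off (cball c b) P" using assms by (simp add: dist_norm norm_minus_commute flat_0 zero_off_def P_def)
  have "P x > 0" if "x \<in> ball c b" for x
  proof -
    have "norm (x - c) < b" using that by (simp add: dist_norm norm_minus_commute)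
    then have "(norm (x - c))\<^sup>2 < b\<^sup>2" by (intro power_strict_mono) auto
    then have "?f x > 0" by (simp add: flat_pos)
    then show ?thesis using pos[of x] by (simp add: P_def)
  qed
  moreover have "0 \<le> P x" "P x \<le> 1" for x
    using pos[of x] flat_nonneg[of 0 "b\<^sup>2 - (norm (x - c))\<^sup>2"] flat_nonneg[of 0 "(norm (x - c))\<^sup>2 - a\<^sup>2"] by (auto simp: P_def field_simps)
  ultimately show ?thesis using that s one van by blast
qed

text \<open>Smoothness is also demanded of the reflected translates y -> K (x - y), since they serve
  as test functions when a convolution is differentiated.\<close>

definition mollifier :: "real \<Rightarrow> ('a::euclidean_space \<Rightarrow> real) \<Rightarrow> bool" where
  "mollifier e K \<longleftrightarrow> (\<forall>x. smooth (\<lambda>y. K (x - y))) \<and> smooth K \<and> (\<forall>x. 0 \<le> K x) \<and> zero_off (cball 0 e) K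
     \<and> integrable lborel K \<and> (LINT x|lborel. K x) = 1"

lemma mollifier_exists:
  assumes "e > 0" shows "\<exists>K::'a::euclidean_space \<Rightarrow> real. mollifier e K"
proof -
  define F where "F x = flat 0 (e\<^sup>2 - (norm x)\<^sup>2)" for x :: 'a
  have sF: "smooth (\<lambda>y. F (x - y))" for x
    unfolding F_def using smooth_flat[OF smooth_diff[OF smooth_const smooth_sqdist], of 0 "e\<^sup>2" x] by (simp add: norm_minus_commute)
  have sF0: "smooth F" unfolding F_def using smooth_flat[OF smooth_diff[OF smooth_const smooth_sqdist], of 0 "e\<^sup>2" 0] by simp
  have v: "zero_off (cball 0 e) F"
    unfolding zero_off_def F_def using assms by (auto intro!: flat_0 power_mono)
  obtain D where D: "C1 F D" using smooth_C1[OF sF0] .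
  have iF: "integrable lborel F" by (rule integrable_continuous_vanishes[OF C1_continuous[OF D] compact_cball v])
  have nn: "F x \<ge> 0" for x by (simp add: F_def flat_nonneg)
  have pos: "F x > 0" if "x \<in> ball 0 e" for x
  proof -
    have "(norm x)\<^sup>2 < e\<^sup>2" using that by (intro power_strict_mono) auto
    then show ?thesis by (simp add: F_def flat_pos)
  qed
  have "(LINT x|lborel. F x) \<noteq> 0"
  proof
    assume "(LINT x|lborel. F x) = 0"
    then have "AE x in lborel. F x = 0" using integral_nonneg_eq_0_iff_AE[OF iF] nn by simp
    then have "AE x in lborel. x \<notin> ball (0::'a) e"
    proof (rule AE_mp, intro AE_I2 impI)
      fix x :: 'a assume "F x = 0" then show "x \<notin> ball 0 e" using pos[of x] by auto
    qed
    then have "leb (ball (0::'a) e) = 0" by (subst (asm) AE_iff_measurable[of "ball 0 e"]) auto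
    then have "negligible (ball (0::'a) e)" by (simp add: negligible_iff_emeasure0)
    then show False using assms open_not_negligible[of "ball (0::'a) e"] by auto
  qed
  then have c: "(LINT x|lborel. F x) > 0" using nn by (simp add: less_le)
  let ?K = "\<lambda>x. inverse (LINT x|lborel. F x) * F x"
  have "mollifier e ?K"
    unfolding mollifier_def using c nn v iF sF sF0 by (auto intro!: smooth_mult smooth_const simp: zero_off_def)
  then show ?thesis by blast
qed

lemma mollifier_C1:
  assumes "mollifier e K" obtains D where "C1 K D" using assms smooth_C1 by (auto simp: mollifier_def)

section \<open>Continuity of translations in the mean\<close>

lemma compact_inner_approx:
  assumes "A \<in> sets lborel" "leb A < \<infinity>" "(e::real) > 0"
  obtains K where "compact (K :: 'a::euclidean_space set)" "K \<subseteq> A" "leb (A - K) < e"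
proof -
  have [measurable]: "A \<in> sets borel" using assms by simp
  have lb: "A \<in> sets lebesgue" using assms by (simp add: sets_completionI_sets)
  obtain T where T: "closed T" "T \<subseteq> A" "A - T \<in> lmeasurable" "emeasure lebesgue (A - T) < ennreal (e / 2)"
    using sets_lebesgue_inner_closed[OF lb, of "e / 2"] assms(3) by auto
  have [measurable]: "T \<in> sets borel" using T by auto
  have T2: "leb (A - T) < ennreal (e / 2)" using T(4) by (simp add: main_part_sets)
  have "(\<lambda>n. leb (A - cball 0 (real n))) ----> leb (\<Inter>n. A - cball 0 (real n))"
  proof (rule Lim_emeasure_decseq)
    show "decseq (\<lambda>n. A - cball 0 (real n))" by (auto simp: decseq_def)
    fix n have "leb (A - cball 0 (real n)) \<le> leb A" by (intro emeasure_mono) auto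
    then show "leb (A - cball 0 (real n)) \<noteq> \<infinity>" using assms by (auto simp: top_unique)
  qed auto
  moreover have "(\<Inter>n. A - cball 0 (real n)) = {}" using real_arch_simple by (auto simp: not_le)
  ultimately have "(\<lambda>n. leb (A - cball 0 (real n))) ----> 0" by (simp only: emeasure_empty)
  then have "\<forall>\<^sub>F n in sequentially. leb (A - cball 0 (real n)) < ennreal (e / 2)" using assms(3) by (intro order_tendstoD) auto
  then obtain n where n: "leb (A - cball 0 (real n)) < ennreal (e / 2)" by (auto simp: eventually_sequentially)
  have "leb (A - (T \<inter> cball 0 (real n))) \<le> leb ((A - T) \<union> (A - cball 0 (real n)))" by (intro emeasure_mono) auto
  also have "\<dots> \<le> leb (A - T) + leb (A - cball 0 (real n))" by (intro emeasure_subadditive) auto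
  also have "\<dots> < ennreal (e / 2) + ennreal (e / 2)" using T2 n by (rule add_strict_mono)
  also have "\<dots> = ennreal e" using assms(3) by (simp flip: ennreal_plus)
  finally show ?thesis using T by (intro that[of "T \<inter> cball 0 (real n)"]) (auto simp: closed_Int_compact)
qed

definition shift_diff :: "('a::euclidean_space \<Rightarrow> 'b::{banach, second_countable_topology}) \<Rightarrow> 'a \<Rightarrow> ennreal" where
  "shift_diff f h = (NN x. ennreal (norm (f (x + h) - f x)))"

text \<open>A density argument along \<open>integrable_induct\<close>. For an indicator, a compact
  set inside \<open>A\<close> and an open set around \<open>A\<close> approximate it in measure, and
  shifts shorter than the distance from the compact set to the complement of the open one move the
  first into the second.\<close>

lemma L1_translation:
  fixes f :: "'a::euclidean_space \<Rightarrow> 'b::{banach, second_countable_topology}"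
  assumes "integrable lborel f"
  shows "\<forall>e>0::real. \<exists>d>0. \<forall>h. norm h < d \<longrightarrow> shift_diff f h \<le> e"
  using assms
proof (induction rule: integrable_induct)
  case (base A c)
  show ?case
  proof (intro allI impI)
    fix e :: real assume e: "e > 0"
    define e1 where "e1 = e / (4 * (norm c + 1))"
    have e1: "e1 > 0" using e by (simp add: e1_def add_nonneg_pos)
    have [measurable]: "A \<in> sets borel" using base by simp
    obtain K where K: "compact K" "K \<subseteq> A" "leb (A - K) < e1"
      using compact_inner_approx[OF base e1] .
    obtain U where U: "open U" "A \<subseteq> U" "leb (U - A) < e1" using outer_regular_lborel[of A e1] e1 base(1) by auto
    have [measurable]: "K \<in> sets borel" "U \<in> sets borel" using K U by (auto simp: compact_imp_closed)
    have "K \<inter> (- U) = {}" using K U by auto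
    then obtain d where d: "d > 0" "\<And>x y. x \<in> K \<Longrightarrow> y \<in> - U \<Longrightarrow> d \<le> dist x y"
      using separate_compact_closed[OF K(1), of "- U"] U by (auto simp: closed_Compl)
    have "shift_diff (\<lambda>x. indicator A x *\<^sub>R c) h \<le> e" if h: "norm h < d" for h
    proof -
      \<comment> \<open>Where \<open>A\<close> and its shift disagree, the point or its shifted copy
        lies in one of the thin sets \<open>A - K\<close> and \<open>U - A\<close>.\<close>
      define g where "g x = ennreal (norm c) * (indicator (A - K) x + indicator (U - A) x)" for x
      have [measurable]: "g \<in> Borel" unfolding g_def by measurable
      have pw: "ennreal (norm (indicator A (x + h) *\<^sub>R c - indicator A x *\<^sub>R c)) \<le> g (x + h) + g x" for x
      proof -
        have "x \<in> K \<Longrightarrow> x + h \<in> U" "x + h \<in> K \<Longrightarrow> x \<in> U"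
          using d(2)[of x "x + h"] d(2)[of "x + h" x] h by (auto simp: dist_norm)
        then show ?thesis using K(2) by (auto simp: g_def indicator_def)
      qed
      have G: "(NN x. g x) \<le> ennreal (norm c) * (e1 + e1)"
      proof -
        have "(NN x. g x) = ennreal (norm c) * (leb (A - K) + leb (U - A))"
          unfolding g_def by (simp add: nn_integral_cmult nn_integral_add)
        also have "\<dots> \<le> ennreal (norm c) * (ennreal e1 + ennreal e1)" using K U by (intro mult_left_mono add_mono) auto
        finally show ?thesis using e1 by (simp flip: ennreal_plus)
      qed
      have "shift_diff (\<lambda>x. indicator A x *\<^sub>R c) h \<le> (NN x. g (x + h) + g x)"
        unfolding shift_diff_def by (intro nn_integral_mono pw)
      also have "\<dots> = (NN x. g x) + (NN x. g x)" by (simp add: nn_integral_add nn_integral_shift)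
      also have "\<dots> \<le> ennreal (norm c) * (e1 + e1) + ennreal (norm c) * (e1 + e1)" using G by (intro add_mono)
      also have "\<dots> = ennreal (norm c * (4 * e1))" using e1 by (simp add: ennreal_mult[symmetric] flip: ennreal_plus)
      also have "\<dots> \<le> ennreal e"
      proof (rule ennreal_leI)
        have "4 * e1 = e / (norm c + 1)" unfolding e1_def by (metis mult_divide_mult_cancel_left times_divide_eq_right zero_neq_numeral)
        then have "norm c * (4 * e1) = e * (norm c / (norm c + 1))" by simp
        also have "\<dots> \<le> e * 1" using e by (intro mult_left_mono) (auto simp: divide_le_eq_1 add_nonneg_pos)
        finally show "norm c * (4 * e1) \<le> e" by simp
      qed
      finally show ?thesis .
    qed
    then show "\<exists>d>0. \<forall>h. norm h < d \<longrightarrow> shift_diff (\<lambda>x. indicator A x *\<^sub>R c) h \<le> e" using d by blast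
  qed
next
  case (add f g)
  have [measurable]: "f \<in> Borel" "g \<in> Borel" using add by auto
  show ?case
  proof (intro allI impI)
    fix e :: real assume "e > 0"
    then have "e / 2 > 0" by simp
    then obtain d1 d2 where d: "d1 > 0" "\<And>h. norm h < d1 \<Longrightarrow> shift_diff f h \<le> e / 2"
       "d2 > 0" "\<And>h. norm h < d2 \<Longrightarrow> shift_diff g h \<le> e / 2"
      using add.IH(1)[rule_format, of "e / 2"] add.IH(2)[rule_format, of "e / 2"] by auto
    have "shift_diff (\<lambda>x. f x + g x) h \<le> e" if "norm h < min d1 d2" for h
    proof -
      have "shift_diff (\<lambda>x. f x + g x) h \<le> (NN x. ennreal (norm (f (x + h) - f x)) + ennreal (norm (g (x + h) - g x)))"
        unfolding shift_diff_def by (intro nn_integral_mono) (simp add: ennreal_plus[symmetric] add_diff_add norm_triangle_ineq del: ennreal_plus)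
      also have "\<dots> = shift_diff f h + shift_diff g h" unfolding shift_diff_def by (rule nn_integral_add) auto
      also have "\<dots> \<le> ennreal (e / 2) + ennreal (e / 2)" using d that by (intro add_mono) auto
      also have "\<dots> = ennreal e" using \<open>e > 0\<close> by (simp flip: ennreal_plus)
      finally show ?thesis .
    qed
    then show "\<exists>d>0. \<forall>h. norm h < d \<longrightarrow> shift_diff (\<lambda>x. f x + g x) h \<le> e" using d by (metis min_less_iff_conj)
  qed
next
  case (lim f s)
  have [measurable]: "f \<in> Borel" "\<And>i. s i \<in> Borel" using lim by auto
  have "(\<lambda>i. (NN x. ennreal (norm (s i x - f x)))) ----> (\<integral>\<^sup>+x. 0 \<partial>(lborel :: 'a measure))"
  proof (rule nn_integral_dominated_convergence[where w="\<lambda>x. ennreal (3 * norm (f x))"])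
    show "(NN x. ennreal (3 * norm (f x))) < \<infinity>"
      using lim.hyps(4) by (simp add: integrable_iff_bounded ennreal_mult' nn_integral_cmult ennreal_mult_less_top)
    show "AE x in lborel. ennreal (norm (s i x - f x)) \<le> ennreal (3 * norm (f x))" for i
    proof (intro AE_I2 ennreal_leI)
      fix x :: 'a
      show "norm (s i x - f x) \<le> 3 * norm (f x)" using lim.hyps(3)[of x i] norm_triangle_ineq4[of "s i x" "f x"] by simp
    qed
    show "AE x in lborel. (\<lambda>i. ennreal (norm (s i x - f x))) ----> 0"
    proof (intro AE_I2)
      fix x :: 'a
      have "(\<lambda>i. norm (s i x - f x)) ----> 0" using lim.hyps(2)[of x] by (simp add: LIM_zero tendsto_norm_zero)
      then show "(\<lambda>i. ennreal (norm (s i x - f x))) ----> 0" using tendsto_ennrealI by fastforce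
    qed
  qed auto
  then have conv: "(\<lambda>i. (NN x. ennreal (norm (s i x - f x)))) ----> 0" by simp
  show ?case
  proof (intro allI impI)
    fix e :: real assume e: "e > 0"
    then have "\<forall>\<^sub>F i in sequentially. (NN x. ennreal (norm (s i x - f x))) < ennreal (e / 3)" using conv by (intro order_tendstoD) auto
    then obtain i where i: "(NN x. ennreal (norm (s i x - f x))) < ennreal (e / 3)" by (auto simp: eventually_sequentially)
    obtain d where d: "d > 0" "\<And>h. norm h < d \<Longrightarrow> shift_diff (s i) h \<le> e / 3" using lim.IH[of i, rule_format, of "e / 3"] e by auto
    have "shift_diff f h \<le> e" if "norm h < d" for h
    proof -
      have "shift_diff f h \<le> (NN x. ennreal (norm (s i (x + h) - f (x + h))) + ennreal (norm (s i (x + h) - s i x)) + ennreal (norm (s i x - f x)))"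
        unfolding shift_diff_def
      proof (intro nn_integral_mono)
        fix x
        have "norm (f (x + h) - f x) \<le> norm (s i (x + h) - f (x + h)) + norm (s i (x + h) - s i x) + norm (s i x - f x)" by norm
        then show "ennreal (norm (f (x + h) - f x)) \<le> ennreal (norm (s i (x + h) - f (x + h))) + ennreal (norm (s i (x + h) - s i x)) + ennreal (norm (s i x - f x))"
          by (simp add: ennreal_plus[symmetric] ennreal_leI del: ennreal_plus)
      qed
      also have "\<dots> = (NN x. ennreal (norm (s i x - f x))) + shift_diff (s i) h + (NN x. ennreal (norm (s i x - f x)))"
        unfolding shift_diff_def by (simp add: nn_integral_add nn_integral_shift[of "\<lambda>x. ennreal (norm (s i x - f x))"])
      also have "\<dots> \<le> ennreal (e / 3) + ennreal (e / 3) + ennreal (e / 3)" using i d(2)[OF that] by (intro add_mono) auto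
      also have "\<dots> = ennreal e" using e by (simp flip: ennreal_plus)
      finally show ?thesis .
    qed
    then show "\<exists>d>0. \<forall>h. norm h < d \<longrightarrow> shift_diff f h \<le> e" using d by blast
  qed
qed

section \<open>Mollification\<close>

definition mol :: "('a::euclidean_space \<Rightarrow> real) \<Rightarrow> ('a \<Rightarrow> 'b::{banach, second_countable_topology}) \<Rightarrow> 'a \<Rightarrow> 'b" where
  "mol K w x = (LINT y|lborel. K (x - y) *\<^sub>R w y)"

lemma lborel_reflect: "distr lborel borel (\<lambda>y. x - y) = (lborel :: 'a::euclidean_space measure)"
proof -
  have "(lborel::'a measure) = distr lborel borel (\<lambda>y. x + (-1) *\<^sub>R y)" by (subst lborel_affine[of "-1" x]) (auto simp: density_1)
  then show ?thesis by simp
qed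

lemma integral_reflect:
  fixes f :: "'a::euclidean_space \<Rightarrow> 'b::{banach, second_countable_topology}"
  assumes "f \<in> Borel"
  shows "(LINT y|lborel. f (x - y)) = (LINT y|lborel. f y)" using integral_distr[of "\<lambda>y. x - y" lborel borel f] assms lborel_reflect[of x] by simp

lemma integrable_reflect:
  fixes f :: "'a::euclidean_space \<Rightarrow> 'b::{banach, second_countable_topology}"
  assumes "integrable lborel f"
  shows "integrable lborel (\<lambda>y. f (x - y))"
proof -
  have "f \<in> Borel" using assms by auto
  then show ?thesis using integrable_distr_eq[of "\<lambda>y. x - y" lborel borel f] assms lborel_reflect[of x] by simp
qed

lemma integrable_bounded_scaleR:
  fixes w :: "'a \<Rightarrow> 'b::{banach, second_countable_topology}"
  assumes "integrable M w" "k \<in> borel_measurable M" "\<And>x. \<bar>k x\<bar> \<le> B"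
  shows "integrable M (\<lambda>x. k x *\<^sub>R w x)"
proof (rule Bochner_Integration.integrable_bound[of M "\<lambda>x. B *\<^sub>R w x"])
  show "AE x in M. norm (k x *\<^sub>R w x) \<le> norm (B *\<^sub>R w x)"
  proof (rule AE_I2)
    fix x
    have "\<bar>k x\<bar> \<le> \<bar>B\<bar>" using assms(3)[of x] by simp
    then show "norm (k x *\<^sub>R w x) \<le> norm (B *\<^sub>R w x)" by (simp add: mult_right_mono)
  qed
qed (use assms in auto)

lemma integrable_scaleR_bounded:
  fixes w :: "'a \<Rightarrow> real" and k :: "'a \<Rightarrow> 'b::{banach, second_countable_topology}"
  assumes "integrable M w" "k \<in> borel_measurable M" "\<And>x. norm (k x) \<le> B"
  shows "integrable M (\<lambda>x. w x *\<^sub>R k x)"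
proof (rule Bochner_Integration.integrable_bound[of M "\<lambda>x. B * w x"])
  show "AE x in M. norm (w x *\<^sub>R k x) \<le> norm (B * w x)"
  proof (rule AE_I2)
    fix x
    have "norm (k x) \<le> \<bar>B\<bar>" using assms(3)[of x] by simp
    then have "\<bar>w x\<bar> * norm (k x) \<le> \<bar>w x\<bar> * \<bar>B\<bar>" by (intro mult_left_mono) auto
    then show "norm (w x *\<^sub>R k x) \<le> norm (B * w x)" by (simp add: abs_mult mult.commute)
  qed
qed (use assms in auto)

lemma integrable_mol:
  fixes w :: "'a::euclidean_space \<Rightarrow> 'b::{banach, second_countable_topology}"
  assumes "C1 K D" "compact S" "zero_off S K" "integrable lborel w"
  shows "integrable lborel (\<lambda>y. K (x - y) *\<^sub>R w y)"
proof -
  obtain B where "\<And>x. \<bar>K x\<bar> \<le> B" using C1_bounded[OF assms(1-3)] by blast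
  then show ?thesis using C1_measurable[OF assms(1)] by (intro integrable_bounded_scaleR[where B=B] assms(4)) auto
qed

lemma uniformly_continuous_vanishes:
  fixes f :: "'a::euclidean_space \<Rightarrow> 'b::real_normed_vector"
  assumes "continuous_on UNIV f" "compact S" "zero_off S f" "e > 0"
  obtains d where "d > 0" "\<And>x y. norm (x - y) < d \<Longrightarrow> norm (f x - f y) < e"
proof -
  obtain R where R: "\<And>x. x \<in> S \<Longrightarrow> norm x \<le> R" "R > 0" using compact_imp_bounded[OF assms(2)] by (auto simp: bounded_pos)
  have "uniformly_continuous_on (cball 0 (R + 1)) f" by (intro compact_uniformly_continuous continuous_on_subset[OF assms(1)]) auto
  then obtain d where d: "d > 0" "\<And>x y. x \<in> cball 0 (R + 1) \<Longrightarrow> y \<in> cball 0 (R + 1) \<Longrightarrow> dist y x < d \<Longrightarrow> dist (f y) (f x) < e"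
    unfolding uniformly_continuous_on_def using assms(4) by meson
  show ?thesis
  proof (rule that[of "min d 1"])
    fix x y :: 'a assume xy: "norm (x - y) < min d 1"
    show "norm (f x - f y) < e"
    proof (cases "norm x \<le> R + 1 \<and> norm y \<le> R + 1")
      case True then show ?thesis using d(2)[of y x] xy by (auto simp: dist_norm)
    next
      case False
      have "norm x \<le> norm y + norm (x - y)" "norm y \<le> norm x + norm (x - y)" by norm+
      then have "norm x > R" "norm y > R" using False xy by auto
      then have "x \<notin> S" "y \<notin> S" using R by force+
      then show ?thesis using assms by (simp add: zero_off_def)
    qed
  qed (use d in auto)
qed

text \<open>The mean value theorem and the uniform continuity of \<open>D\<close> give a first-order
  remainder that is uniform in the integration variable; it is then integrated against |w|.\<close>

lemma C1_mol:
  fixes w :: "'a::euclidean_space \<Rightarrow> real"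
  assumes K: "C1 K D" "compact S" "zero_off S K" and w: "integrable lborel w"
  shows "C1 (mol K w) (\<lambda>x. LINT y|lborel. w y *\<^sub>R D (x - y))"
proof -
  have vD: "zero_off S D" by (rule C1_zero_off[OF K(1) compact_imp_closed[OF K(2)] K(3)])
  obtain B where B: "\<And>x. norm (D x) \<le> B" using continuous_vanishes_bounded[OF C1_continuous_grad[OF K(1)] K(2) vD] by blast
  note [measurable] = C1_measurable[OF K(1)] borel_measurable_integrable[OF w]
  define G where "G x = (LINT y|lborel. w y *\<^sub>R D (x - y))" for x
  define N where "N = (LINT y|lborel. \<bar>w y\<bar>)"
  have N0: "N \<ge> 0" by (simp add: N_def)
  have iD: "integrable lborel (\<lambda>y. w y *\<^sub>R D (x - y))" for x by (rule integrable_scaleR_bounded[OF w _ B]) measurable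
  have iK: "integrable lborel (\<lambda>y. K (x - y) * w y)" for x using integrable_mol[OF K w, of x] by simp
  have UC: "\<exists>d>0. \<forall>x y. norm (x - y) < d \<longrightarrow> norm (D x - D y) < e" if "e > 0" for e
    using uniformly_continuous_vanishes[OF C1_continuous_grad[OF K(1)] K(2) vD that] by metis
  have der: "(mol K w has_derivative (\<lambda>h. G x \<bullet> h)) (at x)" for x
    unfolding has_derivative_at_alt
  proof (intro conjI allI impI)
    show "bounded_linear ((\<bullet>) (G x))" by (rule bounded_linear_inner_right)
    fix e :: real assume e: "e > 0"
    \<comment> \<open>\<open>N\<close> is the L^1 norm of \<open>w\<close>; the added 1 avoids a
      division by zero when \<open>w\<close> vanishes.\<close>
    define e1 where "e1 = e / (N + 1)"
    have e1: "e1 > 0" using e N0 by (simp add: e1_def)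
    obtain d where d: "d > 0" "\<And>x y. norm (x - y) < d \<Longrightarrow> norm (D x - D y) < e1" using UC[OF e1] by blast
    have "norm (mol K w y - mol K w x - G x \<bullet> (y - x)) \<le> e * norm (y - x)" if y: "norm (y - x) < d" for y
    proof -
      define h where "h = y - x"
      have pw: "\<bar>K (z + h) - K z - D z \<bullet> h\<bar> \<le> e1 * norm h" for z
      proof -
        have "\<exists>t::real. 0 < t \<and> t < 1 \<and> K (z + 1 *\<^sub>R h) - K (z + 0 *\<^sub>R h) = (1 - 0) * (D (z + t *\<^sub>R h) \<bullet> h)"
          by (rule MVT2) (use C1_line[OF K(1), of z h] in auto)
        then obtain t where t: "0 < t" "t < 1" "K (z + h) - K z = D (z + t *\<^sub>R h) \<bullet> h" by auto
        have "norm (t *\<^sub>R h) < d" using t y by (simp add: h_def mult_less_cancel_right1 le_less_trans[OF mult_left_le_one_le])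
        then have "norm (D (z + t *\<^sub>R h) - D z) < e1" using d(2)[of "z + t *\<^sub>R h" z] by simp
        then have "\<bar>(D (z + t *\<^sub>R h) - D z) \<bullet> h\<bar> \<le> e1 * norm h"
          using Cauchy_Schwarz_ineq2[of "D (z + t *\<^sub>R h) - D z" h] by (meson less_imp_le mult_right_mono norm_ge_zero order_trans)
        then show ?thesis using t by (simp add: inner_diff_left)
      qed
      have "mol K w y - mol K w x - G x \<bullet> (y - x) = (LINT z|lborel. K (y - z) * w z - K (x - z) * w z - (w z *\<^sub>R D (x - z)) \<bullet> h)"
        using iK iD integral_inner_left[OF iD[of x], of h] by (simp add: mol_def G_def h_def del: inner_scaleR_left)
      also have "\<dots> = (LINT z|lborel. w z * (K ((x - z) + h) - K (x - z) - D (x - z) \<bullet> h))"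
        by (rule Bochner_Integration.integral_cong) (auto simp: h_def algebra_simps)
      also have "norm \<dots> \<le> (LINT z|lborel. (e1 * norm h) * \<bar>w z\<bar>)"
      proof (rule Bochner_Integration.integral_norm_bound_integral)
        have "integrable lborel (\<lambda>z. K (y - z) * w z - K (x - z) * w z - (w z *\<^sub>R D (x - z)) \<bullet> h)"
          using iK iD by (intro Bochner_Integration.integrable_diff integrable_inner_left) auto
        then show "integrable lborel (\<lambda>z. w z * (K ((x - z) + h) - K (x - z) - D (x - z) \<bullet> h))"
          by (rule Bochner_Integration.integrable_cong[THEN iffD1, rotated 2]) (auto simp: h_def algebra_simps)
        show "integrable lborel (\<lambda>z. (e1 * norm h) * \<bar>w z\<bar>)" using w by simp
        fix z
        show "norm (w z * (K ((x - z) + h) - K (x - z) - D (x - z) \<bullet> h)) \<le> (e1 * norm h) * \<bar>w z\<bar>"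
          using mult_left_mono[OF pw[of "x - z"], of "\<bar>w z\<bar>"] by (simp add: abs_mult mult.commute)
      qed
      also have "\<dots> = (N * e1) * norm h" using w by (simp add: N_def)
      also have "\<dots> \<le> e * norm h"
      proof (rule mult_right_mono)
        have "N * e1 = e * (N / (N + 1))" by (simp add: e1_def)
        also have "\<dots> \<le> e * 1" using e N0 by (intro mult_left_mono) auto
        finally show "N * e1 \<le> e" by simp
      qed simp
      finally show ?thesis by (simp add: h_def)
    qed
    then show "\<exists>d>0. \<forall>y. norm (y - x) < d \<longrightarrow> norm (mol K w y - mol K w x - G x \<bullet> (y - x)) \<le> e * norm (y - x)"
      using d(1) by blast
  qed
  have "continuous_on UNIV G"
    unfolding continuous_on_iff
  proof (intro ballI allI impI)
    fix x :: 'a and e :: real assume e: "e > 0"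
    define e1 where "e1 = e / (N + 1)"
    have e1: "e1 > 0" using e N0 by (simp add: e1_def)
    obtain d where d: "d > 0" "\<And>x y. norm (x - y) < d \<Longrightarrow> norm (D x - D y) < e1" using UC[OF e1] by blast
    have "dist (G y) (G x) < e" if y: "dist y x < d" for y
    proof -
      have "G y - G x = (LINT z|lborel. w z *\<^sub>R D (y - z) - w z *\<^sub>R D (x - z))" using iD by (simp add: G_def)
      also have "norm \<dots> \<le> (LINT z|lborel. e1 * \<bar>w z\<bar>)"
      proof (rule Bochner_Integration.integral_norm_bound_integral)
        fix z
        have "norm (D (y - z) - D (x - z)) \<le> e1" using d(2)[of "y - z" "x - z"] y by (simp add: dist_norm)
        from mult_left_mono[OF this, of "\<bar>w z\<bar>"]
        show "norm (w z *\<^sub>R D (y - z) - w z *\<^sub>R D (x - z)) \<le> e1 * \<bar>w z\<bar>" by (simp add: scaleR_diff_right[symmetric] mult.commute)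
      qed (use w iD in auto)
      also have "\<dots> = e * (N / (N + 1))" by (simp add: e1_def N_def)
      also have "\<dots> < e * 1" using e N0 by (intro mult_strict_left_mono) auto
      finally show ?thesis by (simp add: dist_norm)
    qed
    then show "\<exists>d>0. \<forall>y\<in>UNIV. dist y x < d \<longrightarrow> dist (G y) (G x) < e" using d(1) by blast
  qed
  then show ?thesis using der by (simp add: C1_def G_def)
qed

lemma mol_measurable[measurable]:
  fixes w :: "'a::euclidean_space \<Rightarrow> 'b::{banach, second_countable_topology}"
  assumes "K \<in> Borel" "w \<in> Borel"
  shows "mol K w \<in> Borel"
proof -
  note [measurable] = assms
  have "(\<lambda>x. LINT y|lborel. K (x - y) *\<^sub>R w y) \<in> borel_measurable lborel" by (rule lborel.borel_measurable_lebesgue_integral) measurable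
  then show ?thesis by (simp add: mol_def[abs_def])
qed

text \<open>Convolution minus identity is an average of shifted differences; Fubini's theorem turns
  its L^1 norm into an average of \<open>shift_diff\<close>.\<close>

lemma mol_L1:
  fixes w :: "'a::euclidean_space \<Rightarrow> 'b::{banach, second_countable_topology}"
  assumes K: "mollifier e K" and w: "integrable lborel w" and s: "\<And>h. norm h \<le> e \<Longrightarrow> shift_diff w h \<le> ennreal d"
  shows "(NN x. ennreal (norm (mol K w x - w x))) \<le> ennreal d"
proof -
  obtain D where D: "C1 K D" using mollifier_C1[OF K] .
  have Kp: "K x \<ge> 0" "zero_off (cball 0 e) K" "integrable lborel K" "(LINT x|lborel. K x) = 1" for x using K by (auto simp: mollifier_def)
  note [measurable] = C1_measurable[OF D] borel_measurable_integrable[OF w]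
  have pw: "ennreal (norm (mol K w x - w x)) \<le> (NN y. ennreal (K y) * ennreal (norm (w (x + - y) - w x)))" for x
  proof -
    have i1: "integrable lborel (\<lambda>y. K y *\<^sub>R w (x - y))" using integrable_reflect[OF integrable_mol[OF D compact_cball Kp(2) w, of x], of x] by simp
    have i2: "integrable lborel (\<lambda>y. K y *\<^sub>R w x)" using Kp by simp
    have "mol K w x = (LINT y|lborel. K y *\<^sub>R w (x - y))" using integral_reflect[of "\<lambda>y. K (x - y) *\<^sub>R w y" x] by (simp add: mol_def)
    then have "mol K w x - w x = (LINT y|lborel. K y *\<^sub>R w (x - y) - K y *\<^sub>R w x)" using i1 i2 Kp by simp
    also have "ennreal (norm \<dots>) \<le> (NN y. ennreal (norm (K y *\<^sub>R w (x - y) - K y *\<^sub>R w x)))"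
      by (rule integral_norm_bound_ennreal) (use i1 i2 in auto)
    also have "\<dots> = (NN y. ennreal (K y) * ennreal (norm (w (x + - y) - w x)))"
      using Kp by (intro nn_integral_cong) (simp add: scaleR_diff_right[symmetric] ennreal_mult)
    finally show ?thesis .
  qed
  have "(NN x. ennreal (norm (mol K w x - w x))) \<le> (NN x. (NN y. ennreal (K y) * ennreal (norm (w (x + - y) - w x))))" by (intro nn_integral_mono pw)
  also have "\<dots> = (NN y. (NN x. ennreal (K y) * ennreal (norm (w (x + - y) - w x))))" by (rule lborel_pair.Fubini') measurable
  also have "\<dots> = (NN y. ennreal (K y) * shift_diff w (- y))"
    unfolding shift_diff_def by (simp add: nn_integral_cmult)
  also have "\<dots> \<le> (NN y. ennreal (K y) * ennreal d)"
  proof (intro nn_integral_mono)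
    fix y
    show "ennreal (K y) * shift_diff w (- y) \<le> ennreal (K y) * ennreal d"
    proof (cases "norm y \<le> e")
      case True then show ?thesis using s[of "- y"] by (intro mult_left_mono) auto
    next
      case False then show ?thesis using Kp(2) by (simp add: zero_off_def)
    qed
  qed
  also have "\<dots> = (NN y. ennreal (K y)) * ennreal d" by (rule nn_integral_multc) measurable
  also have "\<dots> = ennreal d" using Kp by (simp add: nn_integral_eq_integral)
  finally show ?thesis .
qed

lemma mol_integrable:
  fixes w :: "'a::euclidean_space \<Rightarrow> 'b::{banach, second_countable_topology}"
  assumes K: "mollifier e K" and w: "integrable lborel w"
  shows "integrable lborel (mol K w)"
proof -
  obtain D where D: "C1 K D" using mollifier_C1[OF K] .
  have Kp: "K x \<ge> 0" "zero_off (cball 0 e) K" "integrable lborel K" "(LINT x|lborel. K x) = 1" for x using K by (auto simp: mollifier_def)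
  note [measurable] = C1_measurable[OF D] borel_measurable_integrable[OF w]
  have "(NN x. ennreal (norm (mol K w x))) \<le> (NN x. (NN y. ennreal (K (x - y)) * ennreal (norm (w y))))"
  proof (intro nn_integral_mono)
    fix x
    have "ennreal (norm (mol K w x)) \<le> (NN y. ennreal (norm (K (x - y) *\<^sub>R w y)))"
      unfolding mol_def by (rule integral_norm_bound_ennreal) (rule integrable_mol[OF D compact_cball Kp(2) w])
    then show "ennreal (norm (mol K w x)) \<le> (NN y. ennreal (K (x - y)) * ennreal (norm (w y)))" using Kp by (simp add: ennreal_mult)
  qed
  also have "\<dots> = (NN y. (NN x. ennreal (K (x - y)) * ennreal (norm (w y))))" by (rule lborel_pair.Fubini') measurable
  also have "\<dots> = (NN y. (NN x. ennreal (K (x + - y))) * ennreal (norm (w y)))" by (simp add: nn_integral_multc)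
  also have "\<dots> = (NN y. ennreal (norm (w y)))" using Kp by (subst nn_integral_shift) (auto simp: nn_integral_eq_integral)
  also have "\<dots> < \<infinity>" using w by (simp add: integrable_iff_bounded)
  finally show ?thesis by (simp add: integrable_iff_bounded)
qed

lemma tendsto_zero_ennreal:
  fixes f :: "'b \<Rightarrow> ennreal"
  assumes "\<And>e::real. e > 0 \<Longrightarrow> \<forall>\<^sub>F x in F. f x < ennreal e"
  shows "(f \<longlongrightarrow> 0) F"
proof (rule order_tendstoI)
  fix a :: ennreal assume "a > 0"
  then obtain e :: real where "e > 0" "ennreal e \<le> a" by (cases a) (auto intro: that[of 1])
  then show "\<forall>\<^sub>F x in F. f x < a" using assms[of e] by (auto elim: eventually_mono)
qed simp

lemma mollifier_seq:
  obtains K :: "nat \<Rightarrow> 'a::euclidean_space \<Rightarrow> real" where "\<And>j. mollifier (1 / (real j + 1)) (K j)"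
  by (force intro: choice mollifier_exists)

lemma mol_L1_tendsto:
  fixes w :: "'a::euclidean_space \<Rightarrow> 'b::{banach, second_countable_topology}"
  assumes K: "\<And>j. mollifier (1 / (real j + 1)) (K j)" and w: "integrable lborel w"
  shows "(\<lambda>j. (NN x. ennreal (norm (mol (K j) w x - w x)))) ----> 0"
proof (rule tendsto_zero_ennreal)
  fix e :: real assume e: "e > 0"
  then obtain d where d: "d > 0" "\<And>h. norm h < d \<Longrightarrow> shift_diff w h \<le> e / 2" using L1_translation[OF w] by (meson half_gt_zero)
  have "(\<lambda>j. 1 / (real j + 1)) ----> 0" using LIMSEQ_inverse_real_of_nat by (simp add: inverse_eq_divide add.commute)
  then have "\<forall>\<^sub>F j in sequentially. 1 / (real j + 1) < d" using d(1) by (rule order_tendstoD)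
  then show "\<forall>\<^sub>F j in sequentially. (NN x. ennreal (norm (mol (K j) w x - w x))) < ennreal e"
  proof eventually_elim
    case (elim j)
    have "(NN x. ennreal (norm (mol (K j) w x - w x))) \<le> ennreal (e / 2)" by (rule mol_L1[OF K w]) (use d(2) elim in auto)
    also have "\<dots> < ennreal e" using e by (simp add: ennreal_lessI)
    finally show ?case .
  qed
qed

section \<open>Weakly differentiable functions on the whole space\<close>

text \<open>This is W^(1,1) of the whole space with the gradient as explicit data. Integrability
  over \<open>lborel\<close> makes both functions Borel, and C^1 test functions keep products with
  C^1 cut-offs simple; by \<open>sobI_smooth\<close> smooth ones describe the same class.\<close>

definition sob :: "('a::euclidean_space \<Rightarrow> real) \<Rightarrow> ('a \<Rightarrow> 'a) \<Rightarrow> bool" where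
  "sob w g \<longleftrightarrow> integrable lborel w \<and> integrable lborel g \<and>
     (\<forall>\<phi> D S. C1 \<phi> D \<longrightarrow> compact S \<longrightarrow> zero_off S \<phi> \<longrightarrow>
        by_parts w g \<phi> D)"

definition L1_conv :: "(nat \<Rightarrow> 'a::euclidean_space \<Rightarrow> 'b::{banach, second_countable_topology}) \<Rightarrow> ('a \<Rightarrow> 'b) \<Rightarrow> bool" where
  "L1_conv f g \<longleftrightarrow> (\<forall>j. integrable lborel (f j)) \<and> integrable lborel g \<and>
     (\<lambda>j. (NN x. ennreal (norm (f j x - g x)))) ----> 0"

lemma sobD:
  assumes "sob w g" shows "integrable lborel w" "integrable lborel g"
    "C1 \<phi> D \<Longrightarrow> compact S \<Longrightarrow> zero_off S \<phi> \<Longrightarrow> by_parts w g \<phi> D" using assms by (auto simp: sob_def)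

lemma sob_measurable:
  assumes "sob w g" shows "w \<in> Borel" "g \<in> Borel" using sobD(1,2)[OF assms] by auto

lemma tendsto_0_le_ennreal:
  fixes f g :: "nat \<Rightarrow> ennreal"
  assumes "g ----> 0" "\<And>j. f j \<le> g j"
  shows "f ----> 0" by (rule tendsto_sandwich[of "\<lambda>_. 0" f sequentially g]) (use assms in auto)

lemma L1_conv_bound:
  fixes f :: "nat \<Rightarrow> 'a::euclidean_space \<Rightarrow> 'b::{banach, second_countable_topology}"
    and F :: "nat \<Rightarrow> 'a \<Rightarrow> 'c::{banach, second_countable_topology}"
  assumes "L1_conv f g" "\<And>j. integrable lborel (F j)" "integrable lborel G"
    and "\<And>j x. norm (F j x - G x) \<le> B * norm (f j x - g x)" "B \<ge> 0"
  shows "L1_conv F G"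
  unfolding L1_conv_def
proof (intro conjI allI assms)
  have i: "integrable lborel (f j)" "integrable lborel g" for j using assms(1) by (auto simp: L1_conv_def)
  note [measurable] = borel_measurable_integrable[OF i(1)] borel_measurable_integrable[OF i(2)]
  have "(\<lambda>j. ennreal B * (NN x. ennreal (norm (f j x - g x)))) ----> ennreal B * 0" using assms(1) by (intro ennreal_tendsto_cmult) (auto simp: L1_conv_def)
  then have "(\<lambda>j. ennreal B * (NN x. ennreal (norm (f j x - g x)))) ----> 0" by simp
  moreover have "(NN x. ennreal (norm (F j x - G x))) \<le> ennreal B * (NN x. ennreal (norm (f j x - g x)))" for j
  proof -
    have "(NN x. ennreal (norm (F j x - G x))) \<le> (NN x. ennreal B * ennreal (norm (f j x - g x)))"
      using assms(4,5) by (intro nn_integral_mono) (simp add: ennreal_mult[symmetric] ennreal_leI)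
    also have "\<dots> = ennreal B * (NN x. ennreal (norm (f j x - g x)))" by (rule nn_integral_cmult) measurable
    finally show ?thesis .
  qed
  ultimately show "(\<lambda>j. (NN x. ennreal (norm (F j x - G x)))) ----> 0" by (rule tendsto_0_le_ennreal)
qed

lemma L1_conv_integral:
  assumes "L1_conv f g"
  shows "(\<lambda>j. LINT x|lborel. f j x) ----> (LINT x|lborel. g x)" using assms by (intro tendsto_L1_int) (auto simp: L1_conv_def)

lemma L1_conv_scaleR_left:
  fixes w :: "'a::euclidean_space \<Rightarrow> real" and k :: "'a \<Rightarrow> 'b::{banach, second_countable_topology}"
  assumes "L1_conv f w" "k \<in> Borel" "\<And>x. norm (k x) \<le> B"
  shows "L1_conv (\<lambda>j x. f j x *\<^sub>R k x) (\<lambda>x. w x *\<^sub>R k x)"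
proof (rule L1_conv_bound[OF assms(1)])
  show "norm (f j x *\<^sub>R k x - w x *\<^sub>R k x) \<le> B * norm (f j x - w x)" for j x
    using mult_left_mono[OF assms(3)[of x], of "\<bar>f j x - w x\<bar>"] by (simp add: scaleR_diff_left[symmetric] mult.commute)
  show "B \<ge> 0" using assms(3) norm_ge_zero order_trans by blast
qed (use assms in \<open>auto simp: L1_conv_def intro!: integrable_scaleR_bounded\<close>)

lemma L1_conv_scaleR_right:
  fixes w :: "'a::euclidean_space \<Rightarrow> 'b::{banach, second_countable_topology}" and k :: "'a \<Rightarrow> real"
  assumes "L1_conv f w" "k \<in> Borel" "\<And>x. \<bar>k x\<bar> \<le> B"
  shows "L1_conv (\<lambda>j x. k x *\<^sub>R f j x) (\<lambda>x. k x *\<^sub>R w x)"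
proof (rule L1_conv_bound[OF assms(1)])
  show "norm (k x *\<^sub>R f j x - k x *\<^sub>R w x) \<le> B * norm (f j x - w x)" for j x
    using mult_right_mono[OF assms(3)[of x], of "norm (f j x - w x)"] by (simp add: scaleR_diff_right[symmetric])
  show "B \<ge> 0" using assms(3) abs_ge_zero order_trans by blast
qed (use assms in \<open>auto simp: L1_conv_def intro!: integrable_bounded_scaleR\<close>)

lemma L1_conv_dominated:
  fixes f :: "nat \<Rightarrow> 'a::euclidean_space \<Rightarrow> 'b::{banach, second_countable_topology}"
  assumes "integrable lborel k" "\<And>j. f j \<in> Borel" "g \<in> Borel"
    "\<And>j. AE x in lborel. norm (f j x) \<le> k x" "AE x in lborel. (\<lambda>j. f j x) ----> g x"
  shows "L1_conv f g"
proof -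
  have [measurable]: "f j \<in> Borel" "g \<in> Borel" "k \<in> Borel" for j using assms by auto
  have ig: "integrable lborel g" and if': "integrable lborel (f j)" for j
    using integrable_dominated_convergence[of g lborel f k] integrable_dominated_convergence2[of g lborel f k] assms by auto
  have "(\<lambda>i. (NN x. ennreal (norm (f i x - g x)))) ----> (\<integral>\<^sup>+x. 0 \<partial>(lborel :: 'a measure))"
  proof (rule nn_integral_dominated_convergence[where w="\<lambda>x. ennreal (norm (k x) + norm (g x))"])
    have "integrable lborel (\<lambda>x. norm (k x) + norm (g x))" using assms(1) ig by auto
    then show "(NN x. ennreal (norm (k x) + norm (g x))) < \<infinity>" by (auto simp: integrable_iff_bounded abs_of_nonneg)
    show "AE x in lborel. ennreal (norm (f i x - g x)) \<le> ennreal (norm (k x) + norm (g x))" for i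
      using assms(4)[of i]
    proof (rule AE_mp, intro AE_I2 impI ennreal_leI)
      fix x assume "norm (f i x) \<le> k x"
      then show "norm (f i x - g x) \<le> norm (k x) + norm (g x)" using norm_triangle_ineq4[of "f i x" "g x"] by simp
    qed
    show "AE x in lborel. (\<lambda>i. ennreal (norm (f i x - g x))) ----> 0"
      using assms(5)
    proof (rule AE_mp, intro AE_I2 impI)
      fix x assume "(\<lambda>j. f j x) ----> g x"
      then have "(\<lambda>i. norm (f i x - g x)) ----> 0" by (simp add: LIM_zero tendsto_norm_zero)
      then show "(\<lambda>i. ennreal (norm (f i x - g x))) ----> 0" using tendsto_ennrealI by fastforce
    qed
  qed auto
  then show ?thesis using ig if' by (simp add: L1_conv_def)
qed

lemma L1_conv_AE_subseq:
  fixes f :: "nat \<Rightarrow> 'a::euclidean_space \<Rightarrow> 'b::{banach, second_countable_topology}"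
  assumes "L1_conv f g"
  obtains r where "strict_mono (r :: nat \<Rightarrow> nat)" "AE x in lborel. (\<lambda>j. f (r j) x) ----> g x"
proof -
  have i: "integrable lborel (\<lambda>x. f j x - g x)" for j using assms by (auto simp: L1_conv_def)
  have "(\<lambda>j. ennreal (LINT x|lborel. norm (f j x - g x))) ----> ennreal 0" using assms i by (simp add: L1_conv_def nn_integral_eq_integral)
  then have "(\<lambda>j. LINT x|lborel. norm (f j x - g x)) ----> 0" by (subst (asm) tendsto_ennreal_iff) auto
  from tendsto_L1_AE_subseq[OF i this] obtain r where r: "strict_mono (r :: nat \<Rightarrow> nat)" "AE x in lborel. (\<lambda>n. f (r n) x - g x) ----> 0" by blast
  show ?thesis by (rule that[OF r(1)], rule AE_mp[OF r(2)]) (auto intro!: AE_I2 LIM_zero_cancel)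
qed

lemma L1_conv_subseq: "L1_conv f g \<Longrightarrow> strict_mono r \<Longrightarrow> L1_conv (\<lambda>j. f (r j)) g"
  using LIMSEQ_subseq_LIMSEQ by (fastforce simp: L1_conv_def o_def)

lemma L1_conv_mol:
  assumes K: "\<And>j. mollifier (1 / (real j + 1)) (K j)" and w: "integrable lborel w"
  shows "L1_conv (\<lambda>j. mol (K j) w) w"
  unfolding L1_conv_def using mol_integrable[OF K w] w mol_L1_tendsto[OF K w] by blast

lemma C1_bounds:
  assumes "C1 \<phi> D" "compact S" "zero_off S \<phi>"
  obtains B where "\<And>x. \<bar>\<phi> x\<bar> \<le> B" "\<And>x. norm (D x) \<le> B"
proof -
  obtain B1 where 1: "\<And>x. \<bar>\<phi> x\<bar> \<le> B1" using C1_bounded[OF assms] by blast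
  obtain B2 where 2: "\<And>x. norm (D x) \<le> B2"
    using continuous_vanishes_bounded[OF C1_continuous_grad[OF assms(1)] assms(2) C1_zero_off[OF assms(1) compact_imp_closed[OF assms(2)] assms(3)]] by blast
  show ?thesis by (rule that[of "max B1 B2"]) (use 1 2 in \<open>auto intro: le_max_iff_disj[THEN iffD2]\<close>)
qed

text \<open>The approximants are asked to satisfy integration by parts rather than to lie in
  \<open>sob\<close>, so that C^1 functions can be inserted directly.\<close>

lemma sob_limit:
  assumes "\<And>j. \<forall>\<phi> D S. C1 \<phi> D \<longrightarrow> compact S \<longrightarrow> zero_off S \<phi> \<longrightarrow>
        (LINT x|lborel. w j x *\<^sub>R D x) = - (LINT x|lborel. \<phi> x *\<^sub>R g j x)"
    and "L1_conv w W" "L1_conv g G"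
  shows "sob W G"
  unfolding sob_def
proof (intro conjI allI impI)
  show "integrable lborel W" "integrable lborel G" using assms by (auto simp: L1_conv_def)
  fix \<phi> D and S :: "'a set" assume \<phi>: "C1 \<phi> D" "compact S" "zero_off S \<phi>"
  obtain B where B: "\<And>x. \<bar>\<phi> x\<bar> \<le> B" "\<And>x. norm (D x) \<le> B" using C1_bounds[OF \<phi>] by blast
  have "(\<lambda>j. LINT x|lborel. w j x *\<^sub>R D x) ----> (LINT x|lborel. W x *\<^sub>R D x)"
    by (intro L1_conv_integral L1_conv_scaleR_left[OF assms(2) _ B(2)] C1_measurable(2)[OF \<phi>(1)])
  moreover have "(\<lambda>j. - (LINT x|lborel. \<phi> x *\<^sub>R g j x)) ----> - (LINT x|lborel. \<phi> x *\<^sub>R G x)"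
    by (intro tendsto_minus L1_conv_integral L1_conv_scaleR_right[OF assms(3) _ B(1)] C1_measurable(1)[OF \<phi>(1)])
  ultimately show "by_parts W G \<phi> D" using assms(1) \<phi> LIMSEQ_unique by (metis (no_types, lifting) LIMSEQ_unique ext)
qed

lemma sob_limit': "(\<And>j. sob (w j) (g j)) \<Longrightarrow> L1_conv w W \<Longrightarrow> L1_conv g G \<Longrightarrow> sob W G"
  by (rule sob_limit[of w g]) (auto simp: sob_def)

text \<open>The kernel y -> K (x - y) is used as a test function; its gradient is -D (x - y), which
  accounts for the sign.\<close>

lemma mol_gradient:
  fixes w :: "'a::euclidean_space \<Rightarrow> real"
  assumes K: "mollifier e K" and w: "integrable lborel w"
    and ibp: "\<And>\<phi> D. smooth \<phi> \<Longrightarrow> C1 \<phi> D \<Longrightarrow> zero_off (cball x e) \<phi> \<Longrightarrow>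
          by_parts w g \<phi> D"
    and D: "C1 K D"
  shows "(LINT y|lborel. w y *\<^sub>R D (x - y)) = mol K g x"
proof -
  have Kp: "zero_off (cball 0 e) K" "smooth (\<lambda>y. K (x - y))" using K by (auto simp: mollifier_def)
  have "C1 (\<lambda>y. K (x - y)) (\<lambda>y. - D (x - y))"
    unfolding C1_def
  proof (intro conjI allI)
    fix y
    have "((\<lambda>y. K (x - y)) has_derivative (\<lambda>h. D (x - y) \<bullet> (- h))) (at y)"
      by (rule has_derivative_compose[OF _ C1_derivative[OF D]]) (auto intro!: derivative_eq_intros)
    then show "((\<lambda>y. K (x - y)) has_derivative (\<lambda>h. (- D (x - y)) \<bullet> h)) (at y)" by simp
    show "continuous_on UNIV (\<lambda>y. - D (x - y))" by (intro continuous_intros continuous_on_compose2[OF C1_continuous_grad[OF D]]) auto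
  qed
  moreover have "zero_off (cball x e) (\<lambda>y. K (x - y))" using Kp(1) by (auto simp: zero_off_def dist_norm)
  ultimately have "(LINT y|lborel. w y *\<^sub>R (- D (x - y))) = - (LINT y|lborel. K (x - y) *\<^sub>R g y)" using ibp[OF Kp(2)] by blast
  then show ?thesis by (simp add: mol_def)
qed

lemma sob_mol_C1:
  assumes "sob w g" "mollifier e K"
  shows "C1 (mol K w) (mol K g)"
proof -
  obtain D where D: "C1 K D" using mollifier_C1[OF assms(2)] .
  have "zero_off (cball 0 e) K" using assms(2) by (simp add: mollifier_def)
  from C1_mol[OF D compact_cball this sobD(1)[OF assms(1)]]
  show ?thesis using mol_gradient[OF assms(2) sobD(1)[OF assms(1)] sobD(3)[OF assms(1) _ compact_cball] D] by simp
qed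

text \<open>Smooth test functions suffice to compute the gradients of mollifications. These are C^1,
  hence can be integrated by parts against every C^1 test function, and the identity survives the
  L^1 limit. This bridges \<open>test_functions\<close> and \<open>sob\<close>.\<close>

lemma sobI_smooth:
  assumes w: "integrable lborel w" and g: "integrable lborel g"
    and ibp: "\<And>\<phi> D S. smooth \<phi> \<Longrightarrow> C1 \<phi> D \<Longrightarrow> compact S \<Longrightarrow> zero_off S \<phi> \<Longrightarrow>
          by_parts w g \<phi> D"
  shows "sob w g"
proof -
  obtain K where K: "\<And>j. mollifier (1 / (real j + 1)) (K j :: 'a \<Rightarrow> real)" using mollifier_seq by blast
  have C: "C1 (mol (K j) w) (mol (K j) g)" for j
  proof -
    obtain D where D: "C1 (K j) D" using mollifier_C1[OF K] .
    have "zero_off (cball 0 (1 / (real j + 1))) (K j)" using K[of j] by (simp add: mollifier_def)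
    from C1_mol[OF D compact_cball this w]
    show ?thesis using mol_gradient[OF K w ibp[OF _ _ compact_cball] D] by simp
  qed
  show ?thesis by (rule sob_limit[OF _ L1_conv_mol[OF K w] L1_conv_mol[OF K g]]) (use integration_by_parts_C1[OF C] in blast)
qed

lemma sob_C1:
  assumes "C1 w g" "compact S" "zero_off S w"
  shows "sob w g"
  unfolding sob_def
  using integrable_continuous_vanishes[OF C1_continuous[OF assms(1)] assms(2,3)]
    integral_C1_grad(1)[OF assms] integration_by_parts_C1[OF assms(1)] by blast

section \<open>Calculus of weak gradients: sums, products, uniqueness, chain rule,
  truncation\<close>

lemma sob_add: "sob w g \<Longrightarrow> sob v h \<Longrightarrow> sob (\<lambda>x. w x + v x) (\<lambda>x. g x + h x)"
  unfolding sob_def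
proof (intro conjI allI impI; (elim conjE)?)
  fix \<phi> D and S :: "'a set" assume \<phi>: "C1 \<phi> D" "compact S" "zero_off S \<phi>"
  assume a: "integrable lborel w" "integrable lborel g" "integrable lborel v" "integrable lborel h"
     "\<forall>\<phi> D S. C1 \<phi> D \<longrightarrow> compact S \<longrightarrow> zero_off S \<phi> \<longrightarrow> by_parts w g \<phi> D"
     "\<forall>\<phi> D S. C1 \<phi> D \<longrightarrow> compact S \<longrightarrow> zero_off S \<phi> \<longrightarrow> by_parts v h \<phi> D"
  obtain B where B: "\<And>x. \<bar>\<phi> x\<bar> \<le> B" "\<And>x. norm (D x) \<le> B" using C1_bounds[OF \<phi>] by blast
  note [measurable] = C1_measurable[OF \<phi>(1)]
  have "integrable lborel (\<lambda>x. w x *\<^sub>R D x)" "integrable lborel (\<lambda>x. v x *\<^sub>R D x)"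
    "integrable lborel (\<lambda>x. \<phi> x *\<^sub>R g x)" "integrable lborel (\<lambda>x. \<phi> x *\<^sub>R h x)"
    using a(1-4) by (auto intro!: integrable_scaleR_bounded[OF _ _ B(2)] integrable_bounded_scaleR[OF _ _ B(1)])
  moreover have "by_parts w g \<phi> D" using a(5) \<phi> by blast
  moreover have "by_parts v h \<phi> D" using a(6) \<phi> by blast
  ultimately show "(LINT x|lborel. (w x + v x) *\<^sub>R D x) = - (LINT x|lborel. \<phi> x *\<^sub>R (g x + h x))" by (simp add: scaleR_add_left scaleR_add_right)
qed auto

lemma sob_cmult: "sob w g \<Longrightarrow> sob (\<lambda>x. c * w x) (\<lambda>x. c *\<^sub>R g x)"
  unfolding sob_def by (auto simp: scaleR_left_commute simp flip: scaleR_scaleR)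

lemma sob_diff: "sob w g \<Longrightarrow> sob v h \<Longrightarrow> sob (\<lambda>x. w x - v x) (\<lambda>x. g x - h x)"
  using sob_add[OF _ sob_cmult[of v h "-1"], of w g] by simp

text \<open>The product of \<open>\<phi>\<close> and \<open>\<eta>\<close> is again a test function
  for \<open>w\<close>; its product rule, rearranged, is the claim.\<close>

lemma sob_mult_C1:
  fixes w :: "'a::euclidean_space \<Rightarrow> real"
  assumes "sob w g" "C1 \<eta> E" "\<And>x. \<bar>\<eta> x\<bar> \<le> B" "\<And>x. norm (E x) \<le> B"
  shows "sob (\<lambda>x. \<eta> x * w x) (\<lambda>x. \<eta> x *\<^sub>R g x + w x *\<^sub>R E x)"
  unfolding sob_def
proof (intro conjI allI impI)
  note [measurable] = C1_measurable[OF assms(2)]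
  note i = sobD(1,2)[OF assms(1)]
  have i1: "integrable lborel (\<lambda>x. \<eta> x *\<^sub>R w x)" by (intro integrable_bounded_scaleR[OF _ _ assms(3)] i) auto
  then show "integrable lborel (\<lambda>x. \<eta> x * w x)" by simp
  have i2: "integrable lborel (\<lambda>x. \<eta> x *\<^sub>R g x)" by (intro integrable_bounded_scaleR[OF _ _ assms(3)] i) auto
  have i3: "integrable lborel (\<lambda>x. w x *\<^sub>R E x)" by (intro integrable_scaleR_bounded[OF _ _ assms(4)] i) auto
  show "integrable lborel (\<lambda>x. \<eta> x *\<^sub>R g x + w x *\<^sub>R E x)" using i2 i3 by simp
  fix \<phi> D and S :: "'a set" assume \<phi>: "C1 \<phi> D" "compact S" "zero_off S \<phi>"
  obtain A where A: "\<And>x. \<bar>\<phi> x\<bar> \<le> A" "\<And>x. norm (D x) \<le> A" using C1_bounds[OF \<phi>] by blast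
  note [measurable] = C1_measurable[OF \<phi>(1)]
  have j1: "integrable lborel (\<lambda>x. \<phi> x *\<^sub>R (\<eta> x *\<^sub>R g x))" "integrable lborel (\<lambda>x. \<phi> x *\<^sub>R (w x *\<^sub>R E x))"
    by (intro integrable_bounded_scaleR[OF _ _ A(1)] i2 i3; simp)+
  have j2: "integrable lborel (\<lambda>x. (\<eta> x *\<^sub>R w x) *\<^sub>R D x)" by (rule integrable_scaleR_bounded[OF i1 _ A(2)]) simp
  have "(LINT x|lborel. w x *\<^sub>R (\<eta> x *\<^sub>R D x + \<phi> x *\<^sub>R E x)) = - (LINT x|lborel. (\<phi> x * \<eta> x) *\<^sub>R g x)"
    by (rule sobD(3)[OF assms(1) C1_mult[OF \<phi>(1) assms(2)] \<phi>(2)]) (use \<phi>(3) in \<open>auto simp: zero_off_def\<close>)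
  moreover have "(\<lambda>x. w x *\<^sub>R (\<eta> x *\<^sub>R D x + \<phi> x *\<^sub>R E x)) = (\<lambda>x. (\<eta> x *\<^sub>R w x) *\<^sub>R D x + \<phi> x *\<^sub>R (w x *\<^sub>R E x))"
    by (auto simp: algebra_simps)
  ultimately show "(LINT x|lborel. (\<eta> x * w x) *\<^sub>R D x) = - (LINT x|lborel. \<phi> x *\<^sub>R (\<eta> x *\<^sub>R g x + w x *\<^sub>R E x))"
    using j1 j2 by (simp add: scaleR_add_right add_eq_0_iff algebra_simps)
qed

text \<open>The difference of the two gradients is a gradient of the zero function; its
  mollifications vanish identically and converge to it.\<close>

lemma sob_unique:
  assumes "sob w g" "sob w h"
  shows "AE x in lborel. g x = h x"
proof -
  define d where "d x = g x - h x" for x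
  have s: "sob (\<lambda>x. 0) d" using sob_diff[OF assms] by (simp add: d_def[abs_def])
  obtain K where K: "\<And>j. mollifier (1 / (real j + 1)) (K j :: 'a \<Rightarrow> real)" using mollifier_seq by blast
  have "mol (K j) d x = 0" for j x using C1_grad_zero[OF sob_mol_C1[OF s K], of UNIV x j] by (auto simp: mol_def)
  then have "(\<lambda>j. (NN x. ennreal (norm (d x)))) ----> 0" using L1_conv_mol[OF K sobD(2)[OF s]] by (simp add: L1_conv_def)
  then have "(NN x. ennreal (norm (d x))) = 0" by (simp add: LIMSEQ_const_iff)
  then have "AE x in lborel. ennreal (norm (d x)) = 0" using sob_measurable[OF s] by (subst (asm) nn_integral_0_iff_AE) auto
  then show ?thesis by (rule AE_mp) (auto simp: d_def)
qed

lemma sob_AE_cong: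
  assumes "sob w g" "AE x in lborel. w x = v x" "AE x in lborel. g x = h x"
    "v \<in> Borel" "h \<in> Borel"
  shows "sob v h"
  unfolding sob_def
proof (intro conjI allI impI)
  note [measurable] = assms(4,5) sob_measurable[OF assms(1)]
  show "integrable lborel v" "integrable lborel h"
    using integrable_cong_AE[of v lborel w] integrable_cong_AE[of h lborel g] assms sobD(1,2)[OF assms(1)] by (auto simp: eq_commute)
  fix \<phi> D and S :: "'a set" assume \<phi>: "C1 \<phi> D" "compact S" "zero_off S \<phi>"
  note [measurable] = C1_measurable[OF \<phi>(1)]
  have "(LINT x|lborel. v x *\<^sub>R D x) = (LINT x|lborel. w x *\<^sub>R D x)" by (rule integral_cong_AE) (use assms(2) in auto)
  moreover have "(LINT x|lborel. \<phi> x *\<^sub>R h x) = (LINT x|lborel. \<phi> x *\<^sub>R g x)" by (rule integral_cong_AE) (use assms(3) in auto)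
  ultimately show "by_parts v h \<phi> D" using sobD(3)[OF assms(1) \<phi>] by simp
qed

text \<open>The classical chain rule for mollifications and a passage to the limit. A subsequence
  converging almost everywhere controls the nonlinear factor h' (W j).\<close>

lemma sob_chain:
  fixes w :: "'a::euclidean_space \<Rightarrow> real"
  assumes w: "sob w g" and h: "\<And>s. (h has_real_derivative h' s) (at s)" "continuous_on UNIV h'" "\<And>s. \<bar>h' s\<bar> \<le> 1" "h 0 = 0"
  shows "sob (\<lambda>x. h (w x)) (\<lambda>x. h' (w x) *\<^sub>R g x)"
proof -
  obtain K where K: "\<And>j. mollifier (1 / (real j + 1)) (K j :: 'a \<Rightarrow> real)" using mollifier_seq by blast
  have cw: "L1_conv (\<lambda>j. mol (K j) w) w" and cg: "L1_conv (\<lambda>j. mol (K j) g) g" using L1_conv_mol[OF K] sobD[OF w] by auto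
  obtain r where r: "strict_mono r" "AE x in lborel. (\<lambda>j. mol (K (r j)) w x) ----> w x"
    using L1_conv_AE_subseq[OF cw] .
  define W where "W j = mol (K (r j)) w" for j
  define G where "G j = mol (K (r j)) g" for j
  have cW: "L1_conv W w" and cG: "L1_conv G g" unfolding W_def[abs_def] G_def[abs_def] using L1_conv_subseq[OF cw r(1)] L1_conv_subseq[OF cg r(1)] by auto
  have C: "C1 (W j) (G j)" for j unfolding W_def G_def by (rule sob_mol_C1[OF w K])
  have lip: "\<bar>h s - h t\<bar> \<le> \<bar>s - t\<bar>" for s t
  proof -
    have "norm (h s - h t) \<le> 1 * norm (s - t)" by (rule field_differentiable_bound[of UNIV h h']) (use h(1,3) in auto)
    then show ?thesis by simp
  qed
  have contH: "continuous_on UNIV h" using h(1) by (meson DERIV_isCont continuous_at_imp_continuous_on)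
  have [measurable]: "h \<in> Borel" "h' \<in> Borel" using contH h(2) by (auto intro: borel_measurable_continuous_onI)
  note [measurable] = sob_measurable[OF w] C1_measurable[OF C]
  have iW: "integrable lborel (W j)" "integrable lborel (G j)" for j using cW cG by (auto simp: L1_conv_def)
  have ih: "integrable lborel (\<lambda>x. h (v x))" if "integrable lborel v" for v :: "'a \<Rightarrow> real"
    by (rule Bochner_Integration.integrable_bound[OF that]) (use lip[of _ 0] h(4) that in auto)
  have ih': "integrable lborel (\<lambda>x. h' (v x) *\<^sub>R k x)" if "integrable lborel k" "v \<in> Borel" for v :: "'a \<Rightarrow> real" and k :: "'a \<Rightarrow> 'a"
    by (rule integrable_bounded_scaleR[OF that(1) _ h(3)]) (use that(2) in measurable)
  show ?thesis
  proof (rule sob_limit[of "\<lambda>j x. h (W j x)" "\<lambda>j x. h' (W j x) *\<^sub>R G j x"])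
    show "\<forall>\<phi> D S. C1 \<phi> D \<longrightarrow> compact S \<longrightarrow> zero_off S \<phi> \<longrightarrow>
        (LINT x|lborel. h (W j x) *\<^sub>R D x) = - (LINT x|lborel. \<phi> x *\<^sub>R (h' (W j x) *\<^sub>R G j x))" for j
      using integration_by_parts_C1[OF C1_compose[OF C[of j] h(1,2)]] by blast
    show "L1_conv (\<lambda>j x. h (W j x)) (\<lambda>x. h (w x))" by (rule L1_conv_bound[OF cW ih[OF iW(1)] ih[OF sobD(1)[OF w]], where B=1]) (use lip in auto)
    \<comment> \<open>First only the factor h' (W j) varies, by dominated convergence; exchanging
      \<open>G j\<close> and \<open>g\<close> afterwards costs no more than their L^1 distance
      because |h'| <= 1.\<close>
    have A: "L1_conv (\<lambda>j x. h' (W j x) *\<^sub>R g x) (\<lambda>x. h' (w x) *\<^sub>R g x)"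
    proof (rule L1_conv_dominated[of "\<lambda>x. norm (g x)"])
      show "AE x in lborel. norm (h' (W j x) *\<^sub>R g x) \<le> norm (g x)" for j using h(3) by (auto intro!: mult_left_le_one_le)
      have "AE x in lborel. (\<lambda>j. W j x) ----> w x" using r(2) by (simp add: W_def)
      then show "AE x in lborel. (\<lambda>j. h' (W j x) *\<^sub>R g x) ----> h' (w x) *\<^sub>R g x"
      proof (rule AE_mp, intro AE_I2 impI)
        fix x assume "(\<lambda>j. W j x) ----> w x"
        then have "(\<lambda>j. h' (W j x)) ----> h' (w x)" by (rule continuous_on_tendsto_compose[OF h(2)]) auto
        then show "(\<lambda>j. h' (W j x) *\<^sub>R g x) ----> h' (w x) *\<^sub>R g x" by (intro tendsto_intros)
      qed
    qed (use sobD[OF w] in auto)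
    show "L1_conv (\<lambda>j x. h' (W j x) *\<^sub>R G j x) (\<lambda>x. h' (w x) *\<^sub>R g x)"
      unfolding L1_conv_def
    proof (intro conjI allI)
      have "(\<lambda>j. (NN x. ennreal (norm (G j x - g x))) + (NN x. ennreal (norm (h' (W j x) *\<^sub>R g x - h' (w x) *\<^sub>R g x)))) ----> 0 + 0"
        using A cG by (intro tendsto_add) (auto simp: L1_conv_def)
      then have "(\<lambda>j. (NN x. ennreal (norm (G j x - g x))) + (NN x. ennreal (norm (h' (W j x) *\<^sub>R g x - h' (w x) *\<^sub>R g x)))) ----> 0" by simp
      moreover have "(NN x. ennreal (norm (h' (W j x) *\<^sub>R G j x - h' (w x) *\<^sub>R g x))) \<le>
         (NN x. ennreal (norm (G j x - g x))) + (NN x. ennreal (norm (h' (W j x) *\<^sub>R g x - h' (w x) *\<^sub>R g x)))" for j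
      proof (subst nn_integral_add[symmetric]; (intro nn_integral_mono)?)
        fix x
        have "h' (W j x) *\<^sub>R G j x - h' (w x) *\<^sub>R g x = h' (W j x) *\<^sub>R (G j x - g x) + (h' (W j x) *\<^sub>R g x - h' (w x) *\<^sub>R g x)"
          by (simp add: algebra_simps)
        then have "norm (h' (W j x) *\<^sub>R G j x - h' (w x) *\<^sub>R g x) \<le> norm (h' (W j x) *\<^sub>R (G j x - g x)) + norm (h' (W j x) *\<^sub>R g x - h' (w x) *\<^sub>R g x)"
          by (metis norm_triangle_ineq)
        also have "norm (h' (W j x) *\<^sub>R (G j x - g x)) \<le> norm (G j x - g x)" using h(3)[of "W j x"] by (auto intro!: mult_left_le_one_le)
        finally show "ennreal (norm (h' (W j x) *\<^sub>R G j x - h' (w x) *\<^sub>R g x)) \<le> ennreal (norm (G j x - g x)) + ennreal (norm (h' (W j x) *\<^sub>R g x - h' (w x) *\<^sub>R g x))"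
          by (simp add: ennreal_plus[symmetric] ennreal_leI del: ennreal_plus)
      qed auto
      ultimately show "(\<lambda>j. (NN x. ennreal (norm (h' (W j x) *\<^sub>R G j x - h' (w x) *\<^sub>R g x)))) ----> 0" by (rule tendsto_0_le_ennreal)
    qed (use iW sobD[OF w] in \<open>auto intro!: ih'\<close>)
  qed
qed

text \<open>The truncation \<open>(s - k)\<^sub>+\<close> is approximated by the \<open>C\<^sup>1\<close> functions
  \<open>sqrt ((s - k)\<^sub>+\<^sup>2 + d\<^sup>2) - d\<close>.\<close>
lemma sob_pos_part:
  fixes w :: "'a::euclidean_space \<Rightarrow> real"
  assumes w: "sob w g" and k: "k \<ge> 0"
  shows "sob (\<lambda>x. max (w x - k) 0) (\<lambda>x. indicator {x. w x > k} x *\<^sub>R g x)"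
proof -
  define p where "p s = max (s - k) 0" for s :: real
  define d where "d j = 1 / (real j + 1)" for j :: nat
  define h where "h j s = sqrt ((p s)\<^sup>2 + (d j)\<^sup>2) - d j" for j s
  define h' where "h' j s = p s / sqrt ((p s)\<^sup>2 + (d j)\<^sup>2)" for j s
  have d: "d j > 0" for j by (simp add: d_def)
  have dl: "d ----> 0"
    unfolding d_def[abs_def] using LIMSEQ_inverse_real_of_nat by (simp add: inverse_eq_divide add.commute)
  have pd: "((\<lambda>s. (p s)\<^sup>2) has_real_derivative 2 * p s) (at s)" for s
  proof -
    have "((\<lambda>s. (p s)\<^sup>2) has_field_derivative 2 * p s) (at s within {k..} \<union> {..k})"
    proof (cases "s = k")
      case True
      have "((\<lambda>y. ((p y)\<^sup>2 - (p k)\<^sup>2) / (y - k)) \<longlongrightarrow> 0) (at k)"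
      proof (rule tendsto_sandwich[of "\<lambda>y. - \<bar>y - k\<bar>" _ _ "\<lambda>y. \<bar>y - k\<bar>"])
        have "((\<lambda>y. \<bar>y - k\<bar>) \<longlongrightarrow> \<bar>k - k\<bar>) (at k)" by (intro tendsto_intros)
        then show "((\<lambda>y. \<bar>y - k\<bar>) \<longlongrightarrow> 0) (at k)" by simp
        from tendsto_minus[OF this] show "((\<lambda>y. - \<bar>y - k\<bar>) \<longlongrightarrow> 0) (at k)" by simp
      qed (auto simp: p_def power2_eq_square max_def intro!: always_eventually divide_nonneg_pos)
      then have "((\<lambda>s. (p s)\<^sup>2) has_field_derivative 2 * p s) (at s)" using True by (simp add: has_field_derivative_iff p_def)
      then show ?thesis by (rule has_field_derivative_at_within)
    next
      case False
      have "((\<lambda>s. (p s)\<^sup>2) has_field_derivative 2 * p s) (at s)"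
      proof (cases "s > k")
        case True
        have "((\<lambda>s. (s - k)\<^sup>2) has_field_derivative 2 * p s) (at s)" using True by (auto intro!: derivative_eq_intros simp: p_def)
        then show ?thesis by (rule has_field_derivative_transform_within_open[of _ _ _ "{k<..}"]) (use True in \<open>auto simp: p_def\<close>)
      next
        case f2: False
        have "((\<lambda>s. 0) has_field_derivative 2 * p s) (at s)" using f2 by (simp add: p_def)
        then show ?thesis by (rule has_field_derivative_transform_within_open[of _ _ _ "{..<k}"]) (use f2 False in \<open>auto simp: p_def\<close>)
      qed
      then show ?thesis by (rule has_field_derivative_at_within)
    qed
    moreover have "{k..} \<union> {..k} = (UNIV::real set)" by auto
    ultimately show ?thesis by simp
  qed
  have pos: "(p s)\<^sup>2 + (d j)\<^sup>2 > 0" for s j using d[of j] by (simp add: add_nonneg_pos)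
  have ge: "p s \<le> sqrt ((p s)\<^sup>2 + (d j)\<^sup>2)" "p s \<ge> 0" for s j by (auto intro!: real_le_rsqrt simp: p_def)
  have spos: "sqrt ((p s)\<^sup>2 + (d j)\<^sup>2) > 0" for s j using pos[of s j] by simp
  have hd: "(h j has_real_derivative h' j s) (at s)" for j s
  proof -
    have "((\<lambda>s. (p s)\<^sup>2 + (d j)\<^sup>2) has_real_derivative 2 * p s) (at s)" using DERIV_add[OF pd DERIV_const] by simp
    from DERIV_diff[OF DERIV_chain2[OF DERIV_real_sqrt[OF pos] this] DERIV_const, of "d j"]
    show ?thesis by (simp add: h_def[abs_def] h'_def field_simps)
  qed
  have cp: "continuous_on UNIV p" unfolding p_def by (intro continuous_intros)
  have hc: "continuous_on UNIV (h' j)" for j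
    unfolding h'_def using spos[of _ j] by (intro continuous_intros cp) (metis less_irrefl)
  have hb: "\<bar>h' j s\<bar> \<le> 1" for j s using ge(1)[of s j] ge(2)[of s] spos[of s j] by (simp add: h'_def)
  \<comment> \<open>Here k >= 0 enters: the truncation vanishes at 0 and thus keeps integrable
    functions integrable.\<close>
  have h0: "h j 0 = 0" for j using k d[of j] by (simp add: h_def p_def)
  have hp: "\<bar>h j s\<bar> \<le> \<bar>s\<bar>" for j s
  proof -
    have "norm (h j s - h j 0) \<le> 1 * norm (s - 0)" by (rule field_differentiable_bound[of UNIV "h j" "h' j"]) (use hd hb in auto)
    then show ?thesis using h0 by simp
  qed
  have hl: "(\<lambda>j. h j s) ----> p s" for s
  proof -
    have "(\<lambda>j. sqrt ((p s)\<^sup>2 + (d j)\<^sup>2) - d j) ----> sqrt ((p s)\<^sup>2 + 0\<^sup>2) - 0" by (intro tendsto_intros dl)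
    then show ?thesis using ge(2)[of s] by (simp add: h_def)
  qed
  \<comment> \<open>At s = k the derivatives are all 0, so the limit is the indicator of the open
    half-line and the gradient lives on {w > k}.\<close>
  have hl': "(\<lambda>j. h' j s) ----> indicator {s. s > k} s" for s
  proof (cases "s > k")
    case True
    then have "p s > 0" by (simp add: p_def)
    then have "(\<lambda>j. p s / sqrt ((p s)\<^sup>2 + (d j)\<^sup>2)) ----> p s / sqrt ((p s)\<^sup>2 + 0\<^sup>2)" by (intro tendsto_intros dl) auto
    then show ?thesis using True \<open>p s > 0\<close> by (simp add: h'_def)
  next
    case False
    then have "p s = 0" by (simp add: p_def)
    then show ?thesis using False by (simp add: h'_def)
  qed
  have [measurable]: "h j \<in> Borel" "h' j \<in> Borel" for j
    using hd hc by (auto intro!: borel_measurable_continuous_onI) (meson DERIV_isCont continuous_at_imp_continuous_on)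
  note [measurable] = sob_measurable[OF w]
  show ?thesis
  proof (rule sob_limit'[OF sob_chain[OF w hd hc hb h0]])
    show "L1_conv (\<lambda>j x. h j (w x)) (\<lambda>x. max (w x - k) 0)" by (rule L1_conv_dominated[of "\<lambda>x. \<bar>w x\<bar>"])
        (use sobD[OF w] hp hl in \<open>auto simp: p_def\<close>)
    show "L1_conv (\<lambda>j x. h' j (w x) *\<^sub>R g x) (\<lambda>x. indicator {x. w x > k} x *\<^sub>R g x)"
    proof (rule L1_conv_dominated[of "\<lambda>x. norm (g x)"])
      show "AE x in lborel. norm (h' j (w x) *\<^sub>R g x) \<le> norm (g x)" for j using hb by (auto intro!: mult_left_le_one_le)
      have "(\<lambda>j. h' j (w x) *\<^sub>R g x) ----> indicator {x. w x > k} x *\<^sub>R g x" for x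
      proof -
        have "(\<lambda>j. h' j (w x) *\<^sub>R g x) ----> indicator {s. s > k} (w x) *\<^sub>R g x" by (intro tendsto_intros hl')
        then show ?thesis by (simp add: indicator_def)
      qed
      then show "AE x in lborel. (\<lambda>j. h' j (w x) *\<^sub>R g x) ----> indicator {x. w x > k} x *\<^sub>R g x" by simp
    qed (use sobD[OF w] in auto)
  qed
qed

section \<open>Approximation with control of the gradient\<close>

text \<open>Young's inequality for a^p and c^p with weights 1/p and 1 - 1/p, rearranged: a convex
  power lies above its tangent at \<open>c\<close>.\<close>

lemma powr_tangent:
  fixes a c p :: real
  assumes "0 \<le> a" "0 \<le> c" "1 \<le> p"
  shows "c powr p + p * c powr (p - 1) * (a - c) \<le> a powr p"
proof (cases "c = 0")
  case True then show ?thesis using assms by simp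
next
  case False
  then have c: "c > 0" using assms by simp
  have cc: "c powr (p - 1) * c = c powr p" using c by (simp add: powr_diff)
  show ?thesis
  proof (cases "a = 0")
    case True
    have "c powr p + p * c powr (p - 1) * (a - c) = c powr p - p * (c powr (p - 1) * c)" using True by simp
    also have "\<dots> = (1 - p) * c powr p" unfolding cc by (simp add: algebra_simps)
    also have "\<dots> \<le> 0" using assms by (intro mult_nonpos_nonneg) auto
    finally show ?thesis using True by simp
  next
    case False
    then have a: "a > 0" using assms by simp
    have "(a powr p) powr (1 / p) * (c powr p) powr (1 - 1 / p) \<le> 1 / p * a powr p + (1 - 1 / p) * c powr p"
      by (rule Youngs_inequality_0) (use a c assms in auto)
    moreover have "(a powr p) powr (1 / p) = a" using a assms by (simp add: powr_powr)
    moreover have "(c powr p) powr (1 - 1 / p) = c powr (p - 1)" using assms by (simp add: powr_powr algebra_simps)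
    ultimately have "p * (a * c powr (p - 1)) \<le> p * (1 / p * a powr p + (1 - 1 / p) * c powr p)" using assms by (intro mult_left_mono) auto
    also have "\<dots> = a powr p + (p - 1) * c powr p" using assms by (simp add: field_simps)
    finally have "p * (a * c powr (p - 1)) \<le> a powr p + (p - 1) * c powr p" .
    moreover have "c powr p + p * c powr (p - 1) * (a - c) = p * (a * c powr (p - 1)) + c powr p - p * (c powr (p - 1) * c)" by (simp add: algebra_simps)
    ultimately show ?thesis unfolding cc by (simp add: left_diff_distrib)
  qed
qed

text \<open>Jensen's inequality by integrating the tangent at the mean \<open>c\<close> against the
  kernel. The indicator of \<open>Q\<close> allows the p-th power to be integrable only on a set
  that contains the support of the kernel.\<close>

lemma mol_Jensen:
  fixes w :: "'a::euclidean_space \<Rightarrow> 'b::{banach, second_countable_topology}"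
  assumes K: "mollifier e K" and w: "integrable lborel w" and p: "1 \<le> p"
    and Q: "integrable lborel (\<lambda>x. indicator Q x * norm (w x) powr p)" "cball x e \<subseteq> Q"
  shows "norm (mol K w x) powr p \<le> mol K (\<lambda>x. indicator Q x * norm (w x) powr p) x"
proof -
  obtain D where D: "C1 K D" using mollifier_C1[OF K] .
  have Kp: "K x \<ge> 0" "zero_off (cball 0 e) K" "integrable lborel K" "(LINT x|lborel. K x) = 1" for x using K by (auto simp: mollifier_def)
  note [measurable] = C1_measurable[OF D] borel_measurable_integrable[OF w]
  have i1: "integrable lborel (\<lambda>y. K (x - y) * norm (w y))" using integrable_mol[OF D compact_cball Kp(2) integrable_norm[OF w], of x] by simp
  have iK: "integrable lborel (\<lambda>y. K (x - y))" by (rule integrable_reflect[OF Kp(3)])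
  have IK: "(LINT y|lborel. K (x - y)) = 1" using integral_reflect[of K x] Kp by simp
  have i2: "integrable lborel (\<lambda>y. K (x - y) * (indicator Q y * norm (w y) powr p))" using integrable_mol[OF D compact_cball Kp(2) Q(1), of x] by simp
  define c where "c = (LINT y|lborel. K (x - y) * norm (w y))"
  have c0: "c \<ge> 0" unfolding c_def using Kp by (intro integral_nonneg_AE) auto
  have nc: "norm (mol K w x) \<le> c"
    unfolding mol_def c_def using Kp(1) by (intro integral_norm_bound[THEN order_trans]) simp
  have "(LINT y|lborel. (c powr p - p * c powr (p - 1) * c) * K (x - y) + p * c powr (p - 1) * (K (x - y) * norm (w y)))
     \<le> (LINT y|lborel. K (x - y) * (indicator Q y * norm (w y) powr p))"
  proof (rule integral_mono)
    show "integrable lborel (\<lambda>y. (c powr p - p * c powr (p - 1) * c) * K (x - y) + p * c powr (p - 1) * (K (x - y) * norm (w y)))" using iK i1 by auto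
    fix y
    show "(c powr p - p * c powr (p - 1) * c) * K (x - y) + p * c powr (p - 1) * (K (x - y) * norm (w y))
       \<le> K (x - y) * (indicator Q y * norm (w y) powr p)"
    proof (cases "y \<in> Q")
      case True
      show ?thesis using mult_left_mono[OF powr_tangent[OF norm_ge_zero[of "w y"] c0 p] Kp(1)[of "x - y"]] True by (simp add: algebra_simps)
    next
      case False
      then have "x - y \<notin> cball 0 e" using Q(2) by (auto simp: dist_norm subset_iff norm_minus_commute)
      then have "K (x - y) = 0" using Kp(2) by (simp add: zero_off_def)
      then show ?thesis by simp
    qed
  qed (rule i2)
  moreover have "(LINT y|lborel. (c powr p - p * c powr (p - 1) * c) * K (x - y) + p * c powr (p - 1) * (K (x - y) * norm (w y)))
     = (c powr p - p * c powr (p - 1) * c) + p * c powr (p - 1) * c" using iK i1 IK by (simp add: c_def[symmetric])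
  ultimately have "c powr p \<le> mol K (\<lambda>x. indicator Q x * norm (w x) powr p) x" by (simp add: mol_def)
  moreover have "norm (mol K w x) powr p \<le> c powr p" using nc p by (intro powr_mono2) auto
  ultimately show ?thesis by simp
qed

lemma mol_zero_off:
  assumes "mollifier e K" "zero_off (cube c R) w"
  shows "zero_off (cube c (R + e)) (mol K w)"
  unfolding zero_off_def
proof (intro allI impI)
  fix x assume x: "x \<notin> cube c (R + e)"
  have "K (x - y) *\<^sub>R w y = 0" for y
  proof (cases "y \<in> cube c R")
    case True
    obtain i where i: "i \<in> Basis" "\<bar>x \<bullet> i - c \<bullet> i\<bar> > R + e" using x by (auto simp: mem_cube not_le)
    moreover have "\<bar>y \<bullet> i - c \<bullet> i\<bar> \<le> R" using True i by (auto simp: mem_cube)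
    ultimately have "\<bar>(x - y) \<bullet> i\<bar> > e" by (simp add: inner_diff_left)
    then have "norm (x - y) > e" using Basis_le_norm[OF i(1), of "x - y"] by simp
    then show ?thesis using assms(1) by (auto simp: mollifier_def zero_off_def)
  next
    case False then show ?thesis using assms(2) by (simp add: zero_off_def)
  qed
  then show "mol K w x = 0" unfolding mol_def by (simp only: Bochner_Integration.integral_zero)
qed

text \<open>The majorants \<open>H j\<close> are mollifications of the p-th power itself; their L^1
  convergence takes the place of L^p convergence of the gradients when Sobolev and Poincare
  inequalities are passed to the limit.\<close>

lemma sob_approx:
  fixes w :: "'a::euclidean_space \<Rightarrow> real"
  assumes w: "sob w g" and p: "1 \<le> p" and Q: "integrable lborel (\<lambda>x. indicator Q x * norm (g x) powr p)" and e: "e > 0"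
  obtains W G H where "\<And>j::nat. C1 (W j) (G j)" "AE x in lborel. (\<lambda>j. W j x) ----> w x"
    "L1_conv H (\<lambda>x. indicator Q x * norm (g x) powr p)" "\<And>j x. 0 \<le> H j x"
    "\<And>j x. cball x e \<subseteq> Q \<Longrightarrow> norm (G j x) powr p \<le> H j x"
    "\<And>j c R. zero_off (cube c R) w \<Longrightarrow> zero_off (cube c (R + e)) (W j)"
proof -
  obtain K where K: "\<And>j. mollifier (1 / (real j + 1)) (K j :: 'a \<Rightarrow> real)" using mollifier_seq by blast
  obtain r where r: "strict_mono r" "AE x in lborel. (\<lambda>j. mol (K (r j)) w x) ----> w x"
    using L1_conv_AE_subseq[OF L1_conv_mol[OF K sobD(1)[OF w]]] .
  \<comment> \<open>Dropping the first \<open>N\<close> terms makes every kernel radius at most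
    \<open>e\<close>, uniformly in j.\<close>
  obtain N :: nat where N: "1 / (real N + 1) < e" using reals_Archimedean[OF e] by (auto simp: inverse_eq_divide add.commute)
  define k where "k j = r (j + N)" for j
  have sk: "strict_mono k" using r(1) by (auto simp: k_def strict_mono_def)
  have small: "1 / (real (k j) + 1) \<le> e" for j
  proof -
    have "N \<le> k j" using seq_suble[OF r(1), of "j + N"] by (simp add: k_def)
    then have "1 / (real (k j) + 1) \<le> 1 / (real N + 1)" by (simp add: frac_le)
    then show ?thesis using N by simp
  qed
  define H where "H j = mol (K (k j)) (\<lambda>x. indicator Q x * norm (g x) powr p)" for j
  show ?thesis
  proof (rule that[of "\<lambda>j. mol (K (k j)) w" "\<lambda>j. mol (K (k j)) g" H])
    show "C1 (mol (K (k j)) w) (mol (K (k j)) g)" for j by (rule sob_mol_C1[OF w K])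
    show "AE x in lborel. (\<lambda>j. mol (K (k j)) w x) ----> w x"
      using r(2)
    proof (rule AE_mp, intro AE_I2 impI)
      fix x assume "(\<lambda>j. mol (K (r j)) w x) ----> w x"
      from LIMSEQ_ignore_initial_segment[OF this, of N] show "(\<lambda>j. mol (K (k j)) w x) ----> w x" by (simp add: k_def)
    qed
    show "L1_conv H (\<lambda>x. indicator Q x * norm (g x) powr p)"
      unfolding H_def[abs_def] by (rule L1_conv_subseq[OF L1_conv_mol[OF K Q] sk])

    show "0 \<le> H j x" for j x
      unfolding H_def mol_def using K[of "k j"] by (intro integral_nonneg_AE) (auto simp: mollifier_def)
    show "norm (mol (K (k j)) g x) powr p \<le> H j x" if "cball x e \<subseteq> Q" for j x
    proof -
      have "cball x (1 / (real (k j) + 1)) \<subseteq> Q" using that small[of j] by (auto simp: subset_iff)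
      then show ?thesis unfolding H_def by (rule mol_Jensen[OF K sobD(2)[OF w] p Q])
    qed
    show "zero_off (cube c (R + e)) (mol (K (k j)) w)" if "zero_off (cube c R) w" for j c R
      by (rule zero_off_mono[OF mol_zero_off[OF K that] cube_mono]) (use small[of j] in simp)
  qed
qed

lemma L1_conv_nn_integral:
  fixes H :: "nat \<Rightarrow> 'a::euclidean_space \<Rightarrow> real"
  assumes H: "L1_conv H h" "\<And>j x. 0 \<le> H j x" "\<And>x. 0 \<le> h x" and A[measurable]: "A \<in> sets borel"
  shows "(\<lambda>j. (NN x. ennreal (H j x) * indicator A x)) ----> (NN x. ennreal (h x) * indicator A x)"
proof -
  have i: "integrable lborel (H j)" "integrable lborel h" for j using H by (auto simp: L1_conv_def)
  have eq: "(NN x. ennreal (k x) * indicator A x) = ennreal (LINT x|lborel. indicator A x *\<^sub>R k x)"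
    if "integrable lborel k" "\<And>x. 0 \<le> k x" for k :: "'a \<Rightarrow> real"
  proof -
    have "integrable lborel (\<lambda>x. indicator A x *\<^sub>R k x)" using that(1) by (intro integrable_mult_indicator) auto
    then have "(NN x. ennreal (indicator A x *\<^sub>R k x)) = ennreal (LINT x|lborel. indicator A x *\<^sub>R k x)"
      using that(2) by (intro nn_integral_eq_integral) auto
    moreover have "ennreal (indicator A x *\<^sub>R k x) = ennreal (k x) * indicator A x" for x by (auto simp: indicator_def)
    ultimately show ?thesis by simp
  qed
  have "L1_conv (\<lambda>j x. indicator A x *\<^sub>R H j x) (\<lambda>x. indicator A x *\<^sub>R h x)" by (rule L1_conv_scaleR_right[OF H(1), where B=1]) auto
  from L1_conv_integral[OF this] show ?thesis using i H by (simp add: eq tendsto_ennrealI del: real_scaleR_def)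
qed

section \<open>Poincare inequality\<close>

lemma nn_integral_affine:
  fixes F :: "'a::euclidean_space \<Rightarrow> ennreal"
  assumes [measurable]: "F \<in> Borel" and a: "a > 0"
  shows "(NN x. F (t + a *\<^sub>R x)) = ennreal ((1 / a) ^ DIM('a)) * (NN x. F x)"
proof -
  have "(NN x. F x) = (\<integral>\<^sup>+x. F x \<partial>density (distr lborel borel (\<lambda>x. t + a *\<^sub>R x)) (\<lambda>_. \<bar>a\<bar>^DIM('a)))"
    using lborel_affine[of a t] a by simp
  also have "\<dots> = ennreal (a ^ DIM('a)) * (NN x. F (t + a *\<^sub>R x))" using a by (simp add: nn_integral_density nn_integral_distr nn_integral_cmult)
  finally have "ennreal ((1 / a) ^ DIM('a)) * (NN x. F x) = (ennreal ((1 / a) ^ DIM('a)) * ennreal (a ^ DIM('a))) * (NN x. F (t + a *\<^sub>R x))"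
    by (simp add: mult.assoc)
  also have "ennreal ((1 / a) ^ DIM('a)) * ennreal (a ^ DIM('a)) = 1" using a by (simp add: ennreal_mult[symmetric] power_mult_distrib[symmetric])
  finally show ?thesis by simp
qed

text \<open>Jensen's inequality on the unit interval, obtained as Hoelder's inequality against the
  constant 1.\<close>

lemma epowr_integral_01:
  assumes [measurable]: "f \<in> Borel" and p: "1 \<le> p"
  shows "epowr (NN s. f s * indicator {0..1} s) p \<le> (NN s. epowr (f s) p * indicator {0..1::real} s)"
proof -
  have "(NN s. f s * indicator {0..1} s)
     = (NN s. epowr (epowr (f s) p * indicator {0..1} s) (1 / p) * epowr (indicator {0..1} s) (1 - 1 / p))"
    using p by (intro nn_integral_cong) (auto simp: indicator_def epowr_epowr)
  also have "\<dots> \<le> epowr (NN s. epowr (f s) p * indicator {0..1} s) (1 / p) * epowr (NN s. indicator {0..1::real} s) (1 - 1 / p)"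
    using p nn_integral_Holder2[of "\<lambda>s. epowr (f s) p * indicator {0..1} s" lborel "indicator {0..1}" "1 / p"] by simp
  also have "(NN s. indicator {0..1::real} s) = 1" by simp
  finally show ?thesis using p by (subst epowr_le_iff) auto
qed

lemma norm_diff_cube:
  fixes c :: "'a::euclidean_space"
  assumes "x \<in> cube c r" "y \<in> cube c r"
  shows "norm (y - x) \<le> 2 * r * DIM('a)"
proof -
  have "norm (y - x) \<le> (\<Sum>b\<in>Basis. \<bar>(y - x) \<bullet> b\<bar>)" by (rule norm_le_l1)
  also have "\<dots> \<le> (\<Sum>b\<in>(Basis::'a set). 2 * r)"
  proof (rule sum_mono)
    fix b :: 'a assume b: "b \<in> Basis"
    have "\<bar>x \<bullet> b - c \<bullet> b\<bar> \<le> r" "\<bar>y \<bullet> b - c \<bullet> b\<bar> \<le> r" using assms b by (auto simp: mem_cube)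
    then show "\<bar>(y - x) \<bullet> b\<bar> \<le> 2 * r" by (simp add: inner_diff_left)
  qed
  finally show ?thesis by (simp add: mult.commute)
qed

lemma convex_cube: "convex (cube c r)" by (simp add: cube_def convex_box)

lemma C1_segment_powr:
  fixes w :: "'a::euclidean_space \<Rightarrow> real"
  assumes w: "C1 w D" and p: "1 \<le> p" and xy: "x \<in> cube c r" "y \<in> cube c r" and r: "0 < r"
  shows "ennreal (\<bar>w x - w y\<bar> powr p) \<le> ennreal ((2 * r * DIM('a)) powr p) *
     (NN s. ennreal (norm (D (x + s *\<^sub>R (y - x))) powr p) * indicator {0..1} s)"
proof -
  define B where "B = 2 * r * DIM('a)"
  have B: "B > 0" using r by (simp add: B_def)
  note [measurable] = C1_measurable[OF w]
  have cont: "continuous_on T (\<lambda>s. D (x + s *\<^sub>R (y - x)))" for T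
    by (rule continuous_on_compose2[OF C1_continuous_grad[OF w]]) (auto intro!: continuous_intros)
  have "(LINT s|lborel. indicator {0..1} s *\<^sub>R (D (x + s *\<^sub>R (y - x)) \<bullet> (y - x))) = w (x + 1 *\<^sub>R (y - x)) - w (x + 0 *\<^sub>R (y - x))"
    by (rule integral_FTC_Icc)
       (use C1_line[OF w, of x "y - x"] cont in \<open>auto simp: has_real_derivative_iff_has_vector_derivative intro!: continuous_intros\<close>)
  then have "ennreal \<bar>w x - w y\<bar> = ennreal (norm (LINT s|lborel. indicator {0..1} s *\<^sub>R (D (x + s *\<^sub>R (y - x)) \<bullet> (y - x))))"
    by (simp add: abs_minus_commute)
  also have "\<dots> \<le> (NN s. ennreal (norm (indicator {0..1} s *\<^sub>R (D (x + s *\<^sub>R (y - x)) \<bullet> (y - x)))))"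
    by (rule integral_norm_bound_ennreal) (rule borel_integrable_compact, use cont in \<open>auto intro!: continuous_intros\<close>)
  also have "\<dots> \<le> (NN s. ennreal (B * norm (D (x + s *\<^sub>R (y - x)))) * indicator {0..1} s)"
  proof (intro nn_integral_mono)
    fix s :: real
    have "\<bar>D (x + s *\<^sub>R (y - x)) \<bullet> (y - x)\<bar> \<le> norm (D (x + s *\<^sub>R (y - x))) * norm (y - x)" by (rule Cauchy_Schwarz_ineq2)
    also have "\<dots> \<le> norm (D (x + s *\<^sub>R (y - x))) * B" using norm_diff_cube[OF xy] by (intro mult_left_mono) (auto simp: B_def)
    finally show "ennreal (norm (indicator {0..1} s *\<^sub>R (D (x + s *\<^sub>R (y - x)) \<bullet> (y - x)))) \<le> ennreal (B * norm (D (x + s *\<^sub>R (y - x)))) * indicator {0..1} s"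
      by (auto simp: indicator_def mult.commute intro!: ennreal_leI)
  qed
  finally have "ennreal \<bar>w x - w y\<bar> \<le> (NN s. ennreal (B * norm (D (x + s *\<^sub>R (y - x)))) * indicator {0..1} s)" .
  then have "epowr (ennreal \<bar>w x - w y\<bar>) p \<le> epowr (NN s. ennreal (B * norm (D (x + s *\<^sub>R (y - x)))) * indicator {0..1} s) p"
    using p by (intro epowr_mono) auto
  also have "\<dots> \<le> (NN s. epowr (ennreal (B * norm (D (x + s *\<^sub>R (y - x))))) p * indicator {0..1} s)" by (rule epowr_integral_01[OF _ p]) measurable
  also have "\<dots> = (NN s. ennreal (B powr p) * (ennreal (norm (D (x + s *\<^sub>R (y - x))) powr p) * indicator {0..1} s))"
    using p B by (intro nn_integral_cong) (simp add: epowr_mult epowr_ennreal ennreal_mult mult.assoc)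
  also have "\<dots> = ennreal (B powr p) * (NN s. ennreal (norm (D (x + s *\<^sub>R (y - x))) powr p) * indicator {0..1} s)" by (rule nn_integral_cmult) measurable
  finally show ?thesis using p by (simp add: epowr_ennreal B_def)
qed

text \<open>The difference w x - w y is integrated along the segment from x to y. For a fixed
  parameter s the variable with coefficient at least 1/2, y if s >= 1/2 and x otherwise, is
  substituted, so the Jacobian costs at most 2^n and no singular kernel appears.\<close>

lemma Poincare_C1:
  fixes w :: "'a::euclidean_space \<Rightarrow> real"
  assumes w: "C1 w D" and p: "1 \<le> p" and r: "0 < r"
  shows "(NN x. (NN y. ennreal (\<bar>w x - w y\<bar> powr p) * indicator (cube c r) y) * indicator (cube c r) x)
      \<le> ennreal ((2 * r * DIM('a)) powr p * (4 * r) ^ DIM('a)) * (NN x. ennreal (norm (D x) powr p) * indicator (cube c r) x)"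
proof -
  define Q where "Q = cube c r"
  have [measurable]: "Q \<in> sets borel" by (simp add: Q_def)
  note [measurable] = C1_measurable[OF w]
  define B where "B = (2 * r * DIM('a)) powr p"
  define F where "F x = ennreal (norm (D x) powr p) * indicator Q x" for x
  have [measurable]: "F \<in> Borel" unfolding F_def by measurable
  define I where "I = (NN x. F x)"
  have seg: "x + s *\<^sub>R (y - x) \<in> Q" if "x \<in> Q" "y \<in> Q" "0 \<le> s" "s \<le> 1" for x y s
  proof -
    have "(1 - s) *\<^sub>R x + s *\<^sub>R y \<in> Q" using convex_cube[of c r] that unfolding Q_def convex_alt by blast
    then show ?thesis by (simp add: algebra_simps)
  qed
  have pw: "ennreal (\<bar>w x - w y\<bar> powr p) * indicator Q y * indicator Q x
      \<le> ennreal B * (NN s. F (x + s *\<^sub>R (y - x)) * indicator {0..1} s * indicator Q y * indicator Q x)" for x y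
  proof (cases "x \<in> Q \<and> y \<in> Q")
    case True
    then have "ennreal (\<bar>w x - w y\<bar> powr p) \<le> ennreal B * (NN s. ennreal (norm (D (x + s *\<^sub>R (y - x))) powr p) * indicator {0..1} s)"
      unfolding B_def Q_def by (intro C1_segment_powr[OF w p _ _ r]) auto
    also have "(NN s. ennreal (norm (D (x + s *\<^sub>R (y - x))) powr p) * indicator {0..1} s)
        = (NN s. F (x + s *\<^sub>R (y - x)) * indicator {0..1} s)" using seg[of x y] True by (intro nn_integral_cong) (auto simp: F_def indicator_def)
    finally show ?thesis using True by simp
  qed auto
  have vol: "(NN x. indicator Q x) = ennreal ((2 * r) ^ DIM('a))" using emeasure_cube[of r c] r by (simp add: Q_def)
  have half: "(NN x. (NN y. F (x + s *\<^sub>R (y - x)) * indicator Q y * indicator Q x)) \<le> ennreal ((4 * r) ^ DIM('a)) * I"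
    if s: "0 \<le> s" "s \<le> 1" for s
  proof -
    have pow: "(1 / a) ^ DIM('a) * (2 * r) ^ DIM('a) \<le> (4 * r) ^ DIM('a)" if "a \<ge> 1 / 2" for a :: real
    proof -
      have "1 / a \<le> 2" using that by (simp add: field_simps)
      then have "(1 / a * (2 * r)) ^ DIM('a) \<le> (2 * (2 * r)) ^ DIM('a)" using that r by (intro power_mono mult_right_mono) auto
      moreover have "(1 / a * (2 * r)) ^ DIM('a) = (1 / a) ^ DIM('a) * (2 * r) ^ DIM('a)" by (rule power_mult_distrib)
      ultimately show ?thesis by (simp only: mult.assoc[symmetric]) simp
    qed
    have one: "(NN x. (NN y. F (a *\<^sub>R x + b *\<^sub>R y)) * indicator Q x) \<le> ennreal ((4 * r) ^ DIM('a)) * I"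
      if "b \<ge> 1 / 2" for a b :: real
    proof -
      have "(NN x. (NN y. F (a *\<^sub>R x + b *\<^sub>R y)) * indicator Q x) = (NN x. (ennreal ((1 / b) ^ DIM('a)) * I) * indicator Q x)"
        using that by (simp add: nn_integral_affine I_def)
      also have "\<dots> = ennreal ((1 / b) ^ DIM('a)) * I * ennreal ((2 * r) ^ DIM('a))" using vol by (simp add: nn_integral_cmult)
      also have "\<dots> = ennreal ((1 / b) ^ DIM('a) * (2 * r) ^ DIM('a)) * I" using that r by (simp add: ennreal_mult mult_ac)
      also have "\<dots> \<le> ennreal ((4 * r) ^ DIM('a)) * I" by (intro mult_right_mono ennreal_leI pow that) auto
      finally show ?thesis .
    qed
    show ?thesis
    proof (cases "s \<ge> 1 / 2")
      case True
      have "(NN x. (NN y. F (x + s *\<^sub>R (y - x)) * indicator Q y * indicator Q x))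
         \<le> (NN x. (NN y. F ((1 - s) *\<^sub>R x + s *\<^sub>R y)) * indicator Q x)"
        by (auto simp: indicator_def algebra_simps nn_integral_multc intro!: nn_integral_mono)
      also have "\<dots> \<le> ennreal ((4 * r) ^ DIM('a)) * I" by (rule one[OF True])
      finally show ?thesis .
    next
      case False
      have "(NN x. (NN y. F (x + s *\<^sub>R (y - x)) * indicator Q y * indicator Q x))
         = (NN y. (NN x. F (x + s *\<^sub>R (y - x)) * indicator Q y * indicator Q x))" by (rule lborel_pair.Fubini'[symmetric]) measurable
      also have "\<dots> \<le> (NN y. (NN x. F (s *\<^sub>R y + (1 - s) *\<^sub>R x)) * indicator Q y)"
        by (auto simp: indicator_def algebra_simps nn_integral_multc intro!: nn_integral_mono)
      also have "\<dots> \<le> ennreal ((4 * r) ^ DIM('a)) * I" by (rule one) (use False in simp)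
      finally show ?thesis .
    qed
  qed
  have "(NN x. (NN y. ennreal (\<bar>w x - w y\<bar> powr p) * indicator Q y) * indicator Q x)
     = (NN x. (NN y. ennreal (\<bar>w x - w y\<bar> powr p) * indicator Q y * indicator Q x))" by (simp add: nn_integral_multc)
  also have "\<dots> \<le> (NN x. (NN y. ennreal B * (NN s. F (x + s *\<^sub>R (y - x)) * indicator {0..1} s * indicator Q y * indicator Q x)))"
    by (intro nn_integral_mono pw)
  also have "\<dots> = ennreal B * (NN x. (NN y. (NN s. F (x + s *\<^sub>R (y - x)) * indicator {0..1} s * indicator Q y * indicator Q x)))"
    by (simp add: nn_integral_cmult)
  also have "(NN x. (NN y. (NN s. F (x + s *\<^sub>R (y - x)) * indicator {0..1} s * indicator Q y * indicator Q x)))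
     = (NN x. (NN s. (NN y. F (x + s *\<^sub>R (y - x)) * indicator {0..1} s * indicator Q y * indicator Q x)))"
    by (intro nn_integral_cong lborel_pair.Fubini'[symmetric]) measurable
  also have "\<dots> = (NN s. (NN x. (NN y. F (x + s *\<^sub>R (y - x)) * indicator {0..1} s * indicator Q y * indicator Q x)))"
    by (rule lborel_pair.Fubini'[symmetric]) measurable
  also have "\<dots> = (NN s. (NN x. (NN y. F (x + s *\<^sub>R (y - x)) * indicator Q y * indicator Q x)) * indicator {0..1} s)"
    by (intro nn_integral_cong) (auto simp: indicator_def)
  also have "\<dots> \<le> (NN s. (ennreal ((4 * r) ^ DIM('a)) * I) * indicator {0..1::real} s)" using half by (intro nn_integral_mono) (auto simp: indicator_def)
  also have "\<dots> = ennreal ((4 * r) ^ DIM('a)) * I" by (simp add: nn_integral_cmult)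
  finally show ?thesis using r by (simp add: Q_def[symmetric] B_def I_def F_def ennreal_mult mult.assoc mult_left_mono)
qed

lemma powr_liminf_le:
  assumes "(\<lambda>j. X j) ----> (x::real)" "p \<ge> 1"
  shows "ennreal (\<bar>x\<bar> powr p) \<le> liminf (\<lambda>j. ennreal (\<bar>X j\<bar> powr p))"
proof -
  have "(\<lambda>j. \<bar>X j\<bar> powr p) ----> \<bar>x\<bar> powr p" using assms by (intro tendsto_powr' tendsto_intros) auto
  then have "(\<lambda>j. ennreal (\<bar>X j\<bar> powr p)) ----> ennreal (\<bar>x\<bar> powr p)" by (rule tendsto_ennrealI)
  from lim_imp_Liminf[OF _ this] show ?thesis by simp
qed

text \<open>Fatou's lemma in y for almost every x and then in x; the right-hand side converges
  through the majorants of \<open>sob_approx\<close>.\<close>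

lemma Poincare_sob:
  fixes w :: "'a::euclidean_space \<Rightarrow> real"
  assumes w: "sob w g" and p: "1 \<le> p" and r: "0 < r"
    and P: "integrable lborel (\<lambda>x. indicator P x * norm (g x) powr p)" "e > 0" "\<And>x. x \<in> cube c r \<Longrightarrow> cball x e \<subseteq> P"
  shows "(NN x. (NN y. ennreal (\<bar>w x - w y\<bar> powr p) * indicator (cube c r) y) * indicator (cube c r) x)
      \<le> ennreal ((2 * r * DIM('a)) powr p * (4 * r) ^ DIM('a)) * (NN x. ennreal (norm (g x) powr p) * indicator (cube c r) x)"
proof -
  define Q where "Q = cube c r"
  define B where "B = (2 * r * DIM('a)) powr p * (4 * r) ^ DIM('a)"
  have [measurable]: "Q \<in> sets borel" by (simp add: Q_def)
  obtain W G H where A: "\<And>j::nat. C1 (W j) (G j)" "AE x in lborel. (\<lambda>j. W j x) ----> w x"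
    "L1_conv H (\<lambda>x. indicator P x * norm (g x) powr p)" "\<And>j x. 0 \<le> H j x"
    "\<And>j x. cball x e \<subseteq> P \<Longrightarrow> norm (G j x) powr p \<le> H j x" by (rule sob_approx[OF w p P(1,2)]) (rule that; assumption)
  note [measurable] = C1_measurable[OF A(1)] sob_measurable[OF w]
  let ?T = "\<lambda>W x. (NN y. ennreal (\<bar>W x - W y\<bar> powr p) * indicator Q y) * indicator Q x"
  have inn: "?T w x \<le> liminf (\<lambda>j. ?T (W j) x)" if x: "(\<lambda>j. W j x) ----> w x" for x
  proof (cases "x \<in> Q")
    case True
    have "(NN y. ennreal (\<bar>w x - w y\<bar> powr p) * indicator Q y) \<le> (NN y. liminf (\<lambda>j. ennreal (\<bar>W j x - W j y\<bar> powr p) * indicator Q y))"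
    proof (rule nn_integral_mono_AE, rule AE_mp[OF A(2)], intro AE_I2 impI)
      fix y assume y: "(\<lambda>j. W j y) ----> w y"
      show "ennreal (\<bar>w x - w y\<bar> powr p) * indicator Q y \<le> liminf (\<lambda>j. ennreal (\<bar>W j x - W j y\<bar> powr p) * indicator Q y)"
        using powr_liminf_le[OF tendsto_diff[OF x y] p] by (cases "y \<in> Q") auto
    qed
    also have "\<dots> \<le> liminf (\<lambda>j. (NN y. ennreal (\<bar>W j x - W j y\<bar> powr p) * indicator Q y))" by (rule nn_integral_liminf) measurable
    finally show ?thesis using True by simp
  qed simp
  have "(NN x. ?T w x) \<le> (NN x. liminf (\<lambda>j. ?T (W j) x))" by (rule nn_integral_mono_AE, rule AE_mp[OF A(2)], intro AE_I2 impI inn)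
  also have "\<dots> \<le> liminf (\<lambda>j. (NN x. ?T (W j) x))" by (rule nn_integral_liminf) measurable
  also have "\<dots> \<le> liminf (\<lambda>j. ennreal B * (NN x. ennreal (H j x) * indicator Q x))"
  proof (rule Liminf_mono, rule always_eventually, rule allI)
    fix j
    have "(NN x. ?T (W j) x) \<le> ennreal B * (NN x. ennreal (norm (G j x) powr p) * indicator Q x)"
      unfolding Q_def B_def by (rule Poincare_C1[OF A(1) p r])
    also have "\<dots> \<le> ennreal B * (NN x. ennreal (H j x) * indicator Q x)"
      using A(5) P(3) by (intro mult_left_mono nn_integral_mono) (auto simp: indicator_def Q_def intro!: ennreal_leI)
    finally show "(NN x. ?T (W j) x) \<le> ennreal B * (NN x. ennreal (H j x) * indicator Q x)" .
  qed
  also have "\<dots> = ennreal B * (NN x. ennreal (indicator P x * norm (g x) powr p) * indicator Q x)"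
    by (intro lim_imp_Liminf ennreal_tendsto_cmult L1_conv_nn_integral[OF A(3,4)]) (auto simp: indicator_def)
  also have "(NN x. ennreal (indicator P x * norm (g x) powr p) * indicator Q x) = (NN x. ennreal (norm (g x) powr p) * indicator Q x)"
  proof (intro nn_integral_cong)
    fix x
    have "x \<in> P" if "x \<in> Q" using P(2) P(3)[of x] that by (auto simp: Q_def)
    then show "ennreal (indicator P x * norm (g x) powr p) * indicator Q x = ennreal (norm (g x) powr p) * indicator Q x" by (auto simp: indicator_def)
  qed
  finally show ?thesis by (simp add: Q_def B_def)
qed

text \<open>At points x of the zero set the inner integral of \<open>Poincare_sob\<close> is the
  full integral of |w|^p, and the zero set carries at least half of the volume.\<close>

lemma Poincare_half:
  fixes w :: "'a::euclidean_space \<Rightarrow> real"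
  assumes w: "sob w g" and p: "1 \<le> p" and r: "0 < r"
    and P: "integrable lborel (\<lambda>x. indicator P x * norm (g x) powr p)" "e > 0" "\<And>x. x \<in> cube c r \<Longrightarrow> cball x e \<subseteq> P"
    and half: "2 * leb {x \<in> cube c r. w x \<noteq> 0} \<le> leb (cube c r)"
  shows "(NN x. ennreal (\<bar>w x\<bar> powr p) * indicator (cube c r) x)
      \<le> ennreal (2 * (2 * r * DIM('a)) powr p * 2 ^ DIM('a)) * (NN x. ennreal (norm (g x) powr p) * indicator (cube c r) x)"
proof -
  define Q where "Q = cube c r"
  define B where "B = (2 * r * DIM('a)) powr p"
  define Z where "Z = {x \<in> Q. w x = 0}"
  note [measurable] = sob_measurable[OF w]
  have [measurable]: "Q \<in> sets borel" by (simp add: Q_def)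
  have [measurable]: "Z \<in> sets borel" unfolding Z_def by measurable
  define X where "X = (NN x. ennreal (\<bar>w x\<bar> powr p) * indicator Q x)"
  define Y where "Y = (NN x. ennreal (norm (g x) powr p) * indicator Q x)"
  have vol: "leb Q = ennreal ((2 * r) ^ DIM('a))" unfolding Q_def using r by (intro emeasure_cube) simp
  have volZ: "ennreal ((2 * r) ^ DIM('a) / 2) \<le> leb Z"
  proof -
    have fin: "leb {x \<in> Q. w x \<noteq> 0} \<le> leb Q" by (intro emeasure_mono) auto
    define a where "a = enn2real (leb {x \<in> Q. w x \<noteq> 0})"
    define b where "b = enn2real (leb Z)"
    have "leb Z \<le> leb Q" unfolding Z_def by (intro emeasure_mono) auto
    then have "leb Z < top" "leb {x \<in> Q. w x \<noteq> 0} < top" using vol fin by (auto intro: le_less_trans)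
    then have b: "leb Z = ennreal b" "b \<ge> 0" and a: "leb {x \<in> Q. w x \<noteq> 0} = ennreal a" "a \<ge> 0" by (auto simp: b_def a_def less_top)
    have "leb Q = leb ({x \<in> Q. w x \<noteq> 0} \<union> Z)" by (rule arg_cong[where f="leb"]) (auto simp: Z_def)
    also have "\<dots> = leb {x \<in> Q. w x \<noteq> 0} + leb Z" by (rule plus_emeasure[symmetric]) (auto simp: Z_def)
    finally have "(2 * r) ^ DIM('a) = a + b" using vol a b r by (simp flip: ennreal_plus)
    moreover have "2 * a \<le> (2 * r) ^ DIM('a)" using half[folded Q_def] vol a r by (simp add: ennreal_mult[symmetric] numeral_mult_ennreal)
    ultimately show ?thesis using b by (simp add: ennreal_leI)
  qed
  have "ennreal ((2 * r) ^ DIM('a) / 2) * X \<le> leb Z * X" by (intro mult_right_mono volZ) auto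
  also have "\<dots> = (NN x. X * indicator Z x)" by (simp add: nn_integral_cmult mult.commute)
  also have "\<dots> \<le> (NN x. (NN y. ennreal (\<bar>w x - w y\<bar> powr p) * indicator Q y) * indicator Q x)"
    by (intro nn_integral_mono) (auto simp: indicator_def Z_def X_def)
  also have "\<dots> \<le> ennreal (B * (4 * r) ^ DIM('a)) * Y"
    unfolding Q_def Y_def B_def by (rule Poincare_sob[OF w p r P])
  finally have le: "ennreal ((2 * r) ^ DIM('a) / 2) * X \<le> ennreal (B * (4 * r) ^ DIM('a)) * Y" .
  have c: "2 / (2 * r) ^ DIM('a) * (B * (4 * r) ^ DIM('a)) = 2 * B * 2 ^ DIM('a)"
  proof -
    have "(4 * r) ^ DIM('a) = (2 * (2 * r)) ^ DIM('a)" by simp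
    then have "(4 * r) ^ DIM('a) = 2 ^ DIM('a) * (2 * r) ^ DIM('a)" by (simp only: power_mult_distrib)
    moreover have "(2 * r) ^ DIM('a) \<noteq> 0" using r by simp
    ultimately show ?thesis by (simp add: field_simps)
  qed
  have "X = ennreal (2 / (2 * r) ^ DIM('a)) * (ennreal ((2 * r) ^ DIM('a) / 2) * X)" using r by (simp add: mult.assoc[symmetric] ennreal_mult[symmetric])
  also have "\<dots> \<le> ennreal (2 / (2 * r) ^ DIM('a)) * (ennreal (B * (4 * r) ^ DIM('a)) * Y)" by (intro mult_left_mono le) auto
  also have "\<dots> = ennreal (2 * B * 2 ^ DIM('a)) * Y"
  proof -
    have "B \<ge> 0" by (simp add: B_def)
    then have "ennreal (2 / (2 * r) ^ DIM('a)) * ennreal (B * (4 * r) ^ DIM('a)) = ennreal (2 / (2 * r) ^ DIM('a) * (B * (4 * r) ^ DIM('a)))"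
      using r by (intro ennreal_mult[symmetric]) auto
    then show ?thesis unfolding c by (simp only: mult.assoc[symmetric])
  qed
  finally show ?thesis by (simp add: X_def Y_def Q_def B_def)
qed

section \<open>Sobolev inequalities for weakly differentiable functions\<close>

lemma lborel_slice_Basis: "(lborel :: 'a::euclidean_space measure) = distr (PiM Basis (\<lambda>_. lborel)) borel (slice 0 Basis)"
  unfolding slice_def by (subst lborel_def) (simp add: lborel_eq_real[symmetric])

lemma nn_integral_slices:
  fixes F :: "'a::euclidean_space \<Rightarrow> ennreal"
  assumes [measurable]: "F \<in> Borel" and b: "b \<in> Basis"
  shows "(NN x. F x) = (NN t. \<integral>\<^sup>+y. F (slice (t *\<^sub>R b) (Basis - {b}) y) \<partial>PiM (Basis - {b}) (\<lambda>_. lborel))"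
proof -
  have ins: "Basis = insert b (Basis - {b})" using b by auto
  have sl: "slice 0 (insert b (Basis - {b})) (y(b := t)) = slice (t *\<^sub>R b) (Basis - {b}) y" for y t
    unfolding slice_def by (subst sum.insert) (auto intro!: sum.cong)
  have "(NN x. F x) = (\<integral>\<^sup>+y. F (slice 0 Basis y) \<partial>PiM Basis (\<lambda>_. lborel))"
    by (subst lborel_slice_Basis) (simp add: nn_integral_distr)
  also have "\<dots> = (\<integral>\<^sup>+y. F (slice 0 (insert b (Basis - {b})) y) \<partial>PiM (insert b (Basis - {b})) (\<lambda>_. lborel))" using ins by simp
  also have "\<dots> = (NN t. \<integral>\<^sup>+y. F (slice 0 (insert b (Basis - {b})) (y(b := t))) \<partial>PiM (Basis - {b}) (\<lambda>_. lborel))"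
  proof (rule lborel_product.product_nn_integral_insert_rev)
    show "(\<lambda>y. F (slice 0 (insert b (Basis - {b})) y)) \<in> borel_measurable (PiM (insert b (Basis - {b})) (\<lambda>_. lborel))" by measurable
  qed auto
  also have "\<dots> = (NN t. \<integral>\<^sup>+y. F (slice (t *\<^sub>R b) (Basis - {b}) y) \<partial>PiM (Basis - {b}) (\<lambda>_. lborel))" by (simp only: sl)
  finally show ?thesis .
qed

lemma epowr_abs_liminf:
  assumes "(\<lambda>j. X j) ----> (x::real)" "q > 0"
  shows "epowr (ennreal \<bar>x\<bar>) q \<le> liminf (\<lambda>j. epowr (ennreal \<bar>X j\<bar>) q)"
proof -
  have "(\<lambda>j. \<bar>X j\<bar> powr q) ----> \<bar>x\<bar> powr q" using assms by (intro tendsto_powr' tendsto_intros) auto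
  then have "(\<lambda>j. ennreal (\<bar>X j\<bar> powr q)) ----> ennreal (\<bar>x\<bar> powr q)" by (rule tendsto_ennrealI)
  from lim_imp_Liminf[OF _ this] show ?thesis using assms(2) by (simp add: epowr_ennreal)
qed

abbreviation slice_integral :: "'a::euclidean_space \<Rightarrow> ('a \<Rightarrow> ennreal) \<Rightarrow> real \<Rightarrow> ennreal" where
  "slice_integral b l t \<equiv> \<integral>\<^sup>+y. l (slice (t *\<^sub>R b) (Basis - {b}) y) \<partial>PiM (Basis - {b}) (\<lambda>_. lborel)"

text \<open>Slices are null sets, while \<open>w\<close> is determined only almost everywhere. The
  everywhere defined lower limit \<open>l\<close> of the approximants majorises |w|^q almost
  everywhere and obeys a Fatou bound at every height t; a second application of Fatou's lemma, in t,
  gives the integral bound.\<close>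

lemma mixed_sobolev:
  assumes pq: "admissible (DIM('a::euclidean_space) - 1) p q"
  obtains C where "C > 0" "\<And>(w :: 'a \<Rightarrow> real) g c R b. sob w g \<Longrightarrow> integrable lborel (\<lambda>x. norm (g x) powr p) \<Longrightarrow>
     zero_off (cube c R) w \<Longrightarrow> 0 < R \<Longrightarrow> b \<in> Basis \<Longrightarrow>
     \<exists>l\<in>Borel. (AE x in lborel. epowr (ennreal \<bar>w x\<bar>) q \<le> l x) \<and>
     (NN t. epowr (slice_integral b l t) (p / q))
     \<le> ennreal (C * R powr (real (DIM('a) - 1) * p / q - real (DIM('a) - 1) + p)) * (NN x. ennreal (norm (g x) powr p))"
proof -
  define m where "m = DIM('a) - 1"
  define s where "s = m * p / q - m + p"
  obtain C where C: "C > 0" "\<And>(w :: 'a \<Rightarrow> real) D c R I a. C1 w D \<Longrightarrow> zero_off (cube c R) w \<Longrightarrow> 0 < R \<Longrightarrow>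
     I \<subseteq> Basis \<Longrightarrow> card I = m \<Longrightarrow>
     epowr (\<integral>\<^sup>+y. epowr (ennreal \<bar>w (slice a I y)\<bar>) q \<partial>PiM I (\<lambda>_. lborel)) (p / q)
     \<le> ennreal (C * R powr s) * (\<integral>\<^sup>+y. epowr (ennreal (norm (D (slice a I y)))) p \<partial>PiM I (\<lambda>_. lborel))"
    using slice_sobolev[OF pq[folded m_def], where ?'a='a] unfolding s_def by metis
  have p: "1 \<le> p" "p < q" using pq by (auto simp: admissible_def)
  show ?thesis
  proof (rule that[of "C * 2 powr s"])
    show "C * 2 powr s > 0" using C(1) by simp
    fix w :: "'a \<Rightarrow> real" and g c and R :: real and b :: 'a
    assume w: "sob w g" "integrable lborel (\<lambda>x. norm (g x) powr p)" "zero_off (cube c R) w" and R: "0 < R" and b: "b \<in> Basis"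
    define I where "I = Basis - {b}"
    have I: "I \<subseteq> Basis" "card I = m" "finite I" using b by (auto simp: I_def m_def)
    have iU: "integrable lborel (\<lambda>x. indicator UNIV x * norm (g x) powr p)" using w(2) by simp
    obtain W G H where A: "\<And>j::nat. C1 (W j) (G j)" "AE x in lborel. (\<lambda>j. W j x) ----> w x"
      "L1_conv H (\<lambda>x. indicator UNIV x * norm (g x) powr p)" "\<And>j x. 0 \<le> H j x"
      "\<And>j x. cball x R \<subseteq> UNIV \<Longrightarrow> norm (G j x) powr p \<le> H j x"
      "\<And>j c R'. zero_off (cube c R') w \<Longrightarrow> zero_off (cube c (R' + R)) (W j)" by (rule sob_approx[OF w(1) p(1) iU R]) (rule that; assumption)
    note [measurable] = C1_measurable[OF A(1)] sob_measurable[OF w(1)]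
    define l where "l x = liminf (\<lambda>j. epowr (ennreal \<bar>W j x\<bar>) q)" for x
    have [measurable]: "l \<in> Borel" unfolding l_def by measurable
    \<comment> \<open>The mollification radius may be as large as \<open>R\<close>, so the support
      can grow to the cube of radius 2 R; this is the origin of the factor
      \<open>2 powr s\<close>.\<close>
    have v: "zero_off (cube c (2 * R)) (W j)" for j using A(6)[OF w(3), of j] by simp
    have AEl: "AE x in lborel. epowr (ennreal \<bar>w x\<bar>) q \<le> l x"
      by (rule AE_mp[OF A(2)], intro AE_I2 impI) (use p epowr_abs_liminf in \<open>auto simp: l_def\<close>)
    let ?N = "PiM I (\<lambda>_. lborel :: real measure)"
    let ?\<Phi> = "\<lambda>j t. epowr (\<integral>\<^sup>+y. epowr (ennreal \<bar>W j (slice (t *\<^sub>R b) I y)\<bar>) q \<partial>?N) (p / q)"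
    interpret N: sigma_finite_measure ?N by (rule lborel_product.sigma_finite) (rule I(3))
    have slm: "(\<lambda>(t, y). slice (t *\<^sub>R b) I y) \<in> (lborel :: real measure) \<Otimes>\<^sub>M ?N \<rightarrow>\<^sub>M borel"
      unfolding slice_def split_beta' using I(3) by measurable
    have slm': "(\<lambda>z. F (slice (fst z *\<^sub>R b) I (snd z))) \<in> borel_measurable ((lborel :: real measure) \<Otimes>\<^sub>M ?N)"
      if "F \<in> Borel" for F :: "'a \<Rightarrow> ennreal" using measurable_compose[OF slm that] by (simp add: split_beta')
    have \<Phi>m: "?\<Phi> j \<in> borel_measurable lborel" for j
    proof (rule measurable_epowr, rule N.borel_measurable_nn_integral)
      show "(\<lambda>(t, y). epowr (ennreal \<bar>W j (slice (t *\<^sub>R b) I y)\<bar>) q) \<in> borel_measurable (lborel \<Otimes>\<^sub>M ?N)"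
        using slm'[of "\<lambda>x. epowr (ennreal \<bar>W j x\<bar>) q"] by (simp add: split_beta')
    qed
    have ineq: "epowr (\<integral>\<^sup>+y. l (slice (t *\<^sub>R b) I y) \<partial>?N) (p / q) \<le> liminf (\<lambda>j. ?\<Phi> j t)" for t
    proof -
      have "(\<integral>\<^sup>+y. l (slice (t *\<^sub>R b) I y) \<partial>?N) \<le> liminf (\<lambda>j. \<integral>\<^sup>+y. epowr (ennreal \<bar>W j (slice (t *\<^sub>R b) I y)\<bar>) q \<partial>?N)"
        unfolding l_def by (rule nn_integral_liminf) (use I(3) in measurable)
      then have "epowr (\<integral>\<^sup>+y. l (slice (t *\<^sub>R b) I y) \<partial>?N) (p / q) \<le> epowr (liminf (\<lambda>j. \<integral>\<^sup>+y. epowr (ennreal \<bar>W j (slice (t *\<^sub>R b) I y)\<bar>) q \<partial>?N)) (p / q)"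
        using p by (intro epowr_mono) auto
      also have "\<dots> \<le> liminf (\<lambda>j. ?\<Phi> j t)" using p by (intro epowr_liminf_le) auto
      finally show ?thesis .
    qed
    have "(NN t. epowr (\<integral>\<^sup>+y. l (slice (t *\<^sub>R b) I y) \<partial>?N) (p / q)) \<le> (NN t. liminf (\<lambda>j. ?\<Phi> j t))"
      by (intro nn_integral_mono ineq)
    also have "\<dots> \<le> liminf (\<lambda>j. (NN t. ?\<Phi> j t))" by (rule nn_integral_liminf) (rule \<Phi>m)
    also have "\<dots> \<le> liminf (\<lambda>j. ennreal (C * (2 * R) powr s) * (NN x. ennreal (H j x) * indicator UNIV x))"
    proof (rule Liminf_mono, rule always_eventually, rule allI)
      fix j
      have "(NN t. ?\<Phi> j t) \<le> (NN t. ennreal (C * (2 * R) powr s) * (\<integral>\<^sup>+y. epowr (ennreal (norm (G j (slice (t *\<^sub>R b) I y)))) p \<partial>?N))"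
        using R by (intro nn_integral_mono C(2)[OF A(1) v _ I(1,2)]) auto
      also have "\<dots> = ennreal (C * (2 * R) powr s) * (NN t. (\<integral>\<^sup>+y. epowr (ennreal (norm (G j (slice (t *\<^sub>R b) I y)))) p \<partial>?N))"
      proof (rule nn_integral_cmult, rule N.borel_measurable_nn_integral)
        show "(\<lambda>(t, y). epowr (ennreal (norm (G j (slice (t *\<^sub>R b) I y)))) p) \<in> borel_measurable (lborel \<Otimes>\<^sub>M ?N)"
          using slm'[of "\<lambda>x. epowr (ennreal (norm (G j x))) p"] by (simp add: split_beta')
      qed
      also have "(NN t. (\<integral>\<^sup>+y. epowr (ennreal (norm (G j (slice (t *\<^sub>R b) I y)))) p \<partial>?N)) = (NN x. epowr (ennreal (norm (G j x))) p)"
        unfolding I_def by (rule nn_integral_slices[symmetric, OF _ b]) measurable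
      also have "\<dots> \<le> (NN x. ennreal (H j x) * indicator UNIV x)" using A(5) p by (intro nn_integral_mono) (auto simp: epowr_ennreal intro!: ennreal_leI)
      finally show "(NN t. ?\<Phi> j t) \<le> ennreal (C * (2 * R) powr s) * (NN x. ennreal (H j x) * indicator UNIV x)" by (simp add: mult_left_mono)
    qed
    also have "\<dots> = ennreal (C * (2 * R) powr s) * (NN x. ennreal (indicator UNIV x * norm (g x) powr p) * indicator UNIV x)"
      by (intro lim_imp_Liminf ennreal_tendsto_cmult L1_conv_nn_integral[OF A(3,4)]) auto
    finally have "(NN t. epowr (\<integral>\<^sup>+y. l (slice (t *\<^sub>R b) I y) \<partial>?N) (p / q))
        \<le> ennreal (C * 2 powr s * R powr s) * (NN x. ennreal (norm (g x) powr p))" using R by (simp add: powr_mult mult.assoc)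
    then show "\<exists>l\<in>Borel. (AE x in lborel. epowr (ennreal \<bar>w x\<bar>) q \<le> l x) \<and>
     (NN t. epowr (slice_integral b l t) (p / q))
     \<le> ennreal (C * 2 powr s * R powr (real (DIM('a) - 1) * p / q - real (DIM('a) - 1) + p)) * (NN x. ennreal (norm (g x) powr p))"
      using AEl by (intro bexI[of _ l]) (auto simp: I_def s_def m_def)
  qed
qed

text \<open>The full-dimensional inequality for p = 1, from the slice version with all basis
  directions. It later yields the gain in measure between two levels.\<close>

lemma GNS_sob:
  fixes w :: "'a::euclidean_space \<Rightarrow> real"
  assumes w: "sob w g" "zero_off (cube c R) w" and n: "DIM('a) \<ge> 2"
  shows "(NN x. epowr (ennreal \<bar>w x\<bar>) (DIM('a) / (DIM('a) - 1))) \<le> epowr (NN x. ennreal (norm (g x))) (DIM('a) / (DIM('a) - 1))"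
proof -
  define a where "a = real DIM('a) / (real DIM('a) - 1)"
  have a: "a > 0" using n by (simp add: a_def)
  have ig: "integrable lborel (\<lambda>x. indicator UNIV x * norm (g x) powr 1)" using sobD(2)[OF w(1)] by simp
  obtain W G H where A: "\<And>j::nat. C1 (W j) (G j)" "AE x in lborel. (\<lambda>j. W j x) ----> w x"
      "L1_conv H (\<lambda>x. indicator UNIV x * norm (g x) powr 1)" "\<And>j x. 0 \<le> H j x"
      "\<And>j x. cball x 1 \<subseteq> UNIV \<Longrightarrow> norm (G j x) powr 1 \<le> H j x"
      "\<And>j c R'. zero_off (cube c R') w \<Longrightarrow> zero_off (cube c (R' + 1)) (W j)"
    by (rule sob_approx[OF w(1) order_refl ig zero_less_one]) (rule that; assumption)
  note [measurable] = C1_measurable[OF A(1)] sob_measurable[OF w(1)]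
  have slint: "(NN x. F x) = (\<integral>\<^sup>+y. F (slice 0 Basis y) \<partial>PiM Basis (\<lambda>_. lborel))" if "F \<in> Borel" for F :: "'a \<Rightarrow> ennreal"
    using that by (subst lborel_slice_Basis) (simp add: nn_integral_distr)
  have one: "(NN x. epowr (ennreal \<bar>W j x\<bar>) a) \<le> epowr (NN x. ennreal (H j x) * indicator UNIV x) a" for j
  proof -
    have "(NN x. epowr (ennreal \<bar>W j x\<bar>) a) \<le> epowr (NN x. ennreal (norm (G j x))) a"
      using GNS_slice[OF A(1) compact_cube A(6)[OF w(2)] order_refl n, of j 0] by (simp add: slint a_def)
    also have "\<dots> \<le> epowr (NN x. ennreal (H j x) * indicator UNIV x) a" using A(5) a by (intro epowr_mono nn_integral_mono) (auto intro!: ennreal_leI)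
    finally show ?thesis .
  qed
  have lim: "(\<lambda>j. (NN x. ennreal (H j x) * indicator UNIV x)) ----> (NN x. ennreal (norm (g x)))" using L1_conv_nn_integral[OF A(3,4), of UNIV] by simp
  have "(NN x. epowr (ennreal \<bar>w x\<bar>) a) \<le> (NN x. liminf (\<lambda>j. epowr (ennreal \<bar>W j x\<bar>) a))"
    by (rule nn_integral_mono_AE, rule AE_mp[OF A(2)], intro AE_I2 impI epowr_abs_liminf a)
  also have "\<dots> \<le> liminf (\<lambda>j. (NN x. epowr (ennreal \<bar>W j x\<bar>) a))" by (rule nn_integral_liminf) measurable
  finally have "epowr (NN x. epowr (ennreal \<bar>w x\<bar>) a) (1 / a) \<le> epowr (liminf (\<lambda>j. (NN x. epowr (ennreal \<bar>W j x\<bar>) a))) (1 / a)"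
    using a by (intro epowr_mono) auto
  also have "\<dots> \<le> liminf (\<lambda>j. epowr (NN x. epowr (ennreal \<bar>W j x\<bar>) a) (1 / a))" using a by (intro epowr_liminf_le) auto
  also have "\<dots> \<le> liminf (\<lambda>j. (NN x. ennreal (H j x) * indicator UNIV x))"
    using one a by (intro Liminf_mono always_eventually allI) (simp add: epowr_le_iff)
  also have "\<dots> = (NN x. ennreal (norm (g x)))" by (rule lim_imp_Liminf[OF _ lim]) simp
  finally show ?thesis using a n by (simp add: epowr_le_iff a_def of_nat_diff)
qed

section \<open>Multipliers of weakly differentiable functions\<close>

text \<open>A class of factors that satisfy the product rule. It contains the cut-off functions needed below,
  which are Lipschitz but not \<open>C\<^sup>1\<close>, and avoids Rademacher's theorem.\<close>
definition multiplier :: "('a::euclidean_space \<Rightarrow> real) \<Rightarrow> ('a \<Rightarrow> 'a) \<Rightarrow> bool" where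
  "multiplier \<eta> E \<longleftrightarrow> \<eta> \<in> Borel \<and> E \<in> Borel \<and>
     (\<exists>B. \<forall>x. \<bar>\<eta> x\<bar> \<le> B \<and> norm (E x) \<le> B) \<and>
     (\<forall>w g. sob w g \<longrightarrow> sob (\<lambda>x. \<eta> x * w x) (\<lambda>x. \<eta> x *\<^sub>R g x + w x *\<^sub>R E x))"

lemma multiplier_sob: "multiplier \<eta> E \<Longrightarrow> sob w g \<Longrightarrow> sob (\<lambda>x. \<eta> x * w x) (\<lambda>x. \<eta> x *\<^sub>R g x + w x *\<^sub>R E x)"
  by (simp add: multiplier_def)

lemma multiplier_measurable:
  assumes "multiplier \<eta> E" shows "\<eta> \<in> Borel" "E \<in> Borel" using assms by (auto simp: multiplier_def)

lemma multiplier_C1: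
  assumes "C1 \<eta> E" "\<And>x. \<bar>\<eta> x\<bar> \<le> B" "\<And>x. norm (E x) \<le> B"
  shows "multiplier \<eta> E" using assms C1_measurable[OF assms(1)] sob_mult_C1[OF _ assms] by (auto simp: multiplier_def)

lemma multiplier_limit:
  assumes m: "\<And>j. multiplier (\<eta> j) (E j)" and B: "\<And>j x. \<bar>\<eta> j x\<bar> \<le> B" "\<And>j x. norm (E j x) \<le> B"
    and l: "\<And>x. (\<lambda>j. \<eta> j x) ----> H x" "\<And>x. (\<lambda>j. E j x) ----> G x"
  shows "multiplier H G"
  unfolding multiplier_def
proof (intro conjI allI impI)
  have [measurable]: "\<eta> j \<in> Borel" "E j \<in> Borel" for j using m by (auto simp: multiplier_def)
  show Hm[measurable]: "H \<in> Borel" by (rule borel_measurable_LIMSEQ_metric[where f=\<eta>]) (use l in auto)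
  show Gm[measurable]: "G \<in> Borel" by (rule borel_measurable_LIMSEQ_metric[where f=E]) (use l in auto)
  have "\<bar>H x\<bar> \<le> B" for x by (rule LIMSEQ_le_const2[OF tendsto_rabs[OF l(1)]]) (use B in auto)
  moreover have "norm (G x) \<le> B" for x by (rule LIMSEQ_le_const2[OF tendsto_norm[OF l(2)]]) (use B in auto)
  ultimately show "\<exists>B. \<forall>x. \<bar>H x\<bar> \<le> B \<and> norm (G x) \<le> B" by blast
  fix w :: "'a \<Rightarrow> real" and g assume w: "sob w g"
  note [measurable] = sob_measurable[OF w]
  note i = sobD(1,2)[OF w]
  have "B \<ge> 0" using B(1) abs_ge_zero order_trans by blast
  show "sob (\<lambda>x. H x * w x) (\<lambda>x. H x *\<^sub>R g x + w x *\<^sub>R G x)"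
  proof (rule sob_limit'[OF multiplier_sob[OF m w]])
    show "L1_conv (\<lambda>j x. \<eta> j x * w x) (\<lambda>x. H x * w x)"
    proof (rule L1_conv_dominated[of "\<lambda>x. B * \<bar>w x\<bar>"])
      show "AE x in lborel. norm (\<eta> j x * w x) \<le> B * \<bar>w x\<bar>" for j using B by (auto simp: abs_mult intro!: mult_right_mono)
    qed (use i l in \<open>auto intro!: tendsto_intros\<close>)
    show "L1_conv (\<lambda>j x. \<eta> j x *\<^sub>R g x + w x *\<^sub>R E j x) (\<lambda>x. H x *\<^sub>R g x + w x *\<^sub>R G x)"
    proof (rule L1_conv_dominated[of "\<lambda>x. B * norm (g x) + B * \<bar>w x\<bar>"])
      show "AE x in lborel. norm (\<eta> j x *\<^sub>R g x + w x *\<^sub>R E j x) \<le> B * norm (g x) + B * \<bar>w x\<bar>" for j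
      proof (rule AE_I2)
        fix x
        have "norm (\<eta> j x *\<^sub>R g x + w x *\<^sub>R E j x) \<le> \<bar>\<eta> j x\<bar> * norm (g x) + \<bar>w x\<bar> * norm (E j x)"
          by (metis norm_scaleR norm_triangle_ineq)
        also have "\<dots> \<le> B * norm (g x) + \<bar>w x\<bar> * B" using B by (intro add_mono mult_right_mono mult_left_mono) auto
        finally show "norm (\<eta> j x *\<^sub>R g x + w x *\<^sub>R E j x) \<le> B * norm (g x) + B * \<bar>w x\<bar>" by (simp add: mult.commute)
      qed
    qed (use i l in \<open>auto intro!: tendsto_intros\<close>)
  qed
qed

lemma multiplier_const: "multiplier (\<lambda>x. c) (\<lambda>x. 0)" by (rule multiplier_C1[OF C1_const, of _ "\<bar>c\<bar>"]) auto

lemma multiplier_mult: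
  assumes "multiplier \<eta> E" "multiplier \<theta> F"
  shows "multiplier (\<lambda>x. \<eta> x * \<theta> x) (\<lambda>x. \<eta> x *\<^sub>R F x + \<theta> x *\<^sub>R E x)"
  unfolding multiplier_def
proof (intro conjI allI impI)
  note [measurable] = multiplier_measurable[OF assms(1)] multiplier_measurable[OF assms(2)]
  show "(\<lambda>x. \<eta> x * \<theta> x) \<in> Borel" "(\<lambda>x. \<eta> x *\<^sub>R F x + \<theta> x *\<^sub>R E x) \<in> Borel" by measurable
  obtain A where A: "\<And>x. \<bar>\<eta> x\<bar> \<le> A" "\<And>x. norm (E x) \<le> A" using assms(1) by (auto simp: multiplier_def)
  obtain B where B: "\<And>x. \<bar>\<theta> x\<bar> \<le> B" "\<And>x. norm (F x) \<le> B" using assms(2) by (auto simp: multiplier_def)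
  have AB: "A \<ge> 0" "B \<ge> 0" using A(1) B(1) abs_ge_zero order_trans by blast+
  have "\<bar>\<eta> x * \<theta> x\<bar> \<le> A * B + B * A" for x
  proof -
    have "\<bar>\<eta> x * \<theta> x\<bar> \<le> A * B" using mult_mono[OF A(1)[of x] B(1)[of x]] AB by (simp add: abs_mult)
    moreover have "0 \<le> B * A" using AB by simp
    ultimately show ?thesis by linarith
  qed
  moreover have "norm (\<eta> x *\<^sub>R F x + \<theta> x *\<^sub>R E x) \<le> A * B + B * A" for x
  proof -
    have "norm (\<eta> x *\<^sub>R F x + \<theta> x *\<^sub>R E x) \<le> \<bar>\<eta> x\<bar> * norm (F x) + \<bar>\<theta> x\<bar> * norm (E x)"
      by (metis norm_scaleR norm_triangle_ineq)
    also have "\<dots> \<le> A * B + B * A" using A B AB by (intro add_mono mult_mono) auto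
    finally show ?thesis .
  qed
  ultimately show "\<exists>B. \<forall>x. \<bar>\<eta> x * \<theta> x\<bar> \<le> B \<and> norm (\<eta> x *\<^sub>R F x + \<theta> x *\<^sub>R E x) \<le> B" by blast
  fix w :: "'a \<Rightarrow> real" and g assume w: "sob w g"
  from multiplier_sob[OF assms(1) multiplier_sob[OF assms(2) w]]
  show "sob (\<lambda>x. \<eta> x * \<theta> x * w x) (\<lambda>x. (\<eta> x * \<theta> x) *\<^sub>R g x + w x *\<^sub>R (\<eta> x *\<^sub>R F x + \<theta> x *\<^sub>R E x))"
    by (simp add: algebra_simps)
qed

lemma multiplier_add:
  assumes "multiplier \<eta> E" "multiplier \<theta> F"
  shows "multiplier (\<lambda>x. \<eta> x + \<theta> x) (\<lambda>x. E x + F x)"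
  unfolding multiplier_def
proof (intro conjI allI impI)
  note [measurable] = multiplier_measurable[OF assms(1)] multiplier_measurable[OF assms(2)]
  show "(\<lambda>x. \<eta> x + \<theta> x) \<in> Borel" "(\<lambda>x. E x + F x) \<in> Borel" by measurable
  obtain A where A: "\<And>x. \<bar>\<eta> x\<bar> \<le> A" "\<And>x. norm (E x) \<le> A" using assms(1) by (auto simp: multiplier_def)
  obtain B where B: "\<And>x. \<bar>\<theta> x\<bar> \<le> B" "\<And>x. norm (F x) \<le> B" using assms(2) by (auto simp: multiplier_def)
  have "\<bar>\<eta> x + \<theta> x\<bar> \<le> A + B \<and> norm (E x + F x) \<le> A + B" for x using A[of x] B[of x] by (auto intro: norm_triangle_le)
  then show "\<exists>B. \<forall>x. \<bar>\<eta> x + \<theta> x\<bar> \<le> B \<and> norm (E x + F x) \<le> B" by blast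
  fix w :: "'a \<Rightarrow> real" and g assume w: "sob w g"
  from sob_add[OF multiplier_sob[OF assms(1) w] multiplier_sob[OF assms(2) w]]
  show "sob (\<lambda>x. (\<eta> x + \<theta> x) * w x) (\<lambda>x. (\<eta> x + \<theta> x) *\<^sub>R g x + w x *\<^sub>R (E x + F x))" by (simp add: algebra_simps)
qed

lemma multiplier_cmult: "multiplier \<eta> E \<Longrightarrow> multiplier (\<lambda>x. c * \<eta> x) (\<lambda>x. c *\<^sub>R E x)"
  using multiplier_mult[OF multiplier_const[of c]] by fastforce

lemma multiplier_diff:
  "multiplier \<eta> E \<Longrightarrow> multiplier \<theta> F \<Longrightarrow> multiplier (\<lambda>x. \<eta> x - \<theta> x) (\<lambda>x. E x - F x)"
  using multiplier_add[OF _ multiplier_cmult[of \<theta> F "-1"]] by fastforce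

lemma multiplier_sum:
  "finite I \<Longrightarrow> (\<And>i. i \<in> I \<Longrightarrow> multiplier (\<eta> i) (E i)) \<Longrightarrow> multiplier (\<lambda>x. \<Sum>i\<in>I. \<eta> i x) (\<lambda>x. \<Sum>i\<in>I. E i x)"
  by (induction I rule: finite_induct) (auto intro: multiplier_const multiplier_add)

lemma multiplier_prod:
  assumes "finite I" "\<And>i. i \<in> I \<Longrightarrow> multiplier (\<eta> i) (E i)"
  shows "multiplier (\<lambda>x. \<Prod>i\<in>I. \<eta> i x) (\<lambda>x. \<Sum>i\<in>I. (\<Prod>j\<in>I - {i}. \<eta> j x) *\<^sub>R E i x)"
  using assms
proof (induction I rule: finite_induct)
  case empty then show ?case using multiplier_const[of 1] by simp
next
  case (insert a I)
  have "(\<Sum>i\<in>insert a I. (\<Prod>j\<in>insert a I - {i}. \<eta> j x) *\<^sub>R E i x)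
     = \<eta> a x *\<^sub>R (\<Sum>i\<in>I. (\<Prod>j\<in>I - {i}. \<eta> j x) *\<^sub>R E i x) + (\<Prod>i\<in>I. \<eta> i x) *\<^sub>R E a x" for x
  proof -
    have "(\<Prod>j\<in>insert a I - {i}. \<eta> j x) = \<eta> a x * (\<Prod>j\<in>I - {i}. \<eta> j x)" if "i \<in> I" for i
    proof -
      have "insert a I - {i} = insert a (I - {i})" using insert that by auto
      then show ?thesis using insert by simp
    qed
    moreover have "insert a I - {a} = I" using insert by auto
    ultimately show ?thesis using insert by (simp add: scaleR_sum_right)
  qed
  moreover have "multiplier (\<lambda>x. \<eta> a x * (\<Prod>i\<in>I. \<eta> i x))
      (\<lambda>x. \<eta> a x *\<^sub>R (\<Sum>i\<in>I. (\<Prod>j\<in>I - {i}. \<eta> j x) *\<^sub>R E i x) + (\<Prod>i\<in>I. \<eta> i x) *\<^sub>R E a x)"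
    by (rule multiplier_mult) (use insert in auto)
  ultimately show ?case by (simp only: prod.insert[OF insert.hyps])
qed

lemma antiderivative_continuous_UNIV:
  fixes h :: "real \<Rightarrow> real"
  assumes "continuous_on UNIV h"
  obtains F where "\<And>t. (F has_real_derivative h t) (at t)"
proof -
  define F where "F t = (LBINT y=ereal 0..ereal t. h y)" for t
  have "(F has_real_derivative h t) (at t)" for t
  proof -
    define a where "a = min 0 t - 1"
    define b where "b = max 0 t + 1"
    have "((\<lambda>u. LBINT y=ereal 0..ereal u. h y) has_vector_derivative h t) (at t within {a..b})"
      by (rule interval_integral_FTC2) (use assms continuous_on_subset in \<open>auto simp: a_def b_def\<close>)
    moreover have "at t within {a..b} = at t" by (rule at_within_interior) (auto simp: a_def b_def)
    ultimately show ?thesis by (simp add: F_def[abs_def] has_real_derivative_iff_has_vector_derivative)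
  qed
  then show ?thesis using that by blast
qed

text \<open>The function grows with slope 1 exactly at the heights in \<open>T\<close>. The
  indicator of the closed set \<open>T\<close> is a pointwise limit of continuous functions, whose
  primitives give C^1 multipliers, and \<open>multiplier_limit\<close> applies.\<close>

lemma multiplier_cumulative:
  fixes b :: "'a::euclidean_space"
  assumes T: "compact T" and b: "b \<in> Basis"
  shows "multiplier (\<lambda>x. measure lborel (T \<inter> {..x \<bullet> b})) (\<lambda>x. indicator T (x \<bullet> b) *\<^sub>R b)"
proof (cases "T = {}")
  case True then show ?thesis using multiplier_const[of 0] by simp
next
  case ne: False
  have cT: "closed T" using T by (rule compact_imp_closed)
  have [measurable]: "T \<in> sets borel" using cT by auto
  obtain R where R: "R > 0" "\<And>t. t \<in> T \<Longrightarrow> \<bar>t\<bar> \<le> R" using compact_imp_bounded[OF T] by (auto simp: bounded_pos)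
  \<comment> \<open>Continuous functions that are 1 on \<open>T\<close> and vanish at distance 1/(j
    + 1) from it; closedness of \<open>T\<close> makes them tend to 0 at every other point.\<close>
  define h where "h j s = max 0 (1 - (real j + 1) * infdist s T)" for j s
  have hc: "continuous_on UNIV (h j)" for j
    unfolding h_def by (intro continuous_intros continuous_on_infdist)
  have [measurable]: "h j \<in> Borel" for j using hc by (auto intro: borel_measurable_continuous_onI)
  have h01: "0 \<le> h j s" "h j s \<le> 1" for j s by (auto simp: h_def infdist_nonneg)
  have h0: "h j s = 0" if "\<bar>s\<bar> > R + 1" for j s
  proof -
    obtain t where t: "t \<in> T" "infdist s T = dist s t" using infdist_attains_inf[OF cT ne] by blast
    then have "dist s t > 1" using R(2)[of t] that by (auto simp: dist_real_def)
    then have "1 * 1 \<le> (real j + 1) * infdist s T" using t by (intro mult_mono) auto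
    then show ?thesis by (simp add: h_def)
  qed
  have hl: "(\<lambda>j. h j s) ----> indicator T s" for s
  proof (cases "s \<in> T")
    case True then show ?thesis by (simp add: h_def)
  next
    case False
    then have pos: "infdist s T > 0" using in_closed_iff_infdist_zero[OF cT ne] infdist_nonneg[of s T] by (metis less_eq_real_def)
    obtain N :: nat where N: "1 / infdist s T < real N" using reals_Archimedean2 by blast
    have "h j s = 0" if "j \<ge> N" for j
    proof -
      have "1 / infdist s T \<le> real j + 1" using N that by linarith
      then have "1 \<le> (real j + 1) * infdist s T" using pos by (simp add: field_simps)
      then show ?thesis by (simp add: h_def)
    qed
    then have "\<forall>\<^sub>F j in sequentially. h j s = indicator T s" using False by (auto simp: eventually_sequentially)
    then show ?thesis by (rule tendsto_eventually)
  qed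
  \<comment> \<open>Every \<open>h j\<close> vanishes at and below this height, which serves as the
    common base point of the primitives.\<close>
  define a where "a = - R - 2"
  have hdom: "norm (indicator {..t} s * h j s) \<le> indicator {a..R+1} s" for t s j using h01[of j s] by (auto simp: h0 indicator_def a_def)
  have idom: "integrable lborel (indicator {a..R+1} :: real \<Rightarrow> real)" by (rule integrable_real_indicator) (auto simp: emeasure_lborel_Icc_eq)
  define \<eta> where "\<eta> j t = (LINT s|lborel. indicator {..t} s * h j s)" for j and t :: real
  have int: "integrable lborel (\<lambda>s. indicator {..t} s * h j s)" for t j
    by (rule Bochner_Integration.integrable_bound[OF idom]) (use hdom in \<open>auto intro!: AE_I2\<close>)
  have d\<eta>: "(\<eta> j has_real_derivative h j t) (at t)" for j t
  proof -
    obtain F where F: "\<And>t. (F has_real_derivative h j t) (at t)" using antiderivative_continuous_UNIV[OF hc] by blast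
    have Fv: "(F has_vector_derivative h j t) (at t within S)" for t S
      using F by (simp add: has_real_derivative_iff_has_vector_derivative has_vector_derivative_at_within)
    have "\<eta> j t = F t - F a" for t
    proof (cases "a \<le> t")
      case True
      have "(LINT s|lborel. indicator {a..t} s *\<^sub>R h j s) = F t - F a" by (rule integral_FTC_Icc[OF True]) (use Fv continuous_on_subset[OF hc] in auto)
      moreover have "(\<lambda>s. indicator {..t} s * h j s) = (\<lambda>s. indicator {a..t} s *\<^sub>R h j s)"
      proof
        fix s
        show "indicator {..t} s * h j s = indicator {a..t} s *\<^sub>R h j s" using h0[of s j] R(1) by (cases "a \<le> s") (auto simp: indicator_def a_def)
      qed
      ultimately show ?thesis unfolding \<eta>_def by simp
    next
      case False
      then have le: "t \<le> a" by simp
      have "(LINT s|lborel. indicator {t..a} s *\<^sub>R h j s) = F a - F t" by (rule integral_FTC_Icc[OF le]) (use Fv continuous_on_subset[OF hc] in auto)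
      moreover have "(\<lambda>s. indicator {t..a} s *\<^sub>R h j s) = (\<lambda>s. 0)" using h0[of _ j] R(1) by (auto simp: indicator_def a_def)
      moreover have "(\<lambda>s. indicator {..t} s * h j s) = (\<lambda>s. 0)" using h0[of _ j] R(1) le by (auto simp: indicator_def a_def)
      ultimately show ?thesis unfolding \<eta>_def by (simp only: Bochner_Integration.integral_zero)
    qed
    then have "\<eta> j = (\<lambda>t. F t - F a)" by auto
    then show ?thesis using DERIV_diff[OF F DERIV_const[of "F a"], of t] by simp
  qed
  have \<eta>b: "\<bar>\<eta> j t\<bar> \<le> 2 * R + 3" for j t
  proof -
    have "norm (\<eta> j t) \<le> (LINT s|lborel. indicator {a..R+1} s)"
      unfolding \<eta>_def by (rule Bochner_Integration.integral_norm_bound_integral[OF int idom hdom])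
    also have "\<dots> = 2 * R + 3" using R by (simp add: a_def)
    finally show ?thesis by simp
  qed
  have \<eta>l: "(\<lambda>j. \<eta> j t) ----> measure lborel (T \<inter> {..t})" for t
  proof -
    have "(\<lambda>j. \<eta> j t) ----> (LINT s|lborel. indicator {..t} s * indicator T s)"
      unfolding \<eta>_def by (rule integral_dominated_convergence[OF _ _ idom]) (use hl hdom in \<open>auto intro!: tendsto_intros AE_I2\<close>)
    also have "(LINT s|lborel. indicator {..t} s * indicator T s) = measure lborel (T \<inter> {..t})" by (simp add: indicator_inter_arith[symmetric] Int_commute)
    finally show ?thesis .
  qed
  show ?thesis
  proof (rule multiplier_limit[of "\<lambda>j x. \<eta> j (x \<bullet> b)" "\<lambda>j x. h j (x \<bullet> b) *\<^sub>R b" "2 * R + 3"])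
    have nb: "norm (h j t *\<^sub>R b) \<le> 2 * R + 3" for j t using h01[of j t] b R(1) by simp
    show "multiplier (\<lambda>x. \<eta> j (x \<bullet> b)) (\<lambda>x. h j (x \<bullet> b) *\<^sub>R b)" for j
      by (rule multiplier_C1[OF C1_compose[OF C1_inner d\<eta> hc] \<eta>b nb])
    show "norm (h j (x \<bullet> b) *\<^sub>R b) \<le> 2 * R + 3" for j x by (rule nb)
  qed (use \<eta>b \<eta>l hl in \<open>auto intro!: tendsto_intros\<close>)
qed

section \<open>Cut-off functions adapted to a given function\<close>

text \<open>The supports of the two slopes of a one-dimensional cut-off. A quarter of the length is
  what \<open>good_set\<close> retains: half may be lost to bad heights and a further quarter to
  compactness.\<close>

definition good_pair :: "real \<Rightarrow> real \<Rightarrow> real \<Rightarrow> real set \<Rightarrow> real set \<Rightarrow> bool" where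
  "good_pair c \<rho> \<sigma> T U \<longleftrightarrow> compact T \<and> compact U \<and> T \<subseteq> {c - \<sigma><..<c - \<rho>} \<and> U \<subseteq> {c + \<rho><..<c + \<sigma>} \<and>
     (\<sigma> - \<rho>) / 4 \<le> measure lborel T \<and> (\<sigma> - \<rho>) / 4 \<le> measure lborel U"

text \<open>The first quotient climbs from 0 to 1 across \<open>T\<close>, left of the inner
  interval, and the second does so across \<open>U\<close>, right of it; their difference is a
  plateau.\<close>

lemma cutoff_1d:
  assumes gp: "good_pair c \<rho> \<sigma> T U" and r: "0 < \<rho>" "\<rho> < \<sigma>"
  defines "\<eta> \<equiv> \<lambda>t. measure lborel (T \<inter> {..t}) / measure lborel T - measure lborel (U \<inter> {..t}) / measure lborel U"
  shows "0 \<le> \<eta> t" "\<eta> t \<le> 1" "\<bar>t - c\<bar> \<le> \<rho> \<Longrightarrow> \<eta> t = 1" "\<sigma> \<le> \<bar>t - c\<bar> \<Longrightarrow> \<eta> t = 0"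
proof -
  have T: "compact T" "compact U" "T \<subseteq> {c - \<sigma><..<c - \<rho>}" "U \<subseteq> {c + \<rho><..<c + \<sigma>}"
    and m: "measure lborel T > 0" "measure lborel U > 0" using gp r by (auto simp: good_pair_def)
  have T': "\<And>x. x \<in> T \<Longrightarrow> c - \<sigma> < x \<and> x < c - \<rho>" "\<And>x. x \<in> U \<Longrightarrow> c + \<rho> < x \<and> x < c + \<sigma>"
    using T(3,4) by auto
  have fin: "leb S \<noteq> top" "S \<in> sets lborel" if "compact S" for S :: "real set"
    using emeasure_compact_finite[OF that] that by (auto simp: less_top compact_imp_closed)
  have le: "measure lborel (S \<inter> {..t}) \<le> measure lborel S" if "compact S" for S :: "real set"
    using fin[OF that] by (intro measure_mono_fmeasurable) (auto simp: fmeasurable_def less_top)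
  have q: "0 \<le> measure lborel (S \<inter> {..t}) / measure lborel S" "measure lborel (S \<inter> {..t}) / measure lborel S \<le> 1"
    if "compact S" "measure lborel S > 0" for S :: "real set" using le[OF that(1)] that(2) by auto
  have lo: "measure lborel (U \<inter> {..t}) / measure lborel U = 0" if "t \<le> c + \<rho>"
  proof -
    have "U \<inter> {..t} = {}" using T'(2) that by force
    then show ?thesis by simp
  qed
  have hi: "measure lborel (T \<inter> {..t}) / measure lborel T = 1" if "t \<ge> c - \<rho>"
  proof -
    have "T \<inter> {..t} = T" using T'(1) that by force
    then show ?thesis using m by simp
  qed
  have lo2: "measure lborel (T \<inter> {..t}) / measure lborel T = 0" if "t \<le> c - \<sigma>"
  proof -
    have "T \<inter> {..t} = {}" using T'(1) that by force
    then show ?thesis by simp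
  qed
  have hi2: "measure lborel (U \<inter> {..t}) / measure lborel U = 1" if "t \<ge> c + \<sigma>"
  proof -
    have "U \<inter> {..t} = U" using T'(2) that by force
    then show ?thesis using m by simp
  qed
  have "0 \<le> \<eta> t \<and> \<eta> t \<le> 1"
  proof (cases "t \<le> c + \<rho>")
    case True
    then show ?thesis using q[OF T(1) m(1)] unfolding \<eta>_def lo[OF True] by simp
  next
    case False
    then have ge: "t \<ge> c - \<rho>" using r by simp
    show ?thesis using q[OF T(2) m(2)] unfolding \<eta>_def hi[OF ge] by simp
  qed
  then show "0 \<le> \<eta> t" "\<eta> t \<le> 1" by auto
  show "\<eta> t = 1" if "\<bar>t - c\<bar> \<le> \<rho>"
  proof -
    have ge: "t \<le> c + \<rho>" "t \<ge> c - \<rho>" using that by auto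
    show ?thesis unfolding \<eta>_def lo[OF ge(1)] hi[OF ge(2)] by simp
  qed
  show "\<eta> t = 0" if "\<sigma> \<le> \<bar>t - c\<bar>"
  proof (cases "t \<ge> c")
    case True
    then have ge: "t \<ge> c + \<sigma>" "t \<ge> c - \<rho>" using that r by auto
    show ?thesis unfolding \<eta>_def hi[OF ge(2)] hi2[OF ge(1)] by simp
  next
    case False
    then have ge: "t \<le> c - \<sigma>" "t \<le> c + \<rho>" using that r by auto
    show ?thesis unfolding \<eta>_def lo[OF ge(2)] lo2[OF ge(1)] by simp
  qed
qed

text \<open>A weak gradient is determined only up to null sets, so its vanishing outside the cube is
  demanded pointwise.\<close>

definition cutoff :: "'a::euclidean_space \<Rightarrow> real \<Rightarrow> real \<Rightarrow> ('a \<Rightarrow> real) \<Rightarrow> ('a \<Rightarrow> 'a) \<Rightarrow> bool" where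
  "cutoff c \<rho> \<sigma> \<eta> E \<longleftrightarrow> multiplier \<eta> E \<and> (\<forall>x. 0 \<le> \<eta> x) \<and> (\<forall>x. \<eta> x \<le> 1) \<and> (\<forall>x\<in>cube c \<rho>. \<eta> x = 1) \<and>
     zero_off (cube c \<sigma>) \<eta> \<and> zero_off (cube c \<sigma>) E"

lemma cutoffD:
  assumes "cutoff c \<rho> \<sigma> \<eta> E"
  shows "multiplier \<eta> E" "0 \<le> \<eta> x" "\<eta> x \<le> 1" "x \<in> cube c \<rho> \<Longrightarrow> \<eta> x = 1" "zero_off (cube c \<sigma>) \<eta>" "zero_off (cube c \<sigma>) E"
  using assms by (auto simp: cutoff_def)

text \<open>In each term of the product rule the undifferentiated factors lie in [0, 1], so the
  gradient is bounded by the sum of the one-dimensional slopes.\<close>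

lemma product_cutoff:
  fixes c :: "'a::euclidean_space"
  assumes gp: "\<And>b. b \<in> Basis \<Longrightarrow> good_pair (c \<bullet> b) \<rho> \<sigma> (T b) (U b)" and r: "0 < \<rho>" "\<rho> < \<sigma>"
  obtains \<eta> E where "cutoff c \<rho> \<sigma> \<eta> E" "\<And>x. norm (E x) \<le> (\<Sum>b\<in>Basis. 4 / (\<sigma> - \<rho>) * indicator (T b \<union> U b) (x \<bullet> b))"
proof -
  define \<theta> where "\<theta> b t = measure lborel (T b \<inter> {..t}) / measure lborel (T b) - measure lborel (U b \<inter> {..t}) / measure lborel (U b)" for b t
  define e where "e b t = indicator (T b) t / measure lborel (T b) - indicator (U b) t / measure lborel (U b)" for b and t :: real
  have \<theta>: "0 \<le> \<theta> b t" "\<theta> b t \<le> 1" "\<bar>t - c \<bullet> b\<bar> \<le> \<rho> \<Longrightarrow> \<theta> b t = 1" "\<sigma> \<le> \<bar>t - c \<bullet> b\<bar> \<Longrightarrow> \<theta> b t = 0" if "b \<in> Basis" for b t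
    unfolding \<theta>_def by (rule cutoff_1d[OF gp[OF that] r]; assumption)+
  have m: "multiplier (\<lambda>x. \<theta> b (x \<bullet> b)) (\<lambda>x. e b (x \<bullet> b) *\<^sub>R b)" if b: "b \<in> Basis" for b
  proof -
    have "compact (T b)" "compact (U b)" using gp[OF b] by (auto simp: good_pair_def)
    from multiplier_diff[OF multiplier_cmult[OF multiplier_cumulative[OF this(1) b], of "1 / measure lborel (T b)"]
        multiplier_cmult[OF multiplier_cumulative[OF this(2) b], of "1 / measure lborel (U b)"]]
    show ?thesis by (simp add: \<theta>_def e_def scaleR_diff_left)
  qed
  define \<eta> where "\<eta> x = (\<Prod>b\<in>Basis. \<theta> b (x \<bullet> b))" for x :: 'a
  define E where "E x = (\<Sum>b\<in>Basis. (\<Prod>j\<in>Basis - {b}. \<theta> j (x \<bullet> j)) *\<^sub>R (e b (x \<bullet> b) *\<^sub>R b))" for x :: 'a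
  have eb: "\<bar>e b t\<bar> \<le> 4 / (\<sigma> - \<rho>) * indicator (T b \<union> U b) t" if b: "b \<in> Basis" for b t
  proof -
    have g: "T b \<subseteq> {c \<bullet> b - \<sigma><..<c \<bullet> b - \<rho>}" "U b \<subseteq> {c \<bullet> b + \<rho><..<c \<bullet> b + \<sigma>}"
      "(\<sigma> - \<rho>) / 4 \<le> measure lborel (T b)" "(\<sigma> - \<rho>) / 4 \<le> measure lborel (U b)" using gp[OF b] by (auto simp: good_pair_def)
    have inv: "1 / x \<le> 4 / (\<sigma> - \<rho>)" if "(\<sigma> - \<rho>) / 4 \<le> x" for x :: real
    proof -
      have "1 / x \<le> 1 / ((\<sigma> - \<rho>) / 4)" using that r by (intro divide_left_mono mult_pos_pos) auto
      then show ?thesis by simp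
    qed
    have "t \<notin> T b \<or> t \<notin> U b"
    proof (rule ccontr)
      assume "\<not> ?thesis"
      then have "t < c \<bullet> b - \<rho>" "c \<bullet> b + \<rho> < t" using g(1,2) by auto
      then show False using r by simp
    qed
    then show ?thesis using inv[OF g(3)] inv[OF g(4)] by (auto simp: e_def indicator_def)
  qed
  have pi: "0 \<le> (\<Prod>j\<in>J. \<theta> j (x \<bullet> j))" "(\<Prod>j\<in>J. \<theta> j (x \<bullet> j)) \<le> 1" if "J \<subseteq> Basis" for J and x :: 'a
    using that \<theta> by (auto intro!: prod_nonneg prod_le_1)
  have outside: "\<exists>i\<in>Basis. \<theta> i (x \<bullet> i) = 0 \<and> \<bar>x \<bullet> i - c \<bullet> i\<bar> > \<sigma>" if x: "x \<notin> cube c \<sigma>" for x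
  proof -
    obtain i where i: "i \<in> Basis" "\<bar>x \<bullet> i - c \<bullet> i\<bar> > \<sigma>" using x by (auto simp: mem_cube not_le)
    then show ?thesis using \<theta>(4)[OF i(1), of "x \<bullet> i"] by (intro bexI[of _ i]) auto
  qed
  show ?thesis
  proof (rule that[of \<eta> E])
    have "multiplier \<eta> E" unfolding \<eta>_def[abs_def] E_def[abs_def] by (rule multiplier_prod) (use m in auto)
    moreover have "0 \<le> \<eta> x" "\<eta> x \<le> 1" for x using pi[of Basis x] by (auto simp: \<eta>_def)
    moreover have "\<eta> x = 1" if "x \<in> cube c \<rho>" for x using that \<theta>(3) by (auto simp: \<eta>_def mem_cube intro!: prod.neutral)
    moreover have "zero_off (cube c \<sigma>) \<eta>"
      unfolding zero_off_def \<eta>_def using outside by (auto intro!: prod_zero)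
    moreover have "zero_off (cube c \<sigma>) E"
      unfolding zero_off_def
    proof (intro allI impI)
      fix x assume "x \<notin> cube c \<sigma>"
      then obtain i where i: "i \<in> Basis" "\<theta> i (x \<bullet> i) = 0" "\<bar>x \<bullet> i - c \<bullet> i\<bar> > \<sigma>" using outside by blast
      have "(\<Prod>j\<in>Basis - {b}. \<theta> j (x \<bullet> j)) *\<^sub>R (e b (x \<bullet> b) *\<^sub>R b) = 0" if b: "b \<in> Basis" for b
      proof (cases "b = i")
        case True
        have "T b \<subseteq> {c \<bullet> b - \<sigma><..<c \<bullet> b - \<rho>}" "U b \<subseteq> {c \<bullet> b + \<rho><..<c \<bullet> b + \<sigma>}" using gp[OF b] by (auto simp: good_pair_def)
        then have "x \<bullet> b \<notin> T b \<union> U b" using i True r by auto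
        then show ?thesis by (simp add: e_def)
      next
        case False
        then have "(\<Prod>j\<in>Basis - {b}. \<theta> j (x \<bullet> j)) = 0" using i by (intro prod_zero) auto
        then show ?thesis by simp
      qed
      then show "E x = 0" unfolding E_def by (intro sum.neutral ballI)
    qed
    ultimately show "cutoff c \<rho> \<sigma> \<eta> E" by (simp add: cutoff_def)
    show "norm (E x) \<le> (\<Sum>b\<in>Basis. 4 / (\<sigma> - \<rho>) * indicator (T b \<union> U b) (x \<bullet> b))" for x
      unfolding E_def
    proof (rule order_trans[OF norm_sum], rule sum_mono)
      fix b :: 'a assume b: "b \<in> Basis"
      have "norm ((\<Prod>j\<in>Basis - {b}. \<theta> j (x \<bullet> j)) *\<^sub>R (e b (x \<bullet> b) *\<^sub>R b)) = (\<Prod>j\<in>Basis - {b}. \<theta> j (x \<bullet> j)) * \<bar>e b (x \<bullet> b)\<bar>"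
        using pi[of "Basis - {b}" x] b by (simp add: abs_mult)
      also have "\<dots> \<le> 1 * \<bar>e b (x \<bullet> b)\<bar>" using pi[of "Basis - {b}" x] by (intro mult_right_mono) auto
      also have "\<dots> \<le> 4 / (\<sigma> - \<rho>) * indicator (T b \<union> U b) (x \<bullet> b)" using eb[OF b] by simp
      finally show "norm ((\<Prod>j\<in>Basis - {b}. \<theta> j (x \<bullet> j)) *\<^sub>R (e b (x \<bullet> b) *\<^sub>R b)) \<le> 4 / (\<sigma> - \<rho>) * indicator (T b \<union> U b) (x \<bullet> b)" .
    qed
  qed
qed

text \<open>The case with no function to adapt to: the slopes occupy the middle halves of the two
  shells. The margins make the gradient vanish pointwise on the closed inner cube.\<close>

lemma plain_cutoff:
  fixes c :: "'a::euclidean_space"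
  assumes r: "0 < \<rho>" "\<rho> < \<sigma>"
  obtains \<eta> E where "cutoff c \<rho> \<sigma> \<eta> E" "\<And>x. norm (E x) \<le> 4 * DIM('a) / (\<sigma> - \<rho>)" "\<And>x. x \<in> cube c \<rho> \<Longrightarrow> E x = 0"
proof -
  define d where "d = (\<sigma> - \<rho>) / 4"
  have d: "d > 0" "4 * d = \<sigma> - \<rho>" using r by (auto simp: d_def)
  define T where "T b = {c \<bullet> b - \<sigma> + d..c \<bullet> b - \<rho> - d}" for b
  define U where "U b = {c \<bullet> b + \<rho> + d..c \<bullet> b + \<sigma> - d}" for b
  have gp: "good_pair (c \<bullet> b) \<rho> \<sigma> (T b) (U b)" for b
    unfolding good_pair_def T_def U_def using d by auto
  obtain \<eta> E where \<eta>: "cutoff c \<rho> \<sigma> \<eta> E" "\<And>x. norm (E x) \<le> (\<Sum>b\<in>Basis. 4 / (\<sigma> - \<rho>) * indicator (T b \<union> U b) (x \<bullet> b))"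
    by (rule product_cutoff[OF gp r]) (rule that; assumption)
  have "norm (E x) \<le> 4 * DIM('a) / (\<sigma> - \<rho>)" for x
  proof -
    have "norm (E x) \<le> (\<Sum>b\<in>(Basis::'a set). 4 / (\<sigma> - \<rho>))"
      by (rule order_trans[OF \<eta>(2)], rule sum_mono) (use r in \<open>auto simp: indicator_def\<close>)
    then show ?thesis by (simp add: mult.commute)
  qed
  moreover have "E x = 0" if x: "x \<in> cube c \<rho>" for x
  proof -
    have "norm (E x) \<le> (\<Sum>b\<in>(Basis::'a set). 0)"
    proof (rule order_trans[OF \<eta>(2)], rule sum_mono)
      fix b :: 'a assume "b \<in> Basis"
      then have "\<bar>x \<bullet> b - c \<bullet> b\<bar> \<le> \<rho>" using x by (simp add: mem_cube)
      then have "x \<bullet> b \<notin> T b \<union> U b" using d(1) by (auto simp: T_def U_def)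
      then show "4 / (\<sigma> - \<rho>) * indicator (T b \<union> U b) (x \<bullet> b) \<le> (0::real)" by simp
    qed
    then show ?thesis by simp
  qed
  ultimately show ?thesis using that \<eta> by blast
qed

text \<open>Chebyshev's inequality at twice the average leaves at least half of the interval; inner
  regularity replaces that set by a compact one of at least a quarter.\<close>

lemma good_set:
  fixes F :: "real \<Rightarrow> ennreal"
  assumes [measurable]: "F \<in> Borel" and M: "(NN t. F t) \<le> ennreal M" "0 \<le> M" and ab: "a < b"
  obtains T where "compact T" "T \<subseteq> {a<..<b}" "(b - a) / 4 \<le> measure lborel T" "\<And>t. t \<in> T \<Longrightarrow> F t \<le> ennreal (2 * M / (b - a))"
proof -
  define d where "d = b - a"
  have d: "d > 0" using ab by (simp add: d_def)
  define N where "N = {t \<in> {a<..<b}. \<not> F t \<le> ennreal (2 * M / d)}"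
  define S where "S = {t \<in> {a<..<b}. F t \<le> ennreal (2 * M / d)}"
  have [measurable]: "N \<in> sets borel" "S \<in> sets borel" unfolding N_def S_def by measurable
  have N: "leb N \<le> ennreal (d / 2)"
  proof (cases "M = 0")
    \<comment> \<open>The threshold is then 0 and cannot be divided by, but \<open>F\<close>
      vanishes almost everywhere.\<close>
    case True
    then have "AE t in lborel. F t = 0" using M nn_integral_0_iff_AE[of F lborel] by simp
    then have "AE t in lborel. t \<notin> N" by (rule AE_mp) (auto simp: N_def True)
    then have "leb N = 0" by (subst (asm) AE_iff_measurable[of N]) (auto simp: N_def)
    then show ?thesis by simp
  next
    case False
    then have M0: "M > 0" using M by simp
    have "ennreal (2 * M / d) * leb N = (NN t. ennreal (2 * M / d) * indicator N t)" by (simp add: nn_integral_cmult)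
    also have "\<dots> \<le> (NN t. F t)" by (intro nn_integral_mono) (auto simp: N_def indicator_def)
    also have "\<dots> \<le> ennreal (2 * M / d) * ennreal (d / 2)" using M(1) M0 d by (simp add: ennreal_mult[symmetric])
    finally show ?thesis using M0 d by (subst (asm) ennreal_mult_le_mult_iff) auto
  qed
  have "ennreal d = leb (S \<union> N)"
  proof -
    have "S \<union> N = {a<..<b}" by (auto simp: S_def N_def)
    then show ?thesis using ab by (simp add: d_def)
  qed
  also have "\<dots> \<le> leb S + leb N" by (rule emeasure_subadditive) auto
  also have "\<dots> \<le> leb S + ennreal (d / 2)" using N by (intro add_left_mono)
  finally have SN: "ennreal d \<le> leb S + ennreal (d / 2)" .
  have "leb S \<le> leb {a<..<b}" by (intro emeasure_mono) (auto simp: S_def)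
  then have fin: "leb S < \<infinity>" using ab by (auto intro: le_less_trans)
  then have eS: "leb S = ennreal (measure lborel S)" by (simp add: emeasure_eq_ennreal_measure)
  then have mS: "d / 2 \<le> measure lborel S" using SN d by (simp flip: ennreal_plus)
  obtain T where T: "compact T" "T \<subseteq> S" "leb (S - T) < ennreal (d / 4)" using compact_inner_approx[of S "d / 4"] fin d by auto
  have [measurable]: "T \<in> sets borel" using T by (auto simp: compact_imp_closed)
  have "measure lborel (S - T) < d / 4"
  proof -
    have "leb (S - T) = ennreal (measure lborel (S - T))" using T(3) by (intro emeasure_eq_ennreal_measure) (auto simp: top_unique)
    then show ?thesis using T(3) d by (simp add: ennreal_less_iff)
  qed
  moreover have "measure lborel (S - T) = measure lborel S - measure lborel T" using T fin by (intro measure_Diff) (auto simp: less_top)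
  ultimately have "d / 4 \<le> measure lborel T" using mS by simp
  moreover have "T \<subseteq> {a<..<b}" "\<And>t. t \<in> T \<Longrightarrow> F t \<le> ennreal (2 * M / (b - a))" using T(2) by (auto simp: S_def d_def)
  ultimately show ?thesis using that[of T] T(1) by (simp add: d_def)
qed

text \<open>Through the largest summand; the constant is crude but valid for every exponent q >= 0,
  also below 1.\<close>

lemma powr_sum_le:
  fixes a :: "'i \<Rightarrow> real"
  assumes "finite I" "\<And>i. i \<in> I \<Longrightarrow> 0 \<le> a i" "0 \<le> q"
  shows "(\<Sum>i\<in>I. a i) powr q \<le> real (card I) powr q * (\<Sum>i\<in>I. a i powr q)"
proof (cases "I = {}")
  case False
  define m where "m = Max (a ` I)"
  have "m \<in> a ` I" unfolding m_def using assms False by (intro Max_in) auto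
  then obtain k where k: "k \<in> I" "m = a k" by auto
  have le: "a i \<le> m" if "i \<in> I" for i unfolding m_def using assms that by (intro Max_ge) auto
  have "(\<Sum>i\<in>I. a i) \<le> real (card I) * m" using sum_bounded_above[of I a m] le by simp
  then have "(\<Sum>i\<in>I. a i) powr q \<le> (real (card I) * m) powr q" using assms by (intro powr_mono2 sum_nonneg) auto
  also have "\<dots> = real (card I) powr q * a k powr q" using assms k by (simp add: powr_mult)
  also have "\<dots> \<le> real (card I) powr q * (\<Sum>i\<in>I. a i powr q)" using assms k by (intro mult_left_mono member_le_sum) auto
  finally show ?thesis .
qed (use assms in auto)

lemma powr_add_le:
  fixes a b :: real
  assumes "0 \<le> a" "0 \<le> b" "0 \<le> p"
  shows "(a + b) powr p \<le> 2 powr p * (a powr p + b powr p)"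
  using powr_sum_le[of "UNIV::bool set" "\<lambda>i. if i then a else b" p] assms by (simp add: UNIV_bool add.commute)

lemma cutoff_gradient:
  fixes g :: "'a::euclidean_space \<Rightarrow> 'a"
  assumes \<eta>: "cutoff c \<rho> \<sigma> \<eta> E" "\<And>x. norm (E x) \<le> D" and p: "1 \<le> p"
    and [measurable]: "v \<in> Borel" "g \<in> Borel"
  shows "(NN x. ennreal (norm (\<eta> x *\<^sub>R g x + v x *\<^sub>R E x) powr p))
    \<le> ennreal (2 powr p) * (NN x. ennreal (norm (g x) powr p) * indicator (cube c \<sigma>) x)
      + ennreal (2 powr p * D powr p) * (NN x. ennreal (\<bar>v x\<bar> powr p) * indicator (cube c \<sigma>) x)"
proof -
  note \<eta>' = cutoffD[OF \<eta>(1)]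
  have "ennreal (norm (\<eta> x *\<^sub>R g x + v x *\<^sub>R E x) powr p) \<le> ennreal (2 powr p) * (ennreal (norm (g x) powr p) * indicator (cube c \<sigma>) x)
      + ennreal (2 powr p * D powr p) * (ennreal (\<bar>v x\<bar> powr p) * indicator (cube c \<sigma>) x)" for x
  proof (cases "x \<in> cube c \<sigma>")
    case True
    have "norm (\<eta> x *\<^sub>R g x + v x *\<^sub>R E x) \<le> \<bar>\<eta> x\<bar> * norm (g x) + \<bar>v x\<bar> * norm (E x)" by (metis norm_scaleR norm_triangle_ineq)
    also have "\<dots> \<le> 1 * norm (g x) + \<bar>v x\<bar> * D" using \<eta>'(2,3)[of x] \<eta>(2)[of x] by (intro add_mono mult_right_mono mult_left_mono) auto
    finally have "norm (\<eta> x *\<^sub>R g x + v x *\<^sub>R E x) powr p \<le> (norm (g x) + \<bar>v x\<bar> * D) powr p" using p by (intro powr_mono2) auto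
    also have "\<dots> \<le> 2 powr p * (norm (g x) powr p + (\<bar>v x\<bar> * D) powr p)"
      using p order_trans[OF norm_ge_zero \<eta>(2)] by (intro powr_add_le) auto
    finally have "ennreal (norm (\<eta> x *\<^sub>R g x + v x *\<^sub>R E x) powr p) \<le> ennreal (2 powr p * norm (g x) powr p + 2 powr p * D powr p * \<bar>v x\<bar> powr p)"
      by (intro ennreal_leI) (simp add: powr_mult algebra_simps)
    then show ?thesis using True by (simp add: ennreal_mult)
  next
    case False
    then show ?thesis using p \<eta>'(5,6) by (simp add: zero_off_def)
  qed
  then have "(NN x. ennreal (norm (\<eta> x *\<^sub>R g x + v x *\<^sub>R E x) powr p)) \<le> (NN x. ennreal (2 powr p) * (ennreal (norm (g x) powr p) * indicator (cube c \<sigma>) x)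
      + ennreal (2 powr p * D powr p) * (ennreal (\<bar>v x\<bar> powr p) * indicator (cube c \<sigma>) x))" by (rule nn_integral_mono)
  then show ?thesis by (simp add: nn_integral_add nn_integral_cmult)
qed

lemma nn_integral_finite_integrable:
  assumes "f \<in> borel_measurable lborel" "\<And>x. 0 \<le> f x" "(NN x. ennreal (f x)) < top"
  shows "integrable lborel f" using assms by (simp add: integrable_iff_bounded)

text \<open>The hypothesis of \<open>Poincare_half\<close>, which stands in for zero boundary
  values.\<close>

definition half_zero :: "('a::euclidean_space \<Rightarrow> real) \<Rightarrow> 'a \<Rightarrow> real \<Rightarrow> bool" where
  "half_zero v c r \<longleftrightarrow> 2 * leb {x \<in> cube c r. v x \<noteq> 0} \<le> leb (cube c r)"

text \<open>This is where dimension n - 1 enters. A plain cut-off and Poincare's inequality make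
  \<open>v\<close> compactly supported at the cost of a factor (\<sigma> / (\<sigma> - \<rho>))^p.
  In each direction b, \<open>mixed_sobolev\<close> bounds the integral of \<Psi>_b^(p/q) over the
  heights by M2. At good heights \<Psi>_b is at most (4 M2 / d)^(q/p), slopes are of order 1/d, and
  the strips of one direction have total width at most d; together this gives d^(-q) d d^(-q/p) =
  d^(1 - q - q/p).\<close>

lemma good_cutoff:
  assumes pq: "admissible (DIM('a::euclidean_space) - 1) p q"
  obtains C where "C > 0" "\<And>(v :: 'a \<Rightarrow> real) g c \<rho> \<sigma> P e M. sob v g \<Longrightarrow> 0 < \<rho> \<Longrightarrow> \<rho> < \<sigma> \<Longrightarrow>
     integrable lborel (\<lambda>x. indicator P x * norm (g x) powr p) \<Longrightarrow> e > 0 \<Longrightarrow> (\<And>x. x \<in> cube c \<sigma> \<Longrightarrow> cball x e \<subseteq> P) \<Longrightarrow>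
     half_zero v c \<sigma> \<Longrightarrow> 0 \<le> M \<Longrightarrow>
     (NN x. ennreal (norm (g x) powr p) * indicator (cube c \<sigma>) x) \<le> ennreal M \<Longrightarrow>
     \<exists>\<eta> E. cutoff c \<rho> ((\<rho> + \<sigma>) / 2) \<eta> E \<and>
       (grad_weight q v E) \<le>
        ennreal (C * (\<sigma> - \<rho>) powr (1 - q - q / p) * (\<sigma> powr (real (DIM('a) - 1) * p / q - real (DIM('a) - 1) + p) * ((1 + (\<sigma> / (\<sigma> - \<rho>)) powr p) * M)) powr (q / p))"
proof -
  define s where "s = real (DIM('a) - 1) * p / q - real (DIM('a) - 1) + p"
  define n where "n = real DIM('a)"
  have n: "n \<ge> 1" using DIM_positive[where 'a='a] by (simp add: n_def Suc_le_eq)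
  have p: "1 \<le> p" "p < q" "0 < q" using pq by (auto simp: admissible_def)
  show ?thesis
  proof (rule mixed_sobolev[OF pq], goal_cases)
  case (1 C)
  note C = 1[folded s_def]
  define C1 where "C1 = 2 * (2 * n) powr p * 2 ^ DIM('a)"
  define C2 where "C2 = 2 powr p * (1 + (8 * n) powr p * C1)"
  define C3 where "C3 = n * n powr q * 8 powr q * (4 * C * C2) powr (q / p)"
  have C1: "C1 > 0" using n by (simp add: C1_def)
  have C2: "C2 > 0" using C1 by (simp add: C2_def add_pos_nonneg)
  show ?thesis
  proof (rule that[of C3])
    show "C3 > 0" using n C(1) C2 by (simp add: C3_def)
    fix v :: "'a \<Rightarrow> real" and g c P and \<rho> \<sigma> e M :: real
    assume v: "sob v g" and r: "0 < \<rho>" "\<rho> < \<sigma>"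
      and P: "integrable lborel (\<lambda>x. indicator P x * norm (g x) powr p)" "e > 0" "\<And>x. x \<in> cube c \<sigma> \<Longrightarrow> cball x e \<subseteq> P"
      and half: "half_zero v c \<sigma>" and M: "0 \<le> M"
      and Y: "(NN x. ennreal (norm (g x) powr p) * indicator (cube c \<sigma>) x) \<le> ennreal M"
    define d where "d = \<sigma> - \<rho>"
    \<comment> \<open>The outer half of the shell serves the plain cut-off \<open>\<chi>'\<close>,
      the inner half the adapted one; where the latter lives, \<open>w\<close> equals
      \<open>v\<close>.\<close>
    define \<tau> where "\<tau> = (\<rho> + \<sigma>) / 2"
    have d: "d > 0" "\<sigma> - \<tau> = d / 2" "\<tau> - \<rho> = d / 2" "\<tau> < \<sigma>" "\<rho> < \<tau>" "0 < \<tau>" "0 < \<sigma>" using r by (auto simp: d_def \<tau>_def field_simps)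
    note [measurable] = sob_measurable[OF v]
    obtain \<chi>' F where \<chi>0: "cutoff c \<tau> \<sigma> \<chi>' F" "\<And>x. norm (F x) \<le> 4 * DIM('a) / (\<sigma> - \<tau>)"
      by (rule plain_cutoff[OF d(6,4), of c]) (rule that; assumption)
    note \<chi> = cutoffD[OF \<chi>0(1)]
    have Fb: "norm (F x) \<le> 8 * n / d" for x using \<chi>0(2)[of x] d by (simp add: n_def)
    define w where "w x = \<chi>' x * v x" for x
    define G where "G x = \<chi>' x *\<^sub>R g x + v x *\<^sub>R F x" for x
    have sw: "sob w G" unfolding w_def[abs_def] G_def[abs_def] by (rule multiplier_sob[OF \<chi>(1) v])
    note [measurable] = sob_measurable[OF sw]
    define Q where "Q = cube c \<sigma>"
    have [measurable]: "Q \<in> sets borel" by (simp add: Q_def)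
    have vw: "zero_off Q w" using \<chi>(5) by (auto simp: zero_off_def w_def Q_def)
    have Poin: "(NN x. ennreal (\<bar>v x\<bar> powr p) * indicator Q x) \<le> ennreal (C1 * \<sigma> powr p * M)"
    proof -
      have "(NN x. ennreal (\<bar>v x\<bar> powr p) * indicator Q x) \<le> ennreal (2 * (2 * \<sigma> * DIM('a)) powr p * 2 ^ DIM('a)) * (NN x. ennreal (norm (g x) powr p) * indicator Q x)"
        unfolding Q_def by (rule Poincare_half[OF v p(1) d(7) P half[unfolded half_zero_def]])
      also have "\<dots> \<le> ennreal (2 * (2 * \<sigma> * DIM('a)) powr p * 2 ^ DIM('a)) * ennreal M" using Y by (intro mult_left_mono) (auto simp: Q_def)
      also have "\<dots> = ennreal (C1 * \<sigma> powr p * M)" using d M n by (simp add: C1_def n_def ennreal_mult[symmetric] powr_mult mult_ac)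
      finally show ?thesis .
    qed
    define M1 where "M1 = C2 * ((1 + (\<sigma> / d) powr p) * M)"
    have M1: "M1 \<ge> 0" using C2 M by (simp add: M1_def)
    have GM: "(NN x. ennreal (norm (G x) powr p)) \<le> ennreal M1"
    proof -
      have "(NN x. ennreal (norm (G x) powr p)) \<le> ennreal (2 powr p) * (NN x. ennreal (norm (g x) powr p) * indicator Q x)
          + ennreal (2 powr p * (8 * n / d) powr p) * (NN x. ennreal (\<bar>v x\<bar> powr p) * indicator Q x)"
        unfolding G_def Q_def by (rule cutoff_gradient[OF \<chi>0(1) Fb p(1)]) measurable
      also have "\<dots> \<le> ennreal (2 powr p) * ennreal M + ennreal (2 powr p * (8 * n / d) powr p) * ennreal (C1 * \<sigma> powr p * M)"
        using Y Poin by (intro add_mono mult_left_mono) (auto simp: Q_def)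
      also have "\<dots> = ennreal (2 powr p * M + 2 powr p * (8 * n / d) powr p * (C1 * \<sigma> powr p * M))" using M C1 by (simp add: ennreal_plus ennreal_mult)
      also have "\<dots> \<le> ennreal M1" using n d M C1 by (simp add: powr_mult powr_divide algebra_simps mult.assoc M1_def C2_def mult_ac)
      finally show ?thesis .
    qed
    have iG: "integrable lborel (\<lambda>x. norm (G x) powr p)" by (rule nn_integral_finite_integrable) (use GM in \<open>auto intro: le_less_trans\<close>)
    define M2 where "M2 = C * \<sigma> powr s * M1"
    have M2: "M2 \<ge> 0" using M1 C(1) by (simp add: M2_def)
    define ok where "ok b l \<longleftrightarrow> l \<in> Borel \<and> (AE x in lborel. epowr (ennreal \<bar>w x\<bar>) q \<le> l x) \<and>
       (NN t. epowr (slice_integral b l t) (p / q)) \<le> ennreal M2" for b l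
    have "\<exists>l. ok b l" if b: "b \<in> Basis" for b
    proof -
      obtain l where l: "l \<in> Borel" "AE x in lborel. epowr (ennreal \<bar>w x\<bar>) q \<le> l x"
        "(NN t. epowr (slice_integral b l t) (p / q))
          \<le> ennreal (C * \<sigma> powr s) * (NN x. ennreal (norm (G x) powr p))" using C(2)[OF sw iG vw[unfolded Q_def] d(7) b] by blast
      note l(3)
      also have "ennreal (C * \<sigma> powr s) * (NN x. ennreal (norm (G x) powr p)) \<le> ennreal (C * \<sigma> powr s) * ennreal M1"
        by (intro mult_left_mono GM) auto
      also have "\<dots> = ennreal M2" using C(1) M1 by (simp add: M2_def ennreal_mult)
      finally show ?thesis using l(1,2) unfolding ok_def by blast
    qed
    then obtain l where l0: "\<And>b. b \<in> Basis \<Longrightarrow> ok b (l b)" by metis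
    note l = l0[unfolded ok_def, THEN conjunct1] l0[unfolded ok_def, THEN conjunct2, THEN conjunct1] l0[unfolded ok_def, THEN conjunct2, THEN conjunct2]
    define \<Psi> where "\<Psi> b t = slice_integral b (l b) t" for b t
    have \<Psi>m: "\<Psi> b \<in> Borel" if b: "b \<in> Basis" for b
    proof -
      let ?N = "PiM (Basis - {b}) (\<lambda>_. lborel :: real measure)"
      interpret N: sigma_finite_measure ?N by (rule lborel_product.sigma_finite) simp
      have slm: "(\<lambda>(t, y). slice (t *\<^sub>R b) (Basis - {b}) y) \<in> (lborel :: real measure) \<Otimes>\<^sub>M ?N \<rightarrow>\<^sub>M borel"
        unfolding slice_def split_beta' by measurable
      have "(\<lambda>(t, y). l b (slice (t *\<^sub>R b) (Basis - {b}) y)) \<in> borel_measurable (lborel \<Otimes>\<^sub>M ?N)"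
        using measurable_compose[OF slm l(1)[OF b]] by (simp add: split_beta')
      then have "\<Psi> b \<in> borel_measurable lborel" unfolding \<Psi>_def by (rule N.borel_measurable_nn_integral)
      then show ?thesis by simp
    qed
    \<comment> \<open>Twice the bound for the average of \<Psi>_b^(p/q) over an interval of length
      d/2, raised to the power q/p.\<close>
    define A where "A = (4 * M2 / d) powr (q / p)"
    have ex: "\<exists>T. compact T \<and> T \<subseteq> {a<..<a'} \<and> d / 8 \<le> measure lborel T \<and> (\<forall>t\<in>T. \<Psi> b t \<le> ennreal A)"
      if b: "b \<in> Basis" and a: "a' - a = d / 2" for b a a'
    proof -
      have "a < a'" using a d by simp
      obtain T where T: "compact T" "T \<subseteq> {a<..<a'}" "(a' - a) / 4 \<le> measure lborel T" "\<And>t. t \<in> T \<Longrightarrow> epowr (\<Psi> b t) (p / q) \<le> ennreal (2 * M2 / (a' - a))"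
        using good_set[of "\<lambda>t. epowr (\<Psi> b t) (p / q)" M2 a a'] \<Psi>m[OF b] l(3)[OF b] M2 \<open>a < a'\<close> unfolding \<Psi>_def by (metis measurable_epowr)
      have "\<Psi> b t \<le> ennreal A" if "t \<in> T" for t
      proof -
        have "\<Psi> b t \<le> epowr (ennreal (2 * M2 / (d / 2))) (q / p)" using T(4)[OF that] a p by (simp add: epowr_le_iff)
        also have "\<dots> = ennreal A" using p M2 d by (simp add: epowr_ennreal A_def)
        finally show ?thesis .
      qed
      then show ?thesis using T a by auto
    qed
    have "\<forall>b\<in>Basis. \<exists>T U. good_pair (c \<bullet> b) \<rho> \<tau> T U \<and> (\<forall>t\<in>T \<union> U. \<Psi> b t \<le> ennreal A)"
    proof
      fix b :: 'a assume b: "b \<in> Basis"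
      have "(c \<bullet> b - \<rho>) - (c \<bullet> b - \<tau>) = d / 2" "(c \<bullet> b + \<tau>) - (c \<bullet> b + \<rho>) = d / 2" using d by auto
      from ex[OF b this(1)] ex[OF b this(2)] obtain T U where
        "compact T" "T \<subseteq> {c \<bullet> b - \<tau><..<c \<bullet> b - \<rho>}" "d / 8 \<le> measure lborel T" "\<forall>t\<in>T. \<Psi> b t \<le> ennreal A"
        "compact U" "U \<subseteq> {c \<bullet> b + \<rho><..<c \<bullet> b + \<tau>}" "d / 8 \<le> measure lborel U" "\<forall>t\<in>U. \<Psi> b t \<le> ennreal A"
        by blast
      then show "\<exists>T U. good_pair (c \<bullet> b) \<rho> \<tau> T U \<and> (\<forall>t\<in>T \<union> U. \<Psi> b t \<le> ennreal A)"
        using d by (intro exI[of _ T] exI[of _ U]) (auto simp: good_pair_def)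
    qed
    then obtain T U where TU: "\<And>b. b \<in> Basis \<Longrightarrow> good_pair (c \<bullet> b) \<rho> \<tau> (T b) (U b)" "\<And>b t. b \<in> Basis \<Longrightarrow> t \<in> T b \<union> U b \<Longrightarrow> \<Psi> b t \<le> ennreal A"
      by metis
    obtain \<eta> E where \<eta>0: "cutoff c \<rho> \<tau> \<eta> E" "\<And>x. norm (E x) \<le> (\<Sum>b\<in>Basis. 4 / (\<tau> - \<rho>) * indicator (T b \<union> U b) (x \<bullet> b))"
      by (rule product_cutoff[where T=T and U=U and c=c, OF _ r(1) d(5)]) (erule TU(1), (rule that; assumption))
    note \<eta> = cutoffD[OF \<eta>0(1)]
    note [measurable] = multiplier_measurable[OF \<eta>(1)]
    have TUm: "T b \<union> U b \<in> sets borel" "T b \<subseteq> {c \<bullet> b - \<tau><..<c \<bullet> b - \<rho>}" "U b \<subseteq> {c \<bullet> b + \<rho><..<c \<bullet> b + \<tau>}" if "b \<in> Basis" for b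
      using TU(1)[OF that] by (auto simp: good_pair_def compact_imp_closed)
    have TUe: "leb (T b \<union> U b) \<le> ennreal d" if b: "b \<in> Basis" for b
    proof -
      have "leb (T b \<union> U b) \<le> leb ({c \<bullet> b - \<tau><..<c \<bullet> b - \<rho>} \<union> {c \<bullet> b + \<rho><..<c \<bullet> b + \<tau>})"
        using TUm[OF b] by (intro emeasure_mono) auto
      also have "\<dots> \<le> leb {c \<bullet> b - \<tau><..<c \<bullet> b - \<rho>} + leb {c \<bullet> b + \<rho><..<c \<bullet> b + \<tau>}"
        by (rule emeasure_subadditive) auto
      also have "\<dots> = ennreal (\<tau> - \<rho>) + ennreal (\<tau> - \<rho>)" using d(5) by simp
      also have "\<dots> = ennreal (d / 2) + ennreal (d / 2)" unfolding d(3) ..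
      also have "\<dots> = ennreal d" using d by (simp flip: ennreal_plus)
      finally show ?thesis .
    qed
    \<comment> \<open>The power of the sum of slopes is split into a sum of powers, and the strips
      of direction b use their own majorant \<open>l b\<close>.\<close>
    have pw: "AE x in lborel. ennreal (\<bar>v x\<bar> powr q * norm (E x) powr q) \<le> ennreal (n powr q * (8 / d) powr q) * (\<Sum>b\<in>Basis. l b x * indicator (T b \<union> U b) (x \<bullet> b))"
    proof -
      have "AE x in lborel. \<forall>b\<in>Basis. epowr (ennreal \<bar>w x\<bar>) q \<le> l b x" using l(2) by (intro AE_finite_allI) auto
      then show ?thesis
      proof (rule AE_mp, intro AE_I2 impI)
        fix x assume lx: "\<forall>b\<in>Basis. epowr (ennreal \<bar>w x\<bar>) q \<le> l b x"
        show "ennreal (\<bar>v x\<bar> powr q * norm (E x) powr q) \<le> ennreal (n powr q * (8 / d) powr q) * (\<Sum>b\<in>Basis. l b x * indicator (T b \<union> U b) (x \<bullet> b))"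
        proof (cases "x \<in> cube c \<tau>")
          case False
          then have "E x = 0" using \<eta>(6) by (simp add: zero_off_def)
          then show ?thesis by simp
        next
          case True
          then have wv: "w x = v x" using \<chi>(4) by (simp add: w_def)
          have "norm (E x) powr q \<le> (\<Sum>b\<in>Basis. 8 / d * indicator (T b \<union> U b) (x \<bullet> b)) powr q"
            using \<eta>0(2)[of x] p d by (intro powr_mono2) auto
          also have "\<dots> \<le> real (card (Basis :: 'a set)) powr q * (\<Sum>b\<in>Basis. (8 / d * indicator (T b \<union> U b) (x \<bullet> b)) powr q)"
            using p d by (intro powr_sum_le) (auto simp: indicator_def)
          also have "(\<Sum>b\<in>Basis. (8 / d * indicator (T b \<union> U b) (x \<bullet> b)) powr q) = (8 / d) powr q * (\<Sum>b\<in>Basis. indicator (T b \<union> U b) (x \<bullet> b))"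
            unfolding sum_distrib_left by (intro sum.cong) (auto simp: indicator_def)
          finally have "\<bar>v x\<bar> powr q * norm (E x) powr q \<le> \<bar>v x\<bar> powr q * (n powr q * ((8 / d) powr q * (\<Sum>b\<in>Basis. indicator (T b \<union> U b) (x \<bullet> b))))"
            by (intro mult_left_mono) (auto simp: n_def)
          also have "\<dots> = (n powr q * (8 / d) powr q) * (\<Sum>b\<in>Basis. \<bar>w x\<bar> powr q * indicator (T b \<union> U b) (x \<bullet> b))"
            by (simp add: wv sum_distrib_left mult_ac)
          finally have "ennreal (\<bar>v x\<bar> powr q * norm (E x) powr q) \<le> ennreal ((n powr q * (8 / d) powr q) * (\<Sum>b\<in>Basis. \<bar>w x\<bar> powr q * indicator (T b \<union> U b) (x \<bullet> b)))"
            by (rule ennreal_leI)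
          also have "\<dots> = ennreal (n powr q * (8 / d) powr q) * (\<Sum>b\<in>Basis. ennreal (\<bar>w x\<bar> powr q * indicator (T b \<union> U b) (x \<bullet> b)))"
            by (subst sum_ennreal) (auto simp: ennreal_mult intro!: sum_nonneg)
          also have "\<dots> \<le> ennreal (n powr q * (8 / d) powr q) * (\<Sum>b\<in>Basis. l b x * indicator (T b \<union> U b) (x \<bullet> b))"
          proof (intro mult_left_mono sum_mono)
            fix b :: 'a assume "b \<in> Basis"
            then have "epowr (ennreal \<bar>w x\<bar>) q \<le> l b x" using lx by blast
            then show "ennreal (\<bar>w x\<bar> powr q * indicator (T b \<union> U b) (x \<bullet> b)) \<le> l b x * indicator (T b \<union> U b) (x \<bullet> b)"
              using p by (auto simp: indicator_def epowr_ennreal)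
          qed auto
          finally show ?thesis .
        qed
      qed
    qed
    have one: "(NN x. l b x * indicator (T b \<union> U b) (x \<bullet> b)) \<le> ennreal (A * d)" if b: "b \<in> Basis" for b
    proof -
      note [measurable] = TUm(1)[OF b] l(1)[OF b]
      have "(NN x. l b x * indicator (T b \<union> U b) (x \<bullet> b))
         = (NN t. \<integral>\<^sup>+y. l b (slice (t *\<^sub>R b) (Basis - {b}) y) * indicator (T b \<union> U b) (slice (t *\<^sub>R b) (Basis - {b}) y \<bullet> b) \<partial>PiM (Basis - {b}) (\<lambda>_. lborel))"
        by (rule nn_integral_slices[OF _ b]) measurable
      also have "\<dots> = (NN t. \<integral>\<^sup>+y. l b (slice (t *\<^sub>R b) (Basis - {b}) y) * indicator (T b \<union> U b) t \<partial>PiM (Basis - {b}) (\<lambda>_. lborel))"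
        using b by (simp add: inner_not_same_Basis slice_def inner_add_left inner_sum_left)
      also have "\<dots> = (NN t. \<Psi> b t * indicator (T b \<union> U b) t)"
        unfolding \<Psi>_def by (intro nn_integral_cong nn_integral_multc) measurable
      also have "\<dots> \<le> (NN t. ennreal A * indicator (T b \<union> U b) t)" using TU(2)[OF b] by (intro nn_integral_mono) (auto simp: indicator_def)
      also have "\<dots> = ennreal A * leb (T b \<union> U b)" by (rule nn_integral_cmult_indicator) measurable
      also have "\<dots> \<le> ennreal A * ennreal d" by (intro mult_left_mono TUe[OF b]) auto
      also have "\<dots> = ennreal (A * d)" using d by (simp add: A_def ennreal_mult)
      finally show ?thesis .
    qed
    have lm: "(\<lambda>x. l b x * indicator (T b \<union> U b) (x \<bullet> b)) \<in> borel_measurable lborel" if b: "b \<in> Basis" for b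
    proof -
      note [measurable] = TUm(1)[OF b] l(1)[OF b]
      show ?thesis by measurable
    qed
    have "(grad_weight q v E)
       \<le> (NN x. ennreal (n powr q * (8 / d) powr q) * (\<Sum>b\<in>Basis. l b x * indicator (T b \<union> U b) (x \<bullet> b)))"
      by (rule nn_integral_mono_AE[OF pw])
    also have "\<dots> = ennreal (n powr q * (8 / d) powr q) * (\<Sum>b\<in>Basis. (NN x. l b x * indicator (T b \<union> U b) (x \<bullet> b)))"
    proof -
      have "(\<lambda>x. \<Sum>b\<in>Basis. l b x * indicator (T b \<union> U b) (x \<bullet> b)) \<in> borel_measurable lborel" by (intro borel_measurable_sum lm)
      then show ?thesis by (simp only: nn_integral_cmult nn_integral_sum[OF lm])
    qed
    also have "\<dots> \<le> ennreal (n powr q * (8 / d) powr q) * (\<Sum>b\<in>(Basis::'a set). ennreal (A * d))" by (intro mult_left_mono sum_mono one) auto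
    also have "(\<Sum>b\<in>(Basis::'a set). ennreal (A * d)) = ennreal (n * (A * d))" using d by (simp add: n_def ennreal_mult A_def ennreal_of_nat_eq_real_of_nat)
    also have "ennreal (n powr q * (8 / d) powr q) * ennreal (n * (A * d)) = ennreal (n powr q * (8 / d) powr q * (n * (A * d)))"
      using n d by (simp add: ennreal_mult A_def)
    also have "n powr q * (8 / d) powr q * (n * (A * d)) = C3 * d powr (1 - q - q / p) * (\<sigma> powr s * ((1 + (\<sigma> / d) powr p) * M)) powr (q / p)"
    proof -
      have dd: "d powr (1 - q - q / p) = d / d powr q / d powr (q / p)" using d by (simp add: powr_diff)
      define Z where "Z = (\<sigma> powr s * ((1 + (\<sigma> / d) powr p) * M)) powr (q / p)"
      define K where "K = (4 * C * C2) powr (q / p)"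
      have "4 * M2 / d = (4 * C * C2) * (\<sigma> powr s * ((1 + (\<sigma> / d) powr p) * M)) / d" by (simp add: M2_def M1_def)
      then have "A = ((4 * C * C2) * (\<sigma> powr s * ((1 + (\<sigma> / d) powr p) * M))) powr (q / p) / d powr (q / p)"
        using C(1) C2 M d unfolding A_def by (simp only: powr_divide)
      also have "((4 * C * C2) * (\<sigma> powr s * ((1 + (\<sigma> / d) powr p) * M))) powr (q / p) = K * Z"
        unfolding K_def Z_def by (rule powr_mult)
      finally have A: "A = K * Z / d powr (q / p)" .
      have e8: "(8 / d) powr q = 8 powr q / d powr q" using d by (simp add: powr_divide)
      show ?thesis unfolding C3_def K_def[symmetric] Z_def[symmetric] A dd e8 by simp
    qed
    finally have fin: "grad_weight q v E \<le> ennreal (C3 * d powr (1 - q - q / p) * (\<sigma> powr s * ((1 + (\<sigma> / d) powr p) * M)) powr (q / p))" .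
    show "\<exists>\<eta> E. cutoff c \<rho> ((\<rho> + \<sigma>) / 2) \<eta> E \<and>
       (grad_weight q v E) \<le>
        ennreal (C3 * (\<sigma> - \<rho>) powr (1 - q - q / p) * (\<sigma> powr (real (DIM('a) - 1) * p / q - real (DIM('a) - 1) + p) * ((1 + (\<sigma> / (\<sigma> - \<rho>)) powr p) * M)) powr (q / p))"
      using \<eta>0(1)[unfolded \<tau>_def] fin by (intro exI[of _ \<eta>] exI[of _ E]) (auto simp: s_def d_def)
  qed
  qed
qed

section \<open>Cutting off the zero set\<close>

lemma cube_interior: "interior (cube c r) = {x. \<forall>i\<in>Basis. \<bar>x \<bullet> i - c \<bullet> i\<bar> < r}"
  unfolding cube_def interior_cbox by (auto simp: mem_box inner_diff_left inner_add_left abs_less_iff algebra_simps)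

lemma emeasure_interior_cube:
  assumes "0 \<le> r"
  shows "leb (interior (cube (c::'a::euclidean_space) r)) = ennreal ((2 * r) ^ DIM('a))"
proof -
  have "leb (interior (cube c r)) = ennreal (\<Prod>b\<in>(Basis::'a set). (2 * r))"
    unfolding cube_def interior_cbox using assms
    by (subst emeasure_lborel_box) (auto simp: inner_diff_left inner_add_left inner_simps intro!: arg_cong[where f=ennreal] prod.cong)
  then show ?thesis by simp
qed

lemma at_most_one_sum:
  fixes f :: "'i \<Rightarrow> 'b::real_normed_vector"
  assumes "finite I" "\<And>i j. i \<in> I \<Longrightarrow> j \<in> I \<Longrightarrow> f i \<noteq> 0 \<Longrightarrow> f j \<noteq> 0 \<Longrightarrow> i = j"
  shows "(\<Sum>i\<in>I. f i) = 0 \<or> (\<exists>i\<in>I. (\<Sum>i\<in>I. f i) = f i)"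
proof (cases "\<exists>i\<in>I. f i \<noteq> 0")
  case True
  then obtain i where i: "i \<in> I" "f i \<noteq> 0" by auto
  then have "(\<Sum>j\<in>I - {i}. f j) = 0" using assms(2) by (intro sum.neutral) blast
  then show ?thesis using i assms(1) by (auto simp: sum.remove)
qed auto

lemma dyadic_cube:
  fixes u v c :: "'a::euclidean_space"
  assumes "\<forall>i\<in>Basis. v \<bullet> i - u \<bullet> i = ((c + R *\<^sub>R One) \<bullet> i - (c - R *\<^sub>R One) \<bullet> i) / 2 ^ n" "0 < R"
  obtains c' r where "0 < r" "cbox u v = cube c' r"
proof -
  define r where "r = R / 2 ^ n"
  define c' where "c' = u + r *\<^sub>R One"
  have "r > 0" using assms by (simp add: r_def)
  moreover have "v \<bullet> i = u \<bullet> i + 2 * r" if "i \<in> Basis" for i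
    using assms(1)[rule_format, OF that] that by (simp add: r_def inner_add_left inner_diff_left)
  then have "v \<bullet> i = (u + (2 * r) *\<^sub>R One) \<bullet> i" if "i \<in> Basis" for i using that by (simp add: inner_add_left)
  then have "v = u + (2 * r) *\<^sub>R One" by (rule euclidean_eqI)
  then have "cbox u v = cube c' r" by (simp add: cube_def c'_def algebra_simps scaleR_2[symmetric])
  ultimately show ?thesis using that by blast
qed

text \<open>Outer regularity of the finite measure with density \<open>\<psi>\<close>, for which
  \<open>S\<close> is a null set.\<close>

lemma open_superset_small_integral:
  fixes \<psi> :: "'a::euclidean_space \<Rightarrow> ennreal"
  assumes [measurable]: "\<psi> \<in> Borel" and fin: "(NN x. \<psi> x) < \<infinity>"
    and [measurable]: "S \<in> sets borel" and S: "\<And>x. x \<in> S \<Longrightarrow> \<psi> x = 0" and e: "0 < e"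
  obtains U where "open U" "S \<subseteq> U" "(NN x. \<psi> x * indicator U x) < ennreal e"
proof -
  let ?M = "density lborel \<psi>"
  have "(INF U\<in>{U. S \<subseteq> U \<and> open U}. emeasure ?M U) = emeasure ?M S"
    by (rule outer_regular[symmetric]) (use fin in \<open>auto simp: emeasure_density\<close>)
  also have "emeasure ?M S = (NN x. \<psi> x * indicator S x)" by (rule emeasure_density) auto
  also have "(\<lambda>x. \<psi> x * indicator S x) = (\<lambda>x. 0)"
  proof
    fix x show "\<psi> x * indicator S x = 0" using S by (cases "x \<in> S") auto
  qed
  also have "(\<integral>\<^sup>+x. 0 \<partial>(lborel :: 'a measure)) = 0" by simp
  finally have "(INF U\<in>{U. S \<subseteq> U \<and> open U}. emeasure ?M U) < ennreal e" using e by simp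
  then obtain U where U: "S \<subseteq> U" "open U" "emeasure ?M U < ennreal e" by (auto simp: INF_less_iff)
  then have [measurable]: "U \<in> sets borel" by auto
  have "emeasure ?M U = (NN x. \<psi> x * indicator U x)" by (rule emeasure_density) auto
  then show ?thesis using U that by metis
qed

text \<open>Continuity from above of a finite measure. With finitely many cubes the sum of their
  cut-offs is a multiplier by algebra alone.\<close>

lemma finite_subcover_measure:
  fixes D :: "'a::euclidean_space set set"
  assumes D: "countable D" "\<And>K. K \<in> D \<Longrightarrow> K \<in> sets borel" "\<Union>D \<subseteq> B" "leb B < \<infinity>" "B \<in> sets borel" and e: "0 < e"
  obtains F where "finite F" "F \<subseteq> D" "leb (\<Union>D - \<Union>F) \<le> ennreal e"
proof (cases "D = {}")
  case True then show ?thesis using that[of "{}"] by simp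
next
  case False
  define K where "K = from_nat_into D"
  have rK: "range K = D" unfolding K_def using False D(1) by simp
  define A where "A n = \<Union>D - (\<Union>i<n. K i)" for n :: nat
  have Km: "K i \<in> sets borel" for i using rK D(2) by auto
  have Dm: "\<Union>D \<in> sets borel" using D by (intro sets.countable_Union) auto
  have Am: "A n \<in> sets borel" for n unfolding A_def using Dm Km by auto
  have "(\<lambda>n. leb (A n)) ----> leb (\<Inter>n. A n)"
  proof (rule Lim_emeasure_decseq)
    show "decseq A" unfolding A_def decseq_def by (auto intro: less_le_trans)
    have "leb (A n) \<le> leb B" for n using D(3,5) by (intro emeasure_mono) (auto simp: A_def)
    then show "leb (A n) \<noteq> \<infinity>" for n using D(4) by (metis infinity_ennreal_def linorder_not_less top.not_eq_extremum)
  qed (use Am in auto)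
  moreover have "(\<Inter>n. A n) = {}" unfolding A_def using rK by auto
  ultimately have "(\<lambda>n. leb (A n)) ----> 0" by (simp only: emeasure_empty)
  then have "\<forall>\<^sub>F n in sequentially. leb (A n) < ennreal e" using e by (intro order_tendstoD) auto
  then obtain n where "leb (A n) < ennreal e" by (auto simp: eventually_sequentially)
  moreover have "A n = \<Union>D - \<Union>(K ` {..<n})" by (auto simp: A_def)
  ultimately show ?thesis using that[of "K ` {..<n}"] rK by (auto intro: less_imp_le)
qed

text \<open>The zero set is covered by nonoverlapping cubes inside an open set on which the function \<open>\<psi>\<close>, the sum
  of the indicator of \<open>v \<noteq> 0\<close> and of \<open>|g|\<^sup>p\<close>, has small integral. In a cube where the mean of \<open>\<psi>\<close> is at most
  \<open>\<delta>\<close>, \<open>v\<close> vanishes on at least half of it and \<open>good_cutoff\<close> applies; the other cubes have small total measure.\<close>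
lemma zero_set_cutoff:
  fixes v :: "'a::euclidean_space \<Rightarrow> real"
  assumes pq: "admissible (DIM('a) - 1) p q"
    and v: "sob v g" "\<And>x. v x = 0 \<Longrightarrow> g x = 0" "integrable lborel (\<lambda>x. norm (g x) powr p)"
    and R: "0 < R" and e: "0 < e"
  obtains \<zeta> E O' where "multiplier \<zeta> E" "\<And>x. 0 \<le> \<zeta> x" "\<And>x. \<zeta> x \<le> 1" "open O'" "\<And>x. x \<in> O' \<Longrightarrow> \<zeta> x = 0"
    "leb ({x \<in> cube c R. v x = 0} - O') \<le> ennreal e"
    "leb {x. v x \<noteq> 0 \<and> \<zeta> x < 1} \<le> ennreal e"
    "grad_weight q v E \<le> ennreal e"
proof (rule good_cutoff[OF pq], goal_cases)
  case (1 C)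
  note C = 1(2-)
  define n where "n = DIM('a)"
  have n: "n \<ge> 1" using DIM_positive[where 'a='a] by (simp add: n_def Suc_le_eq)
  define s where "s = real (n - 1) * p / q - real (n - 1) + p"
  have p: "1 \<le> p" "p < q" "0 < q" using pq by (auto simp: admissible_def)
  note [measurable] = sob_measurable[OF v(1)]
  define V where "V = (2 * (2 * R)) ^ n"
  have V: "V > 0" using R by (simp add: V_def)
  have volV: "leb (cube c (2 * R)) = ennreal V" using R by (simp add: emeasure_cube V_def n_def)
  \<comment> \<open>Relative thickness of the shell in which each local cut-off falls from 1 to 0;
    by Bernoulli's inequality all shells together have measure at most n t V.\<close>
  define t where "t = min (1 / 2) (e / (3 * n * V))"
  have t: "0 < t" "t < 1" "n * t * V \<le> e / 3"
  proof -
    have "0 < n * V" using n V by simp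
    then have "0 < e / (3 * n * V)" using e by (simp add: mult.assoc)
    then show "0 < t" by (simp add: t_def)
    show "t < 1" by (simp add: t_def)
    have "t \<le> e / (3 * n * V)" by (simp add: t_def)
    then have "t * (n * V) \<le> e / (3 * n * V) * (n * V)" using V by (intro mult_right_mono) auto
    also have "\<dots> = e / 3" using n V by (simp add: field_simps)
    finally show "n * t * V \<le> e / 3" by (simp add: mult_ac)
  qed
  \<comment> \<open>The bound of \<open>good_cutoff\<close> for \<rho> = (1 - t) \<sigma> and M =
    \<delta> (2 \<sigma>)^n, stripped of \<delta>^(q/p) and of the volume factor \<sigma>^n.\<close>
  define L where "L = C * t powr (1 - q - q / p) * ((1 + (1 / t) powr p) * 2 ^ n) powr (q / p)"
  have L: "L > 0"
  proof -
    have "0 < 1 + (1 / t) powr p" by (simp add: add_pos_nonneg)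
    then have "0 < ((1 + (1 / t) powr p) * 2 ^ n) powr (q / p)" by simp
    then show ?thesis unfolding L_def using C(1) t by (intro mult_pos_pos) auto
  qed
  \<comment> \<open>The bound 1/2 gives \<open>half_zero\<close> on marked cubes; the other one
    keeps the sum of the gradient weights, at most L \<delta>^(q/p) times the total volume, below
    \<open>e\<close>.\<close>
  define \<delta> where "\<delta> = min (1 / 2) ((e / (L * V)) powr (p / q))"
  have \<delta>: "0 < \<delta>" "\<delta> \<le> 1 / 2" "L * \<delta> powr (q / p) * V \<le> e"
  proof -
    show "0 < \<delta>" using e L V by (simp add: \<delta>_def)
    show "\<delta> \<le> 1 / 2" by (simp add: \<delta>_def)
    have "\<delta> powr (q / p) \<le> ((e / (L * V)) powr (p / q)) powr (q / p)" using \<open>0 < \<delta>\<close> p by (intro powr_mono2) (auto simp: \<delta>_def)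
    also have "\<dots> = e / (L * V)" using p e L V by (simp add: powr_powr)
    finally have "L * V * \<delta> powr (q / p) \<le> L * V * (e / (L * V))" using L V by (intro mult_left_mono) auto
    then show "L * \<delta> powr (q / p) * V \<le> e" using L V by (simp add: mult_ac)
  qed
  \<comment> \<open>On unmarked cubes the mean of \<open>\<psi>\<close> exceeds \<delta>, so their
    total measure is at most e' / \<delta> = e / 3.\<close>
  define e' where "e' = \<delta> * e / 3"
  have e': "e' > 0" using \<delta> e by (simp add: e'_def)
  define \<psi> where "\<psi> x = (indicator {x \<in> cube c (2 * R). v x \<noteq> 0} x + ennreal (norm (g x) powr p) :: ennreal)" for x
  have [measurable]: "\<psi> \<in> Borel" unfolding \<psi>_def by measurable
  define S where "S = {x \<in> cube c R. v x = 0}"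
  have [measurable]: "S \<in> sets borel" unfolding S_def by measurable
  have fin\<psi>: "(NN x. \<psi> x) < \<infinity>"
  proof -
    have "(NN x. \<psi> x) = leb {x \<in> cube c (2 * R). v x \<noteq> 0} + (NN x. ennreal (norm (g x) powr p))"
      unfolding \<psi>_def by (subst nn_integral_add) auto
    moreover have "leb {x \<in> cube c (2 * R). v x \<noteq> 0} \<le> leb (cube c (2 * R))" by (intro emeasure_mono) auto
    then have "leb {x \<in> cube c (2 * R). v x \<noteq> 0} < \<infinity>" using volV by (auto intro: le_less_trans)
    ultimately show ?thesis using v(3) by (simp add: integrable_iff_bounded)
  qed
  have S0: "\<psi> x = 0" if "x \<in> S" for x using that v(2) p by (simp add: S_def \<psi>_def)
  obtain U0 where U0: "open U0" "S \<subseteq> U0" "(NN x. \<psi> x * indicator U0 x) < ennreal e'"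
    using open_superset_small_integral[of \<psi> S e'] fin\<psi> S0 e' by auto
  define U where "U = U0 \<inter> interior (cube c (2 * R))"
  have U: "open U" "S \<subseteq> U" "U \<subseteq> cube c (2 * R)"
  proof -
    show "open U" using U0 by (auto simp: U_def)
    show "U \<subseteq> cube c (2 * R)" using interior_subset by (auto simp: U_def)
    have "cube c R \<subseteq> interior (cube c (2 * R))"
    proof
      fix x assume "x \<in> cube c R"
      then have "\<bar>x \<bullet> i - c \<bullet> i\<bar> < 2 * R" if "i \<in> Basis" for i using that R by (force simp: mem_cube)
      then show "x \<in> interior (cube c (2 * R))" by (simp add: cube_interior)
    qed
    then show "S \<subseteq> U" using U0(2) by (auto simp: U_def S_def)
  qed
  have [measurable]: "U \<in> sets borel" using U by auto
  have \<psi>U: "(NN x. \<psi> x * indicator U x) \<le> ennreal e'" by (rule order_trans[OF nn_integral_mono less_imp_le[OF U0(3)]]) (auto simp: U_def indicator_def)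
  \<comment> \<open>On \<open>S\<close> the gauge is the open set \<open>U\<close>; every cube of
    the covering is tagged in \<open>S\<close> and therefore lies in \<open>U\<close>.\<close>
  have ga: "gauge (\<lambda>x. if x \<in> S then U else ball x 1)" using U by (auto simp: gauge_def)
  have Sc: "S \<subseteq> cbox (c - R *\<^sub>R One) (c + R *\<^sub>R One)" by (auto simp: S_def cube_def)
  have bne: "box (c - R *\<^sub>R One) (c + R *\<^sub>R One) \<noteq> {}" using R by (auto simp: box_ne_empty inner_simps)
  obtain D where D: "countable D" "\<Union>D \<subseteq> cbox (c - R *\<^sub>R One) (c + R *\<^sub>R One)"
    "\<And>K. K \<in> D \<Longrightarrow> interior K \<noteq> {} \<and> (\<exists>c d. K = cbox c d)"
    "pairwise (\<lambda>A B. interior A \<inter> interior B = {}) D"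
    "\<And>K. K \<in> D \<Longrightarrow> \<exists>x \<in> S \<inter> K. K \<subseteq> (if x \<in> S then U else ball x 1)"
    "\<And>u v. cbox u v \<in> D \<Longrightarrow> \<exists>n. \<forall>i \<in> Basis. v \<bullet> i - u \<bullet> i = ((c + R *\<^sub>R One) \<bullet> i - (c - R *\<^sub>R One) \<bullet> i) / 2^n"
    "S \<subseteq> \<Union>D" by (rule covering_lemma[OF Sc bne ga]) (rule that; assumption)
  have KU: "K \<subseteq> U" if "K \<in> D" for K using D(5)[OF that] by auto
  have "\<exists>k r. 0 < r \<and> K = cube k r" if K: "K \<in> D" for K
  proof -
    obtain a b where ab: "K = cbox a b" using D(3)[OF K] by auto
    then obtain N where "\<forall>i \<in> Basis. b \<bullet> i - a \<bullet> i = ((c + R *\<^sub>R One) \<bullet> i - (c - R *\<^sub>R One) \<bullet> i) / 2^N" using D(6) K by blast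
    then show ?thesis using dyadic_cube[OF _ R] ab by metis
  qed
  then obtain k r where kr: "\<And>K. K \<in> D \<Longrightarrow> 0 < r K" "\<And>K. K \<in> D \<Longrightarrow> K = cube (k K) (r K)" by metis
  have Km: "K \<in> sets borel" if "K \<in> D" for K using kr(2)[OF that] by (metis cube_borel)
  obtain F where F: "finite F" "F \<subseteq> D" "leb (\<Union>D - \<Union>F) \<le> ennreal (e / 3)"
  proof (rule finite_subcover_measure[of D "cube c R" "e / 3"])
    show "leb (cube c R) < \<infinity>" using R by (simp add: emeasure_cube)
  qed (use D(1,2) Km e in \<open>auto simp: cube_def\<close>)
  have volK: "leb (interior K) = ennreal ((2 * r K) ^ n)" "leb K = ennreal ((2 * r K) ^ n)" if "K \<in> D" for K
  proof -
    have "0 \<le> r K" using kr(1)[OF that] by simp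
    then show "leb (interior K) = ennreal ((2 * r K) ^ n)" "leb K = ennreal ((2 * r K) ^ n)"
      using kr(2)[OF that] emeasure_interior_cube[of "r K" "k K"] emeasure_cube[of "r K" "k K"] by (simp_all add: n_def)
  qed
  have disj: "disjoint_family_on interior G" if "G \<subseteq> D" for G using D(4) that by (auto simp: disjoint_family_on_def pairwise_def)
  have sumV: "(\<Sum>K\<in>G. (2 * r K) ^ n) \<le> V" if G: "G \<subseteq> F" for G
  proof -
    have fG: "finite G" "G \<subseteq> D" using G F finite_subset by auto
    have "ennreal (\<Sum>K\<in>G. (2 * r K) ^ n) = (\<Sum>K\<in>G. leb (interior K))"
      using fG kr(1) by (subst sum_ennreal[symmetric]) (auto simp: volK subset_iff less_imp_le intro!: sum.cong)
    also have "\<dots> = leb (\<Union>K\<in>G. interior K)" by (rule sum_emeasure) (use fG disj[OF fG(2)] in auto)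
    also have "\<dots> \<le> leb (cube c (2 * R))"
    proof (rule emeasure_mono)
      show "(\<Union>K\<in>G. interior K) \<subseteq> cube c (2 * R)" using KU U(3) fG interior_subset by blast
    qed simp
    also have "\<dots> = ennreal V" by (rule volV)
    finally show ?thesis using V by simp
  qed
  define mk where "mk K \<longleftrightarrow> (NN x. \<psi> x * indicator K x) \<le> ennreal (\<delta> * (2 * r K) ^ n)" for K
  define D1 where "D1 = {K\<in>F. mk K}"
  define D2 where "D2 = {K\<in>F. \<not> mk K}"
  have D12: "finite D1" "finite D2" "F = D1 \<union> D2" "D1 \<subseteq> D" "D2 \<subseteq> D" "D1 \<subseteq> F" "D2 \<subseteq> F" using F by (auto simp: D1_def D2_def)
  \<comment> \<open>Summing the reversed mean inequality over disjoint interiors; cube boundaries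
    are null sets, so replacing cubes by interiors changes no integral.\<close>
  have unmarked: "leb (\<Union>D2) \<le> ennreal (e / 3)"
  proof -
    have "ennreal \<delta> * (\<Sum>K\<in>D2. ennreal ((2 * r K) ^ n)) = (\<Sum>K\<in>D2. ennreal (\<delta> * (2 * r K) ^ n))"
      unfolding sum_distrib_left
    proof (intro sum.cong refl)
      fix K assume "K \<in> D2"
      then have "0 < r K" using D12 kr(1) by auto
      then show "ennreal \<delta> * ennreal ((2 * r K) ^ n) = ennreal (\<delta> * (2 * r K) ^ n)" using \<delta> by (intro ennreal_mult[symmetric]) auto
    qed
    also have "\<dots> \<le> (\<Sum>K\<in>D2. (NN x. \<psi> x * indicator (interior K) x))"
    proof (rule sum_mono)
      fix K assume K: "K \<in> D2"
      have KD: "K \<in> D" using K D12 by auto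
      have "AE x in lborel. x \<notin> K - interior K"
      proof (rule AE_not_in)
        have "negligible (K - interior K)" using kr(2)[OF KD] by (metis cube_def negligible_frontier_interval interior_cbox)
        moreover have "K - interior K \<in> sets lborel" using Km[OF KD] by auto
        ultimately show "K - interior K \<in> null_sets lborel" using negligible_iff_null_sets null_sets_completion_iff[of "K - interior K" lborel] by blast
      qed
      then have "(NN x. \<psi> x * indicator K x) = (NN x. \<psi> x * indicator (interior K) x)"
        using interior_subset[of K] by (intro nn_integral_cong_AE) (auto elim!: eventually_mono simp: indicator_def)
      then show "ennreal (\<delta> * (2 * r K) ^ n) \<le> (NN x. \<psi> x * indicator (interior K) x)" using K by (auto simp: D2_def mk_def)
    qed
    also have "\<dots> = (NN x. (\<Sum>K\<in>D2. \<psi> x * indicator (interior K) x))" by (rule nn_integral_sum[symmetric]) auto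
    also have "\<dots> \<le> (NN x. \<psi> x * indicator U x)"
    proof (intro nn_integral_mono)
      fix x
      have "(\<Sum>K\<in>D2. indicator (interior K) x) = (indicator (\<Union>K\<in>D2. interior K) x :: ennreal)"
        by (rule indicator_UN_disjoint[symmetric]) (use D12 disj in auto)
      also have "\<dots> \<le> indicator U x"
      proof -
        have "(\<Union>K\<in>D2. interior K) \<subseteq> U" using KU D12 interior_subset by blast
        then show ?thesis by (auto simp: indicator_def)
      qed
      finally show "(\<Sum>K\<in>D2. \<psi> x * indicator (interior K) x) \<le> \<psi> x * indicator U x"
        unfolding sum_distrib_left[symmetric] by (rule mult_left_mono) simp
    qed
    also have "\<dots> \<le> ennreal \<delta> * ennreal (e / 3)" using \<psi>U \<delta> e by (simp add: e'_def ennreal_mult[symmetric])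
    finally have "(\<Sum>K\<in>D2. ennreal ((2 * r K) ^ n)) \<le> ennreal (e / 3)" using \<delta> by (subst (asm) ennreal_mult_le_mult_iff) auto
    moreover have "leb (\<Union>D2) \<le> (\<Sum>K\<in>D2. leb K)" using emeasure_subadditive_finite[of D2 "\<lambda>K. K" lborel] D12 Km by (auto simp: subset_iff)
    moreover have "(\<Sum>K\<in>D2. leb K) = (\<Sum>K\<in>D2. ennreal ((2 * r K) ^ n))" using D12 volK by (intro sum.cong) auto
    ultimately show ?thesis by simp
  qed
  \<comment> \<open>Vanishing is recorded relative to the interior of \<open>K\<close>, so the
    cut-offs of nonoverlapping cubes never interact.\<close>
  define ok where "ok K \<eta> E \<longleftrightarrow> multiplier \<eta> E \<and> (\<forall>x. 0 \<le> \<eta> x \<and> \<eta> x \<le> 1) \<and> (\<forall>x\<in>cube (k K) ((1 - t) * r K). \<eta> x = 1) \<and> zero_off (interior K) \<eta> \<and> zero_off (interior K) E \<and>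
       (grad_weight q v E) \<le> ennreal (L * \<delta> powr (q / p) * (2 * r K) ^ n)" for K \<eta> E
  have "\<exists>\<eta> E. ok K \<eta> E" if K: "K \<in> D1" for K
  proof -
    have KD: "K \<in> D" using K D12 by auto
    define \<sigma> where "\<sigma> = r K"
    define \<rho> where "\<rho> = (1 - t) * \<sigma>"
    define M where "M = \<delta> * (2 * \<sigma>) ^ n"
    have \<sigma>: "\<sigma> > 0" "0 < \<rho>" "\<rho> < \<sigma>" "\<sigma> - \<rho> = t * \<sigma>" using kr(1)[OF KD] t by (auto simp: \<sigma>_def \<rho>_def algebra_simps)
    have KQ: "K = cube (k K) \<sigma>" using kr(2)[OF KD] by (simp add: \<sigma>_def)
    have mK: "(NN x. \<psi> x * indicator K x) \<le> ennreal M" using K by (simp add: D1_def mk_def M_def \<sigma>_def)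
    have [measurable]: "K \<in> sets borel" by (rule Km[OF KD])
    have "half_zero v (k K) \<sigma>"
      unfolding half_zero_def KQ[symmetric]
    proof -
      have "leb {x \<in> K. v x \<noteq> 0} = (NN x. indicator {x \<in> K. v x \<noteq> 0} x)" by simp
      also have "\<dots> \<le> (NN x. \<psi> x * indicator K x)" using KU[OF KD] U(3) by (intro nn_integral_mono) (auto simp: indicator_def \<psi>_def)
      also note mK
      finally have "2 * leb {x \<in> K. v x \<noteq> 0} \<le> 2 * ennreal M" by (intro mult_left_mono) auto
      also have "\<dots> = ennreal (2 * M)" using \<delta> \<sigma> by (simp add: M_def ennreal_mult)
      also have "\<dots> \<le> ennreal ((2 * \<sigma>) ^ n)" using \<delta>(1,2) \<sigma> unfolding M_def by (intro ennreal_leI) (simp add: mult_left_le_one_le)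
      also have "\<dots> = leb K" using volK(2)[OF KD] by (simp add: \<sigma>_def)
      finally show "2 * leb {x \<in> K. v x \<noteq> 0} \<le> leb K" .
    qed
    moreover have "(NN x. ennreal (norm (g x) powr p) * indicator (cube (k K) \<sigma>) x) \<le> ennreal M"
      unfolding KQ[symmetric] by (rule order_trans[OF nn_integral_mono mK]) (auto simp: \<psi>_def indicator_def)
    moreover have "integrable lborel (\<lambda>x. indicator UNIV x * norm (g x) powr p)" using v(3) by simp
    moreover have "0 \<le> M" using \<delta> \<sigma> by (simp add: M_def)
    ultimately obtain \<eta> E where \<eta>: "cutoff (k K) \<rho> ((\<rho> + \<sigma>) / 2) \<eta> E" "grad_weight q v E \<le>
        ennreal (C * (\<sigma> - \<rho>) powr (1 - q - q / p) * (\<sigma> powr s * ((1 + (\<sigma> / (\<sigma> - \<rho>)) powr p) * M)) powr (q / p))"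
      using C(2)[OF v(1) \<sigma>(2,3), of UNIV 1 "k K" M] unfolding s_def n_def by auto
    have sub: "cube (k K) ((\<rho> + \<sigma>) / 2) \<subseteq> interior K"
    proof
      fix x assume x: "x \<in> cube (k K) ((\<rho> + \<sigma>) / 2)"
      have "(\<rho> + \<sigma>) / 2 < \<sigma>" using \<sigma> by simp
      then have "x \<in> interior (cube (k K) \<sigma>)" using x by (auto simp: cube_interior mem_cube intro: le_less_trans)
      then show "x \<in> interior K" using KQ by simp
    qed
    have "C * (\<sigma> - \<rho>) powr (1 - q - q / p) * (\<sigma> powr s * ((1 + (\<sigma> / (\<sigma> - \<rho>)) powr p) * M)) powr (q / p) = L * \<delta> powr (q / p) * \<sigma> ^ n"
    proof -
      have a: "\<sigma> / (\<sigma> - \<rho>) = 1 / t" using \<sigma> t by simp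
      have b: "(\<sigma> - \<rho>) powr (1 - q - q / p) = t powr (1 - q - q / p) * \<sigma> powr (1 - q - q / p)" unfolding \<sigma>(4) by (rule powr_mult)
      have M': "M = 2 ^ n * \<delta> * \<sigma> powr n" using \<sigma> by (simp add: M_def power_mult_distrib powr_realpow)
      have "\<sigma> powr s * ((1 + (\<sigma> / (\<sigma> - \<rho>)) powr p) * M) = ((1 + (1 / t) powr p) * 2 ^ n) * (\<delta> * \<sigma> powr (s + n))"
        unfolding a M' by (simp add: powr_add mult_ac)
      then have c: "(\<sigma> powr s * ((1 + (\<sigma> / (\<sigma> - \<rho>)) powr p) * M)) powr (q / p) = ((1 + (1 / t) powr p) * 2 ^ n) powr (q / p) * (\<delta> powr (q / p) * \<sigma> powr ((s + n) * (q / p)))"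
        by (simp only: powr_mult powr_powr)
      \<comment> \<open>All powers of \<sigma> combine to \<sigma>^n: the weight of a cube is
        proportional to its volume, whatever its size. This scaling is what allows arbitrarily small
        cubes.\<close>
      have ex: "(1 - q - q / p) + (s + n) * (q / p) = n"
      proof -
        have "s * (q / p) = real (n - 1) - real (n - 1) * (q / p) + q" using p by (simp add: s_def field_simps)
        moreover have "real (n - 1) = real n - 1" using n by (simp add: of_nat_diff)
        ultimately show ?thesis by (simp add: algebra_simps)
      qed
      have "\<sigma> powr (1 - q - q / p) * \<sigma> powr ((s + n) * (q / p)) = \<sigma> ^ n"
        unfolding powr_add[symmetric] ex using \<sigma> by (simp add: powr_realpow)
      then show ?thesis unfolding b c L_def by (simp add: mult_ac)
    qed
    also have "\<dots> \<le> L * \<delta> powr (q / p) * (2 * r K) ^ n" using L \<sigma> by (intro mult_left_mono power_mono) (auto simp: \<sigma>_def)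
    finally have "grad_weight q v E \<le> ennreal (L * \<delta> powr (q / p) * (2 * r K) ^ n)" using \<eta>(2) by (meson ennreal_leI order_trans)
    then show ?thesis using cutoffD[OF \<eta>(1)] cutoffD(5,6)[OF \<eta>(1), THEN zero_off_mono, OF sub]
      by (intro exI[of _ \<eta>] exI[of _ E]) (simp add: ok_def \<rho>_def \<sigma>_def)
  qed
  then obtain \<eta> E where "\<And>K. K \<in> D1 \<Longrightarrow> ok K (\<eta> K) (E K)" by metis
  then have \<eta>: "\<And>K. K \<in> D1 \<Longrightarrow> multiplier (\<eta> K) (E K)" "\<And>K x. K \<in> D1 \<Longrightarrow> 0 \<le> \<eta> K x \<and> \<eta> K x \<le> 1"
      "\<And>K x. K \<in> D1 \<Longrightarrow> x \<in> cube (k K) ((1 - t) * r K) \<Longrightarrow> \<eta> K x = 1"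
      "\<And>K. K \<in> D1 \<Longrightarrow> zero_off (interior K) (\<eta> K)" "\<And>K. K \<in> D1 \<Longrightarrow> zero_off (interior K) (E K)"
      "\<And>K. K \<in> D1 \<Longrightarrow> (grad_weight q v (E K)) \<le> ennreal (L * \<delta> powr (q / p) * (2 * r K) ^ n)"
    unfolding ok_def by blast+
  have uniq: "K = K'" if "K \<in> D1" "K' \<in> D1" "x \<in> interior K" "x \<in> interior K'" for K K' x using D(4) D12 that by (auto simp: pairwise_def)
  \<comment> \<open>At each point at most one summand is nonzero, since the interiors are disjoint;
    hence the values stay in [0, 1].\<close>
  define \<zeta> where "\<zeta> x = 1 - (\<Sum>K\<in>D1. \<eta> K x)" for x
  define Z where "Z x = 0 - (\<Sum>K\<in>D1. E K x)" for x
  have inK: "x \<in> interior K" if "K \<in> D1" "\<eta> K x \<noteq> 0 \<or> E K x \<noteq> 0" for K x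
    using \<eta>(4,5)[OF that(1)] that(2) by (auto simp: zero_off_def)
  define O' where "O' = (\<Union>K\<in>D1. interior (cube (k K) ((1 - t) * r K)))"
  have s\<eta>: "(\<Sum>K\<in>D1. \<eta> K x) = 0 \<or> (\<exists>K\<in>D1. (\<Sum>K\<in>D1. \<eta> K x) = \<eta> K x)" for x
    by (rule at_most_one_sum[OF D12(1)]) (metis inK uniq)
  have sE: "(\<Sum>K\<in>D1. E K x) = 0 \<or> (\<exists>K\<in>D1. (\<Sum>K\<in>D1. E K x) = E K x)" for x by (rule at_most_one_sum[OF D12(1)]) (metis inK uniq)
  have "open O'" unfolding O'_def by auto
  have Obor[measurable]: "O' \<in> sets borel" using \<open>open O'\<close> by auto
  have \<zeta>0: "\<zeta> x = 0" if xO: "x \<in> O'" for x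
  proof -
    obtain K where K: "K \<in> D1" "x \<in> interior (cube (k K) ((1 - t) * r K))" using xO by (auto simp: O'_def)
    have one: "\<eta> K x = 1" using \<eta>(3)[OF K(1)] K(2) interior_subset by blast
    have xK: "x \<in> interior K" using inK[OF K(1)] one by auto
    have "(\<Sum>J\<in>D1. \<eta> J x) = \<eta> K x + (\<Sum>J\<in>D1 - {K}. \<eta> J x)" using D12(1) K(1) by (simp add: sum.remove)
    moreover have "(\<Sum>J\<in>D1 - {K}. \<eta> J x) = 0" using inK uniq xK K(1) by (intro sum.neutral) blast
    ultimately show ?thesis using one by (simp add: \<zeta>_def)
  qed
  have lt1: "\<exists>K\<in>D1. x \<in> K" if "\<zeta> x < 1" for x
  proof -
    have "(\<Sum>K\<in>D1. \<eta> K x) \<noteq> 0" using that by (simp add: \<zeta>_def)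
    then obtain K where "K \<in> D1" "\<eta> K x \<noteq> 0" by (meson sum.neutral)
    then show ?thesis using inK interior_subset by blast
  qed
  have mZ: "multiplier \<zeta> Z" unfolding \<zeta>_def[abs_def] Z_def[abs_def] by (intro multiplier_diff multiplier_const multiplier_sum) (use \<eta> D12 in auto)
  show thesis
  proof (rule that[of \<zeta> Z O'])
    show "multiplier \<zeta> Z" by (rule mZ)
    show "0 \<le> \<zeta> x" "\<zeta> x \<le> 1" for x using s\<eta>[of x] \<eta>(2)[of _ x] by (auto simp: \<zeta>_def)
    show "open O'" by fact
    show "\<zeta> x = 0" if "x \<in> O'" for x by (rule \<zeta>0[OF that])
    \<comment> \<open>Where \<zeta> < 1 the point lies in a cube of the covering, hence in
      \<open>U\<close>, and if also v \<noteq> 0 then \<open>\<psi>\<close> is at least 1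
      there.\<close>
    show "leb {x. v x \<noteq> 0 \<and> \<zeta> x < 1} \<le> ennreal e"
    proof -
      note [measurable] = multiplier_measurable[OF mZ]
      have "leb {x. v x \<noteq> 0 \<and> \<zeta> x < 1} = (NN x. indicator {x. v x \<noteq> 0 \<and> \<zeta> x < 1} x)" by simp
      also have "\<dots> \<le> (NN x. \<psi> x * indicator U x)"
      proof (intro nn_integral_mono)
        fix x
        show "indicator {x. v x \<noteq> 0 \<and> \<zeta> x < 1} x \<le> \<psi> x * indicator U x"
        proof (cases "v x \<noteq> 0 \<and> \<zeta> x < 1")
          case True
          then obtain K where "K \<in> D1" "x \<in> K" using lt1 by blast
          then have "x \<in> U" "x \<in> cube c (2 * R)" using KU D12 U(3) by blast+
          then show ?thesis using True by (simp add: \<psi>_def)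
        qed simp
      qed
      also have "\<dots> \<le> ennreal e'" by (rule \<psi>U)
      also have "\<dots> \<le> ennreal e" using \<delta>(1,2) e by (intro ennreal_leI) (auto simp: e'_def field_simps intro: mult_left_le_one_le order_trans)
      finally show ?thesis .
    qed
    show "grad_weight q v Z \<le> ennreal e"
    proof -
      have mE: "E K \<in> Borel" if "K \<in> D1" for K using multiplier_measurable[OF \<eta>(1)[OF that]] by auto
      have "grad_weight q v Z \<le> (NN x. (\<Sum>K\<in>D1. ennreal (\<bar>v x\<bar> powr q * norm (E K x) powr q)))"
      proof (intro nn_integral_mono)
        fix x
        show "ennreal (\<bar>v x\<bar> powr q * norm (Z x) powr q) \<le> (\<Sum>K\<in>D1. ennreal (\<bar>v x\<bar> powr q * norm (E K x) powr q))"
          using sE[of x]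
        proof
          assume "(\<Sum>K\<in>D1. E K x) = 0" then show ?thesis by (simp add: Z_def)
        next
          assume "\<exists>K\<in>D1. (\<Sum>K\<in>D1. E K x) = E K x"
          then obtain K where K: "K \<in> D1" "(\<Sum>K\<in>D1. E K x) = E K x" by blast
          have "ennreal (\<bar>v x\<bar> powr q * norm (E K x) powr q) \<le> (\<Sum>K\<in>D1. ennreal (\<bar>v x\<bar> powr q * norm (E K x) powr q))"
            by (rule sum_nonneg_leq_bound[OF D12(1) _ refl K(1)]) auto
          then show ?thesis using K by (simp add: Z_def)
        qed
      qed
      also have "\<dots> = (\<Sum>K\<in>D1. (grad_weight q v (E K)))" by (rule nn_integral_sum) (use mE in measurable)
      also have "\<dots> \<le> (\<Sum>K\<in>D1. ennreal (L * \<delta> powr (q / p) * (2 * r K) ^ n))" by (intro sum_mono \<eta>(6))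
      also have "\<dots> = ennreal (L * \<delta> powr (q / p) * (\<Sum>K\<in>D1. (2 * r K) ^ n))"
        using L \<delta> kr(1) D12 unfolding sum_distrib_left by (subst sum_ennreal) (auto intro!: mult_nonneg_nonneg simp: subset_iff less_imp_le)
      also have "\<dots> \<le> ennreal (L * \<delta> powr (q / p) * V)" using sumV[OF D12(6)] L \<delta> by (intro ennreal_leI mult_left_mono) auto
      also have "\<dots> \<le> ennreal e" using \<delta>(3) by (rule ennreal_leI)
      finally show ?thesis .
    qed
    show "leb ({x \<in> cube c R. v x = 0} - O') \<le> ennreal e"
    proof -
      let ?I = "\<lambda>K. interior (cube (k K) ((1 - t) * r K))"
      have shell: "leb (\<Union>K\<in>D1. K - ?I K) \<le> ennreal (e / 3)"
      proof -
        have "leb (\<Union>K\<in>D1. K - ?I K) \<le> (\<Sum>K\<in>D1. leb (K - ?I K))" using D12 Km by (intro emeasure_subadditive_finite) auto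
        also have "\<dots> \<le> (\<Sum>K\<in>D1. ennreal (n * t * (2 * r K) ^ n))"
        proof (rule sum_mono)
          fix K assume K: "K \<in> D1"
          then have KD: "K \<in> D" using D12 by auto
          have r0: "r K > 0" by (rule kr(1)[OF KD])
          have vI: "leb (?I K) = ennreal ((2 * ((1 - t) * r K)) ^ n)" using r0 t by (simp add: emeasure_interior_cube n_def)
          have sub: "?I K \<subseteq> K"
          proof -
            have "(1 - t) * r K \<le> 1 * r K" using r0 t by (intro mult_right_mono) auto
            then have "cube (k K) ((1 - t) * r K) \<subseteq> cube (k K) (r K)" by (intro cube_mono) simp
            then show ?thesis using kr(2)[OF KD] interior_subset by (metis order_trans)
          qed
          have "leb (K - ?I K) = leb K - leb (?I K)" by (rule emeasure_Diff) (use vI sub Km[OF KD] in auto)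
          also have "\<dots> = ennreal ((2 * r K) ^ n - (2 * ((1 - t) * r K)) ^ n)"
            unfolding vI volK(2)[OF KD] using r0 t by (intro ennreal_minus) auto
          also have "\<dots> \<le> ennreal (n * t * (2 * r K) ^ n)"
          proof (rule ennreal_leI)
            have "1 + real n * (- t) \<le> (1 + (- t)) ^ n" by (rule Bernoulli_inequality) (use t in simp)
            then have "(1 - n * t) * (2 * r K) ^ n \<le> (1 - t) ^ n * (2 * r K) ^ n" using r0 by (intro mult_right_mono) auto
            moreover have "(1 - t) ^ n * (2 * r K) ^ n = (2 * ((1 - t) * r K)) ^ n" by (simp add: power_mult_distrib)
            ultimately show "(2 * r K) ^ n - (2 * ((1 - t) * r K)) ^ n \<le> n * t * (2 * r K) ^ n" by (simp add: algebra_simps)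
          qed
          finally show "leb (K - ?I K) \<le> ennreal (n * t * (2 * r K) ^ n)" .
        qed
        also have "\<dots> = ennreal (n * t * (\<Sum>K\<in>D1. (2 * r K) ^ n))"
          using t kr(1) D12 unfolding sum_distrib_left by (subst sum_ennreal) (auto intro!: mult_nonneg_nonneg simp: subset_iff less_imp_le)
        also have "\<dots> \<le> ennreal (n * t * V)" using sumV[OF D12(6)] t by (intro ennreal_leI mult_left_mono) auto
        also have "\<dots> \<le> ennreal (e / 3)" using t(3) by (rule ennreal_leI)
        finally show ?thesis .
      qed
      have DFm: "\<Union>D \<in> sets borel" "\<Union>F \<in> sets borel" "\<Union>D2 \<in> sets borel"
      proof -
        show "\<Union>D \<in> sets borel" using D(1) Km by (intro sets.countable_Union) auto
        show "\<Union>F \<in> sets borel" "\<Union>D2 \<in> sets borel" using F D12 Km by (auto intro!: sets.finite_Union)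
      qed
      have shm: "(\<Union>K\<in>D1. K - ?I K) \<in> sets borel" using D12 Km by (intro sets.finite_UN) auto
      \<comment> \<open>Three losses of e / 3 each: cubes beyond the finite subfamily, unmarked
        cubes, and the shells of marked cubes.\<close>
      have "leb ({x \<in> cube c R. v x = 0} - O') \<le> leb ((\<Union>D - \<Union>F) \<union> (\<Union>D2 \<union> (\<Union>K\<in>D1. K - ?I K)))"
      proof (rule emeasure_mono)
        show "{x \<in> cube c R. v x = 0} - O' \<subseteq> (\<Union>D - \<Union>F) \<union> (\<Union>D2 \<union> (\<Union>K\<in>D1. K - ?I K))"
        proof
          fix x assume x: "x \<in> {x \<in> cube c R. v x = 0} - O'"
          then have "x \<in> \<Union>D" using D(7) by (auto simp: S_def)
          moreover have "x \<in> K - ?I K" if "K \<in> D1" "x \<in> K" for K using x that by (auto simp: O'_def)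
          ultimately show "x \<in> (\<Union>D - \<Union>F) \<union> (\<Union>D2 \<union> (\<Union>K\<in>D1. K - ?I K))" using D12(3) by blast
        qed
      qed (use DFm shm in auto)
      also have "\<dots> \<le> leb (\<Union>D - \<Union>F) + leb (\<Union>D2 \<union> (\<Union>K\<in>D1. K - ?I K))"
        by (rule emeasure_subadditive) (use DFm shm in auto)
      also have "leb (\<Union>D2 \<union> (\<Union>K\<in>D1. K - ?I K)) \<le> leb (\<Union>D2) + leb (\<Union>K\<in>D1. K - ?I K)"
        by (rule emeasure_subadditive) (use DFm shm in auto)
      also have "leb (\<Union>D - \<Union>F) + (leb (\<Union>D2) + leb (\<Union>K\<in>D1. K - ?I K)) \<le> ennreal (e / 3) + (ennreal (e / 3) + ennreal (e / 3))"
        by (intro add_mono F(3) unmarked shell)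
      also have "\<dots> = ennreal e" using e by (simp flip: ennreal_plus)
      finally show ?thesis by (simp add: add_left_mono)
    qed
  qed
qed

section \<open>Weak gradients on a domain\<close>

text \<open>Lindelof's theorem reduces the cover by good neighbourhoods to a countable one.\<close>

lemma AE_local:
  assumes "\<And>x. x \<in> \<Omega> \<Longrightarrow> \<exists>U. open U \<and> x \<in> U \<and> (AE y in lebesgue. y \<in> U \<longrightarrow> Q y)"
  shows "AE y in lebesgue. y \<in> (\<Omega>::'a::euclidean_space set) \<longrightarrow> Q y"
proof -
  define \<F> where "\<F> = {U. open U \<and> (AE y in lebesgue. y \<in> U \<longrightarrow> Q y)}"
  obtain \<F>' where F: "\<F>' \<subseteq> \<F>" "countable \<F>'" "\<Union>\<F>' = \<Union>\<F>" using Lindelof[of \<F>] by (auto simp: \<F>_def)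
  have "AE y in lebesgue. \<forall>U\<in>\<F>'. y \<in> U \<longrightarrow> Q y" using F by (intro AE_ball_countable') (auto simp: \<F>_def)
  moreover have "\<exists>U\<in>\<F>'. x \<in> U" if x: "x \<in> \<Omega>" for x using assms[OF x] F(3) by (auto simp: \<F>_def)
  ultimately show ?thesis by (elim eventually_mono) blast
qed

lemma borel_representative:
  fixes f :: "'a::euclidean_space \<Rightarrow> 'b::euclidean_space"
  assumes "integrable lebesgue f"
  obtains g where "integrable lborel g" "AE x in lebesgue. f x = g x"
proof -
  have "\<exists>h. h \<in> borel_measurable lborel \<and> (AE x in lborel. f x \<bullet> b = h x)" for b
    using completion_ex_borel_measurable_real[of "\<lambda>x. f x \<bullet> b" lborel] assms by auto
  then obtain h where h: "\<And>b. h b \<in> borel_measurable lborel" "\<And>b. AE x in lborel. f x \<bullet> b = h b x" by metis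
  define g where "g x = (\<Sum>b\<in>Basis. h b x *\<^sub>R b)" for x
  have gm[measurable]: "g \<in> Borel" unfolding g_def using h(1) by (intro borel_measurable_sum) auto
  have "AE x in lborel. \<forall>b\<in>Basis. f x \<bullet> b = h b x" using h(2) by (intro AE_finite_allI) auto
  then have "AE x in lebesgue. \<forall>b\<in>Basis. f x \<bullet> b = h b x" by (rule AE_completion)
  then have ae: "AE x in lebesgue. f x = g x"
  proof eventually_elim
    case (elim x)
    have "f x = (\<Sum>b\<in>Basis. (f x \<bullet> b) *\<^sub>R b)" by (rule euclidean_representation[symmetric])
    also have "\<dots> = g x" unfolding g_def by (rule sum.cong) (use elim in auto)
    finally show ?case .
  qed
  have "integrable lebesgue g" by (rule integrable_cong_AE_imp[OF assms]) (use ae gm in \<open>auto intro: measurable_completion\<close>)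
  then have "integrable lborel g" using gm by (simp add: integrable_completion)
  then show ?thesis using ae that by blast
qed

lemma integral_lebesgue_lborel:
  fixes f :: "'a::euclidean_space \<Rightarrow> 'b::{banach, second_countable_topology}"
  assumes "f \<in> borel_measurable lebesgue" "g \<in> Borel" "AE x in lebesgue. f x = g x"
  shows "(LINT x|lebesgue. f x) = (LINT x|lborel. g x)"
proof -
  have "(LINT x|lebesgue. f x) = (LINT x|lebesgue. g x)" by (rule integral_cong_AE) (use assms in \<open>auto intro: measurable_completion\<close>)
  also have "\<dots> = (LINT x|lborel. g x)" using assms(2) by (intro integral_completion) auto
  finally show ?thesis .
qed

lemma locally_integrable_compact:
  assumes "locally_integrable \<Omega> u" "compact S" "S \<subseteq> \<Omega>"
  shows "integrable lebesgue (\<lambda>x. indicator S x *\<^sub>R u x)" using assms by (auto simp: locally_integrable_def set_integrable_def)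

lemma weak_gradient_test:
  fixes u :: "'a::euclidean_space \<Rightarrow> real"
  assumes "has_weak_gradient \<Omega> u g" "\<phi> \<in> test_functions \<Omega>" "C1 \<phi> D" "compact S" "S \<subseteq> \<Omega>" "zero_off S \<phi>" "b \<in> Basis"
  shows "(LINT x|lebesgue. (indicator S x *\<^sub>R u x) * (D x \<bullet> b)) = - (LINT x|lebesgue. ((indicator S x *\<^sub>R g x) \<bullet> b) * \<phi> x)"
proof -
  have fd: "frechet_derivative \<phi> (at x) b = D x \<bullet> b" for x using frechet_derivative_at[OF C1_derivative[OF assms(3)], of x] by metis
  have vD: "zero_off S D" by (rule C1_zero_off[OF assms(3) compact_imp_closed[OF assms(4)] assms(6)])
  have "(LINT x:\<Omega>|lebesgue. u x * frechet_derivative \<phi> (at x) b) = - (LINT x:\<Omega>|lebesgue. (g x \<bullet> b) * \<phi> x)"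
    using assms(1,2,7) by (auto simp: has_weak_gradient_def)
  moreover have "indicator \<Omega> x *\<^sub>R (u x * frechet_derivative \<phi> (at x) b) = (indicator S x *\<^sub>R u x) * (D x \<bullet> b)" for x
    using vD assms(5) unfolding fd by (cases "x \<in> S") (auto simp: zero_off_def)
  moreover have "indicator \<Omega> x *\<^sub>R ((g x \<bullet> b) * \<phi> x) = ((indicator S x *\<^sub>R g x) \<bullet> b) * \<phi> x" for x
    using assms(5,6) by (cases "x \<in> S") (auto simp: zero_off_def)
  ultimately show ?thesis unfolding set_lebesgue_integral_def by (simp only:)
qed

text \<open>For every smooth \<open>\<phi>\<close> the product \<open>\<phi> x * P x\<close> is a
  test function on \<open>\<Omega>\<close>, so \<open>P\<close> times \<open>u\<close>, extended by
  0, is weakly differentiable on the whole space. The lemma is also the passage from Lebesgue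
  measurable functions to Borel representatives.\<close>

lemma weak_gradient_localize:
  fixes u :: "'a::euclidean_space \<Rightarrow> real"
  assumes hw: "has_weak_gradient \<Omega> u g" and P: "smooth P" "C1 P DP" "compact S" "S \<subseteq> \<Omega>" "zero_off S P"
  obtains w G where "sob w G" "AE x in lebesgue. w x = P x * u x" "AE x in lebesgue. G x = P x *\<^sub>R g x + u x *\<^sub>R DP x"
proof -
  define u' where "u' x = indicator S x *\<^sub>R u x" for x
  define g' where "g' x = indicator S x *\<^sub>R g x" for x
  have iu: "integrable lebesgue u'" and ig: "integrable lebesgue g'"
  proof -
    have l: "locally_integrable \<Omega> u" "locally_integrable \<Omega> g" using hw by (auto simp: has_weak_gradient_def)
    show "integrable lebesgue u'" unfolding u'_def[abs_def] by (rule locally_integrable_compact[OF l(1) P(3,4)])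
    show "integrable lebesgue g'" unfolding g'_def[abs_def] by (rule locally_integrable_compact[OF l(2) P(3,4)])
  qed
  have vDP: "zero_off S DP" by (rule C1_zero_off[OF P(2) compact_imp_closed[OF P(3)] P(5)])
  obtain B where B: "\<And>x. \<bar>P x\<bar> \<le> B" "\<And>x. norm (DP x) \<le> B" using C1_bounds[OF P(2,3,5)] by blast
  have lm: "f \<in> borel_measurable lebesgue" if "f \<in> Borel" for f :: "'a \<Rightarrow> 'c::{topological_space}"
    using that by (auto intro: measurable_completion)
  note Pm = C1_measurable[OF P(2)] lm[OF C1_measurable(1)[OF P(2)]] lm[OF C1_measurable(2)[OF P(2)]]
  define a where "a x = P x *\<^sub>R u' x" for x
  define A where "A x = P x *\<^sub>R g' x + u' x *\<^sub>R DP x" for x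
  have ia: "integrable lebesgue a" unfolding a_def[abs_def] by (rule integrable_bounded_scaleR[OF iu _ B(1)]) (rule Pm)
  have i1: "integrable lebesgue (\<lambda>x. P x *\<^sub>R g' x)" by (rule integrable_bounded_scaleR[OF ig _ B(1)]) (rule Pm)
  have i2: "integrable lebesgue (\<lambda>x. u' x *\<^sub>R DP x)" by (rule integrable_scaleR_bounded[OF iu _ B(2)]) (rule Pm)
  have iA: "integrable lebesgue A" unfolding A_def[abs_def] using i1 i2 by simp
  obtain w where w: "integrable lborel w" "AE x in lebesgue. a x = w x" using borel_representative[OF ia] .
  obtain G where G: "integrable lborel G" "AE x in lebesgue. A x = G x" using borel_representative[OF iA] .
  have au: "a x = P x * u x" for x using P(5) by (cases "x \<in> S") (auto simp: a_def u'_def zero_off_def)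
  have AG: "A x = P x *\<^sub>R g x + u x *\<^sub>R DP x" for x using P(5) vDP by (cases "x \<in> S") (auto simp: A_def u'_def g'_def zero_off_def)
  have "sob w G"
  proof (rule sobI_smooth[OF w(1) G(1)])
    fix \<phi> D and T :: "'a set"
    assume \<phi>: "smooth \<phi>" "C1 \<phi> D" "compact T" "zero_off T \<phi>"
    obtain K where K: "\<And>x. \<bar>\<phi> x\<bar> \<le> K" "\<And>x. norm (D x) \<le> K" using C1_bounds[OF \<phi>(2,3,4)] by blast
    note \<phi>m = C1_measurable[OF \<phi>(2)] lm[OF C1_measurable(1)[OF \<phi>(2)]] lm[OF C1_measurable(2)[OF \<phi>(2)]]
    have v\<phi>P: "zero_off S (\<lambda>x. \<phi> x * P x)" using P(5) by (simp add: zero_off_def)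
    have test: "(\<lambda>x. \<phi> x * P x) \<in> test_functions \<Omega>" by (rule smooth_test_function[OF smooth_mult[OF \<phi>(1) P(1)] P(3) v\<phi>P P(4)])
    have bw: "integrable lborel (\<lambda>x. w x *\<^sub>R D x)" by (rule integrable_scaleR_bounded[OF w(1) _ K(2)]) (use \<phi>m in simp)
    have bG: "integrable lborel (\<lambda>x. \<phi> x *\<^sub>R G x)" by (rule integrable_bounded_scaleR[OF G(1) _ K(1)]) (use \<phi>m in simp)
    have "(LINT x|lborel. w x *\<^sub>R D x) \<bullet> b = (- (LINT x|lborel. \<phi> x *\<^sub>R G x)) \<bullet> b" if b: "b \<in> Basis" for b
    proof -
      have j1: "integrable lebesgue (\<lambda>x. (a x *\<^sub>R D x) \<bullet> b)"
        by (intro integrable_inner_left integrable_scaleR_bounded[OF ia _ K(2)]) (rule \<phi>m)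
      have j2: "integrable lebesgue (\<lambda>x. \<phi> x *\<^sub>R (u' x *\<^sub>R DP x) \<bullet> b)"
        by (intro integrable_inner_left integrable_bounded_scaleR[OF i2 _ K(1)]) (rule \<phi>m)
      have j3: "integrable lebesgue (\<lambda>x. \<phi> x *\<^sub>R (P x *\<^sub>R g' x) \<bullet> b)"
        by (intro integrable_inner_left integrable_bounded_scaleR[OF i1 _ K(1)]) (rule \<phi>m)
      have "(LINT x|lebesgue. u' x * ((P x *\<^sub>R D x + \<phi> x *\<^sub>R DP x) \<bullet> b)) = - (LINT x|lebesgue. (g' x \<bullet> b) * (\<phi> x * P x))"
        unfolding u'_def g'_def by (rule weak_gradient_test[OF hw test C1_mult[OF \<phi>(2) P(2)] P(3,4) v\<phi>P b])
      moreover have "(\<lambda>x. u' x * ((P x *\<^sub>R D x + \<phi> x *\<^sub>R DP x) \<bullet> b)) = (\<lambda>x. (a x *\<^sub>R D x) \<bullet> b + \<phi> x *\<^sub>R (u' x *\<^sub>R DP x) \<bullet> b)"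
        by (auto simp: a_def inner_add_left algebra_simps)
      moreover have "(\<lambda>x. (g' x \<bullet> b) * (\<phi> x * P x)) = (\<lambda>x. \<phi> x *\<^sub>R (P x *\<^sub>R g' x) \<bullet> b)" by (auto simp: mult_ac)
      ultimately have eq: "(LINT x|lebesgue. (a x *\<^sub>R D x) \<bullet> b) + (LINT x|lebesgue. \<phi> x *\<^sub>R (u' x *\<^sub>R DP x) \<bullet> b) = - (LINT x|lebesgue. \<phi> x *\<^sub>R (P x *\<^sub>R g' x) \<bullet> b)"
        by (simp only: Bochner_Integration.integral_add[OF j1 j2])
      have "(LINT x|lborel. w x *\<^sub>R D x) \<bullet> b = (LINT x|lborel. (w x *\<^sub>R D x) \<bullet> b)" by (rule integral_inner_left[symmetric]) (rule bw)
      also have "\<dots> = (LINT x|lebesgue. (a x *\<^sub>R D x) \<bullet> b)"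
      proof (rule integral_lebesgue_lborel[symmetric])
        show "(\<lambda>x. (a x *\<^sub>R D x) \<bullet> b) \<in> borel_measurable lebesgue" by (rule borel_measurable_integrable[OF j1])
        show "(\<lambda>x. (w x *\<^sub>R D x) \<bullet> b) \<in> Borel" using borel_measurable_integrable[OF integrable_inner_left[OF bw, of b]] by simp
        show "AE x in lebesgue. (a x *\<^sub>R D x) \<bullet> b = (w x *\<^sub>R D x) \<bullet> b" using w(2) by eventually_elim (simp only:)
      qed
      also have "\<dots> = - ((LINT x|lebesgue. \<phi> x *\<^sub>R (P x *\<^sub>R g' x) \<bullet> b) + (LINT x|lebesgue. \<phi> x *\<^sub>R (u' x *\<^sub>R DP x) \<bullet> b))"
        using eq by simp
      also have "(LINT x|lebesgue. \<phi> x *\<^sub>R (P x *\<^sub>R g' x) \<bullet> b) + (LINT x|lebesgue. \<phi> x *\<^sub>R (u' x *\<^sub>R DP x) \<bullet> b) = (LINT x|lebesgue. (\<phi> x *\<^sub>R A x) \<bullet> b)"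
        by (subst Bochner_Integration.integral_add[OF j3 j2, symmetric]) (simp add: A_def scaleR_add_right inner_add_left algebra_simps)
      also have "\<dots> = (LINT x|lborel. (\<phi> x *\<^sub>R G x) \<bullet> b)"
      proof (rule integral_lebesgue_lborel)
        have "integrable lebesgue (\<lambda>x. \<phi> x *\<^sub>R A x)" by (rule integrable_bounded_scaleR[OF iA _ K(1)]) (rule \<phi>m)
        then show "(\<lambda>x. (\<phi> x *\<^sub>R A x) \<bullet> b) \<in> borel_measurable lebesgue"
          by (rule borel_measurable_integrable[OF integrable_inner_left])
        show "(\<lambda>x. (\<phi> x *\<^sub>R G x) \<bullet> b) \<in> Borel" using borel_measurable_integrable[OF integrable_inner_left[OF bG, of b]] by simp
        show "AE x in lebesgue. (\<phi> x *\<^sub>R A x) \<bullet> b = (\<phi> x *\<^sub>R G x) \<bullet> b" using G(2) by eventually_elim (simp only:)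
      qed
      also have "\<dots> = (LINT x|lborel. \<phi> x *\<^sub>R G x) \<bullet> b" by (rule integral_inner_left) (rule bG)
      finally show ?thesis by simp
    qed
    then show "by_parts w G \<phi> D" by (rule euclidean_eqI)
  qed
  then show ?thesis using that w(2) G(2) au AG by (auto elim!: eventually_mono simp: eq_commute)
qed

lemma weak_gradient_test_iff:
  fixes u :: "'a::euclidean_space \<Rightarrow> real"
  assumes "locally_integrable \<Omega> u" "locally_integrable \<Omega> g"
    and "\<And>\<phi> D S b. \<phi> \<in> test_functions \<Omega> \<Longrightarrow> C1 \<phi> D \<Longrightarrow> compact S \<Longrightarrow> S \<subseteq> \<Omega> \<Longrightarrow> zero_off S \<phi> \<Longrightarrow> b \<in> Basis \<Longrightarrow>
      (LINT x|lebesgue. (indicator S x *\<^sub>R u x) * (D x \<bullet> b)) = - (LINT x|lebesgue. ((indicator S x *\<^sub>R g x) \<bullet> b) * \<phi> x)"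
  shows "has_weak_gradient \<Omega> u g"
  unfolding has_weak_gradient_def
proof (intro conjI ballI assms(1,2))
  fix \<phi> and b :: 'a assume \<phi>: "\<phi> \<in> test_functions \<Omega>" and b: "b \<in> Basis"
  obtain D S where D: "C1 \<phi> D" "compact S" "S \<subseteq> \<Omega>" "zero_off S \<phi>" "\<And>x b. frechet_derivative \<phi> (at x) b = D x \<bullet> b"
    using test_function_C1[OF \<phi>] by blast
  have vD: "zero_off S D" by (rule C1_zero_off[OF D(1) compact_imp_closed[OF D(2)] D(4)])
  have "indicator \<Omega> x *\<^sub>R (u x * frechet_derivative \<phi> (at x) b) = (indicator S x *\<^sub>R u x) * (D x \<bullet> b)" for x
    using vD D(3) unfolding D(5) by (cases "x \<in> S") (auto simp: zero_off_def)
  moreover have "indicator \<Omega> x *\<^sub>R ((g x \<bullet> b) * \<phi> x) = ((indicator S x *\<^sub>R g x) \<bullet> b) * \<phi> x" for x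
    using D(3,4) by (cases "x \<in> S") (auto simp: zero_off_def)
  ultimately show "(LINT x:\<Omega>|lebesgue. u x * frechet_derivative \<phi> (at x) b) = - (LINT x:\<Omega>|lebesgue. (g x \<bullet> b) * \<phi> x)"
    unfolding set_lebesgue_integral_def using assms(3)[OF \<phi> D(1-4) b] by (simp only:)
qed

lemma sob_has_weak_gradient:
  fixes w :: "'a::euclidean_space \<Rightarrow> real"
  assumes w: "sob w g" and \<Omega>: "\<Omega> \<in> sets lebesgue"
  shows "has_weak_gradient \<Omega> w g" "w absolutely_integrable_on \<Omega>" "g absolutely_integrable_on \<Omega>"
proof -
  note i = sobD(1,2)[OF w]
  have il: "integrable lebesgue w" "integrable lebesgue g" using i by (simp_all add: integrable_completion)
  have ai: "w absolutely_integrable_on S" "g absolutely_integrable_on S" if "S \<in> sets lebesgue" for S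
    unfolding set_integrable_def by (rule integrable_mult_indicator[OF that il(1)], rule integrable_mult_indicator[OF that il(2)])
  then show "w absolutely_integrable_on \<Omega>" "g absolutely_integrable_on \<Omega>" using \<Omega> by auto
  show "has_weak_gradient \<Omega> w g"
  proof (rule weak_gradient_test_iff)
    show "locally_integrable \<Omega> w" "locally_integrable \<Omega> g"
      unfolding locally_integrable_def using ai lmeasurable_compact fmeasurableD by blast+
    fix \<phi> D and S :: "'a set" and b :: 'a assume D: "\<phi> \<in> test_functions \<Omega>" "C1 \<phi> D" "compact S" "S \<subseteq> \<Omega>" "zero_off S \<phi>"
    have vD: "zero_off S D" by (rule C1_zero_off[OF D(2) compact_imp_closed[OF D(3)] D(5)])
    obtain K where K: "\<And>x. \<bar>\<phi> x\<bar> \<le> K" "\<And>x. norm (D x) \<le> K" using C1_bounds[OF D(2,3,5)] by blast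
    note [measurable] = C1_measurable[OF D(2)] sob_measurable[OF w]
    have bw: "integrable lborel (\<lambda>x. w x *\<^sub>R D x)" by (rule integrable_scaleR_bounded[OF i(1) _ K(2)]) simp
    have bG: "integrable lborel (\<lambda>x. \<phi> x *\<^sub>R g x)" by (rule integrable_bounded_scaleR[OF i(2) _ K(1)]) simp
    have "(LINT x|lebesgue. indicator S x *\<^sub>R w x * (D x \<bullet> b)) = (LINT x|lebesgue. (w x *\<^sub>R D x) \<bullet> b)"
      by (rule Bochner_Integration.integral_cong) (use vD in \<open>auto simp: indicator_def zero_off_def\<close>)
    also have "\<dots> = (LINT x|lborel. (w x *\<^sub>R D x) \<bullet> b)" by (rule integral_completion) measurable
    also have "\<dots> = (LINT x|lborel. w x *\<^sub>R D x) \<bullet> b" by (rule integral_inner_left) (rule bw)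
    also have "\<dots> = - ((LINT x|lborel. \<phi> x *\<^sub>R g x) \<bullet> b)" using sobD(3)[OF w D(2,3,5)] by simp
    also have "(LINT x|lborel. \<phi> x *\<^sub>R g x) \<bullet> b = (LINT x|lborel. (\<phi> x *\<^sub>R g x) \<bullet> b)" by (rule integral_inner_left[symmetric]) (rule bG)
    also have "\<dots> = (LINT x|lebesgue. (\<phi> x *\<^sub>R g x) \<bullet> b)" by (rule integral_completion[symmetric]) measurable
    also have "\<dots> = (LINT x|lebesgue. ((indicator S x *\<^sub>R g x) \<bullet> b) * \<phi> x)"
      by (rule Bochner_Integration.integral_cong) (use D(5) in \<open>auto simp: indicator_def zero_off_def\<close>)
    finally show "(LINT x|lebesgue. indicator S x *\<^sub>R w x * (D x \<bullet> b)) = - (LINT x|lebesgue. ((indicator S x *\<^sub>R g x) \<bullet> b) * \<phi> x)" .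
  qed
qed

lemma plateau_C1:
  fixes x0 :: "'a::euclidean_space"
  assumes "0 < a" "a < b"
  obtains P DP where "smooth P" "C1 P DP" "zero_off (cball x0 b) P" "\<And>x. x \<in> ball x0 a \<Longrightarrow> P x = 1" "\<And>x. x \<in> ball x0 a \<Longrightarrow> DP x = 0"
    "\<And>x. x \<in> ball x0 b \<Longrightarrow> P x > 0"
proof -
  obtain P where P: "smooth P" "\<And>x. x \<in> cball x0 a \<Longrightarrow> P x = 1" "zero_off (cball x0 b) P" "\<And>x. x \<in> ball x0 b \<Longrightarrow> P x > 0"
    by (rule smooth_plateau[OF assms, of x0]) (rule that; assumption)
  obtain DP where DP: "C1 P DP" using smooth_C1[OF P(1)] .
  have "DP x = 0" if "x \<in> ball x0 a" for x using C1_grad_zero[OF C1_diff[OF DP C1_const[of 1]] open_ball that] P(2) by simp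
  then show ?thesis using that P DP by auto
qed

text \<open>Near each point a plateau function reduces the claim to \<open>sob_unique\<close>, since
  the gradients are unchanged where the plateau is 1 and its derivative 0.\<close>

lemma weak_gradient_unique:
  fixes u :: "'a::euclidean_space \<Rightarrow> real"
  assumes "open \<Omega>" "has_weak_gradient \<Omega> u g" "has_weak_gradient \<Omega> u h"
  shows "AE x in lebesgue. x \<in> \<Omega> \<longrightarrow> g x = h x"
proof (rule AE_local)
  fix x0 assume "x0 \<in> \<Omega>"
  then obtain b where b: "b > 0" "cball x0 b \<subseteq> \<Omega>" using assms(1) open_contains_cball by blast
  obtain P DP where P: "smooth P" "C1 P DP" "zero_off (cball x0 b) P" "\<And>x. x \<in> ball x0 (b/2) \<Longrightarrow> P x = 1" "\<And>x. x \<in> ball x0 (b/2) \<Longrightarrow> DP x = 0"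
  proof (rule plateau_C1[of "b / 2" b x0])
    show "0 < b / 2" "b / 2 < b" using b by simp_all
  qed (rule that; assumption)
  obtain w1 G1 where 1: "sob w1 G1" "AE x in lebesgue. w1 x = P x * u x" "AE x in lebesgue. G1 x = P x *\<^sub>R g x + u x *\<^sub>R DP x"
    using weak_gradient_localize[OF assms(2) P(1,2) compact_cball b(2) P(3)] .
  obtain w2 G2 where 2: "sob w2 G2" "AE x in lebesgue. w2 x = P x * u x" "AE x in lebesgue. G2 x = P x *\<^sub>R h x + u x *\<^sub>R DP x"
    using weak_gradient_localize[OF assms(3) P(1,2) compact_cball b(2) P(3)] .
  note [measurable] = sob_measurable[OF 1(1)] sob_measurable[OF 2(1)]
  have "AE x in lebesgue. w2 x = w1 x" using 1(2) 2(2) by (auto elim: AE_mp)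
  then have "AE x in lborel. w2 x = w1 x" by (subst (asm) AE_completion_iff) auto
  then have "sob w1 G2" by (rule sob_AE_cong[OF 2(1)]) auto
  then have "AE x in lborel. G1 x = G2 x" by (rule sob_unique[OF 1(1)])
  then have "AE x in lebesgue. G1 x = G2 x" by (rule AE_completion)
  then have "AE x in lebesgue. x \<in> ball x0 (b/2) \<longrightarrow> g x = h x"
    using 1(3) 2(3)
  proof eventually_elim
    case (elim x) then show ?case using P(4,5)[of x] by auto
  qed
  then show "\<exists>U. open U \<and> x0 \<in> U \<and> (AE y in lebesgue. y \<in> U \<longrightarrow> g y = h y)" using b by (intro exI[of _ "ball x0 (b/2)"]) auto
qed

lemma locally_integrable_add:
  "locally_integrable \<Omega> u \<Longrightarrow> locally_integrable \<Omega> v \<Longrightarrow> locally_integrable \<Omega> (\<lambda>x. u x + v x)"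
  unfolding locally_integrable_def by (auto intro: set_integral_add)

lemma locally_integrable_scaleR:
  "locally_integrable \<Omega> u \<Longrightarrow> locally_integrable \<Omega> (\<lambda>x. c *\<^sub>R u x)"
  unfolding locally_integrable_def by (auto intro: absolutely_integrable_scaleR_left)

lemma has_weak_gradient_lincomb:
  fixes u v :: "'a::euclidean_space \<Rightarrow> real"
  assumes u: "has_weak_gradient \<Omega> u g" and v: "has_weak_gradient \<Omega> v h"
  shows "has_weak_gradient \<Omega> (\<lambda>x. u x + c * v x) (\<lambda>x. g x + c *\<^sub>R h x)"
proof (rule weak_gradient_test_iff)
  have l: "locally_integrable \<Omega> u" "locally_integrable \<Omega> g" "locally_integrable \<Omega> v" "locally_integrable \<Omega> h"
    using u v by (auto simp: has_weak_gradient_def)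
  show "locally_integrable \<Omega> (\<lambda>x. u x + c * v x)" "locally_integrable \<Omega> (\<lambda>x. g x + c *\<^sub>R h x)"
    using locally_integrable_add[OF l(1) locally_integrable_scaleR[OF l(3)]] locally_integrable_add[OF l(2) locally_integrable_scaleR[OF l(4)]] by simp_all
  fix \<phi> D and S :: "'a set" and b :: 'a
  assume t: "\<phi> \<in> test_functions \<Omega>" "C1 \<phi> D" "compact S" "S \<subseteq> \<Omega>" "zero_off S \<phi>" "b \<in> Basis"
  obtain K where K: "\<And>x. \<bar>\<phi> x\<bar> \<le> K" "\<And>x. norm (D x) \<le> K" using C1_bounds[OF t(2,3,5)] by blast
  have m: "\<phi> \<in> borel_measurable lebesgue" "D \<in> borel_measurable lebesgue" using C1_measurable[OF t(2)] by (auto intro: measurable_completion)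
  have i1: "integrable lebesgue (\<lambda>x. (indicator S x *\<^sub>R w x) * (D x \<bullet> b))" if "locally_integrable \<Omega> w" for w :: "'a \<Rightarrow> real"
    using integrable_inner_left[OF integrable_scaleR_bounded[OF locally_integrable_compact[OF that t(3,4)] m(2) K(2)], of b] by simp
  have i2: "integrable lebesgue (\<lambda>x. ((indicator S x *\<^sub>R w x) \<bullet> b) * \<phi> x)" if "locally_integrable \<Omega> w" for w :: "'a \<Rightarrow> 'a"
    using integrable_inner_left[OF integrable_bounded_scaleR[OF locally_integrable_compact[OF that t(3,4)] m(1) K(1)], of b] by (simp only: inner_scaleR_left mult.commute[of "\<phi> _"])
  have "(LINT x|lebesgue. (indicator S x *\<^sub>R (u x + c * v x)) * (D x \<bullet> b))
     = (LINT x|lebesgue. (indicator S x *\<^sub>R u x) * (D x \<bullet> b) + c * ((indicator S x *\<^sub>R v x) * (D x \<bullet> b)))"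
    by (rule Bochner_Integration.integral_cong) (auto simp: algebra_simps)
  also have "\<dots> = (LINT x|lebesgue. (indicator S x *\<^sub>R u x) * (D x \<bullet> b)) + c * (LINT x|lebesgue. (indicator S x *\<^sub>R v x) * (D x \<bullet> b))"
    by (subst Bochner_Integration.integral_add[OF i1[OF l(1)] integrable_mult_right[OF i1[OF l(3)]]]) (simp only: integral_mult_right_zero)
  also have "\<dots> = - (LINT x|lebesgue. ((indicator S x *\<^sub>R g x) \<bullet> b) * \<phi> x) + c * (- (LINT x|lebesgue. ((indicator S x *\<^sub>R h x) \<bullet> b) * \<phi> x))"
    by (simp only: weak_gradient_test[OF u t] weak_gradient_test[OF v t])
  also have "\<dots> = - (LINT x|lebesgue. ((indicator S x *\<^sub>R g x) \<bullet> b) * \<phi> x + c * (((indicator S x *\<^sub>R h x) \<bullet> b) * \<phi> x))"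
    by (subst Bochner_Integration.integral_add[OF i2[OF l(2)] integrable_mult_right[OF i2[OF l(4)]]]) (simp only: integral_mult_right_zero minus_add_distrib mult_minus_right)
  also have "\<dots> = - (LINT x|lebesgue. ((indicator S x *\<^sub>R (g x + c *\<^sub>R h x)) \<bullet> b) * \<phi> x)"
    by (rule arg_cong[where f=uminus], rule Bochner_Integration.integral_cong) (auto simp: algebra_simps inner_add_left)
  finally show "(LINT x|lebesgue. (indicator S x *\<^sub>R (u x + c * v x)) * (D x \<bullet> b)) = - (LINT x|lebesgue. ((indicator S x *\<^sub>R (g x + c *\<^sub>R h x)) \<bullet> b) * \<phi> x)" .
qed

lemma has_weak_gradient_zero: "has_weak_gradient \<Omega> (\<lambda>x. 0) (\<lambda>x. 0)" by (rule weak_gradient_test_iff) (auto simp: locally_integrable_def)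

lemma has_weak_gradient_uminus:
  fixes u :: "'a::euclidean_space \<Rightarrow> real"
  assumes "has_weak_gradient \<Omega> u g" shows "has_weak_gradient \<Omega> (\<lambda>x. - u x) (\<lambda>x. - g x)"
  using has_weak_gradient_lincomb[OF has_weak_gradient_zero assms, of "-1"] by simp

section \<open>The essential support\<close>

lemma AE_lebesgue_on_open:
  assumes "open U" shows "(AE x in lebesgue_on U. Q x) \<longleftrightarrow> (AE x in lebesgue. x \<in> U \<longrightarrow> Q x)"
  using assms by (subst AE_restrict_space_iff) auto

lemma supp_compact:
  fixes \<phi> :: "'a::euclidean_space \<Rightarrow> real"
  assumes "open \<Omega>" "compact S" "S \<subseteq> \<Omega>" "zero_off S \<phi>"
  shows "supp \<Omega> \<phi> \<subseteq> S" "compact (supp \<Omega> \<phi>)"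
proof -
  define V where "V = \<Union>{U. open U \<and> U \<subseteq> \<Omega> \<and> (AE x in lebesgue_on U. \<phi> x = 0)}"
  have oV: "open V" unfolding V_def by auto
  have "open (\<Omega> - S)" using assms by (simp add: open_Diff compact_imp_closed)
  moreover have "AE x in lebesgue_on (\<Omega> - S). \<phi> x = 0" using assms(4) by (intro AE_I2) (auto simp: zero_off_def)
  ultimately have "\<Omega> - S \<subseteq> V" unfolding V_def by blast
  then have eq: "supp \<Omega> \<phi> = S - V" using assms(3) by (auto simp: supp_def V_def[symmetric])
  show "supp \<Omega> \<phi> \<subseteq> S" using eq by auto
  show "compact (supp \<Omega> \<phi>)" unfolding eq using assms(2) oV by (rule compact_diff)
qed

text \<open>Through this fact the open set on which \<zeta> vanishes is removed from the domain of
  comparison.\<close>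

lemma supp_disjoint:
  assumes "open V" "\<And>x. x \<in> V \<Longrightarrow> x \<in> \<Omega> \<Longrightarrow> \<phi> x = 0" "open \<Omega>"
  shows "supp \<Omega> \<phi> \<inter> V = {}" using assms by (auto simp: supp_def intro!: AE_I2)

text \<open>The union removed by \<open>supp\<close> may be uncountable; vanishing almost everywhere
  passes to it through \<open>AE_local\<close>.\<close>

lemma AE_supp:
  fixes \<phi> :: "'a::euclidean_space \<Rightarrow> real"
  shows "AE x in lebesgue. x \<in> \<Omega> \<longrightarrow> \<phi> x \<noteq> 0 \<longrightarrow> x \<in> supp \<Omega> \<phi>"
proof -
  have "AE x in lebesgue. x \<in> \<Union>{U. open U \<and> U \<subseteq> \<Omega> \<and> (AE x in lebesgue_on U. \<phi> x = 0)} \<longrightarrow> \<phi> x = 0"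
    by (rule AE_local) (auto simp: AE_lebesgue_on_open)
  then show ?thesis by (auto simp: supp_def elim!: eventually_mono)
qed

text \<open>Otherwise a nonempty open subset of \<open>V\<close> would be negligible.\<close>

lemma supp_positive:
  fixes \<phi> :: "'a::euclidean_space \<Rightarrow> real"
  assumes "open V" "V \<subseteq> \<Omega>" "\<And>x. x \<in> V \<Longrightarrow> \<phi> x \<noteq> 0"
  shows "V \<subseteq> supp \<Omega> \<phi>"
proof
  fix x assume x: "x \<in> V"
  show "x \<in> supp \<Omega> \<phi>"
  proof (rule ccontr)
    assume "x \<notin> supp \<Omega> \<phi>"
    then obtain U where U: "open U" "AE x in lebesgue_on U. \<phi> x = 0" "x \<in> U" using x assms(2) by (auto simp: supp_def)
    then have "AE y in lebesgue. y \<in> U \<longrightarrow> \<phi> y = 0" by (simp add: AE_lebesgue_on_open)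
    then have "AE y in lebesgue. y \<notin> U \<inter> V" using assms(3) by (auto elim!: eventually_mono)
    then have "negligible (U \<inter> V)"
      unfolding negligible_iff_null_sets using U assms(1) by (subst AE_iff_null_sets) auto
    moreover have "open (U \<inter> V)" "U \<inter> V \<noteq> {}" using U assms(1) x by auto
    ultimately show False using open_not_negligible by blast
  qed
qed

section \<open>Caratheodory integrands\<close>

text \<open>A simple function has countable range, so its composition with \<open>f\<close> is
  measurable; continuity in the second argument carries this over to the limit.\<close>

lemma caratheodory_measurable:
  fixes f :: "'a::euclidean_space \<Rightarrow> 'a \<Rightarrow> real"
  assumes f: "\<And>z. (\<lambda>x. f x z) \<in> borel_measurable lebesgue" "\<And>x. continuous_on UNIV (f x)"
    and g: "g \<in> borel_measurable lebesgue"
  shows "(\<lambda>x. f x (g x)) \<in> borel_measurable lebesgue"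
proof -
  obtain s where s: "\<And>i. simple_function lebesgue (s i)" "\<And>x. (\<lambda>i. s i x) ----> g x"
    using borel_measurable_implies_sequence_metric[OF g, of 0] by auto
  show ?thesis
  proof (rule borel_measurable_LIMSEQ_metric)
    fix i
    have c: "countable (range (s i))" using simple_functionD(1)[OF s(1)[of i]] by (auto intro: countable_finite)
    have "s i \<in> measurable lebesgue (count_space (range (s i)))" using measurable_simple_function[OF s(1)[of i]] by (simp add: measurable_def)
    then show "(\<lambda>x. f x (s i x)) \<in> borel_measurable lebesgue" by (rule measurable_compose_countable'[OF f(1) _ c])
  next
    fix x
    show "(\<lambda>i. f x (s i x)) ----> f x (g x)" by (rule continuous_on_tendsto_compose[OF f(2) s(2)]) auto
  qed
qed

section \<open>De Giorgi iteration\<close>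

lemma tail_integral:
  fixes F w :: "'a::euclidean_space \<Rightarrow> real"
  assumes [measurable]: "F \<in> Borel" "w \<in> Borel"
    and fin: "(NN x. ennreal (F x)) < \<infinity>" and e: "0 < e"
  obtains n :: nat where "\<And>k. real n \<le> k \<Longrightarrow> (NN x. ennreal (F x) * indicator {x. k < w x} x) \<le> ennreal e"
proof -
  have "(\<lambda>n::nat. (NN x. ennreal (F x) * indicator {x. real n < w x} x)) ----> (\<integral>\<^sup>+x. 0 \<partial>(lborel :: 'a measure))"
  proof (rule nn_integral_dominated_convergence[where w="\<lambda>x. ennreal (F x)"])
    show "AE x in lborel. (\<lambda>n::nat. ennreal (F x) * indicator {x. real n < w x} x) ----> 0"
    proof (rule AE_I2)
      fix x
      obtain N :: nat where N: "w x \<le> real N" using real_arch_simple by blast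
      have "\<forall>\<^sub>F n in sequentially. ennreal (F x) * indicator {x. real n < w x} x = 0"
        using eventually_ge_at_top[of N] by eventually_elim (use N in \<open>auto simp: indicator_def\<close>)
      then show "(\<lambda>n::nat. ennreal (F x) * indicator {x. real n < w x} x) ----> 0" by (rule tendsto_eventually)
    qed
  qed (use fin in \<open>auto simp: indicator_def\<close>)
  then have "\<forall>\<^sub>F n in sequentially. (NN x. ennreal (F x) * indicator {x. real n < w x} x) < ennreal e"
    using e by (intro order_tendstoD(2)[where y=0]) auto
  then obtain n :: nat where n: "(NN x. ennreal (F x) * indicator {x. real n < w x} x) < ennreal e" by (auto simp: eventually_sequentially)
  show ?thesis
  proof (rule that[of n])
    fix k assume "real n \<le> k"
    then have "(NN x. ennreal (F x) * indicator {x. k < w x} x) \<le> (NN x. ennreal (F x) * indicator {x. real n < w x} x)"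
      by (intro nn_integral_mono) (auto simp: indicator_def)
    then show "(NN x. ennreal (F x) * indicator {x. k < w x} x) \<le> ennreal e" using n by simp
  qed
qed

text \<open>Absolute continuity of the integral: large values of \<open>F\<close> contribute little
  by \<open>tail_integral\<close>, and elsewhere \<open>F\<close> is bounded.\<close>

lemma integral_small_set:
  fixes F :: "'a::euclidean_space \<Rightarrow> real"
  assumes [measurable]: "F \<in> Borel"
    and fin: "(NN x. ennreal (F x)) < \<infinity>" and e: "0 < e"
  obtains d :: real where "0 < d"
    "\<And>A. A \<in> sets borel \<Longrightarrow> leb A \<le> ennreal d \<Longrightarrow> (NN x. ennreal (F x) * indicator A x) \<le> ennreal e"
proof -
  obtain n :: nat where n: "\<And>k. real n \<le> k \<Longrightarrow> (NN x. ennreal (F x) * indicator {x. k < F x} x) \<le> ennreal (e / 2)"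
    using tail_integral[of F F "e / 2"] fin e by auto
  define d where "d = e / (2 * (real n + 1))"
  show ?thesis
  proof (rule that)
    show "0 < d" using e by (simp add: d_def)
    fix A :: "'a set" assume [measurable]: "A \<in> sets borel" and A: "leb A \<le> ennreal d"
    have "ennreal (F x) * indicator A x \<le> ennreal (F x) * indicator {x. real n < F x} x + ennreal (real n) * indicator A x" for x
      by (cases "x \<in> A"; cases "real n < F x") (auto intro: ennreal_leI)
    then have "(NN x. ennreal (F x) * indicator A x)
      \<le> (NN x. ennreal (F x) * indicator {x. real n < F x} x + ennreal (real n) * indicator A x)" by (intro nn_integral_mono) auto
    also have "\<dots> = (NN x. ennreal (F x) * indicator {x. real n < F x} x) + ennreal (real n) * leb A" by (subst nn_integral_add) (auto simp: nn_integral_cmult)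
    also have "\<dots> \<le> ennreal (e / 2) + ennreal (real n) * ennreal d" using n[of n] A by (intro add_mono mult_left_mono) auto
    also have "\<dots> = ennreal (e / 2 + real n * d)" using e by (simp add: d_def flip: ennreal_mult ennreal_plus)
    also have "\<dots> \<le> ennreal e"
    proof (rule ennreal_leI)
      have "real n * d = (real n / (real n + 1)) * (e / 2)" by (simp add: d_def)
      also have "\<dots> \<le> 1 * (e / 2)" using e by (intro mult_right_mono) auto
      finally show "e / 2 + real n * d \<le> e" by simp
    qed
    finally show "(NN x. ennreal (F x) * indicator A x) \<le> ennreal e" .
  qed
qed

section \<open>Truncations, level sets and the gain in measure\<close>

definition trunc :: "('a \<Rightarrow> real) \<Rightarrow> real \<Rightarrow> 'a \<Rightarrow> real" where
  "trunc w k x = max (w x - k) 0"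

definition level_set :: "('a::euclidean_space \<Rightarrow> real) \<Rightarrow> 'a \<Rightarrow> real \<Rightarrow> real \<Rightarrow> 'a set" where
  "level_set w c r k = {x \<in> cube c r. k < w x}"

lemma level_set_measurable[measurable]:
  assumes [measurable]: "w \<in> Borel" shows "level_set w c r k \<in> sets borel" by (simp add: level_set_def)

lemma level_set_mono: "r \<le> s \<Longrightarrow> k \<le> h \<Longrightarrow> level_set w c r h \<subseteq> level_set w c s k"
  using cube_mono[of r s c] by (auto simp: level_set_def)

lemma emeasure_level_set_finite: "0 \<le> r \<Longrightarrow> leb (level_set w c r k) < \<infinity>"
proof -
  assume r: "0 \<le> r"
  have "leb (level_set w c r k) \<le> leb (cube c r)" by (rule emeasure_mono) (auto simp: level_set_def)
  also have "\<dots> < \<infinity>" using r by (simp add: emeasure_cube)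
  finally show ?thesis .
qed

text \<open>On the upper level set the truncation times the cut-off is at least h - k, so the
  Gagliardo-Nirenberg inequality for p = 1 bounds its measure with the power n/(n - 1) > 1.
  Poincare's inequality controls the term with the gradient of the cut-off.\<close>

lemma measure_gain:
  fixes w :: "'a::euclidean_space \<Rightarrow> real"
  defines "s \<equiv> DIM('a) / (DIM('a) - 1)"
  assumes w: "sob w W" and k: "0 \<le> k" "k < h" and r: "0 < \<rho>" "\<rho> < \<sigma>"
    and half: "half_zero (trunc w k) c \<sigma>" and n: "DIM('a) \<ge> 2"
  shows "ennreal ((h - k) powr s) * leb (level_set w c \<rho> h)
    \<le> epowr (ennreal (2 + 32 * real DIM('a) ^ 2 * 2 ^ DIM('a) * \<sigma> / (\<sigma> - \<rho>)) *
        (NN x. ennreal (norm (W x)) * indicator (level_set w c \<sigma> k) x)) s"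
proof -
  define v where "v = trunc w k"
  define g where "g x = indicator {x. w x > k} x *\<^sub>R W x" for x
  have v: "sob v g" unfolding v_def trunc_def[abs_def] g_def[abs_def] by (rule sob_pos_part[OF w k(1)])
  note [measurable] = sob_measurable[OF w] sob_measurable[OF v]
  have s: "s > 0" using n by (simp add: s_def)
  obtain \<eta> E where e0: "cutoff c \<rho> \<sigma> \<eta> E" "\<And>x. norm (E x) \<le> 4 * DIM('a) / (\<sigma> - \<rho>)"
    by (rule plain_cutoff[OF r, of c]) (rule that; assumption)
  note e = cutoffD[OF e0(1)]
  note [measurable] = multiplier_measurable[OF e(1)]
  define z where "z x = \<eta> x *\<^sub>R g x + v x *\<^sub>R E x" for x
  have sz: "sob (\<lambda>x. \<eta> x * v x) z" unfolding z_def[abs_def] by (rule multiplier_sob[OF e(1) v])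
  have vz: "zero_off (cube c \<sigma>) (\<lambda>x. \<eta> x * v x)" using e(5) by (simp add: zero_off_def)
  define J where "J = (NN x. ennreal (norm (W x)) * indicator (level_set w c \<sigma> k) x)"
  have gJ: "(NN x. ennreal (norm (g x)) * indicator (cube c \<sigma>) x) = J"
    unfolding J_def by (rule nn_integral_cong) (auto simp: g_def level_set_def indicator_def)
  define D where "D = 4 * DIM('a) / (\<sigma> - \<rho>)"
  have D: "0 \<le> D" using r by (simp add: D_def)
  define A where "A = 2 * (2 * \<sigma> * DIM('a)) * 2 ^ DIM('a)"
  have A: "0 \<le> A" using r by (simp add: A_def)
  have "integrable lborel (\<lambda>x. indicator UNIV x * norm (g x) powr 1)" using sobD(2)[OF v] by simp
  from Poincare_half[OF v _ _ this zero_less_one, of \<sigma> c] half r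
  have P: "(NN x. ennreal \<bar>v x\<bar> * indicator (cube c \<sigma>) x) \<le> ennreal (2 * (2 * \<sigma> * DIM('a)) * 2 ^ DIM('a)) * J"
    unfolding half_zero_def v_def[symmetric] gJ[symmetric] by simp
  have "(NN x. ennreal (norm (z x))) \<le> ennreal 2 * J + ennreal (2 * D) * (NN x. ennreal \<bar>v x\<bar> * indicator (cube c \<sigma>) x)"
    using cutoff_gradient[OF e0, of 1 v g] D r unfolding gJ[symmetric] z_def D_def by simp
  also have "\<dots> \<le> ennreal 2 * J + ennreal (2 * D) * (ennreal A * J)"
    unfolding A_def by (intro add_left_mono mult_left_mono P) auto
  also have "\<dots> = (ennreal 2 + ennreal (2 * D) * ennreal A) * J" by (simp only: distrib_right mult.assoc)
  also have "ennreal 2 + ennreal (2 * D) * ennreal A = ennreal (2 + 2 * D * A)" using D A by (subst ennreal_plus) (auto simp: ennreal_mult)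
  \<comment> \<open>Here D = 4 n / (\<sigma> - \<rho>) and A = 4 n \<sigma> 2^n.\<close>
  also have "2 + 2 * D * A = 2 + 32 * real DIM('a) ^ 2 * 2 ^ DIM('a) * \<sigma> / (\<sigma> - \<rho>)" by (simp add: A_def D_def power2_eq_square)
  finally have I: "(NN x. ennreal (norm (z x))) \<le> ennreal (2 + 32 * real DIM('a) ^ 2 * 2 ^ DIM('a) * \<sigma> / (\<sigma> - \<rho>)) * J" .
  have "ennreal ((h - k) powr s) * leb (level_set w c \<rho> h)
      = (NN x. ennreal ((h - k) powr s) * indicator (level_set w c \<rho> h) x)" by (subst nn_integral_cmult) auto
  also have "\<dots> \<le> (NN x. epowr (ennreal \<bar>\<eta> x * v x\<bar>) s)"
  proof (rule nn_integral_mono)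
    fix x :: 'a
    show "ennreal ((h - k) powr s) * indicator (level_set w c \<rho> h) x \<le> epowr (ennreal \<bar>\<eta> x * v x\<bar>) s"
    proof (cases "x \<in> level_set w c \<rho> h")
      case True
      then have "\<eta> x = 1" "h - k \<le> v x" using e(4)[of x] by (auto simp: level_set_def v_def trunc_def)
      then have "ennreal ((h - k) powr s) \<le> ennreal (\<bar>\<eta> x * v x\<bar> powr s)" using k s by (intro ennreal_leI powr_mono2) auto
      then show ?thesis using True s by (simp add: epowr_ennreal)
    qed auto
  qed
  also have "\<dots> \<le> epowr (NN x. ennreal (norm (z x))) s" unfolding s_def by (rule GNS_sob[OF sz vz n])
  also have "\<dots> \<le> epowr (ennreal (2 + 32 * real DIM('a) ^ 2 * 2 ^ DIM('a) * \<sigma> / (\<sigma> - \<rho>)) * J) s" using s by (intro epowr_mono I) auto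
  finally show ?thesis unfolding J_def .
qed

text \<open>The linear term alone contracts by \<theta>; the superlinear one stays below (1 -
  \<theta>)/2 times the current bound, which leaves the rate \<tau> halfway between \<theta> and 1.
  The ratio \<open>l\<close> is chosen such that (l^i)^(-\<beta>) = \<tau>^(-\<kappa> i), a growth
  that the extra power \<kappa> of X exactly compensates.\<close>

lemma geometric_iteration:
  fixes X :: "nat \<Rightarrow> real"
  assumes \<theta>: "0 \<le> \<theta>" "\<theta> < 1" and K: "0 \<le> K" and \<kappa>: "0 < \<kappa>" and \<beta>: "0 < \<beta>"
    and X: "\<And>i. 0 \<le> X i" "X 0 \<le> 1" "K * X 0 powr \<kappa> \<le> (1 - \<theta>) / 2"
  defines "\<tau> \<equiv> (1 + \<theta>) / 2"
  defines "l \<equiv> \<tau> powr (\<kappa> / \<beta>)"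
  assumes step: "\<And>i. X i \<le> 1 \<Longrightarrow> X (Suc i) \<le> \<theta> * X i + K * (l ^ i) powr (- \<beta>) * X i powr (1 + \<kappa>)"
  shows "X i \<le> X 0 * \<tau> ^ i"
proof (induction i)
  case (Suc i)
  have \<tau>: "0 < \<tau>" "\<tau> < 1" using \<theta> by (auto simp: \<tau>_def)
  define T where "T = \<tau> ^ i"
  have T: "0 < T" "T \<le> 1" using \<tau> by (auto simp: T_def power_le_one)
  have lT: "(l ^ i) powr (- \<beta>) = T powr (- \<kappa>)" using \<tau> \<beta> by (simp add: l_def T_def powr_realpow[symmetric] powr_powr mult.commute)
  have le: "X i \<le> X 0 * T" using Suc by (simp add: T_def)
  have "X i \<le> 1 * 1" using le X(1,2) T by (elim order_trans) (intro mult_mono, auto)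
  then have "X (Suc i) \<le> \<theta> * X i + K * T powr (- \<kappa>) * X i powr (1 + \<kappa>)" using step[of i] lT by simp
  also have "\<dots> \<le> \<theta> * (X 0 * T) + K * T powr (- \<kappa>) * (X 0 * T) powr (1 + \<kappa>)"
    using le X(1) \<theta> K \<kappa> by (intro add_mono mult_left_mono powr_mono2) auto
  also have "(X 0 * T) powr (1 + \<kappa>) = (X 0 * X 0 powr \<kappa>) * (T * T powr \<kappa>)" using X(1)[of 0] T by (simp add: powr_mult powr_add)
  also have "K * T powr (- \<kappa>) * ((X 0 * X 0 powr \<kappa>) * (T * T powr \<kappa>)) = (K * X 0 powr \<kappa>) * (X 0 * T) * (T powr (- \<kappa>) * T powr \<kappa>)"
    by (simp add: mult_ac)
  also have "T powr (- \<kappa>) * T powr \<kappa> = 1" using T by (simp add: powr_add[symmetric])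
  also have "\<theta> * (X 0 * T) + K * X 0 powr \<kappa> * (X 0 * T) * 1 \<le> \<theta> * (X 0 * T) + (1 - \<theta>) / 2 * (X 0 * T)"
    using mult_right_mono[OF X(3), of "X 0 * T"] X(1)[of 0] T by simp
  also have "\<dots> = X 0 * (\<tau> * T)" by (simp add: \<tau>_def field_simps)
  also have "\<dots> = X 0 * \<tau> ^ Suc i" by (simp add: T_def)
  finally show ?case .
qed simp

text \<open>What the iteration uses of a quasi-minimizer. \<open>\<Psi>\<close> stands for f (x, Du)
  as a Borel function and \<open>S\<close> for the essential support of \<tau> (w - k)_+, known only
  through the points it contains and the open sets it avoids. Where w <= k the competitor agrees
  with u, so \<open>\<Psi>\<close> stands on both sides there, with the factor \<open>B\<close> on
  the right; the clause on open sets \<open>V\<close> is the means to keep \<open>S\<close> away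
  from that region.\<close>

locale energy_class =
  fixes p q B R :: real and \<Psi> w :: "'a::euclidean_space \<Rightarrow> real" and W :: "'a \<Rightarrow> 'a" and c :: 'a
  assumes dim: "DIM('a) \<ge> 2" and pq: "admissible (DIM('a) - 1) p q" and B: "0 \<le> B" and R: "0 < R"
    and sob: "sob w W" and Wp: "integrable lborel (\<lambda>x. norm (W x) powr p)"
    and Psi_measurable[measurable]: "\<Psi> \<in> Borel" and Psi_nonneg: "\<And>x. 0 \<le> \<Psi> x"
    and Psi_finite: "(NN x. ennreal (\<Psi> x) * indicator (cube c R) x) < \<infinity>"
    and coercive: "AE x in lborel. x \<in> cube c R \<longrightarrow> 0 < w x \<longrightarrow> norm (W x) powr p \<le> \<Psi> x + 1"
    and energy: "\<And>k \<tau> E. 0 \<le> k \<Longrightarrow> multiplier \<tau> E \<Longrightarrow> (\<And>x. 0 \<le> \<tau> x) \<Longrightarrow> (\<And>x. \<tau> x \<le> 1) \<Longrightarrow>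
      zero_off (cube c R) \<tau> \<Longrightarrow> zero_off (cube c R) E \<Longrightarrow>
      \<exists>S. S \<in> sets borel \<and> S \<subseteq> cube c R \<and> (AE x in lborel. k < w x \<longrightarrow> \<tau> x \<noteq> 0 \<longrightarrow> x \<in> S) \<and>
        (\<forall>V. open V \<longrightarrow> (\<forall>x\<in>V. k < w x \<longrightarrow> \<tau> x = 0) \<longrightarrow> S \<inter> V = {}) \<and>
        (NN x. ennreal (\<Psi> x) * indicator S x) \<le> ennreal B * (NN x. ennreal
          (if k < w x then (1 - \<tau> x) * \<Psi> x + ((w x - k) * norm (E x)) powr q + 1 else \<Psi> x) * indicator S x)"
begin

lemmas [measurable] = sob_measurable[OF sob]

lemma trunc_sob:
  assumes "0 \<le> k" shows "sob (trunc w k) (\<lambda>x. indicator {x. w x > k} x *\<^sub>R W x)"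
  unfolding trunc_def[abs_def] by (rule sob_pos_part[OF sob assms])

lemma trunc_gradient_integrable:
  "integrable lborel (\<lambda>x. norm (indicator {x. w x > k} x *\<^sub>R W x) powr p)"
  by (rule Bochner_Integration.integrable_bound[OF Wp]) (auto simp: indicator_def)

text \<open>The product \<tau> = \<eta> \<zeta> is inserted into \<open>energy\<close>. Then
  \<open>S\<close> avoids the open set on which \<zeta> = 0, so it meets {w <= k} in a set of small
  measure only, and every contribution of \<zeta> is a multiple of an arbitrary
  \<open>e\<close>.\<close>

lemma caccioppoli_pre:
  assumes k: "0 \<le> k" and r: "0 < \<rho>" "\<rho> < \<sigma>" "\<sigma> \<le> R"
    and cut: "cutoff c \<rho> ((\<rho> + \<sigma>) / 2) \<eta> E"
    and N: "grad_weight q (trunc w k) E \<le> N"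
  shows "(NN x. ennreal (\<Psi> x) * indicator (level_set w c \<rho> k) x)
    \<le> ennreal B * ((NN x. ennreal (\<Psi> x) * indicator (level_set w c \<sigma> k - level_set w c \<rho> k) x)
        + leb (level_set w c \<sigma> k) + ennreal (2 powr q) * N)" (is "?L \<le> ennreal B * (?I + ?m + _)")
proof (rule ennreal_le_epsilon)
  fix e' :: real assume e': "0 < e'"
  note \<eta> = cutoffD[OF cut]
  have q: "q > 0" using pq by (auto simp: admissible_def)
  define v where "v = trunc w k"
  define g where "g x = indicator {x. w x > k} x *\<^sub>R W x" for x
  have v: "sob v g" using trunc_sob[OF k] by (simp add: v_def g_def[abs_def])
  have v0: "v x = 0 \<longleftrightarrow> w x \<le> k" for x by (auto simp: v_def trunc_def)
  have vw: "v x = w x - k" if "k < w x" for x using that by (auto simp: v_def trunc_def)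
  note [measurable] = sob_measurable[OF v] multiplier_measurable[OF \<eta>(1)]
  \<comment> \<open>Total coefficient of \<open>e\<close>: two small integrals of
    \<open>\<Psi>\<close> and the weight of \<open>Z\<close>, multiplied by \<open>B\<close>, and
    one more small integral of \<open>\<Psi>\<close> from the left-hand side.\<close>
  define K where "K = 1 + B * (2 + 2 powr q)"
  have K: "K \<ge> 1" using B by (simp add: K_def)
  define e where "e = e' / K"
  have e: "0 < e" using e' K by (simp add: e_def)
  define F where "F x = indicator (cube c R) x * \<Psi> x" for x
  have Fm: "F \<in> Borel" unfolding F_def[abs_def] by measurable
  have Ff: "(NN x. ennreal (F x)) < \<infinity>"
  proof -
    have "(NN x. ennreal (F x)) = (NN x. ennreal (\<Psi> x) * indicator (cube c R) x)" by (rule nn_integral_cong) (auto simp: F_def indicator_def)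
    then show ?thesis using Psi_finite by simp
  qed
  obtain d where d: "0 < d" "\<And>A. A \<in> sets borel \<Longrightarrow> leb A \<le> ennreal d \<Longrightarrow> (NN x. ennreal (F x) * indicator A x) \<le> ennreal e"
    using integral_small_set[OF Fm Ff e] by metis
  \<comment> \<open>Small as a measure, for the absolute continuity of the integral, and small as a
    bound for the gradient weight of \<open>Z\<close>.\<close>
  define e1 where "e1 = min d e"
  have e1: "0 < e1" using d e by (simp add: e1_def)
  have gv: "g x = 0" if "v x = 0" for x using that v0 by (auto simp: g_def indicator_def)
  have gi: "integrable lborel (\<lambda>x. norm (g x) powr p)" using trunc_gradient_integrable[of k] by (simp only: g_def[abs_def])
  obtain \<zeta> Z O' where \<zeta>: "multiplier \<zeta> Z" "\<And>x. 0 \<le> \<zeta> x" "\<And>x. \<zeta> x \<le> 1" "open O'" "\<And>x. x \<in> O' \<Longrightarrow> \<zeta> x = 0"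
    "leb ({x \<in> cube c R. v x = 0} - O') \<le> ennreal e1"
    "leb {x. v x \<noteq> 0 \<and> \<zeta> x < 1} \<le> ennreal e1"
    "grad_weight q v Z \<le> ennreal e1" by (rule zero_set_cutoff[OF pq v gv gi R e1, where c=c]) (assumption, (rule that; assumption))
  note [measurable] = multiplier_measurable[OF \<zeta>(1)]
  define \<tau> where "\<tau> x = \<eta> x * \<zeta> x" for x
  define H where "H x = \<eta> x *\<^sub>R Z x + \<zeta> x *\<^sub>R E x" for x
  have m: "multiplier \<tau> H" unfolding \<tau>_def[abs_def] H_def[abs_def] by (rule multiplier_mult[OF \<eta>(1) \<zeta>(1)])
  have sub: "cube c ((\<rho> + \<sigma>) / 2) \<subseteq> cube c \<sigma>" "cube c \<sigma> \<subseteq> cube c R" by (rule cube_mono; use r in simp)+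
  have \<tau>: "\<And>x. 0 \<le> \<tau> x" "\<And>x. \<tau> x \<le> 1" using \<eta>(2,3) \<zeta>(2,3) by (auto simp: \<tau>_def intro: mult_le_one)
  have vt: "zero_off (cube c R) \<tau>" "zero_off (cube c R) H"
  proof -
    have "\<eta> x = 0" "E x = 0" if "x \<notin> cube c R" for x using \<eta>(5,6) sub that unfolding zero_off_def by blast+
    then show "zero_off (cube c R) \<tau>" "zero_off (cube c R) H" by (auto simp: zero_off_def \<tau>_def H_def)
  qed
  obtain S where S: "S \<in> sets borel" "S \<subseteq> cube c R" "AE x in lborel. k < w x \<longrightarrow> \<tau> x \<noteq> 0 \<longrightarrow> x \<in> S"
     "\<And>V. open V \<Longrightarrow> (\<And>x. x \<in> V \<Longrightarrow> k < w x \<Longrightarrow> \<tau> x = 0) \<Longrightarrow> S \<inter> V = {}"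
     "(NN x. ennreal (\<Psi> x) * indicator S x) \<le> ennreal B * (NN x. ennreal
          (if k < w x then (1 - \<tau> x) * \<Psi> x + ((w x - k) * norm (H x)) powr q + 1 else \<Psi> x) * indicator S x)"
    using energy[OF k m \<tau> vt] by (metis (no_types, lifting))
  note [measurable] = S(1)
  have SO: "S \<inter> O' = {}" by (rule S(4)[OF \<zeta>(4)]) (simp add: \<tau>_def \<zeta>(5))
  have S\<sigma>: "S \<subseteq> cube c ((\<rho> + \<sigma>) / 2)"
  proof -
    have "S \<inter> - cube c ((\<rho> + \<sigma>) / 2) = {}" by (rule S(4)) (use \<eta>(5) in \<open>auto simp: \<tau>_def zero_off_def open_Compl\<close>)
    then show ?thesis by blast
  qed
  \<comment> \<open>The two defects of \<zeta>: \<open>T\<close>, where it cuts into {v \<noteq> 0},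
    and \<open>Y\<close>, the part of the zero set that \<open>O'\<close> misses.\<close>
  define T where "T = {x. v x \<noteq> 0 \<and> \<zeta> x < 1}"
  define Y where "Y = {x \<in> cube c R. v x = 0} - O'"
  have [measurable]: "T \<in> sets borel" "Y \<in> sets borel" by (auto simp: T_def Y_def intro!: sets.Diff sets.Int cube_borel borel_open[OF \<zeta>(4)])
  define iT where "iT = (NN x. ennreal (F x) * indicator T x)"
  define iY where "iY = (NN x. ennreal (F x) * indicator Y x)"
  have iTY: "iT \<le> ennreal e" "iY \<le> ennreal e"
    unfolding iT_def iY_def using \<zeta>(6,7) by (auto intro!: d(2) simp: T_def[symmetric] Y_def[symmetric] e1_def min_le_iff_disj intro: order_trans[OF _ ennreal_leI])
  have "?L \<le> (NN x. ennreal (\<Psi> x) * indicator S x + ennreal (F x) * indicator T x)"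
  proof (rule nn_integral_mono_AE)
    show "AE x in lborel. ennreal (\<Psi> x) * indicator (level_set w c \<rho> k) x \<le> ennreal (\<Psi> x) * indicator S x + ennreal (F x) * indicator T x"
      using S(3)
    proof eventually_elim
      case (elim x)
      show ?case
      proof (cases "x \<in> level_set w c \<rho> k")
        case True
        then have x: "x \<in> cube c \<rho>" "k < w x" by (auto simp: level_set_def)
        have xR: "x \<in> cube c R" using x(1) cube_mono[of \<rho> R c] r by auto
        show ?thesis
        proof (cases "\<zeta> x < 1")
          case True
          then have "x \<in> T" using x v0[of x] by (auto simp: T_def)
          then show ?thesis using xR by (auto simp: F_def indicator_def)
        next
          case False
          then have "\<tau> x \<noteq> 0" using \<eta>(4)[OF x(1)] by (auto simp: \<tau>_def)
          then have "x \<in> S" using elim x by auto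
          then show ?thesis by (auto simp: indicator_def)
        qed
      qed auto
    qed
  qed
  also have "\<dots> = (NN x. ennreal (\<Psi> x) * indicator S x) + iT" using Fm by (subst nn_integral_add) (auto simp: iT_def)
  also have "\<dots> \<le> ennreal B * (?I + ?m + ennreal (2 powr q) * N + ennreal ((2 + 2 powr q) * e)) + ennreal e"
  proof (intro add_mono iTY(1) order_trans[OF S(5)] mult_left_mono)
    let ?D = "level_set w c \<sigma> k - level_set w c \<rho> k"
    let ?lhs = "\<lambda>x. ennreal (if k < w x then (1 - \<tau> x) * \<Psi> x + ((w x - k) * norm (H x)) powr q + 1 else \<Psi> x) * indicator S x"
    let ?rhs = "\<lambda>x. ennreal (\<Psi> x) * indicator ?D x + (indicator (level_set w c \<sigma> k) x
         + (ennreal (2 powr q) * ennreal (\<bar>v x\<bar> powr q * norm (E x) powr q)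
         + (ennreal (2 powr q) * ennreal (\<bar>v x\<bar> powr q * norm (Z x) powr q)
         + (ennreal (F x) * indicator T x + ennreal (F x) * indicator Y x))))"
    have pt: "?lhs x
      \<le> ?rhs x" for x
    proof (cases "x \<in> S")
      case xS: True
      then have x: "x \<in> cube c \<sigma>" "x \<in> cube c R" "x \<notin> O'" using S\<sigma> sub SO by auto
      show ?thesis
      proof (cases "k < w x")
        case True
        have lev: "x \<in> level_set w c \<sigma> k" using True x by (auto simp: level_set_def)
        define t1 where "t1 = (if x \<in> ?D then \<Psi> x else 0)"
        define t2 where "t2 = (if x \<in> T then \<Psi> x else 0)"
        have t: "0 \<le> t1" "0 \<le> t2" using Psi_nonneg by (auto simp: t1_def t2_def)
        \<comment> \<open>On the inner cube the factor 1 - \<tau> vanishes off \<open>T\<close>;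
          every other point of the level set in question lies in the shell.\<close>
        have 1: "(1 - \<tau> x) * \<Psi> x \<le> t1 + t2"
        proof (cases "x \<in> cube c \<rho>")
          case False
          then have "t1 = \<Psi> x" using lev by (auto simp: t1_def level_set_def)
          moreover have "(1 - \<tau> x) * \<Psi> x \<le> 1 * \<Psi> x" using \<tau>(1) Psi_nonneg by (intro mult_right_mono) auto
          ultimately show ?thesis using t by simp
        next
          case in_rho: True
          show ?thesis
          proof (cases "\<zeta> x < 1")
            case True
            then have "x \<in> T" using \<open>k < w x\<close> v0[of x] by (auto simp: T_def)
            then have "t2 = \<Psi> x" by (simp add: t2_def)
            moreover have "(1 - \<tau> x) * \<Psi> x \<le> 1 * \<Psi> x" using \<tau>(1) Psi_nonneg by (intro mult_right_mono) auto
            ultimately show ?thesis using t by simp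
          next
            case False
            then have "\<tau> x = 1" using \<zeta>(3)[of x] \<eta>(4)[OF in_rho] by (simp add: \<tau>_def)
            then show ?thesis using t by simp
          qed
        qed
        have "norm (H x) \<le> norm (\<eta> x *\<^sub>R Z x) + norm (\<zeta> x *\<^sub>R E x)" unfolding H_def by (rule norm_triangle_ineq)
        also have "\<dots> \<le> 1 * norm (Z x) + 1 * norm (E x)"
          unfolding norm_scaleR using \<eta>(2,3)[of x] \<zeta>(2,3)[of x] by (intro add_mono mult_right_mono) auto
        finally have "(w x - k) * norm (H x) \<le> (w x - k) * (norm (E x) + norm (Z x))" using True by (intro mult_left_mono) auto
        also have "\<dots> = \<bar>v x\<bar> * norm (E x) + \<bar>v x\<bar> * norm (Z x)" using True vw[of x] by (simp add: distrib_left)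
        finally have "((w x - k) * norm (H x)) powr q \<le> (\<bar>v x\<bar> * norm (E x) + \<bar>v x\<bar> * norm (Z x)) powr q"
          using True q by (intro powr_mono2) auto
        also have "\<dots> \<le> 2 powr q * ((\<bar>v x\<bar> * norm (E x)) powr q + (\<bar>v x\<bar> * norm (Z x)) powr q)" using q by (intro powr_add_le) auto
        finally have 2: "((w x - k) * norm (H x)) powr q \<le> 2 powr q * (\<bar>v x\<bar> powr q * norm (E x) powr q) + 2 powr q * (\<bar>v x\<bar> powr q * norm (Z x) powr q)"
          by (simp add: powr_mult distrib_left)
        have "ennreal ((1 - \<tau> x) * \<Psi> x + ((w x - k) * norm (H x)) powr q + 1)
          \<le> ennreal (t1 + (1 + (2 powr q * (\<bar>v x\<bar> powr q * norm (E x) powr q) + (2 powr q * (\<bar>v x\<bar> powr q * norm (Z x) powr q) + (t2 + 0)))))"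
          by (rule ennreal_leI) (use 1 2 in linarith)
        also have "\<dots> = ennreal t1 + (1 + (ennreal (2 powr q) * ennreal (\<bar>v x\<bar> powr q * norm (E x) powr q)
         + (ennreal (2 powr q) * ennreal (\<bar>v x\<bar> powr q * norm (Z x) powr q) + (ennreal t2 + 0))))" using t by (simp add: ennreal_mult)
        also have "\<dots> \<le> ?rhs x" using lev x by (intro add_mono order_refl) (auto simp: t1_def t2_def F_def)
        finally show ?thesis using True xS by simp
      next
        case False
        then have "x \<in> Y" using x v0[of x] by (auto simp: Y_def)
        then have "ennreal (\<Psi> x) = ennreal (F x) * indicator Y x" using x by (simp add: F_def)
        then show ?thesis using False xS by (simp add: add_increasing)
      qed
    qed simp
    have "(NN x. ?lhs x)
      \<le> (NN x. ?rhs x)" by (rule nn_integral_mono) (rule pt)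
    also have "\<dots> = ?I + (?m + (ennreal (2 powr q) * (grad_weight q v E)
         + (ennreal (2 powr q) * (grad_weight q v Z) + (iT + iY))))" using Fm by (simp add: nn_integral_add nn_integral_cmult iT_def iY_def)
    also have "\<dots> \<le> ?I + (?m + (ennreal (2 powr q) * N + (ennreal (2 powr q) * ennreal e + (ennreal e + ennreal e))))"
      using N \<zeta>(8) iTY by (intro add_mono mult_left_mono order_refl) (auto simp: v_def e1_def intro: order_trans[OF _ ennreal_leI])
    also have "\<dots> = ?I + ?m + ennreal (2 powr q) * N + ennreal ((2 + 2 powr q) * e)"
      using e by (simp add: algebra_simps ennreal_mult ennreal_plus[symmetric] add.assoc)
    finally show "(NN x. ?lhs x)
      \<le> ?I + ?m + ennreal (2 powr q) * N + ennreal ((2 + 2 powr q) * e)" .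
  qed simp
  also have "\<dots> = ennreal B * (?I + ?m + ennreal (2 powr q) * N) + ennreal (B * ((2 + 2 powr q) * e) + e)"
    using B e by (simp add: distrib_left ennreal_mult add.assoc)
  also have "B * ((2 + 2 powr q) * e) + e = K * e" by (simp add: K_def algebra_simps)
  also have "K * e = e'" using K by (simp add: e_def)
  finally show "?L \<le> ennreal B * (?I + ?m + ennreal (2 powr q) * N) + ennreal e'" .
qed

section \<open>The excess, hole filling and the decay estimate\<close>

definition psi_on :: "real \<Rightarrow> real \<Rightarrow> real" where
  "psi_on k r = enn2real (NN x. ennreal (\<Psi> x) * indicator (level_set w c r k) x)"

definition vol :: "real \<Rightarrow> real \<Rightarrow> real" where
  "vol k r = measure lborel (level_set w c r k)"

text \<open>Coercivity bounds |W|^p by \<Psi> + 1, so the volume has to accompany the energy; the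
  gain in measure and the Caccioppoli inequality then act on one quantity.\<close>

definition excess :: "real \<Rightarrow> real \<Rightarrow> real" where
  "excess k r = psi_on k r + vol k r"

lemma psi_on_eq:
  assumes "r \<le> R"
  shows "(NN x. ennreal (\<Psi> x) * indicator (level_set w c r k) x) = ennreal (psi_on k r)"
proof -
  have "(NN x. ennreal (\<Psi> x) * indicator (level_set w c r k) x) \<le> (NN x. ennreal (\<Psi> x) * indicator (cube c R) x)"
    using cube_mono[OF assms, of c] by (intro nn_integral_mono) (auto simp: indicator_def level_set_def)
  then have "(NN x. ennreal (\<Psi> x) * indicator (level_set w c r k) x) < top" using Psi_finite by (simp add: le_less_trans)
  then show ?thesis unfolding psi_on_def by (simp add: ennreal_enn2real)
qed

lemma vol_eq: "0 \<le> r \<Longrightarrow> leb (level_set w c r k) = ennreal (vol k r)"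
  unfolding vol_def by (rule emeasure_eq_ennreal_measure) (use emeasure_level_set_finite[of r w c k] in auto)

lemma psi_on_nonneg: "0 \<le> psi_on k r" by (simp add: psi_on_def)

lemma vol_nonneg: "0 \<le> vol k r" by (simp add: vol_def)

lemma excess_nonneg: "0 \<le> excess k r" by (simp add: excess_def psi_on_nonneg vol_nonneg)

lemma psi_on_mono:
  assumes "r \<le> s" "s \<le> R" "k \<le> h" shows "psi_on h r \<le> psi_on k s"
proof -
  have "(NN x. ennreal (\<Psi> x) * indicator (level_set w c r h) x) \<le> (NN x. ennreal (\<Psi> x) * indicator (level_set w c s k) x)"
    using level_set_mono[OF assms(1,3), of w c] by (intro nn_integral_mono) (auto simp: indicator_def)
  then show ?thesis using assms by (simp add: psi_on_eq psi_on_nonneg)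
qed

lemma vol_mono:
  assumes "0 \<le> r" "r \<le> s" "k \<le> h" shows "vol h r \<le> vol k s"
proof -
  have "leb (level_set w c r h) \<le> leb (level_set w c s k)" by (rule emeasure_mono[OF level_set_mono[OF assms(2,3)]]) simp
  then show ?thesis using assms by (simp add: vol_eq vol_nonneg)
qed

lemma excess_mono: "0 \<le> r \<Longrightarrow> r \<le> s \<Longrightarrow> s \<le> R \<Longrightarrow> k \<le> h \<Longrightarrow> excess h r \<le> excess k s"
  unfolding excess_def by (intro add_mono psi_on_mono vol_mono)

lemma excess_eq:
  assumes "0 \<le> r" "r \<le> R"
  shows "(NN x. ennreal (\<Psi> x + 1) * indicator (level_set w c r k) x) = ennreal (excess k r)"
proof -
  have "(NN x. ennreal (\<Psi> x + 1) * indicator (level_set w c r k) x)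
    = (NN x. ennreal (\<Psi> x) * indicator (level_set w c r k) x + indicator (level_set w c r k) x)"
    using Psi_nonneg by (intro nn_integral_cong) (auto simp: indicator_def)
  also have "\<dots> = ennreal (psi_on k r) + ennreal (vol k r)" using assms by (simp add: nn_integral_add psi_on_eq vol_eq)
  finally show ?thesis by (simp add: excess_def psi_on_nonneg vol_nonneg)
qed

lemma gradient_bounds:
  assumes k: "0 \<le> k" and r: "0 \<le> r" "r \<le> R"
  shows "(NN x. ennreal (norm (indicator {x. w x > k} x *\<^sub>R W x) powr p) * indicator (cube c r) x) \<le> ennreal (excess k r)"
    and "(NN x. ennreal (norm (W x)) * indicator (level_set w c r k) x) \<le> ennreal (2 * excess k r)"
proof -
  have p: "1 \<le> p" using pq by (simp add: admissible_def)
  have sub: "x \<in> cube c R" "0 < w x" if "x \<in> level_set w c r k" for x using that cube_mono[OF r(2), of c] k by (auto simp: level_set_def)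
  have "(NN x. ennreal (norm (indicator {x. w x > k} x *\<^sub>R W x) powr p) * indicator (cube c r) x)
      \<le> (NN x. ennreal (\<Psi> x + 1) * indicator (level_set w c r k) x)"
  proof (rule nn_integral_mono_AE)
    show "AE x in lborel. ennreal (norm (indicator {x. w x > k} x *\<^sub>R W x) powr p) * indicator (cube c r) x
       \<le> ennreal (\<Psi> x + 1) * indicator (level_set w c r k) x"
      using coercive
    proof eventually_elim
      case (elim x)
      show ?case
      proof (cases "x \<in> level_set w c r k")
        case True
        then show ?thesis using elim sub[OF True] by (auto simp: level_set_def indicator_def intro!: ennreal_leI)
      next
        case False
        then show ?thesis using p by (auto simp: level_set_def indicator_def)
      qed
    qed
  qed
  then show "(NN x. ennreal (norm (indicator {x. w x > k} x *\<^sub>R W x) powr p) * indicator (cube c r) x) \<le> ennreal (excess k r)"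
    by (simp only: excess_eq[OF r])
  have "(NN x. ennreal (norm (W x)) * indicator (level_set w c r k) x)
      \<le> (NN x. ennreal 2 * (ennreal (\<Psi> x + 1) * indicator (level_set w c r k) x))"
  proof (rule nn_integral_mono_AE)
    show "AE x in lborel. ennreal (norm (W x)) * indicator (level_set w c r k) x
       \<le> ennreal 2 * (ennreal (\<Psi> x + 1) * indicator (level_set w c r k) x)"
      using coercive
    proof eventually_elim
      case (elim x)
      show ?case
      proof (cases "x \<in> level_set w c r k")
        case True
        have "norm (W x) \<le> 1 + norm (W x) powr p"
        proof (cases "norm (W x) \<le> 1")
          case False
          then have "norm (W x) powr 1 \<le> norm (W x) powr p" using p by (intro powr_mono) auto
          then show ?thesis using False by simp
        qed (simp add: add_increasing2)
        also have "\<dots> \<le> 2 * (\<Psi> x + 1)" using elim sub[OF True] Psi_nonneg[of x] by simp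
        finally have "ennreal (norm (W x)) \<le> ennreal (2 * (\<Psi> x + 1))" by (rule ennreal_leI)
        then show ?thesis using True Psi_nonneg[of x] by (subst (asm) ennreal_mult) auto
      qed auto
    qed
  qed
  also have "\<dots> = ennreal 2 * ennreal (excess k r)" using excess_eq[OF r, of k] by (subst nn_integral_cmult) auto
  also have "\<dots> = ennreal (2 * excess k r)" using excess_nonneg by (simp add: ennreal_mult)
  finally show "(NN x. ennreal (norm (W x)) * indicator (level_set w c r k) x) \<le> ennreal (2 * excess k r)" .
qed

text \<open>Hole filling: adding \<open>B\<close> times the inner integral to both sides completes
  the shell to the larger set, with factor \<theta> = B / (1 + B) < 1. Compared with
  \<open>good_cutoff\<close> there is an extra power d^(-q): it comes from bounding (\<sigma> / d)^p
  by (R / d)^p, which is then raised to q/p.\<close>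

lemma caccioppoli:
  obtains \<theta> K where "0 \<le> \<theta>" "\<theta> < 1" "0 \<le> K"
    "\<And>k \<rho> \<sigma>. 0 \<le> k \<Longrightarrow> R / 2 \<le> \<rho> \<Longrightarrow> \<rho> < \<sigma> \<Longrightarrow> \<sigma> \<le> R \<Longrightarrow> half_zero (trunc w k) c \<sigma> \<Longrightarrow>
       psi_on k \<rho> \<le> \<theta> * excess k \<sigma> + K * (\<sigma> - \<rho>) powr (1 - 2 * q - q / p) * excess k \<sigma> powr (q / p)"
proof -
  have p: "1 \<le> p" "p < q" using pq by (simp_all add: admissible_def)
  define s where "s = real (DIM('a) - 1) * p / q - real (DIM('a) - 1) + p"
  \<comment> \<open>The exponent \<open>s\<close> may have either sign, so the powers of both ends
    of the range of \<sigma> are added.\<close>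
  define R1 where "R1 = R powr s + (R / 2) powr s"
  have R1: "\<sigma> powr s \<le> R1" if "R / 2 \<le> \<sigma>" "\<sigma> \<le> R" for \<sigma>
  proof (cases "0 \<le> s")
    case True
    then have "\<sigma> powr s \<le> R powr s" using that R by (intro powr_mono2) auto
    then show ?thesis by (simp add: R1_def add_increasing2)
  next
    case False
    then have "\<sigma> powr s \<le> (R / 2) powr s" using that R by (intro powr_mono2') auto
    then show ?thesis by (simp add: R1_def add_increasing)
  qed
  have R1n: "0 \<le> R1" by (simp add: R1_def)
  define c1 where "c1 = (R1 * (2 * R powr p)) powr (q / p)"
  show ?thesis
  proof (rule good_cutoff[OF pq], goal_cases)
    case (1 C)
    note C = 1(1) and gc = 1(2)
    define \<theta> where "\<theta> = B / (1 + B)"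
    define K where "K = \<theta> * (2 powr q * (C * c1))"
    have \<theta>: "0 \<le> \<theta>" "\<theta> < 1" using B by (auto simp: \<theta>_def field_simps)
    have K: "0 \<le> K" using \<theta> C by (auto simp: K_def c1_def)
    show ?thesis
    proof (rule that[OF \<theta> K])
      fix k \<rho> \<sigma> assume k: "0 \<le> k" and r: "R / 2 \<le> \<rho>" "\<rho> < \<sigma>" "\<sigma> \<le> R" and half: "half_zero (trunc w k) c \<sigma>"
      define d where "d = \<sigma> - \<rho>"
      define M where "M = excess k \<sigma>"
      have M: "0 \<le> M" by (simp add: M_def excess_nonneg)
      have d: "0 < d" "d \<le> \<sigma>" "\<sigma> / d \<le> R / d" using r R by (auto simp: d_def divide_right_mono)
      have r0: "0 < \<rho>" "0 \<le> \<sigma>" using r R by auto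
      define N where "N = C * (\<sigma> - \<rho>) powr (1 - q - q / p) * (\<sigma> powr s * ((1 + (\<sigma> / (\<sigma> - \<rho>)) powr p) * M)) powr (q / p)"
      have gi: "integrable lborel (\<lambda>x. indicator UNIV x * norm (indicator {x. w x > k} x *\<^sub>R W x) powr p)"
        using trunc_gradient_integrable[of k] by simp
      obtain \<eta> E where \<eta>: "cutoff c \<rho> ((\<rho> + \<sigma>) / 2) \<eta> E" "grad_weight q (trunc w k) E \<le> ennreal N"
        using gc[OF trunc_sob[OF k] r0(1) r(2) gi zero_less_one subset_UNIV half M] gradient_bounds(1)[OF k r0(2) r(3)]
        unfolding N_def s_def M_def by blast
      have "N \<le> C * (c1 * d powr (1 - 2 * q - q / p) * M powr (q / p))"
      proof -
        have "1 \<le> (R / d) powr p" using d r p by (intro ge_one_powr_ge_zero) auto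
        moreover have "(\<sigma> / d) powr p \<le> (R / d) powr p" using d r0 p by (intro powr_mono2) auto
        ultimately have "1 + (\<sigma> / d) powr p \<le> 2 * (R / d) powr p" by simp
        also have "(R / d) powr p = R powr p * d powr (- p)" using R d by (simp add: powr_divide powr_minus_divide)
        finally have a: "1 + (\<sigma> / d) powr p \<le> 2 * (R powr p * d powr (- p))" .
        have "\<sigma> powr s * ((1 + (\<sigma> / d) powr p) * M) \<le> R1 * ((2 * (R powr p * d powr (- p))) * M)"
          using R1[of \<sigma>] r a M R1n by (intro mult_mono) auto
        also have "\<dots> = (R1 * (2 * R powr p)) * (d powr (- p) * M)" by (simp add: mult_ac)
        finally have "(\<sigma> powr s * ((1 + (\<sigma> / d) powr p) * M)) powr (q / p) \<le> ((R1 * (2 * R powr p)) * (d powr (- p) * M)) powr (q / p)"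
          using p M by (intro powr_mono2) auto
        also have "\<dots> = c1 * ((d powr (- p)) powr (q / p) * M powr (q / p))" unfolding c1_def by (simp only: powr_mult)
        also have "(d powr (- p)) powr (q / p) = d powr (- q)" using p by (simp add: powr_powr)
        finally have "N \<le> C * d powr (1 - q - q / p) * (c1 * (d powr (- q) * M powr (q / p)))"
          unfolding N_def d_def[symmetric] using C by (intro mult_left_mono) auto
        also have "\<dots> = C * (c1 * (d powr (1 - q - q / p) * d powr (- q)) * M powr (q / p))" by (simp add: mult_ac)
        also have "d powr (1 - q - q / p) * d powr (- q) = d powr (1 - 2 * q - q / p)"
          unfolding powr_add[symmetric] by (rule arg_cong[where f="\<lambda>t. d powr t"]) simp
        finally show ?thesis .
      qed
      then have N: "2 powr q * N \<le> 2 powr q * (C * c1) * (d powr (1 - 2 * q - q / p) * M powr (q / p))" by (simp add: mult_ac)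
      have N0: "0 \<le> N" using C by (simp add: N_def)
      define I where "I = (NN x. ennreal (\<Psi> x) * indicator (level_set w c \<sigma> k - level_set w c \<rho> k) x)"
      have sub: "level_set w c \<rho> k \<subseteq> level_set w c \<sigma> k" using r by (intro level_set_mono) auto
      have "I + ennreal (psi_on k \<rho>) = ennreal (psi_on k \<sigma>)"
      proof -
        have "I + ennreal (psi_on k \<rho>) = (NN x. ennreal (\<Psi> x) * indicator (level_set w c \<sigma> k - level_set w c \<rho> k) x
            + ennreal (\<Psi> x) * indicator (level_set w c \<rho> k) x)"
          unfolding I_def using r by (subst nn_integral_add) (auto simp: psi_on_eq[symmetric])
        also have "\<dots> = (NN x. ennreal (\<Psi> x) * indicator (level_set w c \<sigma> k) x)" using sub by (intro nn_integral_cong) (auto simp: indicator_def)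
        finally show ?thesis using r by (simp add: psi_on_eq)
      qed
      moreover from this have "I \<noteq> top" by (metis ennreal_less_top ennreal_add_eq_top less_irrefl)
      ultimately obtain i where i: "I = ennreal i" "0 \<le> i" "i + psi_on k \<rho> = psi_on k \<sigma>"
        using psi_on_nonneg by (cases I) (auto simp flip: ennreal_plus)
      have "ennreal (psi_on k \<rho>) \<le> ennreal B * (I + ennreal (vol k \<sigma>) + ennreal (2 powr q) * ennreal N)"
        using caccioppoli_pre[OF k r0(1) r(2,3) \<eta>] r unfolding I_def[symmetric] by (simp add: psi_on_eq vol_eq r0)
      also have "\<dots> = ennreal (B * (i + vol k \<sigma> + 2 powr q * N))"
        unfolding i using i(2) B N0 vol_nonneg by (simp add: ennreal_mult)
      finally have "psi_on k \<rho> \<le> B * (i + vol k \<sigma> + 2 powr q * N)" using B i N0 vol_nonneg[of k \<sigma>] by simp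
      moreover have "i = psi_on k \<sigma> - psi_on k \<rho>" using i(3) by simp
      ultimately have "(1 + B) * psi_on k \<rho> \<le> B * (excess k \<sigma> + 2 powr q * N)" unfolding excess_def by (simp add: algebra_simps)
      then have "psi_on k \<rho> \<le> \<theta> * (excess k \<sigma> + 2 powr q * N)" using B by (simp add: \<theta>_def field_simps)
      also have "\<dots> \<le> \<theta> * (excess k \<sigma> + 2 powr q * (C * c1) * (d powr (1 - 2 * q - q / p) * M powr (q / p)))"
        using N \<theta> by (intro mult_left_mono add_left_mono)
      also have "\<dots> = \<theta> * excess k \<sigma> + K * (\<sigma> - \<rho>) powr (1 - 2 * q - q / p) * excess k \<sigma> powr (q / p)"
        by (simp add: K_def d_def M_def algebra_simps)
      finally show "psi_on k \<rho> \<le> \<theta> * excess k \<sigma> + K * (\<sigma> - \<rho>) powr (1 - 2 * q - q / p) * excess k \<sigma> powr (q / p)" .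
    qed
  qed
qed

text \<open>\<open>measure_gain\<close>, with the integral of |W| over the level set bounded by
  twice the excess.\<close>

lemma volume_gain:
  defines "s \<equiv> real DIM('a) / (real DIM('a) - 1)"
  obtains L where "0 \<le> L" "\<And>k h \<rho> \<sigma>. 0 \<le> k \<Longrightarrow> k < h \<Longrightarrow> 0 < \<rho> \<Longrightarrow> \<rho> < \<sigma> \<Longrightarrow> \<sigma> \<le> R \<Longrightarrow> half_zero (trunc w k) c \<sigma> \<Longrightarrow>
     vol h \<rho> \<le> L * ((h - k) * (\<sigma> - \<rho>)) powr (- s) * excess k \<sigma> powr s"
proof -
  have s: "0 < s" using dim by (simp add: s_def)
  have s_eq: "real DIM('a) / real (DIM('a) - 1) = s" using dim by (simp add: s_def of_nat_diff)
  define c2 where "c2 = 2 * R + 32 * real DIM('a) ^ 2 * 2 ^ DIM('a) * R"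
  have c2: "0 \<le> c2" using R by (simp add: c2_def)
  show ?thesis
  proof (rule that)
    show "0 \<le> (2 * c2) powr s" by simp
    fix k h \<rho> \<sigma> assume k: "0 \<le> k" "k < h" and r: "0 < \<rho>" "\<rho> < \<sigma>" "\<sigma> \<le> R" and half: "half_zero (trunc w k) c \<sigma>"
    define d where "d = \<sigma> - \<rho>"
    have d: "0 < d" "d \<le> R" using r by (auto simp: d_def)
    define M where "M = excess k \<sigma>"
    have M: "0 \<le> M" by (simp add: M_def excess_nonneg)
    have A: "2 + 32 * real DIM('a) ^ 2 * 2 ^ DIM('a) * \<sigma> / (\<sigma> - \<rho>) \<le> c2 / d"
    proof -
      have "2 \<le> 2 * R / d" using d by (simp add: field_simps)
      moreover have "32 * real DIM('a) ^ 2 * 2 ^ DIM('a) * \<sigma> / d \<le> 32 * real DIM('a) ^ 2 * 2 ^ DIM('a) * R / d"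
        using d r by (intro divide_right_mono mult_left_mono) auto
      ultimately show ?thesis by (simp add: c2_def d_def add_divide_distrib)
    qed
    have "ennreal ((h - k) powr s * vol h \<rho>) = ennreal ((h - k) powr s) * leb (level_set w c \<rho> h)" using r vol_nonneg by (simp add: vol_eq ennreal_mult)
    also have "\<dots> \<le> epowr (ennreal (2 + 32 * real DIM('a) ^ 2 * 2 ^ DIM('a) * \<sigma> / (\<sigma> - \<rho>)) *
        (NN x. ennreal (norm (W x)) * indicator (level_set w c \<sigma> k) x)) s"
      using measure_gain[OF sob k r(1,2) half dim] unfolding s_eq .
    also have "\<dots> \<le> epowr (ennreal (c2 / d) * ennreal (2 * M)) s"
      using s k r by (intro epowr_mono mult_mono ennreal_leI A) (auto simp: M_def intro: gradient_bounds(2))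
    also have "\<dots> = ennreal ((c2 / d * (2 * M)) powr s)" using s c2 d M by (simp add: ennreal_mult[symmetric] epowr_ennreal del: ennreal_mult)
    finally have "(h - k) powr s * vol h \<rho> \<le> (c2 / d * (2 * M)) powr s" by simp
    then have "vol h \<rho> \<le> (c2 / d * (2 * M)) powr s / (h - k) powr s" using k by (simp add: field_simps)
    also have "\<dots> = (2 * c2) powr s * ((h - k) powr (- s) * d powr (- s)) * M powr s" by (simp add: powr_mult powr_divide powr_minus_divide mult_ac)
    also have "(h - k) powr (- s) * d powr (- s) = ((h - k) * d) powr (- s)" by (rule powr_mult[symmetric])
    finally show "vol h \<rho> \<le> (2 * c2) powr s * ((h - k) * (\<sigma> - \<rho>)) powr (- s) * excess k \<sigma> powr s" by (simp add: d_def M_def)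
  qed
qed

text \<open>The outer half of the shell is spent on the gain in measure from level k to level h, the
  inner half on the Caccioppoli inequality at level h. The latter contracts only the energy part of
  the excess; the volume part is superlinear by the former.\<close>

lemma excess_decay:
  defines "s \<equiv> real DIM('a) / (real DIM('a) - 1)"
  obtains \<theta> K where "0 \<le> \<theta>" "\<theta> < 1" "0 \<le> K"
    "\<And>k h \<rho> \<sigma>. 0 \<le> k \<Longrightarrow> k < h \<Longrightarrow> R / 2 \<le> \<rho> \<Longrightarrow> \<rho> < \<sigma> \<Longrightarrow> \<sigma> \<le> R \<Longrightarrow>
       half_zero (trunc w k) c \<sigma> \<Longrightarrow> half_zero (trunc w h) c ((\<rho> + \<sigma>) / 2) \<Longrightarrow>
       excess h \<rho> \<le> \<theta> * excess k \<sigma> + K * (((h - k) * (\<sigma> - \<rho>)) powr (- s) * excess k \<sigma> powr s + (\<sigma> - \<rho>) powr (1 - 2 * q - q / p) * excess k \<sigma> powr (q / p))"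
proof -
  have p: "1 \<le> p" "p < q" using pq by (simp_all add: admissible_def)
  show ?thesis
  proof (rule caccioppoli, rule volume_gain, goal_cases)
  case (1 \<theta> K L)
  note \<theta> = 1(1-3) and cac = 1(4) and L = 1(5) and gain = 1(6)[folded s_def]
  define b where "b = 1 - 2 * q - q / p"
  \<comment> \<open>Each half shell has width d/2, whence the powers of 1/2; the gain is counted
    twice, for the volume itself and for its appearance next to \<theta>.\<close>
  define K' where "K' = 2 * L * (1 / 2) powr (- s) + K * (1 / 2) powr b"
  show ?thesis
  proof (rule that[OF \<theta>(1,2)])
    show "0 \<le> K'" using L \<theta> by (simp add: K'_def)
    fix k h \<rho> \<sigma> assume k: "0 \<le> k" "k < h" and r: "R / 2 \<le> \<rho>" "\<rho> < \<sigma>" "\<sigma> \<le> R"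
      and half: "half_zero (trunc w k) c \<sigma>" "half_zero (trunc w h) c ((\<rho> + \<sigma>) / 2)"
    define r' where "r' = (\<rho> + \<sigma>) / 2"
    define d where "d = \<sigma> - \<rho>"
    define M where "M = excess k \<sigma>"
    have d: "0 < d" "\<sigma> - r' = d * (1 / 2)" "r' - \<rho> = d * (1 / 2)" using r by (auto simp: d_def r'_def field_simps)
    have r': "\<rho> < r'" "r' < \<sigma>" "0 < \<rho>" "0 < r'" "r' \<le> R" using r R by (auto simp: r'_def)
    have M: "0 \<le> M" "excess h r' \<le> M" unfolding M_def using r r' k by (auto intro: excess_nonneg excess_mono)
    define U where "U = ((h - k) * d) powr (- s) * M powr s"
    define V where "V = d powr b * M powr (q / p)"
    have UV: "0 \<le> U" "0 \<le> V" by (simp_all add: U_def V_def)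
    have g: "vol h r' \<le> L * (1 / 2) powr (- s) * U"
    proof -
      have "vol h r' \<le> L * ((h - k) * (\<sigma> - r')) powr (- s) * M powr s"
        unfolding M_def using k r r' half by (intro gain) auto
      also have "(h - k) * (\<sigma> - r') = (1 / 2) * ((h - k) * d)" unfolding d(2) by (simp add: mult_ac)
      also have "\<dots> powr (- s) = (1 / 2) powr (- s) * ((h - k) * d) powr (- s)" by (rule powr_mult)
      finally show ?thesis by (simp add: U_def mult_ac)
    qed
    have "psi_on h \<rho> \<le> \<theta> * excess h r' + K * (r' - \<rho>) powr b * excess h r' powr (q / p)"
      unfolding b_def using k r r' half by (intro cac) (auto simp: r'_def)
    also have "\<dots> \<le> \<theta> * (M + L * (1 / 2) powr (- s) * U) + K * (r' - \<rho>) powr b * M powr (q / p)"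
    proof (intro add_mono mult_left_mono powr_mono2)
      have "psi_on h r' \<le> M" using psi_on_mono[of r' \<sigma> k h] r r' k vol_nonneg[of k \<sigma>] by (simp add: M_def excess_def)
      then show "excess h r' \<le> M + L * (1 / 2) powr (- s) * U" using g by (simp add: excess_def)
    qed (use \<theta> M p in \<open>auto simp: excess_nonneg\<close>)
    also have "(r' - \<rho>) powr b = d powr b * (1 / 2) powr b" unfolding d(3) by (rule powr_mult)
    also have "\<theta> * (M + L * (1 / 2) powr (- s) * U) \<le> \<theta> * M + 1 * (L * (1 / 2) powr (- s) * U)"
      unfolding distrib_left using \<theta> L UV by (intro add_left_mono mult_right_mono) auto
    finally have y: "psi_on h \<rho> \<le> \<theta> * M + L * (1 / 2) powr (- s) * U + K * (1 / 2) powr b * V" by (simp add: V_def mult_ac)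
    have "vol h \<rho> \<le> vol h r'" using r' by (intro vol_mono) auto
    then have "excess h \<rho> \<le> \<theta> * M + (2 * L * (1 / 2) powr (- s)) * U + K * (1 / 2) powr b * V" using y g unfolding excess_def by simp
    also have "\<dots> \<le> \<theta> * M + K' * U + K' * V"
      unfolding K'_def using UV L \<theta> by (intro add_mono mult_right_mono order_refl) auto
    finally show "excess h \<rho> \<le> \<theta> * excess k \<sigma> + K' * (((h - k) * (\<sigma> - \<rho>)) powr (- s) * excess k \<sigma> powr s + (\<sigma> - \<rho>) powr (1 - 2 * q - q / p) * excess k \<sigma> powr (q / p))"
      by (simp add: U_def V_def d_def M_def b_def distrib_left)
  qed
  qed
qed

text \<open>Levels increase from n towards n + 1 while radii decrease from R towards R/2. The excess
  tends to 0 along the sequence, so {w > n + 1} is null in the limiting cube. The start n is taken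
  so large that the initial excess is small.\<close>

theorem bounded_above:
  obtains C where "AE x in lborel. x \<in> cube c (R / 2) \<longrightarrow> w x \<le> C"
proof -
  have p: "1 \<le> p" "p < q" using pq by (simp_all add: admissible_def)
  define s where "s = real DIM('a) / (real DIM('a) - 1)"
  have s: "1 < s" using dim by (simp add: s_def)
  define b where "b = 2 * q + q / p - 1"
  have "0 \<le> q / p" using p by simp
  then have b: "0 < b" "1 - 2 * q - q / p = - b" using p unfolding b_def by linarith+
  show ?thesis
  proof (rule excess_decay, goal_cases)
  case (1 \<theta> K)
  note \<theta> = 1(1,2) and K = 1(3) and decay = 1(4)[folded s_def, unfolded b(2)]
  \<comment> \<open>This is positive because both \<open>s\<close> and q/p exceed 1. \<beta>
    dominates the two powers of the step size; the gain in measure carries it twice, in the level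
    step and in the radius step.\<close>
  define \<kappa> where "\<kappa> = min s (q / p) - 1"
  define \<beta> where "\<beta> = max (2 * s) b"
  have \<kappa>: "0 < \<kappa>" "1 + \<kappa> \<le> s" "1 + \<kappa> \<le> q / p" using s p by (auto simp: \<kappa>_def)
  have \<beta>: "0 < \<beta>" "2 * s \<le> \<beta>" "b \<le> \<beta>" using s by (auto simp: \<beta>_def)
  define \<tau> where "\<tau> = (1 + \<theta>) / 2"
  define l where "l = \<tau> powr (\<kappa> / \<beta>)"
  have \<tau>: "0 < \<tau>" "\<tau> < 1" using \<theta> by (auto simp: \<tau>_def)
  have l: "0 < l" "l < 1"
  proof -
    show "0 < l" using \<tau> by (simp add: l_def)
    have "\<tau> powr (\<kappa> / \<beta>) < \<tau> powr 0" using \<tau> \<kappa> \<beta> by (intro powr_less_mono') auto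
    then show "l < 1" using \<tau> by (simp add: l_def)
  qed
  define a where "a = (1 - l) * ((R / 2) * (1 - l))"
  define a' where "a' = (R / 2) * (1 - l)"
  have a: "0 < a" "0 < a'" using l R by (auto simp: a_def a'_def)
  define K' where "K' = K * (a powr (- s) + a' powr (- b))"
  have K': "0 \<le> K'" using K by (simp add: K'_def)
  define \<epsilon> where "\<epsilon> = ((1 - \<theta>) / (2 * (K' + 1))) powr (1 / \<kappa>)"
  have \<epsilon>: "0 < \<epsilon>" "K' * \<epsilon> powr \<kappa> \<le> (1 - \<theta>) / 2"
  proof -
    show "0 < \<epsilon>" using \<theta> K' by (simp add: \<epsilon>_def)
    have "K' * \<epsilon> powr \<kappa> = (K' / (K' + 1)) * ((1 - \<theta>) / 2)" using \<theta> K' \<kappa> by (simp add: \<epsilon>_def powr_powr)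
    also have "\<dots> \<le> 1 * ((1 - \<theta>) / 2)" using \<theta> K' by (intro mult_right_mono) auto
    finally show "K' * \<epsilon> powr \<kappa> \<le> (1 - \<theta>) / 2" by simp
  qed
  \<comment> \<open>The last bound yields \<open>half_zero\<close> at all radii used: a cube of
    radius r >= R/2 has volume at least R^n.\<close>
  define e where "e = min \<epsilon> (min 1 (R ^ DIM('a) / 2))"
  have e: "0 < e" "e \<le> \<epsilon>" "e \<le> 1" "2 * e \<le> R ^ DIM('a)" using \<epsilon> R by (auto simp: e_def min_def)
  define F where "F x = indicator (cube c R) x * (\<Psi> x + 1)" for x
  have Fm: "F \<in> Borel" unfolding F_def[abs_def] by measurable
  have Ff: "(NN x. ennreal (F x)) < \<infinity>"
  proof -
    have "(NN x. ennreal (F x)) = (NN x. ennreal (\<Psi> x) * indicator (cube c R) x + indicator (cube c R) x)"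
      by (rule nn_integral_cong) (auto simp: F_def indicator_def Psi_nonneg)
    also have "\<dots> = (NN x. ennreal (\<Psi> x) * indicator (cube c R) x) + leb (cube c R)" by (subst nn_integral_add) auto
    also have "\<dots> < \<infinity>" using Psi_finite R by (simp add: emeasure_cube)
    finally show ?thesis .
  qed
  obtain n :: nat where n: "\<And>k. real n \<le> k \<Longrightarrow> (NN x. ennreal (F x) * indicator {x. k < w x} x) \<le> ennreal e"
    using tail_integral[OF Fm _ Ff e(1), of w] by auto
  have small: "excess k R \<le> e" if "real n \<le> k" for k
  proof -
    have "ennreal (excess k R) = (NN x. ennreal (F x) * indicator {x. k < w x} x)"
      using R by (subst excess_eq[symmetric]) (auto intro!: nn_integral_cong simp: F_def level_set_def indicator_def)
    then have "ennreal (excess k R) \<le> ennreal e" using n[OF that] by (simp only:)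
    then show ?thesis using e by simp
  qed
  have half: "half_zero (trunc w k) c r" if "real n \<le> k" "R / 2 \<le> r" "r \<le> R" for k r
  proof -
    have "{x \<in> cube c r. trunc w k x \<noteq> 0} = level_set w c r k" by (auto simp: trunc_def level_set_def)
    moreover have "vol k r \<le> e" using vol_mono[of r R k k] small[OF that(1)] psi_on_nonneg[of k R] that R by (simp add: excess_def)
    moreover have "R ^ DIM('a) \<le> (2 * r) ^ DIM('a)" using that R by (intro power_mono) auto
    moreover have "2 * ennreal (vol k r) = ennreal (2 * vol k r)" using vol_nonneg[of k r] by (simp add: ennreal_mult)
    ultimately show ?thesis unfolding half_zero_def using that R e by (simp add: vol_eq emeasure_cube ennreal_leI)
  qed
  define kk where "kk i = real n + 1 - l ^ i" for i
  define rr where "rr i = R / 2 + R / 2 * l ^ i" for i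
  define X where "X i = excess (kk i) (rr i)" for i
  have li: "0 < l ^ i" "l ^ i \<le> 1" for i using l by (auto simp: power_le_one)
  have kk: "real n \<le> kk i" "kk i \<le> real n + 1" for i using li[of i] by (auto simp: kk_def)
  have rr: "R / 2 \<le> rr i" "rr i \<le> R" for i
  proof -
    show "R / 2 \<le> rr i" using li[of i] R by (simp add: rr_def)
    have "R / 2 * l ^ i \<le> R / 2 * 1" using li[of i] R by (intro mult_left_mono) auto
    then show "rr i \<le> R" by (simp add: rr_def)
  qed
  have X0: "X 0 \<le> e" using small[of n] by (simp add: X_def kk_def rr_def)
  have Xn: "0 \<le> X i" for i by (simp add: X_def excess_nonneg)
  have "X i \<le> X 0 * ((1 + \<theta>) / 2) ^ i" for i
  proof (rule geometric_iteration[OF \<theta> K' \<kappa>(1) \<beta>(1) Xn])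
    show "X 0 \<le> 1" using X0 e by simp
    have "X 0 powr \<kappa> \<le> \<epsilon> powr \<kappa>" using X0 e Xn \<kappa> by (intro powr_mono2) auto
    then have "K' * X 0 powr \<kappa> \<le> K' * \<epsilon> powr \<kappa>" using K' by (rule mult_left_mono)
    then show "K' * X 0 powr \<kappa> \<le> (1 - \<theta>) / 2" using \<epsilon> by simp
    fix i assume X1: "X i \<le> 1"
    have dk: "kk (Suc i) - kk i = (1 - l) * l ^ i" and dr: "rr i - rr (Suc i) = a' * l ^ i" by (simp_all add: kk_def rr_def a'_def algebra_simps)
    have "X (Suc i) \<le> \<theta> * X i + K * (((kk (Suc i) - kk i) * (rr i - rr (Suc i))) powr (- s) * X i powr s + (rr i - rr (Suc i)) powr (- b) * X i powr (q / p))"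
      unfolding X_def
    proof (rule decay)
      show "0 \<le> kk i" using kk[of i] by simp
      have "0 < (1 - l) * l ^ i" using l li[of i] by simp
      then show "kk i < kk (Suc i)" using dk by linarith
      show "R / 2 \<le> rr (Suc i)" "rr i \<le> R" by (rule rr)+
      have "0 < a' * l ^ i" using a li by simp
      then show "rr (Suc i) < rr i" using dr by simp
      show "half_zero (trunc w (kk i)) c (rr i)" by (rule half[OF kk(1) rr])
      show "half_zero (trunc w (kk (Suc i))) c ((rr (Suc i) + rr i) / 2)" by (rule half[OF kk(1)]) (use rr[of i] rr[of "Suc i"] in auto)
    qed
    \<comment> \<open>Since X i <= 1 and l^i <= 1, lowering the exponents of X i to 1 + \<kappa> and
      those of l^i to -\<beta> only enlarges the terms.\<close>
    also have "\<dots> \<le> \<theta> * X i + K * ((a powr (- s) * (l ^ i) powr (- \<beta>)) * X i powr (1 + \<kappa>) + (a' powr (- b) * (l ^ i) powr (- \<beta>)) * X i powr (1 + \<kappa>))"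
    proof (intro add_left_mono mult_left_mono[OF _ K] add_mono mult_mono)
      have "((kk (Suc i) - kk i) * (rr i - rr (Suc i))) = a * (l ^ i) powr 2"
        unfolding dk dr using li[of i] by (simp add: a_def a'_def powr_numeral power2_eq_square mult_ac)
      then have "((kk (Suc i) - kk i) * (rr i - rr (Suc i))) powr (- s) = a powr (- s) * (l ^ i) powr (- (2 * s))" by (simp add: powr_mult powr_powr)
      also have "\<dots> \<le> a powr (- s) * (l ^ i) powr (- \<beta>)" using li[of i] \<beta> by (intro mult_left_mono powr_mono') auto
      finally show "((kk (Suc i) - kk i) * (rr i - rr (Suc i))) powr (- s) \<le> a powr (- s) * (l ^ i) powr (- \<beta>)" .
      have "(rr i - rr (Suc i)) powr (- b) = a' powr (- b) * (l ^ i) powr (- b)" unfolding dr by (rule powr_mult)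
      also have "\<dots> \<le> a' powr (- b) * (l ^ i) powr (- \<beta>)" using li[of i] \<beta> by (intro mult_left_mono powr_mono') auto
      finally show "(rr i - rr (Suc i)) powr (- b) \<le> a' powr (- b) * (l ^ i) powr (- \<beta>)" .
      show "X i powr s \<le> X i powr (1 + \<kappa>)" "X i powr (q / p) \<le> X i powr (1 + \<kappa>)" using Xn X1 \<kappa> by (auto intro!: powr_mono')
    qed auto
    also have "\<dots> = \<theta> * X i + K' * ((((1 + \<theta>) / 2) powr (\<kappa> / \<beta>)) ^ i) powr (- \<beta>) * X i powr (1 + \<kappa>)"
      by (simp add: K'_def l_def \<tau>_def algebra_simps)
    finally show "X (Suc i) \<le> \<theta> * X i + K' * ((((1 + \<theta>) / 2) powr (\<kappa> / \<beta>)) ^ i) powr (- \<beta>) * X i powr (1 + \<kappa>)" .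
  qed
  then have X: "X i \<le> X 0 * \<tau> ^ i" for i by (simp add: \<tau>_def)
  have le: "vol (real n + 1) (R / 2) \<le> X 0 * \<tau> ^ i" for i
  proof -
    have "vol (real n + 1) (R / 2) \<le> vol (kk i) (rr i)" using kk rr R by (intro vol_mono) auto
    also have "\<dots> \<le> X i" by (simp add: X_def excess_def psi_on_nonneg)
    finally show ?thesis using X[of i] by simp
  qed
  have "(\<lambda>i. X 0 * \<tau> ^ i) ----> X 0 * 0" by (intro tendsto_intros LIMSEQ_power_zero) (use \<tau> in auto)
  then have "vol (real n + 1) (R / 2) \<le> X 0 * 0" by (rule LIMSEQ_le_const) (use le in auto)
  then have "leb (level_set w c (R / 2) (real n + 1)) = 0" using R vol_nonneg[of "real n + 1" "R / 2"] by (simp add: vol_eq)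
  then have "AE x in lborel. x \<notin> level_set w c (R / 2) (real n + 1)" by (intro AE_not_in) (auto simp: null_sets_def)
  then have "AE x in lborel. x \<in> cube c (R / 2) \<longrightarrow> w x \<le> real n + 1" by (elim eventually_mono) (auto simp: level_set_def)
  then show ?thesis by (rule that)
  qed
qed

end

section \<open>Quasi-minimizers\<close>

text \<open>One constant and the weakened lower bound |z|^p <= h + 1, so that the class tolerates a
  smaller p and a larger q and is invariant under z -> -z.\<close>

definition good_integrand :: "real \<Rightarrow> real \<Rightarrow> real \<Rightarrow> ('a::euclidean_space \<Rightarrow> real) \<Rightarrow> bool" where
  "good_integrand p q K h \<longleftrightarrow> continuous_on UNIV h \<and> convex_on UNIV h \<and>
     (\<forall>z. 0 \<le> h z \<and> norm z powr p \<le> h z + 1 \<and> h z \<le> K * (norm z powr q + 1) \<and> h (2 *\<^sub>R z) \<le> K * (h z + 1))"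

text \<open>The argument is the midpoint of 2 (1 - t) z and -2 y: convexity separates the two,
  doubling removes the factors 2, and convexity between z and 0 extracts 1 - t. With t = \<tau> this
  bounds the energy density of the competitor.\<close>

lemma good_integrand_combination:
  assumes h: "good_integrand p q K h" and K: "1 \<le> K" and q: "0 < q" and t: "0 \<le> t" "t \<le> 1"
  shows "h ((1 - t) *\<^sub>R z - y) \<le> 2 * K\<^sup>2 * ((1 - t) * h z + norm y powr q + 1)"
proof -
  have cx: "convex_on UNIV h" and b: "\<And>z. 0 \<le> h z" "\<And>z. h z \<le> K * (norm z powr q + 1)" "\<And>z. h (2 *\<^sub>R z) \<le> K * (h z + 1)"
    using h by (auto simp: good_integrand_def)
  define X where "X = (1 - t) * h z"
  define Y where "Y = norm y powr q"
  have X: "0 \<le> X" "0 \<le> Y" using t b(1)[of z] by (auto simp: X_def Y_def)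
  have "(1 - t) *\<^sub>R z - y = (1 - 1/2) *\<^sub>R (2 *\<^sub>R ((1 - t) *\<^sub>R z)) + (1/2) *\<^sub>R (2 *\<^sub>R (- y))" by (simp add: algebra_simps)
  then have "h ((1 - t) *\<^sub>R z - y) = h ((1 - 1/2) *\<^sub>R (2 *\<^sub>R ((1 - t) *\<^sub>R z)) + (1/2) *\<^sub>R (2 *\<^sub>R (- y)))" by (rule arg_cong)
  also have "\<dots> \<le> (1 - 1/2) * h (2 *\<^sub>R ((1 - t) *\<^sub>R z)) + (1/2) * h (2 *\<^sub>R (- y))" by (rule convex_onD[OF cx]) auto
  also have "\<dots> \<le> (1 - 1/2) * (K * (h ((1 - t) *\<^sub>R z) + 1)) + (1/2) * (K * (h (- y) + 1))" by (intro add_mono mult_left_mono b(3)) auto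
  also have "h ((1 - t) *\<^sub>R z) \<le> X + K"
  proof -
    have "h ((1 - t) *\<^sub>R z) = h ((1 - t) *\<^sub>R z + t *\<^sub>R 0)" by simp
    also have "\<dots> \<le> (1 - t) * h z + t * h 0" by (rule convex_onD[OF cx]) (use t in auto)
    also have "t * h 0 \<le> 1 * K" using t b(1,2)[of 0] q by (intro mult_mono) auto
    finally show ?thesis by (simp add: X_def)
  qed
  also have "h (- y) \<le> K * (Y + 1)" using b(2)[of "- y"] by (simp add: Y_def)
  finally have "h ((1 - t) *\<^sub>R z - y) \<le> (1/2) * (K * (X + K + 1)) + (1/2) * (K * (K * (Y + 1) + 1))" using K by simp
  also have "\<dots> = (1/2) * (K * X) + K\<^sup>2 + K + (1/2) * (K\<^sup>2 * Y)" by (simp add: algebra_simps power2_eq_square)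
  also have "\<dots> \<le> (1/2) * (K\<^sup>2 * X) + K\<^sup>2 + K\<^sup>2 + (1/2) * (K\<^sup>2 * Y)"
    using K X self_le_power[of K 2] by (intro add_mono mult_left_mono mult_right_mono) auto
  also have "\<dots> = 2 * K\<^sup>2 * (X / 4 + Y / 4 + 1)" by (simp add: algebra_simps)
  also have "\<dots> \<le> 2 * K\<^sup>2 * (X + Y + 1)" using X by (intro mult_left_mono) auto
  finally show ?thesis by (simp add: X_def Y_def)
qed

text \<open>Setting \<open>f\<close> to 0 at the exceptional points makes it continuous in z
  everywhere. The absolute value of a Borel version of the composition is then nonnegative at every
  point.\<close>

lemma integrand_measurable:
  fixes f :: "'a::euclidean_space \<Rightarrow> 'a \<Rightarrow> real"
  assumes \<Omega>: "open \<Omega>" and f: "\<And>z. (\<lambda>x. f x z) \<in> borel_measurable (lebesgue_on \<Omega>)"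
    and good: "AE x in lebesgue. x \<in> \<Omega> \<longrightarrow> good_integrand p q K (f x)" and G: "G \<in> Borel"
  obtains \<Psi> where "\<Psi> \<in> Borel" "\<And>x. 0 \<le> \<Psi> x" "AE x in lebesgue. x \<in> \<Omega> \<longrightarrow> \<Psi> x = f x (G x)"
proof -
  define N where "N = {x \<in> \<Omega>. \<not> good_integrand p q K (f x)}"
  obtain N' where N': "{x \<in> space lebesgue. \<not> (x \<in> \<Omega> \<longrightarrow> good_integrand p q K (f x))} \<subseteq> N'" "N' \<in> null_sets lebesgue"
    using good by (auto simp: eventually_ae_filter)
  have "N \<in> null_sets lebesgue" by (rule null_sets_completion_subset[OF _ N'(2)]) (use N'(1) in \<open>auto simp: N_def\<close>)
  then have A: "\<Omega> - N \<in> sets lebesgue" using \<Omega> by (auto intro: sets.Diff)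
  define F where "F x z = indicator (\<Omega> - N) x *\<^sub>R (indicator \<Omega> x *\<^sub>R f x z)" for x z
  have "(\<lambda>x. F x (G x)) \<in> borel_measurable lebesgue"
  proof (rule caratheodory_measurable)
    fix z
    have "(\<lambda>x. indicator \<Omega> x *\<^sub>R f x z) \<in> borel_measurable lebesgue"
      using f[of z] \<Omega> by (subst (asm) borel_measurable_restrict_space_iff) (auto simp: mult.commute)
    then show "(\<lambda>x. F x z) \<in> borel_measurable lebesgue"
      unfolding F_def by (rule borel_measurable_scaleR[OF borel_measurable_indicator[OF A]])
  next
    fix x
    show "continuous_on UNIV (F x)"
    proof (cases "x \<in> \<Omega> - N")
      case True
      then have "F x = f x" by (auto simp: F_def fun_eq_iff)
      then show ?thesis using True by (auto simp: N_def good_integrand_def)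
    next
      case False
      then have "F x = (\<lambda>z. 0)" by (simp add: F_def fun_eq_iff)
      then show ?thesis by simp
    qed
  next
    show "G \<in> borel_measurable lebesgue" using G by (auto intro: measurable_completion)
  qed
  then obtain P where P: "P \<in> borel_measurable lborel" "AE x in lborel. F x (G x) = P x" using completion_ex_borel_measurable_real by blast
  show ?thesis
  proof (rule that[of "\<lambda>x. \<bar>P x\<bar>"])
    show "(\<lambda>x. \<bar>P x\<bar>) \<in> Borel" using P(1) by simp
    show "AE x in lebesgue. x \<in> \<Omega> \<longrightarrow> \<bar>P x\<bar> = f x (G x)"
      using AE_completion[OF P(2)] good
    proof eventually_elim
      case (elim x)
      show ?case
      proof
        assume x: "x \<in> \<Omega>"
        then have "0 \<le> f x (G x)" "x \<in> \<Omega> - N" using elim by (auto simp: good_integrand_def N_def)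
        then show "\<bar>P x\<bar> = f x (G x)" using elim x by (simp add: F_def)
      qed
    qed
  qed simp
qed

abbreviation energy_on :: "('a::euclidean_space \<Rightarrow> 'a \<Rightarrow> real) \<Rightarrow> ('a \<Rightarrow> 'a) \<Rightarrow> 'a set \<Rightarrow> ennreal" where
  "energy_on f g A \<equiv> \<integral>\<^sup>+x\<in>A. ennreal (f x (g x)) \<partial>lebesgue"

text \<open>A form of minimality that refers to the gradient alone and lets variations range over
  \<open>sob\<close>; passing from u to -u becomes a change of sign in the integrand.\<close>

definition quasi_min :: "'a::euclidean_space set \<Rightarrow> ('a \<Rightarrow> 'a \<Rightarrow> real) \<Rightarrow> real \<Rightarrow> ('a \<Rightarrow> 'a) \<Rightarrow> bool" where
  "quasi_min \<Omega> f Q g \<longleftrightarrow> (\<forall>\<phi> h S. sob \<phi> h \<longrightarrow> compact S \<longrightarrow> S \<subseteq> \<Omega> \<longrightarrow> zero_off S \<phi> \<longrightarrow>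
     (energy_on f g (supp \<Omega> \<phi>)) < \<infinity> \<and>
     (energy_on f g (supp \<Omega> \<phi>)) \<le> ennreal Q * energy_on f (\<lambda>x. g x + h x) (supp \<Omega> \<phi>))"

lemma quasi_minD:
  assumes "quasi_min \<Omega> f Q g" "sob \<phi> h" "compact S" "S \<subseteq> \<Omega>" "zero_off S \<phi>"
  shows "energy_on f g (supp \<Omega> \<phi>) < \<infinity>"
    "energy_on f g (supp \<Omega> \<phi>) \<le> ennreal Q * energy_on f (\<lambda>x. g x + h x) (supp \<Omega> \<phi>)" using assms unfolding quasi_min_def by blast+

lemma energy_eq:
  assumes "open \<Omega>" "has_weak_gradient \<Omega> u g" "S \<subseteq> \<Omega>"
  shows "energy \<Omega> f u S = energy_on f g S"
  unfolding energy_def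
proof (rule nn_integral_cong_AE)
  have "has_weak_gradient \<Omega> u (weak_gradient \<Omega> u)" unfolding weak_gradient_def by (rule someI[of "has_weak_gradient \<Omega> u", OF assms(2)])
  from weak_gradient_unique[OF assms(1) this assms(2)]
  show "AE x in lebesgue. ennreal (f x (weak_gradient \<Omega> u x)) * indicator S x = ennreal (f x (g x)) * indicator S x"
    by eventually_elim (use assms(3) in \<open>auto simp: indicator_def\<close>)
qed

lemma Q_minimizer_quasi_min:
  assumes \<Omega>: "open \<Omega>" and u: "Q_minimizer \<Omega> f Q u" and g: "has_weak_gradient \<Omega> u g"
  shows "quasi_min \<Omega> f Q g"
  unfolding quasi_min_def
proof (intro allI impI)
  fix \<phi> h S assume \<phi>: "sob \<phi> h" and S: "compact S" "S \<subseteq> \<Omega>" "zero_off S \<phi>"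
  have "\<Omega> \<in> sets lebesgue" using \<Omega> by auto
  note w = sob_has_weak_gradient[OF \<phi> this]
  have "\<phi> \<in> W11 \<Omega>" using w by (auto simp: W11_def)
  moreover have "compact (supp \<Omega> \<phi>)" by (rule supp_compact[OF \<Omega> S])
  ultimately have "energy \<Omega> f u (supp \<Omega> \<phi>) < \<infinity>" "energy \<Omega> f u (supp \<Omega> \<phi>) \<le> ennreal Q * energy \<Omega> f (\<lambda>x. u x + \<phi> x) (supp \<Omega> \<phi>)"
    using u by (auto simp: Q_minimizer_def)
  moreover have "has_weak_gradient \<Omega> (\<lambda>x. u x + \<phi> x) (\<lambda>x. g x + h x)" using has_weak_gradient_lincomb[OF g w(1), of 1] by simp
  moreover have "supp \<Omega> \<phi> \<subseteq> \<Omega>" by (auto simp: supp_def)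
  ultimately show "energy_on f g (supp \<Omega> \<phi>) < \<infinity> \<and>
     (energy_on f g (supp \<Omega> \<phi>)) \<le> ennreal Q * energy_on f (\<lambda>x. g x + h x) (supp \<Omega> \<phi>)" using energy_eq[OF \<Omega>] g by simp
qed

lemma quasi_min_uminus:
  assumes "quasi_min \<Omega> f Q g"
  shows "quasi_min \<Omega> (\<lambda>x z. f x (- z)) Q (\<lambda>x. - g x)"
  unfolding quasi_min_def
proof (intro allI impI)
  fix \<phi> h S assume \<phi>: "sob \<phi> h" and S: "compact S" "S \<subseteq> \<Omega>" "zero_off S \<phi>"
  have "sob (\<lambda>x. - \<phi> x) (\<lambda>x. - h x)" using sob_cmult[OF \<phi>, of "-1"] by simp
  moreover have "zero_off S (\<lambda>x. - \<phi> x)" using S(3) by (simp add: zero_off_def)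
  moreover have "supp \<Omega> (\<lambda>x. - \<phi> x) = supp \<Omega> \<phi>" by (simp add: supp_def)
  ultimately show "(\<integral>\<^sup>+x\<in>supp \<Omega> \<phi>. ennreal (f x (- (- g x))) \<partial>lebesgue) < \<infinity> \<and>
     (\<integral>\<^sup>+x\<in>supp \<Omega> \<phi>. ennreal (f x (- (- g x))) \<partial>lebesgue) \<le> ennreal Q * (\<integral>\<^sup>+x\<in>supp \<Omega> \<phi>. ennreal (f x (- (- g x + h x))) \<partial>lebesgue)"
    using quasi_minD[OF assms _ S(1,2), of "\<lambda>x. - \<phi> x" "\<lambda>x. - h x"] by simp
qed

text \<open>Finiteness is given on essential supports only; a plateau function that is positive on
  the open ball has the ball inside its essential support.\<close>

lemma quasi_min_energy_finite:
  fixes x0 :: "'a::euclidean_space"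
  assumes qm: "quasi_min \<Omega> f Q g" and b: "0 < b" "cball x0 b \<subseteq> \<Omega>"
  shows "energy_on f g (ball x0 b) < \<infinity>"
proof -
  obtain P DP where P: "smooth P" "C1 P DP" "zero_off (cball x0 b) P" "\<And>x. x \<in> ball x0 (b/2) \<Longrightarrow> P x = 1" "\<And>x. x \<in> ball x0 (b/2) \<Longrightarrow> DP x = 0"
     "\<And>x. x \<in> ball x0 b \<Longrightarrow> P x > 0"
  proof (rule plateau_C1[of "b / 2" b x0])
    show "0 < b / 2" "b / 2 < b" using b by simp_all
  qed (rule that; assumption)
  have "ball x0 b \<subseteq> supp \<Omega> P" by (rule supp_positive) (use b P(6) in \<open>force+\<close>)
  then have "energy_on f g (ball x0 b) \<le> (\<integral>\<^sup>+x\<in>supp \<Omega> P. ennreal (f x (g x)) \<partial>lebesgue)"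
    by (intro nn_integral_mono) (auto simp: indicator_def)
  also have "\<dots> < \<infinity>" by (rule quasi_minD(1)[OF qm sob_C1[OF P(2) compact_cball P(3)] compact_cball b(2) P(3)])
  finally show ?thesis .
qed

text \<open>Produces whole-space data for \<open>energy_class\<close>. The function \<open>w\<close>
  is a cut-off of (u - k0)_+ and not of u: for large k0 it vanishes on half of a cube, and
  Poincare's inequality then gives the p-integrability that makes the gradient of \<open>w\<close>
  p-integrable.\<close>

lemma quasi_min_local_bound:
  fixes x0 :: "'a::euclidean_space" and u :: "'a \<Rightarrow> real"
  assumes n: "DIM('a) \<ge> 2" and pq: "admissible (DIM('a) - 1) p q" and K: "1 \<le> K" and Q: "0 \<le> Q"
    and \<Omega>: "open \<Omega>" "x0 \<in> \<Omega>" and u: "has_weak_gradient \<Omega> u g" and qm: "quasi_min \<Omega> f Q g"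
    and f: "\<And>z. (\<lambda>x. f x z) \<in> borel_measurable (lebesgue_on \<Omega>)"
    and good: "AE x in lebesgue. x \<in> \<Omega> \<longrightarrow> good_integrand p q K (f x)"
  obtains r C where "0 < r" "AE x in lebesgue. x \<in> cube x0 r \<longrightarrow> u x \<le> C"
proof -
  have p: "1 \<le> p" "p < q" using pq by (simp_all add: admissible_def)
  obtain b where b: "b > 0" "cball x0 b \<subseteq> \<Omega>" using \<Omega> open_contains_cball by blast
  define a where "a = b / 2"
  have a: "0 < a" "a < b" using b by (auto simp: a_def)
  have ab: "ball x0 a \<subseteq> \<Omega>" using a b by (auto simp: subset_iff)
  obtain P DP where P: "smooth P" "C1 P DP" "zero_off (cball x0 b) P" "\<And>x. x \<in> ball x0 a \<Longrightarrow> P x = 1" "\<And>x. x \<in> ball x0 a \<Longrightarrow> DP x = 0"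
    by (rule plateau_C1[OF a, of x0]) (rule that; assumption)
  obtain U G where U: "sob U G" "AE x in lebesgue. U x = P x * u x" "AE x in lebesgue. G x = P x *\<^sub>R g x + u x *\<^sub>R DP x"
    using weak_gradient_localize[OF u P(1,2) compact_cball b(2) P(3)] .
  have Bm[measurable]: "ball x0 a \<in> sets borel" by (rule borel_open) simp
  note [measurable] = sob_measurable[OF U(1)]
  have UG: "AE x in lebesgue. x \<in> ball x0 a \<longrightarrow> U x = u x \<and> G x = g x" using U(2,3) by eventually_elim (use P(4,5) in auto)
  obtain \<Psi> where \<Psi>: "\<Psi> \<in> Borel" "\<And>x. 0 \<le> \<Psi> x" "AE x in lebesgue. x \<in> \<Omega> \<longrightarrow> \<Psi> x = f x (G x)"
    using integrand_measurable[OF \<Omega>(1) f good sob_measurable(2)[OF U(1)]] by metis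
  note [measurable] = \<Psi>(1)
  have \<Psi>g: "AE x in lebesgue. x \<in> ball x0 a \<longrightarrow> \<Psi> x = f x (g x)" using UG \<Psi>(3) by eventually_elim (use ab in auto)
  have \<Psi>f: "(NN x. ennreal (\<Psi> x) * indicator (ball x0 a) x) < \<infinity>"
  proof -
    have "(NN x. ennreal (\<Psi> x) * indicator (ball x0 a) x) = (\<integral>\<^sup>+x. ennreal (\<Psi> x) * indicator (ball x0 a) x \<partial>lebesgue)"
      by (rule nn_integral_completion[symmetric])
    also have "\<dots> = energy_on f g (ball x0 a)" by (rule nn_integral_cong_AE) (use \<Psi>g in eventually_elim, auto simp: indicator_def)
    also have "\<dots> < \<infinity>" by (rule quasi_min_energy_finite[OF qm]) (use a b in \<open>auto simp: subset_iff\<close>)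
    finally show ?thesis .
  qed
  have "AE x in lebesgue. x \<in> ball x0 a \<longrightarrow> norm (G x) powr p \<le> \<Psi> x + 1"
    using \<Psi>(3) good by eventually_elim (use ab in \<open>auto simp: good_integrand_def\<close>)
  then have Gp: "AE x in lborel. x \<in> ball x0 a \<longrightarrow> norm (G x) powr p \<le> \<Psi> x + 1" by (subst (asm) AE_completion_iff) auto
  have Gi: "integrable lborel (\<lambda>x. indicator (ball x0 a) x * norm (G x) powr p)"
  proof (rule nn_integral_finite_integrable)
    have "(NN x. ennreal (indicator (ball x0 a) x * norm (G x) powr p))
      \<le> (NN x. ennreal (\<Psi> x) * indicator (ball x0 a) x + indicator (ball x0 a) x)"
    proof (rule nn_integral_mono_AE, use Gp in eventually_elim)
      case (elim x)
      show ?case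
      proof (cases "x \<in> ball x0 a")
        case True
        then have "ennreal (norm (G x) powr p) \<le> ennreal (\<Psi> x + 1)" using elim by (intro ennreal_leI) auto
        then show ?thesis using True \<Psi>(2)[of x] by simp
      qed simp
    qed
    also have "\<dots> = (NN x. ennreal (\<Psi> x) * indicator (ball x0 a) x) + leb (ball x0 a)" by (subst nn_integral_add) (simp_all del: mem_ball)
    also have "\<dots> < top" using \<Psi>f emeasure_lborel_ball_finite[of x0 a] by simp
    finally show "(NN x. ennreal (indicator (ball x0 a) x * norm (G x) powr p)) < top" .
    show "(\<lambda>x. indicator (ball x0 a) x * norm (G x) powr p) \<in> borel_measurable lborel" by measurable
  qed simp
  \<comment> \<open>Small enough for the cube of radius \<open>r1\<close>, enlarged by
    \<open>r1\<close>, to stay inside the ball of radius \<open>a\<close>; the dimension comes from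
    comparing the norm with coordinates.\<close>
  define r1 where "r1 = a / (4 * DIM('a))"
  have r1: "0 < r1" "2 * r1 * DIM('a) = a / 2" using a n by (auto simp: r1_def)
  have "1 * r1 \<le> DIM('a) * r1" using n r1 by (intro mult_right_mono) auto
  then have r1a: "r1 \<le> a / 4" using r1(2) by (simp add: mult_ac)
  have x0: "x0 \<in> cube x0 r1" using r1 by (simp add: mem_cube)
  have c1: "dist x0 x \<le> a / 2" if "x \<in> cube x0 r1" for x using norm_diff_cube[OF that x0] r1 by (simp add: dist_norm)
  have cb: "cball x r1 \<subseteq> ball x0 a" if "x \<in> cube x0 r1" for x
  proof
    fix y assume "y \<in> cball x r1"
    then have "dist x0 y \<le> a / 2 + a / 4" using c1[OF that] r1a dist_triangle[of x0 y x] by simp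
    then show "y \<in> ball x0 a" using a by simp
  qed
  have cub: "cube x0 r1 \<subseteq> ball x0 a" using cb r1 by force
  define N :: real where "N = (2 * r1) ^ DIM('a)"
  have N: "0 < N" using r1 by (simp add: N_def)
  obtain k0 :: nat where k0: "(NN x. ennreal (indicator (cube x0 r1) x) * indicator {x. real k0 < U x} x) \<le> ennreal (N / 2)"
  proof -
    have "(NN x. ennreal (indicator (cube x0 r1) x)) < \<infinity>" using r1 by (simp add: ennreal_indicator emeasure_cube)
    then show ?thesis using tail_integral[of "indicator (cube x0 r1)" U "N / 2"] N that by auto
  qed
  define v where "v = trunc U (real k0)"
  define gv where "gv x = indicator {x. U x > real k0} x *\<^sub>R G x" for x
  have v: "sob v gv" unfolding v_def trunc_def[abs_def] gv_def[abs_def] by (rule sob_pos_part[OF U(1)]) simp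
  note [measurable] = sob_measurable[OF v]
  have half: "2 * leb {x \<in> cube x0 r1. v x \<noteq> 0} \<le> leb (cube x0 r1)"
  proof -
    have eq: "{x \<in> cube x0 r1. v x \<noteq> 0} = level_set U x0 r1 (real k0)" by (auto simp: v_def trunc_def level_set_def)
    have "leb (level_set U x0 r1 (real k0)) = (NN x. indicator (level_set U x0 r1 (real k0)) x)" by simp
    also have "\<dots> = (NN x. ennreal (indicator (cube x0 r1) x) * indicator {x. real k0 < U x} x)"
      by (rule nn_integral_cong) (auto simp: level_set_def indicator_def)
    finally have "2 * leb (level_set U x0 r1 (real k0)) \<le> 2 * ennreal (N / 2)" using k0 by (simp add: mult_left_mono)
    also have "\<dots> = ennreal N" using N by (simp add: ennreal_mult'[symmetric] flip: ennreal_numeral)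
    finally show ?thesis unfolding eq using r1 by (simp add: emeasure_cube N_def)
  qed
  have gvi: "integrable lborel (\<lambda>x. indicator (ball x0 a) x * norm (gv x) powr p)"
    by (rule Bochner_Integration.integrable_bound[OF Gi]) (auto simp: gv_def indicator_def)
  have gvf: "(NN x. ennreal (norm (gv x) powr p) * indicator (cube x0 r1) x) < \<infinity>"
  proof -
    have "(NN x. ennreal (norm (gv x) powr p) * indicator (cube x0 r1) x) \<le> (NN x. ennreal (indicator (ball x0 a) x * norm (gv x) powr p))"
      using cub by (intro nn_integral_mono) (auto simp: indicator_def)
    also have "\<dots> < \<infinity>" using gvi unfolding integrable_iff_bounded by (simp add: abs_mult)
    finally show ?thesis .
  qed
  have vf: "(NN x. ennreal (\<bar>v x\<bar> powr p) * indicator (cube x0 r1) x) < \<infinity>"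
    by (rule le_less_trans[OF Poincare_half[OF v p(1) r1(1) gvi r1(1) cb half]]) (use gvf in \<open>auto simp: ennreal_mult_less_top\<close>)
  have r2: "0 < r1 / 2" "r1 / 2 < r1" using r1 by auto
  obtain \<chi>' E' where \<chi>0: "cutoff x0 (r1 / 2) r1 \<chi>' E'" "\<And>x. norm (E' x) \<le> 4 * DIM('a) / (r1 - r1 / 2)"
    "\<And>x. x \<in> cube x0 (r1 / 2) \<Longrightarrow> E' x = 0" by (rule plain_cutoff[OF r2, of x0]) (rule that; assumption)
  note \<chi> = cutoffD[OF \<chi>0(1)]
  note [measurable] = multiplier_measurable[OF \<chi>(1)]
  define w where "w x = \<chi>' x * v x" for x
  define W where "W x = \<chi>' x *\<^sub>R gv x + v x *\<^sub>R E' x" for x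
  have w: "sob w W" unfolding w_def[abs_def] W_def[abs_def] by (rule multiplier_sob[OF \<chi>(1) v])
  note [measurable] = sob_measurable[OF w]
  have Wp: "integrable lborel (\<lambda>x. norm (W x) powr p)"
  proof (rule nn_integral_finite_integrable)
    have "(NN x. ennreal (norm (W x) powr p)) \<le> ennreal (2 powr p) * (NN x. ennreal (norm (gv x) powr p) * indicator (cube x0 r1) x)
      + ennreal (2 powr p * (4 * DIM('a) / (r1 - r1 / 2)) powr p) * (NN x. ennreal (\<bar>v x\<bar> powr p) * indicator (cube x0 r1) x)"
      unfolding W_def by (rule cutoff_gradient[OF \<chi>0(1,2) p(1)]) measurable
    also have "\<dots> < top" using gvf vf by (simp add: ennreal_mult_less_top)
    finally show "(NN x. ennreal (norm (W x) powr p)) < top" .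
  qed auto
  define R where "R = r1 / 2"
  have R: "0 < R" using r1 by (simp add: R_def)
  have cR: "cube x0 R \<subseteq> ball x0 a" using cub cube_mono[of R r1 x0] r1 by (auto simp: R_def)
  have wv: "w x = v x" "W x = gv x" if "x \<in> cube x0 R" for x using \<chi>(4)[of x] \<chi>0(3)[of x] that by (auto simp: w_def W_def R_def)
  \<comment> \<open>Where w > 0 in the small cube its gradient is that of u, to which coercivity and
    minimality refer.\<close>
  have WG: "W x = G x" if "x \<in> cube x0 R" "0 < w x" for x using wv[OF that(1)] that(2) by (auto simp: gv_def v_def trunc_def indicator_def)
  interpret energy_class p q "Q * (2 * K\<^sup>2)" R \<Psi> w W x0
  proof
    show "DIM('a) \<ge> 2" "admissible (DIM('a) - 1) p q" "0 < R" "sob w W" "integrable lborel (\<lambda>x. norm (W x) powr p)"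
      "\<Psi> \<in> Borel" "\<And>x. 0 \<le> \<Psi> x" by fact+
    show "0 \<le> Q * (2 * K\<^sup>2)" using Q by simp
    have "(NN x. ennreal (\<Psi> x) * indicator (cube x0 R) x) \<le> (NN x. ennreal (\<Psi> x) * indicator (ball x0 a) x)"
      using cR by (intro nn_integral_mono) (auto simp: indicator_def)
    then show "(NN x. ennreal (\<Psi> x) * indicator (cube x0 R) x) < \<infinity>" using \<Psi>f by (rule le_less_trans)
    show "AE x in lborel. x \<in> cube x0 R \<longrightarrow> 0 < w x \<longrightarrow> norm (W x) powr p \<le> \<Psi> x + 1"
      using Gp by eventually_elim (use cR WG in auto)
    fix k :: real and \<tau> E
    assume k: "0 \<le> k" and \<tau>: "multiplier \<tau> E" "\<And>x. 0 \<le> \<tau> x" "\<And>x. \<tau> x \<le> 1" "zero_off (cube x0 R) \<tau>" "zero_off (cube x0 R) E"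
    note [measurable] = multiplier_measurable[OF \<tau>(1)]
    define y where "y = trunc w k"
    define gy where "gy x = indicator {x. w x > k} x *\<^sub>R W x" for x
    have y: "sob y gy" unfolding y_def trunc_def[abs_def] gy_def[abs_def] by (rule sob_pos_part[OF w k])
    note [measurable] = sob_measurable[OF y]
    \<comment> \<open>The variation lowers u towards the level by the fraction \<tau>: on {w > k}
      the gradient of the competitor is (1 - \<tau>) Du - (w - k) E.\<close>
    define \<phi> where "\<phi> x = - 1 * (\<tau> x * y x)" for x
    define h where "h x = - 1 *\<^sub>R (\<tau> x *\<^sub>R gy x + y x *\<^sub>R E x)" for x
    have \<phi>: "sob \<phi> h" unfolding \<phi>_def[abs_def] h_def[abs_def] by (rule sob_cmult[OF multiplier_sob[OF \<tau>(1) y]])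
    have cO: "cube x0 R \<subseteq> \<Omega>" using cR ab by blast
    have v\<phi>: "zero_off (cube x0 R) \<phi>" using \<tau>(4) by (simp add: \<phi>_def zero_off_def)
    have \<phi>0: "\<phi> x \<noteq> 0 \<longleftrightarrow> k < w x \<and> \<tau> x \<noteq> 0" for x by (auto simp: \<phi>_def y_def trunc_def)
    define S where "S = supp \<Omega> \<phi>"
    have S: "S \<subseteq> cube x0 R" "compact S" unfolding S_def by (rule supp_compact[OF \<Omega>(1) compact_cube cO v\<phi>])+
    have Sb[measurable]: "S \<in> sets borel" using S(2) by (simp add: borel_compact)
    have "AE x in lebesgue. k < w x \<longrightarrow> \<tau> x \<noteq> 0 \<longrightarrow> x \<in> S"
      using AE_supp[of \<Omega> \<phi>] using \<tau>(4) cO \<phi>0 by (auto simp: zero_off_def S_def)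
    then have AES: "AE x in lborel. k < w x \<longrightarrow> \<tau> x \<noteq> 0 \<longrightarrow> x \<in> S" by (subst (asm) AE_completion_iff) auto
    define H where "H x = (if k < w x then (1 - \<tau> x) * \<Psi> x + ((w x - k) * norm (E x)) powr q + 1 else \<Psi> x)" for x
    have Hm[measurable]: "H \<in> Borel" unfolding H_def[abs_def] by measurable
    have H0: "0 \<le> H x" for x using \<tau>(3)[of x] \<Psi>(2)[of x] by (auto simp: H_def)
    have K2: "1 \<le> 2 * K\<^sup>2" using one_le_power[OF K, of 2] by linarith
    have pt: "AE x in lebesgue. x \<in> S \<longrightarrow> f x (g x + h x) \<le> 2 * K\<^sup>2 * H x"
      using UG \<Psi>g good
    proof eventually_elim
      case (elim x)
      show ?case
      proof
        assume "x \<in> S"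
        then have x: "x \<in> cube x0 R" "x \<in> ball x0 a" "x \<in> \<Omega>" using S cR cO by auto
        show "f x (g x + h x) \<le> 2 * K\<^sup>2 * H x"
        proof (cases "k < w x")
          case True
          then have "g x = W x" "gy x = W x" "y x = w x - k" using WG[OF x(1)] k elim x by (auto simp: gy_def y_def trunc_def)
          then have "g x + h x = (1 - \<tau> x) *\<^sub>R g x - (w x - k) *\<^sub>R E x" by (simp add: h_def scaleR_left_diff_distrib)
          moreover have "f x ((1 - \<tau> x) *\<^sub>R g x - (w x - k) *\<^sub>R E x) \<le> 2 * K\<^sup>2 * ((1 - \<tau> x) * f x (g x) + norm ((w x - k) *\<^sub>R E x) powr q + 1)"
            using elim x \<tau>(2,3) p K by (intro good_integrand_combination) auto
          moreover have "norm ((w x - k) *\<^sub>R E x) = (w x - k) * norm (E x)" using True by simp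
          ultimately show ?thesis using True elim x by (simp add: H_def)
        next
          case False
          then have "h x = 0" by (simp add: h_def gy_def y_def trunc_def)
          then have "f x (g x + h x) = 1 * \<Psi> x" using elim x by simp
          also have "\<dots> \<le> 2 * K\<^sup>2 * \<Psi> x" using K2 \<Psi>(2) by (intro mult_right_mono) auto
          finally show ?thesis using False by (simp add: H_def)
        qed
      qed
    qed
    have "(NN x. ennreal (\<Psi> x) * indicator S x) = (\<integral>\<^sup>+x. ennreal (\<Psi> x) * indicator S x \<partial>lebesgue)"
      by (rule nn_integral_completion[symmetric])
    also have "\<dots> = energy_on f g S" by (rule nn_integral_cong_AE) (use \<Psi>g in eventually_elim, use S cR in \<open>auto simp: indicator_def\<close>)
    also have "\<dots> \<le> ennreal Q * energy_on f (\<lambda>x. g x + h x) S"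
      unfolding S_def by (rule quasi_minD(2)[OF qm \<phi> compact_cube cO v\<phi>])
    also have "\<dots> \<le> ennreal Q * (\<integral>\<^sup>+x. ennreal (2 * K\<^sup>2) * (ennreal (H x) * indicator S x) \<partial>lebesgue)"
    proof (intro mult_left_mono nn_integral_mono_AE)
      show "AE x in lebesgue. ennreal (f x (g x + h x)) * indicator S x \<le> ennreal (2 * K\<^sup>2) * (ennreal (H x) * indicator S x)"
        using pt
      proof eventually_elim
        case (elim x)
        then show ?case using H0[of x] by (cases "x \<in> S") (auto simp: ennreal_mult[symmetric] intro!: ennreal_leI)
      qed
    qed simp
    also have "\<dots> = ennreal Q * (NN x. ennreal (2 * K\<^sup>2) * (ennreal (H x) * indicator S x))" by (simp only: nn_integral_completion)
    also have "\<dots> = ennreal (Q * (2 * K\<^sup>2)) * (NN x. ennreal (H x) * indicator S x)" using Q by (simp add: nn_integral_cmult ennreal_mult mult.assoc)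
    finally have "(NN x. ennreal (\<Psi> x) * indicator S x) \<le> ennreal (Q * (2 * K\<^sup>2)) * (NN x. ennreal (H x) * indicator S x)" .
    moreover have "S \<inter> V = {}" if "open V" "\<forall>x\<in>V. k < w x \<longrightarrow> \<tau> x = 0" for V
      unfolding S_def by (rule supp_disjoint[OF that(1) _ \<Omega>(1)]) (use that(2) \<phi>0 in blast)
    ultimately show "\<exists>S. S \<in> sets borel \<and> S \<subseteq> cube x0 R \<and> (AE x in lborel. k < w x \<longrightarrow> \<tau> x \<noteq> 0 \<longrightarrow> x \<in> S) \<and>
        (\<forall>V. open V \<longrightarrow> (\<forall>x\<in>V. k < w x \<longrightarrow> \<tau> x = 0) \<longrightarrow> S \<inter> V = {}) \<and>
        (NN x. ennreal (\<Psi> x) * indicator S x) \<le> ennreal (Q * (2 * K\<^sup>2)) * (NN x. ennreal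
          (if k < w x then (1 - \<tau> x) * \<Psi> x + ((w x - k) * norm (E x)) powr q + 1 else \<Psi> x) * indicator S x)"
      unfolding H_def using Sb S(1) AES by blast
  qed
  obtain C where C: "AE x in lborel. x \<in> cube x0 (R / 2) \<longrightarrow> w x \<le> C" using bounded_above .
  show ?thesis
  proof (rule that)
    show "0 < R / 2" using R by simp
    show "AE x in lebesgue. x \<in> cube x0 (R / 2) \<longrightarrow> u x \<le> C + real k0"
      using AE_completion[OF C] UG
    proof eventually_elim
      case (elim x)
      show ?case
      proof
        assume x: "x \<in> cube x0 (R / 2)"
        then have "x \<in> cube x0 R" using cube_mono[of "R / 2" R x0] R by auto
        then have "w x = v x" "u x = U x" using wv cR elim by auto
        then show "u x \<le> C + real k0" using elim x by (auto simp: v_def trunc_def)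
      qed
    qed
  qed
qed

lemma ball_subset_cube: "ball x r \<subseteq> cube x r"
proof
  fix y assume "y \<in> ball x r"
  then have "norm (y - x) < r" by (simp add: dist_norm norm_minus_commute)
  then show "y \<in> cube x r" unfolding mem_cube by (metis Basis_le_norm inner_diff_left le_less_trans less_imp_le)
qed

section \<open>Compact sets, reduction of the exponents, and the main result\<close>

lemma AE_bounded_compact:
  fixes u :: "'a::euclidean_space \<Rightarrow> real"
  assumes K: "compact K" "K \<subseteq> \<Omega>"
    and loc: "\<And>x0. x0 \<in> \<Omega> \<Longrightarrow> \<exists>r>0. \<exists>C. AE x in lebesgue. x \<in> cube x0 r \<longrightarrow> u x \<le> C"
  obtains C where "AE x in lebesgue. x \<in> K \<longrightarrow> u x \<le> C"
proof -
  obtain r C where rC: "\<And>x0. x0 \<in> \<Omega> \<Longrightarrow> 0 < r x0 \<and> (AE x in lebesgue. x \<in> cube x0 (r x0) \<longrightarrow> u x \<le> C x0)"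
    using loc by metis
  obtain T where T: "T \<subseteq> K" "finite T" "K \<subseteq> (\<Union>c\<in>T. ball c (r c))"
  proof (rule compactE_image[OF K(1), of K "\<lambda>x. ball x (r x)"])
    show "K \<subseteq> (\<Union>c\<in>K. ball c (r c))" using rC K(2) by force
  qed auto
  have "AE x in lebesgue. \<forall>c\<in>T. x \<in> cube c (r c) \<longrightarrow> u x \<le> C c" using T K rC by (intro AE_finite_allI) auto
  then have "AE x in lebesgue. x \<in> K \<longrightarrow> u x \<le> (\<Sum>c\<in>T. \<bar>C c\<bar>)"
  proof eventually_elim
    case (elim x)
    show ?case
    proof
      assume "x \<in> K"
      then obtain c where c: "c \<in> T" "x \<in> cube c (r c)" using T(3) ball_subset_cube by blast
      then have "u x \<le> \<bar>C c\<bar>" using elim by force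
      also have "\<dots> \<le> (\<Sum>c\<in>T. \<bar>C c\<bar>)" using c T(2) by (intro member_le_sum) auto
      finally show "u x \<le> (\<Sum>c\<in>T. \<bar>C c\<bar>)" .
    qed
  qed
  then show ?thesis by (rule that)
qed

text \<open>Growth bounds weaken, up to constants, when p decreases and q increases, so the pair can
  be moved onto the critical curve. First q is raised to at least m/(m - 1), which guarantees p' >=
  1; then p' is read off the curve, and p' < q' holds even if p = q.\<close>

lemma admissible_exponents:
  fixes p q :: real
  assumes m: "1 \<le> m" and pq: "1 \<le> p" "p \<le> q" "1 / p - 1 / real m \<le> 1 / q"
  obtains p' q' where "admissible m p' q'" "p' \<le> p" "q \<le> q'"
proof (cases "m = 1")
  case True
  \<comment> \<open>On lines p' = 1 goes with every larger exponent; the 2 secures q' > 1.\<close>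
  show ?thesis by (rule that[of 1 "max q 2"]) (use True pq in \<open>auto simp: admissible_def\<close>)
next
  case False
  then have m2: "2 \<le> m" using m by simp
  define q' where "q' = max q (real m / (real m - 1))"
  define p' where "p' = 1 / (1 / q' + 1 / real m)"
  have q': "q \<le> q'" "1 < q'" "1 / q' \<le> 1 - 1 / real m"
  proof -
    have "1 < real m / (real m - 1)" using m2 by simp
    then show "q \<le> q'" "1 < q'" by (auto simp: q'_def)
    have "inverse q' \<le> inverse (real m / (real m - 1))" using m2 by (intro le_imp_inverse_le) (auto simp: q'_def)
    also have "\<dots> = 1 - 1 / real m" using m2 by (simp add: field_simps)
    also have "inverse q' = 1 / q'" by (rule inverse_eq_divide)
    finally show "1 / q' \<le> 1 - 1 / real m" .
  qed
  have s: "0 < 1 / q'" "0 < 1 / real m" "1 / q' + 1 / real m \<le> 1" using q' m2 by auto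
  have p': "1 / p' = 1 / q' + 1 / real m" by (simp add: p'_def)
  have "inverse 1 \<le> inverse (1 / p')" unfolding p' using s by (intro le_imp_inverse_le) linarith+
  moreover have "inverse (1 / p') < inverse (1 / q')" unfolding p' using s by (intro less_imp_inverse_less) linarith+
  moreover have "p' \<le> p"
  proof (cases "q' = q")
    case True
    then have "1 / p \<le> 1 / p'" using p' pq by simp
    then have "inverse (1 / p') \<le> inverse (1 / p)" using pq by (intro le_imp_inverse_le) auto
    then show ?thesis by simp
  next
    \<comment> \<open>Then q' = m/(m - 1), hence p' = 1.\<close>
    case False
    then have "q' = real m / (real m - 1)" by (auto simp: q'_def max_def split: if_splits)
    then have "1 / q' = (real m - 1) / real m" by simp
    then have "1 / q' + 1 / real m = 1" using m2 by (simp add: diff_divide_distrib)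
    then show ?thesis using pq by (simp add: p'_def)
  qed
  ultimately have "1 \<le> p'" "p' < q'" "p' \<le> p" by simp_all
  moreover have "1 / q' = 1 / p' - 1 / real m" using p' by simp
  ultimately show ?thesis using that[of p' q'] m2 q' by (simp add: admissible_def)
qed

lemma powr_le_plus1:
  fixes x :: real assumes "0 \<le> x" "0 \<le> p" "p \<le> q" shows "x powr p \<le> x powr q + 1"
proof (cases "x \<le> 1")
  case True
  then have "x powr p \<le> 1 powr p" using assms by (intro powr_mono2) auto
  then show ?thesis by (simp add: add_increasing)
next
  case False
  then have "x powr p \<le> x powr q" using assms by (intro powr_mono) auto
  then show ?thesis by simp
qed

text \<open>The exceptional null set may depend on z. A countable dense set of vectors has a common
  one, and continuity in z extends the inequalities to all vectors.\<close>

lemma AE_growth_all: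
  fixes f :: "'a::euclidean_space \<Rightarrow> 'b::euclidean_space \<Rightarrow> real"
  assumes c: "AE x in M. continuous_on UNIV (f x)" and pq: "0 < p" "0 < q"
    and g: "\<And>z. AE x in M. norm z powr p \<le> f x z \<and> f x z \<le> L * norm z powr q + 1"
    and d: "\<And>z. AE x in M. f x (2 *\<^sub>R z) \<le> \<mu> + L * f x z"
  shows "AE x in M. \<forall>z. norm z powr p \<le> f x z \<and> f x z \<le> L * norm z powr q + 1 \<and> f x (2 *\<^sub>R z) \<le> \<mu> + L * f x z"
proof -
  obtain D :: "'b set" where D: "countable D" "\<And>X. open X \<Longrightarrow> X \<noteq> {} \<Longrightarrow> \<exists>d\<in>D. d \<in> X"
    using countable_dense_setE by blast
  have ext: "a z \<le> b z" if "\<And>z. z \<in> D \<Longrightarrow> a z \<le> b z" "continuous_on UNIV a" "continuous_on UNIV b" for a b :: "'b \<Rightarrow> real" and z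
  proof (rule ccontr)
    assume "\<not> a z \<le> b z"
    moreover have "open {z. b z < a z}" using that(2,3) by (rule open_Collect_less[rotated])
    moreover from calculation(1) have "{z. b z < a z} \<noteq> {}" by (auto simp: not_le)
    ultimately obtain y where "y \<in> D" "b y < a y" using D(2)[of "{z. b z < a z}"] by blast
    then show False using that(1)[of y] by simp
  qed
  have "AE x in M. \<forall>z\<in>D. norm z powr p \<le> f x z \<and> f x z \<le> L * norm z powr q + 1 \<and> f x (2 *\<^sub>R z) \<le> \<mu> + L * f x z"
    using D(1) g d by (intro AE_ball_countable') auto
  then show ?thesis using c
  proof eventually_elim
    case (elim x)
    have n: "continuous_on UNIV (\<lambda>z::'b. norm z powr p)" "continuous_on UNIV (\<lambda>z::'b. L * norm z powr q + 1)"
      using pq by (auto intro!: continuous_intros continuous_on_powr')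
    have c2: "continuous_on UNIV (\<lambda>z. f x (2 *\<^sub>R z))" by (rule continuous_on_compose2[OF elim(2)]) (auto intro!: continuous_intros)
    have c3: "continuous_on UNIV (\<lambda>z. \<mu> + L * f x z)" using elim(2) by (intro continuous_intros)
    show ?case
      using ext[of "\<lambda>z. norm z powr p" "f x"] ext[of "f x" "\<lambda>z. L * norm z powr q + 1"] ext[of "\<lambda>z. f x (2 *\<^sub>R z)" "\<lambda>z. \<mu> + L * f x z"]
        n c2 c3 elim by blast
  qed
qed

theorem theorem1:
  fixes \<Omega> :: "(real ^ 'n) set"
    and f :: "real ^ 'n \<Rightarrow> real ^ 'n \<Rightarrow> real"
    and u :: "real ^ 'n \<Rightarrow> real"
    and p q L \<mu> :: real
  assumes dim: "CARD('n) \<ge> 2"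
    and domain: "open \<Omega>" "connected \<Omega>" "\<Omega> \<noteq> {}" "bounded \<Omega>"
    and exponents: "1 \<le> p" "p \<le> q" "1 / q \<ge> 1 / p - 1 / (real CARD('n) - 1)"
    and caratheodory: "caratheodory \<Omega> f"
    and convex: "AE x in lebesgue_on \<Omega>. convex_on UNIV (f x)"
    and constants: "1 \<le> L" "0 \<le> \<mu>"
    and growth: "\<And>z. AE x in lebesgue_on \<Omega>.
                    norm z powr p \<le> f x z \<and> f x z \<le> L * norm z powr q + 1"
    and doubling: "\<And>z. AE x in lebesgue_on \<Omega>. f x (2 *\<^sub>R z) \<le> \<mu> + L * f x z"
    and u: "u \<in> W11_loc \<Omega>" "quasi_minimizer \<Omega> f u"
  shows "u \<in> Linf_loc \<Omega>"
proof -
  have n: "DIM(real ^ 'n) \<ge> 2" "real (DIM(real ^ 'n) - 1) = real CARD('n) - 1" "1 \<le> DIM(real ^ 'n) - 1" using dim by (auto simp: of_nat_diff)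
  obtain p' q' where pq': "admissible (DIM(real ^ 'n) - 1) p' q'" "p' \<le> p" "q \<le> q'"
    using admissible_exponents[OF n(3) exponents(1,2)] exponents(3) n(2) by metis
  have p': "1 \<le> p'" using pq' by (simp add: admissible_def)
  \<comment> \<open>The raised exponent and the additive 1 in the upper growth bound are absorbed by
    a second copy of \<open>L\<close>; \<mu> serves the doubling inequality.\<close>
  define K where "K = 2 * L + \<mu>"
  have K: "1 \<le> K" using constants by (simp add: K_def)
  have cf: "\<And>z. (\<lambda>x. f x z) \<in> borel_measurable (lebesgue_on \<Omega>)" "AE x in lebesgue_on \<Omega>. continuous_on UNIV (f x)"
    using caratheodory by (auto simp: caratheodory_def)
  have "AE x in lebesgue_on \<Omega>. good_integrand p' q' K (f x)"
  proof -
    have gd: "good_integrand p' q' K (f x)" if c: "continuous_on UNIV (f x)" "convex_on UNIV (f x)"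
      and b: "\<forall>z. norm z powr p \<le> f x z \<and> f x z \<le> L * norm z powr q + 1 \<and> f x (2 *\<^sub>R z) \<le> \<mu> + L * f x z" for x
      unfolding good_integrand_def
    proof (intro conjI allI c)
      fix z
      have z: "norm z powr p \<le> f x z" "f x z \<le> L * norm z powr q + 1" "f x (2 *\<^sub>R z) \<le> \<mu> + L * f x z" using b by auto
      show f0: "0 \<le> f x z" using z(1) by (rule order_trans[OF powr_ge_zero])
      show "norm z powr p' \<le> f x z + 1" using powr_le_plus1[of "norm z" p' p] z(1) p' pq' by simp
      have "L * norm z powr q + 1 \<le> L * (norm z powr q' + 1) + 1"
        using powr_le_plus1[of "norm z" q q'] exponents constants pq' by (intro add_right_mono mult_left_mono) auto
      also have "\<dots> \<le> L * (norm z powr q' + 1) + L * (norm z powr q' + 1)" using mult_mono[of 1 L 1 "norm z powr q' + 1"] constants by simp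
      also have "\<dots> = (2 * L) * (norm z powr q' + 1)" by simp
      also have "\<dots> \<le> K * (norm z powr q' + 1)" unfolding K_def using constants by (intro mult_right_mono) (auto intro: add_nonneg_nonneg)
      finally show "f x z \<le> K * (norm z powr q' + 1)" using z(2) by simp
      have "\<mu> + L * f x z \<le> K + K * f x z" unfolding K_def using constants f0 by (intro add_mono mult_right_mono) auto
      then show "f x (2 *\<^sub>R z) \<le> K * (f x z + 1)" using z(3) by (simp add: algebra_simps)
    qed
    have "0 < p" "0 < q" using exponents by auto
    from AE_growth_all[OF cf(2) this growth doubling] cf(2) convex show ?thesis by eventually_elim (rule gd)
  qed
  then have good: "AE x in lebesgue. x \<in> \<Omega> \<longrightarrow> good_integrand p' q' K (f x)" using domain(1) by (simp add: AE_lebesgue_on_open)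
  have good': "AE x in lebesgue. x \<in> \<Omega> \<longrightarrow> good_integrand p' q' K (\<lambda>z. f x (- z))"
    using good
  proof eventually_elim
    case (elim x)
    show ?case
    proof
      assume "x \<in> \<Omega>"
      then have g: "good_integrand p' q' K (f x)" using elim by simp
      have "continuous_on UNIV (\<lambda>z. f x (- z))"
        by (rule continuous_on_compose2[of UNIV]) (use g in \<open>auto simp: good_integrand_def intro!: continuous_intros\<close>)
      moreover have "convex_on UNIV (\<lambda>z. f x (- z))"
      proof (rule convex_onI)
        fix t :: real and y z :: "real ^ 'n" assume t: "0 < t" "t < 1"
        have "- ((1 - t) *\<^sub>R y + t *\<^sub>R z) = (1 - t) *\<^sub>R (- y) + t *\<^sub>R (- z)" by simp
        then show "f x (- ((1 - t) *\<^sub>R y + t *\<^sub>R z)) \<le> (1 - t) * f x (- y) + t * f x (- z)"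
          using convex_onD[of UNIV "f x" t "- y" "- z"] g t by (simp add: good_integrand_def)
      qed simp
      ultimately show "good_integrand p' q' K (\<lambda>z. f x (- z))" using g unfolding good_integrand_def by (metis norm_minus_cancel scaleR_minus_right)
    qed
  qed
  obtain Q where Q: "0 \<le> Q" "Q_minimizer \<Omega> f Q u" using u(2) unfolding quasi_minimizer_def by (meson order_trans zero_le_one)
  obtain g where g: "has_weak_gradient \<Omega> u g" using u(1) by (auto simp: W11_loc_def)
  have qm: "quasi_min \<Omega> f Q g" by (rule Q_minimizer_quasi_min[OF domain(1) Q(2) g])
  have up: "\<exists>r>0. \<exists>C. AE x in lebesgue. x \<in> cube x0 r \<longrightarrow> u x \<le> C" if x0: "x0 \<in> \<Omega>" for x0
    by (rule quasi_min_local_bound[OF n(1) pq'(1) K Q(1) domain(1) x0 g qm cf(1) good]) blast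
  have dn: "\<exists>r>0. \<exists>C. AE x in lebesgue. x \<in> cube x0 r \<longrightarrow> - u x \<le> C" if x0: "x0 \<in> \<Omega>" for x0
    by (rule quasi_min_local_bound[OF n(1) pq'(1) K Q(1) domain(1) x0 has_weak_gradient_uminus[OF g] quasi_min_uminus[OF qm] cf(1) good']) blast
  show ?thesis
    unfolding Linf_loc_def
  proof (intro CollectI allI impI conjI)
    fix S :: "(real ^ 'n) set" assume "compact S \<and> S \<subseteq> \<Omega>"
    then have S: "compact S" "S \<subseteq> \<Omega>" by auto
    have Sm: "S \<in> sets lebesgue" using S(1) lmeasurable_compact fmeasurableD by blast
    have "integrable lebesgue (\<lambda>x. indicator S x *\<^sub>R u x)"
      by (rule locally_integrable_compact[OF _ S]) (use g in \<open>auto simp: has_weak_gradient_def\<close>)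
    then have "(\<lambda>x. indicator S x *\<^sub>R u x) \<in> borel_measurable lebesgue" by (rule borel_measurable_integrable)
    then show "u \<in> borel_measurable (lebesgue_on S)" using Sm by (subst borel_measurable_restrict_space_iff) (auto simp: mult.commute)
    obtain C where C: "AE x in lebesgue. x \<in> S \<longrightarrow> u x \<le> C" by (rule AE_bounded_compact[OF S up])
    obtain C' where C': "AE x in lebesgue. x \<in> S \<longrightarrow> - u x \<le> C'" by (rule AE_bounded_compact[OF S dn])
    have "AE x in lebesgue. x \<in> S \<longrightarrow> \<bar>u x\<bar> \<le> max C C'" using C C' by eventually_elim auto
    then show "\<exists>C. AE x in lebesgue_on S. \<bar>u x\<bar> \<le> C" using Sm by (subst AE_restrict_space_iff) auto
  qed
qed

end
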